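(* Let $V=V_1+V_2$ be a real-valued function with $V_1\in W^{2,2}(\mathbb{R})$ and $V_2\in W^{2,\infty}(\mathbb{R})$, let $M$ be the Schr\"odinger operator $$Mf(x)=-\partial_x^2f(x)+V(x)f(x),\qquad f\in\mathrm{Dom}\,M:=W^{2,2}(\mathbb{R}),$$ acting on $L^2(\mathbb{R})$, and let $\mathcal{L}_n=\mathrm{span}\{\phi_0,\ldots,\phi_n\}$, where $\phi_j$ are the normalized Hermite functions. Then for every $\lambda\in\mathrm{Spec}_{\mathrm{disc}}\,M$ there are $z_n\in\mathrm{Spec}\,P_n$ such that $z_n\to\lambda$ as $n\to\infty$. Furthermore, if $\partial_x^qV(x)$ is continuous and bounded for some integer $q\ge 3$, then (for a suitable such choice of $z_n$) $|z_n-\lambda|=o\big(n^{\frac{2-q}{4}}\big)$ as $n\to\infty$.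
   Context: $W^{n,p}(\mathbb{R})$ is the Sobolev space of $V\in L^p(\mathbb{R})$ with $\partial_x^qV\in L^p(\mathbb{R})$ for $q=1,\ldots,n$. With the domain $\mathrm{Dom}\,M=W^{2,2}(\mathbb{R})$, the operator $M=-\partial_x^2+V$ is self-adjoint and $\mathrm{Dom}\,M^2=W^{4,2}(\mathbb{R})$. $\mathrm{Spec}_{\mathrm{disc}}\,M$ is the set of isolated eigenvalues of $M$ of finite multiplicity. The Hermite functions are $\phi_j(x)=c_jh_j(x)e^{-x^2/2}$, $j=0,1,\ldots$, with $c_j=\frac{1}{\sqrt{2^jj!\sqrt{\pi}}}$ and $h_j(x)=(-1)^je^{x^2}(\partial_x^je^{-x^2})$; they form an orthonormal basis of $L^2(\mathbb{R})$. $\Pi_n$ is the orthogonal projection onto $\mathcal{L}_n$, $P_n(z):=\Pi_n(z-M)^2|_{\mathcal{L}_n}=z^2-2z\,\Pi_nM|_{\mathcal{L}_n}+\Pi_nM^2|_{\mathcal{L}_n}$ for $z\in\mathbb{C}$ (a quadratic matrix polynomial on $\mathcal{L}_n$), and $\mathrm{Spec}\,P_n:=\{z\in\mathbb{C}:\det P_n(z)=0\}$. *)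

theory Defs
  imports
    "HOL-Analysis.Analysis"
    "HOL-Library.Landau_Symbols"
    "Jordan_Normal_Form.Determinant"
begin

(* Elements of L^p(R) are represented by Lebesgue measurable functions; equality of elements
   is equality almost everywhere, which is always written out explicitly. *)

definition Lp :: "ennreal \<Rightarrow> (real \<Rightarrow> 'a::{banach, second_countable_topology}) set" where
  "Lp p = {f \<in> borel_measurable lebesgue.
     if p = \<infinity> then \<exists>C. AE x in lebesgue. norm (f x) \<le> C
     else integrable lebesgue (\<lambda>x. norm (f x) powr enn2real p)}"

definition locally_integrable :: "(real \<Rightarrow> 'a::{banach, second_countable_topology}) \<Rightarrow> bool" where
  "locally_integrable f \<longleftrightarrow> (\<forall>a b. set_integrable lebesgue {a..b} f)"

definition test_functions :: "(real \<Rightarrow> real) set" where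
  "test_functions = {\<phi>. (\<forall>k x. (deriv ^^ k) \<phi> field_differentiable at x) \<and>
     compact (closure {x. \<phi> x \<noteq> 0})}"

(* g is the distributional derivative of order k of f. *)
definition has_weak_deriv ::
  "nat \<Rightarrow> (real \<Rightarrow> 'a::{banach, second_countable_topology}) \<Rightarrow> (real \<Rightarrow> 'a) \<Rightarrow> bool" where
  "has_weak_deriv k f g \<longleftrightarrow> locally_integrable f \<and> locally_integrable g \<and>
     (\<forall>\<phi>\<in>test_functions.
        (LINT x|lebesgue. (deriv ^^ k) \<phi> x *\<^sub>R f x) =
        (-1) ^ k *\<^sub>R (LINT x|lebesgue. \<phi> x *\<^sub>R g x))"

definition sobolev :: "nat \<Rightarrow> ennreal \<Rightarrow> (real \<Rightarrow> 'a::{banach, second_countable_topology}) set" where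
  "sobolev n p = {f \<in> Lp p. \<forall>q\<in>{1..n}. \<exists>g\<in>Lp p. has_weak_deriv q f g}"

(* A representative of the weak derivative; it is determined by f up to a null set. *)
definition weak_deriv ::
  "nat \<Rightarrow> (real \<Rightarrow> 'a::{banach, second_countable_topology}) \<Rightarrow> real \<Rightarrow> 'a" where
  "weak_deriv k f = (SOME g. has_weak_deriv k f g)"

definition L2_inner :: "(real \<Rightarrow> complex) \<Rightarrow> (real \<Rightarrow> complex) \<Rightarrow> complex" where
  "L2_inner f g = (LINT x|lebesgue. f x * cnj (g x))"

definition L2_norm :: "(real \<Rightarrow> complex) \<Rightarrow> real" where
  "L2_norm f = sqrt (LINT x|lebesgue. (norm (f x))\<^sup>2)"


(* In the next definitions, T is a linear operator in L^2(R) with domain D. *)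

(* T - z maps D bijectively onto L^2(R) and its inverse is bounded. *)
definition resolvent_set ::
  "(real \<Rightarrow> complex) set \<Rightarrow> ((real \<Rightarrow> complex) \<Rightarrow> real \<Rightarrow> complex) \<Rightarrow> complex set" where
  "resolvent_set D T = {z. \<exists>C. \<forall>g\<in>Lp 2. \<exists>f\<in>D.
     (AE x in lebesgue. T f x - z * f x = g x) \<and>
     (\<forall>f'\<in>D. (AE x in lebesgue. T f' x - z * f' x = g x) \<longrightarrow> (AE x in lebesgue. f' x = f x)) \<and>
     L2_norm f \<le> C * L2_norm g}"

definition spectrum ::
  "(real \<Rightarrow> complex) set \<Rightarrow> ((real \<Rightarrow> complex) \<Rightarrow> real \<Rightarrow> complex) \<Rightarrow> complex set" where
  "spectrum D T = - resolvent_set D T"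

definition eigenspace ::
  "(real \<Rightarrow> complex) set \<Rightarrow> ((real \<Rightarrow> complex) \<Rightarrow> real \<Rightarrow> complex) \<Rightarrow> complex
     \<Rightarrow> (real \<Rightarrow> complex) set" where
  "eigenspace D T z = {f \<in> D. AE x in lebesgue. T f x = z * f x}"

definition is_eigenvalue ::
  "(real \<Rightarrow> complex) set \<Rightarrow> ((real \<Rightarrow> complex) \<Rightarrow> real \<Rightarrow> complex) \<Rightarrow> complex \<Rightarrow> bool" where
  "is_eigenvalue D T z \<longleftrightarrow> (\<exists>f\<in>eigenspace D T z. \<not> (AE x in lebesgue. f x = 0))"

definition finite_multiplicity ::
  "(real \<Rightarrow> complex) set \<Rightarrow> ((real \<Rightarrow> complex) \<Rightarrow> real \<Rightarrow> complex) \<Rightarrow> complex \<Rightarrow> bool" where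
  "finite_multiplicity D T z \<longleftrightarrow>
     (\<exists>(m::nat) e. (\<forall>i<m. e i \<in> eigenspace D T z) \<and>
        (\<forall>f\<in>eigenspace D T z. \<exists>c. AE x in lebesgue. f x = (\<Sum>i<m. c i * e i x)))"

definition disc_spectrum ::
  "(real \<Rightarrow> complex) set \<Rightarrow> ((real \<Rightarrow> complex) \<Rightarrow> real \<Rightarrow> complex) \<Rightarrow> complex set" where
  "disc_spectrum D T = {z. z isolated_in spectrum D T \<and>
     is_eigenvalue D T z \<and> finite_multiplicity D T z}"


definition Dom_M :: "(real \<Rightarrow> complex) set" where
  "Dom_M = sobolev 2 2"

definition schroedinger :: "(real \<Rightarrow> real) \<Rightarrow> (real \<Rightarrow> complex) \<Rightarrow> real \<Rightarrow> complex" where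
  "schroedinger V f = (\<lambda>x. - weak_deriv 2 f x + of_real (V x) * f x)"

definition hermite_poly :: "nat \<Rightarrow> real \<Rightarrow> real" where
  "hermite_poly j x = (-1) ^ j * exp (x\<^sup>2) * (deriv ^^ j) (\<lambda>t. exp (- t\<^sup>2)) x"

definition hermite_fun :: "nat \<Rightarrow> real \<Rightarrow> complex" where
  "hermite_fun j x =
     of_real (1 / sqrt (2 ^ j * fact j * sqrt pi) * hermite_poly j x * exp (- x\<^sup>2 / 2))"

definition hermite_space :: "nat \<Rightarrow> (real \<Rightarrow> complex) set" where
  "hermite_space n = {f. \<exists>c. f = (\<lambda>x. \<Sum>j\<le>n. c j * hermite_fun j x)}"

(* The elements of hermite_space n are continuous, so that the orthogonal projection of an
   element of L^2(R) is unique as a function and not merely up to a null set. *)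
definition hermite_proj :: "nat \<Rightarrow> (real \<Rightarrow> complex) \<Rightarrow> real \<Rightarrow> complex" where
  "hermite_proj n f =
     (THE g. g \<in> hermite_space n \<and> (\<forall>h\<in>hermite_space n. L2_inner (\<lambda>x. f x - g x) h = 0))"

definition shifted_op ::
  "((real \<Rightarrow> complex) \<Rightarrow> real \<Rightarrow> complex) \<Rightarrow> complex \<Rightarrow> (real \<Rightarrow> complex) \<Rightarrow> real \<Rightarrow> complex" where
  "shifted_op T z f = (\<lambda>x. z * f x - T f x)"

definition P_op :: "(real \<Rightarrow> real) \<Rightarrow> nat \<Rightarrow> complex \<Rightarrow> (real \<Rightarrow> complex) \<Rightarrow> real \<Rightarrow> complex" where
  "P_op V n z f =
     hermite_proj n (shifted_op (schroedinger V) z (shifted_op (schroedinger V) z f))"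

(* The matrix of P_op V n z, a linear map of hermite_space n into itself, with respect to the
   orthonormal basis of Hermite functions. *)
definition P_mat :: "(real \<Rightarrow> real) \<Rightarrow> nat \<Rightarrow> complex \<Rightarrow> complex mat" where
  "P_mat V n z = mat (Suc n) (Suc n)
     (\<lambda>(j, k). L2_inner (P_op V n z (hermite_fun k)) (hermite_fun j))"

definition Spec_P :: "(real \<Rightarrow> real) \<Rightarrow> nat \<Rightarrow> complex set" where
  "Spec_P V n = {z. Determinant.det (P_mat V n z) = 0}"

end

theory Submission
  imports Defs "HOL-Probability.Probability" "HOL-Complex_Analysis.Complex_Analysis"
begin

text \<open>An isolated eigenvalue \<open>\<lambda>\<close> of \<open>M\<close> is simple, since two square integrable solutions of a second order equation are
  proportional, and \<open>N = M - \<lambda>\<close> satisfies \<open>\<parallel>N w\<parallel> \<ge> \<delta> \<parallel>w\<parallel>\<close> on the orthogonal complement of the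
  eigenfunction \<open>\<phi>\<close>. Let \<open>p\<close> be the projection of \<open>\<phi>\<close> to \<open>\<L>\<^sub>n\<close> and let \<open>\<epsilon>\<close> bound
  \<open>\<parallel>\<phi> - p\<parallel>\<close> and \<open>\<parallel>N (\<phi> - p)\<parallel>\<close>. If \<open>P\<^sub>n\<close> had no zero in the disc of radius \<open>20 \<epsilon>\<close> around \<open>\<lambda>\<close>,
  the solution \<open>u(z)\<close> of \<open>P\<^sub>n(z) u = P\<^sub>n(\<lambda>) p\<close> would be holomorphic there with \<open>u(\<lambda>) = p\<close>; but coercivity of the
  form \<open>\<langle>(z - M) u, (z\<^sup>* - M) v\<rangle>\<close> on the circle forces \<open>\<bar>\<langle>u(z), \<phi>\<rangle>\<bar> \<le> 1/2\<close> there,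
  contradicting the maximum principle. It remains to bound \<open>\<epsilon>\<close>: \<open>\<phi>\<close> and \<open>\<phi>'\<close> decay faster than every power,
  so \<open>\<phi>\<close> lies in the domain of powers of the harmonic oscillator \<open>-\<partial>\<^sup>2 + x\<^sup>2\<close>, which multiplies the
  \<open>j\<close>-th Hermite coefficient by \<open>2 j + 1\<close>; the tails are therefore small of the order allowed by the smoothness of \<open>V\<close>.\<close>

section \<open>Antiderivatives of locally integrable functions\<close>

text \<open>For non-real z the matrix \<open>P_mat V n z\<close> is not hermitian. At z = lam +
  \<zeta> the form is \<zeta>^2 along the eigenfunction but close to the square of the norm of N w
  on the complement, and on the circle the first part turns through all phases against the second.
  So the test vector must be rotated along the eigenfunction; only its projection to the Hermite
  span is an admissible direction, which costs terms of order \<epsilon>. The radius must be a large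
  enough multiple of \<epsilon>, and 20 closes the inequality. The gap is derived from the resolvent
  set alone, by quadratic form estimates near an isolated point. For the rate, \<epsilon> is
  controlled by the Hermite tail of the oscillator applied to \<phi>. Decay alone puts \<phi> in the
  domain of the oscillator, so this first application costs no smoothness of \<open>V\<close>; each
  further one costs two derivatives and gains a factor 1/n. After t = (q + 1) div 4 of them n^(-t)
  reaches the exponent (2 - q) / 4, and the little o comes from the tail of a fixed vector. As
  \<open>z n\<close> is demanded for every n, small n need a separate proof that
  \<open>Spec_P V n\<close> is not empty.\<close>

lemma sigma_finite_lebesgue: "sigma_finite_measure (lebesgue :: real measure)"
proof
  obtain A where A: "countable A" "A \<subseteq> sets (lborel :: real measure)" "\<Union>A = space (lborel::real measure)"
     "\<forall>a\<in>A. emeasure (lborel :: real measure) a \<noteq> \<infinity>"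
    using lborel.sigma_finite_countable by blast
  then show "\<exists>A. countable A \<and> A \<subseteq> sets (lebesgue :: real measure) \<and> \<Union>A = space (lebesgue::real measure) \<and> (\<forall>a\<in>A. emeasure (lebesgue :: real measure) a \<noteq> \<infinity>)"
    by (intro exI[of _ A]) auto
qed

text \<open>Closed intervals form an intersection-stable generator of the Borel sets, so Dynkin's
  argument extends the vanishing to Borel sets. Lebesgue sets differ from Borel sets by null sets,
  and a density whose integrals all vanish is 0.\<close>

lemma AE_zero_if_interval_integrals_zero_aux:
  fixes f :: "real \<Rightarrow> 'a::euclidean_space"
  assumes f: "integrable lebesgue f"
    and z: "\<And>a b. (LINT x:{a..b}|lebesgue. f x) = 0"
  shows "AE x in lebesgue. f x = 0"
proof -
  have si: "set_integrable lebesgue A f" if "A \<in> sets lebesgue" for A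
    using f that by (simp add: set_integrable_def integrable_mult_indicator)
  \<comment> \<open>The complement step of the induction subtracts from the integral over the whole
    line.\<close>
  have tot: "(LINT x|lebesgue. f x) = 0"
  proof -
    have "(\<lambda>n. LINT x:{- real n..real n}|lebesgue. f x) \<longlonglongrightarrow> (LINT x:(\<Union>n. {- real n..real n})|lebesgue. f x)"
      by (rule set_integral_cont_up) (auto simp: incseq_def intro!: si)
    moreover have "(\<Union>n. {- real n..real n}) = UNIV"
    proof -
      have "\<exists>n. x \<in> {- real n..real n}" for x
        using real_arch_simple[of "\<bar>x\<bar>"] by (auto simp: abs_le_iff) (metis minus_le_iff)
      then show ?thesis by blast
    qed
    ultimately show ?thesis using z LIMSEQ_unique[OF _ tendsto_const] by (simp add: set_lebesgue_integral_def)
  qed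
  have B: "(LINT x:A|lebesgue. f x) = 0" if "A \<in> sets borel" for A
  proof -
    have A: "A \<in> sigma_sets UNIV (range (\<lambda>(a, b). {a..b}))"
      using that by (metis borel_eq_atLeastAtMost sets_measure_of top_greatest Pow_UNIV)
    have "Int_stable (range (\<lambda>(a, b). {a..b::real}))"
      by (auto simp: Int_stable_def image_iff)
    moreover have "range (\<lambda>(a, b). {a..b::real}) \<subseteq> Pow UNIV" by simp
    ultimately show ?thesis using A
    proof (induction rule: sigma_sets_induct_disjoint)
      case (basic A) then show ?case using z by auto
    next
      case empty show ?case by (simp add: set_lebesgue_integral_def)
    next
      case (compl A)
      then have "A \<in> sets borel" by (metis borel_eq_atLeastAtMost sets_measure_of top_greatest Pow_UNIV)
      then have A: "A \<in> sets lebesgue" by simp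
      have "(LINT x:(UNIV - A) \<union> A|lebesgue. f x) = (LINT x:UNIV - A|lebesgue. f x) + (LINT x:A|lebesgue. f x)"
        using A by (intro set_integral_Un si) auto
      then show ?case using compl tot by (simp add: set_lebesgue_integral_def)
    next
      case (union A)
      have "A i \<in> sets borel" for i using union(2) borel_eq_atLeastAtMost
        by (metis Pow_UNIV range_subsetD sets_measure_of top_greatest)
      then have A: "\<And>i. A i \<in> sets lebesgue" by simp
      have "(LINT x:(\<Union>i. A i)|lebesgue. f x) = (\<Sum>i. LINT x:A i|lebesgue. f x)"
        using A union(1) by (intro lebesgue_integral_countable_add si) (auto simp: disjoint_family_on_def)
      then show ?case using union by simp
    qed
  qed
  have "(LINT x:A|lebesgue. f x) = 0" if A: "A \<in> sets lebesgue" for A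
  proof -
    obtain S N N' where S: "A = S \<union> N" "N \<subseteq> N'" "N' \<in> null_sets lborel" "S \<in> sets lborel"
      using A by (rule sets_completionE)
    have N': "N' \<in> null_sets lebesgue" using S(3) by (rule null_sets_completionI)
    have "AE x in lebesgue. x \<in> A \<longleftrightarrow> x \<in> S"
      using AE_not_in[OF N'] by eventually_elim (use S in auto)
    moreover have "set_borel_measurable lebesgue S f" "set_borel_measurable lebesgue A f"
      using si[of S] si[of A] S(4) A
      by (simp_all add: set_borel_measurable_def set_integrable_def borel_measurable_integrable)
    ultimately have "(LINT x:A|lebesgue. f x) = (LINT x:S|lebesgue. f x)"
      by (intro set_integral_cong_set) auto
    then show ?thesis using B S by simp
  qed
  then show ?thesis by (intro sigma_finite_measure.density_zero[OF sigma_finite_lebesgue] f)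
qed

lemma AE_zero_if_interval_integrals_zero:
  fixes f :: "real \<Rightarrow> 'a::euclidean_space"
  assumes f: "locally_integrable f" and z: "\<And>a b. a \<le> b \<Longrightarrow> integral {a..b} f = 0"
  shows "AE x in lebesgue. f x = 0"
proof -
  have si: "set_integrable lebesgue {a..b} f" for a b
    using f by (auto simp: locally_integrable_def)
  have "AE x in lebesgue. indicator {- real n..real n} x *\<^sub>R f x = 0" for n
  proof (rule AE_zero_if_interval_integrals_zero_aux)
    show "integrable lebesgue (\<lambda>x. indicator {- real n..real n} x *\<^sub>R f x)"
      using si by (simp add: set_integrable_def)
    fix a b
    have "(LINT x:{a..b}|lebesgue. indicator {- real n..real n} x *\<^sub>R f x)
       = (LINT x:{max a (- real n)..min b (real n)}|lebesgue. f x)"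
      by (auto simp: set_lebesgue_integral_def intro!: Bochner_Integration.integral_cong split: split_indicator)
    also have "\<dots> = integral {max a (- real n)..min b (real n)} f"
      by (rule set_lebesgue_integral_eq_integral[OF si])
    also have "\<dots> = 0" using z by (cases "max a (- real n) \<le> min b (real n)") auto
    finally show "(LINT x:{a..b}|lebesgue. indicator {- real n..real n} x *\<^sub>R f x) = 0" .
  qed
  then have "AE x in lebesgue. \<forall>n. indicator {- real n..real n} x *\<^sub>R f x = 0"
    by (subst AE_all_countable) blast
  then show ?thesis
  proof eventually_elim
    case (elim x)
    obtain n where "\<bar>x\<bar> \<le> real n" using real_arch_simple by blast
    then show ?case using elim[rule_format, of n] by (simp add: abs_le_iff)
  qed
qed

text \<open>Local absolute continuity of \<open>F\<close>, expressed by the fundamental theorem of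
  calculus: \<open>F\<close> is determined at every point, \<open>f\<close> only up to a null set.
  Weak derivatives are turned into such pairs, so that integration by parts and differential
  equations become available.\<close>

definition antideriv :: "(real \<Rightarrow> complex) \<Rightarrow> (real \<Rightarrow> complex) \<Rightarrow> bool" where
  "antideriv F f \<longleftrightarrow> locally_integrable f \<and> (\<forall>a b. a \<le> b \<longrightarrow> F b - F a = integral {a..b} f)"

lemma antiderivD: "antideriv F f \<Longrightarrow> a \<le> b \<Longrightarrow> F b - F a = integral {a..b} f"
  by (simp add: antideriv_def)

lemma antideriv_locally_integrable: "antideriv F f \<Longrightarrow> locally_integrable f"
  by (simp add: antideriv_def)

lemma locally_integrable_integrable_on:
  fixes f :: "real \<Rightarrow> 'a::euclidean_space"
  assumes "locally_integrable f" shows "f integrable_on {a..b}"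
  using assms set_lebesgue_integral_eq_integral(1) locally_integrable_def by blast

lemma locally_integrable_borel_measurable:
  fixes f :: "real \<Rightarrow> 'a::euclidean_space"
  assumes f: "locally_integrable f" shows "f \<in> borel_measurable lebesgue"
proof (rule borel_measurable_LIMSEQ_metric)
  show "(\<lambda>x. indicator {- real n..real n} x *\<^sub>R f x) \<in> borel_measurable lebesgue" for n
    using f by (intro borel_measurable_integrable) (simp add: locally_integrable_def set_integrable_def)
  fix x
  obtain n where n: "\<bar>x\<bar> \<le> real n" using real_arch_simple by blast
  show "(\<lambda>n. indicator {- real n..real n} x *\<^sub>R f x) \<longlonglongrightarrow> f x"
    by (rule tendsto_eventually, rule eventually_sequentiallyI[of n])
      (use n in \<open>auto simp: indicator_def abs_le_iff\<close>)
qed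

lemma continuous_locally_integrable:
  fixes f :: "real \<Rightarrow> 'a::euclidean_space"
  assumes "continuous_on UNIV f" shows "locally_integrable f"
  unfolding locally_integrable_def
  using assms absolutely_integrable_continuous_real continuous_on_subset by blast

lemma locally_integrable_cong_AE:
  fixes f :: "real \<Rightarrow> 'a::euclidean_space"
  assumes f: "locally_integrable f" and ae: "AE x in lebesgue. f x = g x"
  shows "locally_integrable g"
proof -
  have g: "g \<in> borel_measurable lebesgue"
    using borel_measurable_AE[OF locally_integrable_borel_measurable[OF f] ae] .
  show ?thesis unfolding locally_integrable_def set_integrable_def
  proof (intro allI)
    fix a b
    show "integrable lebesgue (\<lambda>x. indicat_real {a..b} x *\<^sub>R g x)"
      by (rule integrable_cong_AE_imp[where g = "\<lambda>x. indicat_real {a..b} x *\<^sub>R f x"])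
        (use f g ae in \<open>auto simp: locally_integrable_def set_integrable_def
           intro!: borel_measurable_scaleR borel_measurable_indicator\<close>)
  qed
qed

lemma integral_cong_AE_interval:
  fixes f :: "real \<Rightarrow> 'a::euclidean_space"
  assumes f: "locally_integrable f" and ae: "AE x in lebesgue. f x = g x"
  shows "integral {a..b} f = integral {a..b} g"
proof -
  have g: "locally_integrable g" by (rule locally_integrable_cong_AE[OF f ae])
  have "(LINT x:{a..b}|lebesgue. f x) = (LINT x:{a..b}|lebesgue. g x)"
    unfolding set_lebesgue_integral_def
    by (rule integral_cong_AE) (use ae locally_integrable_borel_measurable[OF f] locally_integrable_borel_measurable[OF g] in
      \<open>auto intro!: borel_measurable_scaleR borel_measurable_indicator\<close>)
  then show ?thesis
    using f g by (simp add: locally_integrable_def set_lebesgue_integral_eq_integral(2))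
qed

lemma antideriv_cong_AE:
  assumes F: "antideriv F f" and ae: "AE x in lebesgue. f x = g x"
  shows "antideriv F g"
  using assms locally_integrable_cong_AE[OF _ ae] integral_cong_AE_interval[OF _ ae]
  by (simp add: antideriv_def)

lemma antideriv_unique_AE:
  assumes "antideriv F f" "antideriv F g"
  shows "AE x in lebesgue. f x = g x"
proof -
  have "AE x in lebesgue. f x - g x = 0"
  proof (rule AE_zero_if_interval_integrals_zero)
    show "locally_integrable (\<lambda>x. f x - g x)"
      using assms by (auto simp: antideriv_def locally_integrable_def)
    fix a b :: real assume "a \<le> b"
    then have "integral {a..b} f = integral {a..b} g" using assms by (metis antiderivD)
    then show "integral {a..b} (\<lambda>x. f x - g x) = 0"
      using assms by (subst Henstock_Kurzweil_Integration.integral_diff)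
        (auto simp: antideriv_def intro: locally_integrable_integrable_on)
  qed
  then show ?thesis by simp
qed

text \<open>The case split is there because the integral over \<open>{a..b}\<close> with b < a is 0
  and not minus the integral over the reversed interval.\<close>

lemma antideriv_integral:
  assumes f: "locally_integrable f"
  shows "antideriv (\<lambda>x. c + (if x0 \<le> x then integral {x0..x} f else - integral {x..x0} f)) f"
  unfolding antideriv_def
proof (intro conjI allI impI f)
  fix a b :: real assume "a \<le> b"
  note I = locally_integrable_integrable_on[OF f]
  note C = Henstock_Kurzweil_Integration.integral_combine[OF _ _ I]
  show "c + (if x0 \<le> b then integral {x0..b} f else - integral {b..x0} f) -
       (c + (if x0 \<le> a then integral {x0..a} f else - integral {a..x0} f)) = integral {a..b} f"
    using \<open>a \<le> b\<close> C[of x0 a b] C[of a x0 b] C[of a b x0] by (auto simp: algebra_simps)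
qed

lemma antideriv_exists: 
  assumes f: "locally_integrable f" obtains F where "antideriv F f" "F x0 = c"
  using antideriv_integral[OF f, of c x0] that by auto

lemma antideriv_continuous: 
  assumes F: "antideriv F f" shows "continuous_on UNIV F"
proof -
  have "isCont F x" for x
  proof -
    have "continuous_on {x-1..x+1} (\<lambda>y. F (x-1) + integral {x-1..y} f)"
      using F by (intro continuous_intros indefinite_integral_continuous_1 locally_integrable_integrable_on antideriv_locally_integrable)
    moreover have "F (x-1) + integral {x-1..y} f = F y" if "y \<in> {x-1..x+1}" for y
      using antiderivD[OF F, of "x-1" y] that by (simp add: algebra_simps)
    ultimately have "continuous_on {x-1..x+1} F" by (metis (no_types, lifting) continuous_on_cong)
    then show ?thesis by (rule continuous_on_interior) auto
  qed
  then show ?thesis by (simp add: continuous_on_eq_continuous_at)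
qed

lemma antideriv_eqI:
  assumes "antideriv F f" "antideriv G f" "F x0 = G x0" shows "F = G"
proof
  fix x show "F x = G x"
    using assms antiderivD[OF assms(1), of x0 x] antiderivD[OF assms(2), of x0 x]
      antiderivD[OF assms(1), of x x0] antiderivD[OF assms(2), of x x0]
    by (cases "x0 \<le> x") (metis diff_add_cancel, metis diff_diff_eq2 diff_add_cancel add_diff_cancel_left' nle_le)
qed

lemma antideriv_derivative:
  assumes F: "antideriv F f" and c: "continuous_on UNIV f"
  shows "(F has_vector_derivative f x) (at x)"
proof -
  have "((\<lambda>u. integral {x-1..u} f) has_vector_derivative f x) (at x within {x-1..x+1})"
    by (rule integral_has_vector_derivative) (use c continuous_on_subset in auto)
  then have "((\<lambda>u. F (x-1) + integral {x-1..u} f) has_vector_derivative f x) (at x within {x-1..x+1})"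
    by (auto intro!: derivative_eq_intros)
  then have "((\<lambda>u. F (x-1) + integral {x-1..u} f) has_vector_derivative f x) (at x within {x-1<..<x+1})"
    by (rule has_vector_derivative_within_subset) auto
  then have "((\<lambda>u. F (x-1) + integral {x-1..u} f) has_vector_derivative f x) (at x)"
    by (subst (asm) at_within_open) auto
  then show ?thesis
    by (rule has_vector_derivative_transform_within_open[where S = "{x-1<..<x+1}"])
      (auto simp: antiderivD[OF F, symmetric])
qed

lemma antideriv_C1:
  assumes "\<And>x. (F has_vector_derivative f x) (at x)" "continuous_on UNIV f"
  shows "antideriv F f"
  unfolding antideriv_def
proof (intro conjI allI impI)
  show "locally_integrable f" using assms(2) by (rule continuous_locally_integrable)
  fix a b :: real assume "a \<le> b"
  then have "(f has_integral (F b - F a)) {a..b}"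
    using assms(1) by (intro fundamental_theorem_of_calculus) (auto intro: has_vector_derivative_at_within)
  then show "F b - F a = integral {a..b} f" by (simp add: integral_unique)
qed

lemma antideriv_const: "antideriv (\<lambda>x. c) (\<lambda>x. 0)"
  by (rule antideriv_C1) auto

lemma antideriv_add:
  assumes "antideriv F f" "antideriv G g" shows "antideriv (\<lambda>x. F x + G x) (\<lambda>x. f x + g x)"
  unfolding antideriv_def
proof (intro conjI allI impI)
  show "locally_integrable (\<lambda>x. f x + g x)"
    using assms by (auto simp: antideriv_def locally_integrable_def)
  fix a b :: real assume "a \<le> b"
  then show "F b + G b - (F a + G a) = integral {a..b} (\<lambda>x. f x + g x)"
    using antiderivD[OF assms(1), of a b, symmetric] antiderivD[OF assms(2), of a b, symmetric]
      assms[THEN antideriv_locally_integrable]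
    by (subst Henstock_Kurzweil_Integration.integral_add) (auto intro: locally_integrable_integrable_on)
qed

lemma antideriv_bounded_linear:
  fixes h :: "complex \<Rightarrow> complex"
  assumes F: "antideriv F f" and h: "bounded_linear h"
  shows "antideriv (\<lambda>x. h (F x)) (\<lambda>x. h (f x))"
  unfolding antideriv_def
proof (intro conjI allI impI)
  have "set_integrable lebesgue {a..b} (\<lambda>x. h (f x))" for a b
    using F absolutely_integrable_linear[OF _ h, of "{a..b}" f]
    by (auto simp: antideriv_def locally_integrable_def o_def)
  then show "locally_integrable (\<lambda>x. h (f x))" by (simp add: locally_integrable_def)
  fix a b :: real assume ab: "a \<le> b"
  have "integral {a..b} (h \<circ> f) = h (integral {a..b} f)"
    using F by (intro integral_linear h) (auto simp: antideriv_def intro: locally_integrable_integrable_on)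
  then show "h (F b) - h (F a) = integral {a..b} (\<lambda>x. h (f x))"
    using antiderivD[OF F ab] h by (simp add: o_def linear_diff[OF bounded_linear.linear, symmetric])
qed

lemma antideriv_cmult: "antideriv F f \<Longrightarrow> antideriv (\<lambda>x. c * F x) (\<lambda>x. c * f x)"
  by (rule antideriv_bounded_linear[OF _ bounded_linear_mult_right])

lemma antideriv_cnj: "antideriv F f \<Longrightarrow> antideriv (\<lambda>x. cnj (F x)) (\<lambda>x. cnj (f x))"
  by (rule antideriv_bounded_linear[OF _ bounded_linear_cnj])

lemma antideriv_minus: "antideriv F f \<Longrightarrow> antideriv (\<lambda>x. - F x) (\<lambda>x. - f x)"
  by (rule antideriv_bounded_linear[OF _ bounded_linear_minus[OF bounded_linear_ident]])

lemma antideriv_diff: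
  "antideriv F f \<Longrightarrow> antideriv G g \<Longrightarrow> antideriv (\<lambda>x. F x - G x) (\<lambda>x. f x - g x)"
  using antideriv_add[of F f "\<lambda>x. - G x" "\<lambda>x. - g x"] antideriv_minus[of G g] by simp

lemma antideriv_sum:
  assumes "\<And>i. i \<in> I \<Longrightarrow> antideriv (F i) (f i)"
  shows "antideriv (\<lambda>x. \<Sum>i\<in>I. F i x) (\<lambda>x. \<Sum>i\<in>I. f i x)"
  using assms
proof (induction I rule: infinite_finite_induct)
  case (insert x A) then show ?case by (simp add: antideriv_add)
qed (simp_all add: antideriv_const)

lemma locally_integrable_mult_continuous:
  fixes f g :: "real \<Rightarrow> complex"
  assumes f: "locally_integrable f" and g: "continuous_on UNIV g"
  shows "locally_integrable (\<lambda>x. g x * f x)"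
  unfolding locally_integrable_def
proof (intro allI)
  fix a b :: real
  have g': "continuous_on {a..b} g" using g continuous_on_subset by blast
  show "set_integrable lebesgue {a..b} (\<lambda>x. g x * f x)"
  proof (rule absolutely_integrable_bounded_measurable_product[where h = "(*)"])
    show "bilinear ((*) :: complex \<Rightarrow> _)" by (rule bilinear_times)
    show "g \<in> borel_measurable (lebesgue_on {a..b})"
      by (rule continuous_imp_measurable_on_sets_lebesgue[OF g']) simp
    show "bounded (g ` {a..b})" using compact_continuous_image[OF g'] compact_imp_bounded by blast
  qed (use f in \<open>auto simp: locally_integrable_def\<close>)
qed

text \<open>The product rule for absolutely continuous functions, where neither factor need be
  differentiable at a given point. Fubini on the triangle a \<le> x \<le> y \<le> b for f(x) g(y):
  integrating x out leaves (F y - F a) g y, integrating y out leaves f x (G b - G x).\<close>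

lemma antideriv_mult:
  assumes F: "antideriv F f" and G: "antideriv G g"
  shows "antideriv (\<lambda>x. F x * G x) (\<lambda>x. f x * G x + F x * g x)"
  unfolding antideriv_def
proof (intro conjI allI impI)
  interpret L: sigma_finite_measure "lebesgue :: real measure" by (rule sigma_finite_lebesgue)
  interpret P: pair_sigma_finite "lebesgue :: real measure" "lebesgue :: real measure" ..
  have lf: "locally_integrable f" and lg: "locally_integrable g"
    using F G by (auto simp: antideriv_def)
  have Fc: "continuous_on UNIV F" and Gc: "continuous_on UNIV G"
    using F G by (auto intro: antideriv_continuous)
  have l1: "locally_integrable (\<lambda>x. f x * G x)" "locally_integrable (\<lambda>x. F x * g x)"
    using locally_integrable_mult_continuous[OF lf Gc] locally_integrable_mult_continuous[OF lg Fc]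
    by (simp_all add: mult.commute)
  then show "locally_integrable (\<lambda>x. f x * G x + F x * g x)"
    by (auto simp: locally_integrable_def)
  fix a b :: real assume ab: "a \<le> b"
  define f' where "f' x = indicator {a..b} x *\<^sub>R f x" for x
  define g' where "g' x = indicator {a..b} x *\<^sub>R g x" for x
  have f': "integrable lebesgue f'" and g': "integrable lebesgue g'"
    using lf lg by (auto simp: locally_integrable_def set_integrable_def f'_def[abs_def] g'_def[abs_def])
  have seg: "set_integrable lebesgue {u..v} f" "set_integrable lebesgue {u..v} g" for u v
    using lf lg by (auto simp: locally_integrable_def)
  have fi: "(LINT x|lebesgue. indicator {u..v} x *\<^sub>R f' x) = F v - F u" if "a \<le> u" "u \<le> v" "v \<le> b" for u v
  proof -
    have "(LINT x|lebesgue. indicator {u..v} x *\<^sub>R f' x) = (LINT x:{u..v}|lebesgue. f x)"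
      unfolding set_lebesgue_integral_def f'_def using that
      by (intro Bochner_Integration.integral_cong) (auto split: split_indicator)
    then show ?thesis using set_lebesgue_integral_eq_integral(2)[OF seg(1)] antiderivD[OF F] that by simp
  qed
  have gi: "(LINT x|lebesgue. indicator {u..v} x *\<^sub>R g' x) = G v - G u" if "a \<le> u" "u \<le> v" "v \<le> b" for u v
  proof -
    have "(LINT x|lebesgue. indicator {u..v} x *\<^sub>R g' x) = (LINT x:{u..v}|lebesgue. g x)"
      unfolding set_lebesgue_integral_def g'_def using that
      by (intro Bochner_Integration.integral_cong) (auto split: split_indicator)
    then show ?thesis using set_lebesgue_integral_eq_integral(2)[OF seg(2)] antiderivD[OF G] that by simp
  qed
  have f0: "f' x = indicator {a..b} x *\<^sub>R f' x" for x by (simp add: f'_def split: split_indicator)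
  have g0: "g' x = indicator {a..b} x *\<^sub>R g' x" for x by (simp add: g'_def split: split_indicator)
  have tf: "(LINT x|lebesgue. f' x) = F b - F a" using fi[of a b] ab by (subst f0) auto
  have tg: "(LINT x|lebesgue. g' x) = G b - G a" using gi[of a b] ab by (subst g0) auto
  have [measurable]: "f' \<in> borel_measurable lebesgue" "g' \<in> borel_measurable lebesgue"
    using f' g' by auto
  have [measurable]: "(\<lambda>x. x) \<in> borel_measurable (lebesgue :: real measure)"
    by (rule measurable_completion) simp
  define h where "h p = (if fst p \<le> snd p then f' (fst p) * g' (snd p) else 0)" for p :: "real \<times> real"
  have hm[measurable]: "h \<in> borel_measurable (lebesgue \<Otimes>\<^sub>M lebesgue)"
  proof -
    have "(\<lambda>p. fst p :: real) \<in> borel_measurable (lebesgue \<Otimes>\<^sub>M lebesgue)"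
      "(\<lambda>p. snd p :: real) \<in> borel_measurable (lebesgue \<Otimes>\<^sub>M lebesgue)"
      using measurable_compose[OF measurable_fst, of "\<lambda>x. x" lebesgue borel lebesgue]
        measurable_compose[OF measurable_snd, of "\<lambda>x. x" lebesgue borel lebesgue] by auto
    then have "Measurable.pred (lebesgue \<Otimes>\<^sub>M lebesgue) (\<lambda>p::real\<times>real. fst p \<le> snd p)"
      unfolding pred_def by (rule borel_measurable_le)
    then show ?thesis unfolding h_def by measurable
  qed
  have hb: "norm (h (x, y)) \<le> norm (f' x) * norm (g' y)" for x y
    by (simp add: h_def norm_mult)
  have i2: "integrable lebesgue (\<lambda>y. h (x, y))" for x
  proof (rule Bochner_Integration.integrable_bound)
    show "integrable lebesgue (\<lambda>y. norm (f' x) * norm (g' y))" using g' by simp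
    show "(\<lambda>y. h (x, y)) \<in> borel_measurable lebesgue" by measurable
  qed (use hb in auto)
  have hint: "integrable (lebesgue \<Otimes>\<^sub>M lebesgue) h"
  proof (rule P.Fubini_integrable[OF hm])
    show "integrable lebesgue (\<lambda>x. LINT y|lebesgue. norm (h (x, y)))"
    proof (rule Bochner_Integration.integrable_bound)
      show "integrable lebesgue (\<lambda>x. norm (f' x) * (LINT y|lebesgue. norm (g' y)))" using f' by simp
      show "(\<lambda>x. LINT y|lebesgue. norm (h (x, y))) \<in> borel_measurable lebesgue" by measurable
      have "(LINT y|lebesgue. norm (h (x, y))) \<le> (LINT y|lebesgue. norm (f' x) * norm (g' y))" for x
        by (rule integral_mono) (use i2[of x] g' hb in auto)
      then show "AE x in lebesgue. norm (LINT y|lebesgue. norm (h (x, y))) \<le> norm (norm (f' x) * (LINT y|lebesgue. norm (g' y)))"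
        by (intro AE_I2) (auto simp: abs_mult)
    qed
    show "AE x in lebesgue. integrable lebesgue (\<lambda>y. h (x, y))" using i2 by simp
  qed
  have eq: "(LINT y|lebesgue. (LINT x|lebesgue. h (x, y))) = (LINT x|lebesgue. (LINT y|lebesgue. h (x, y)))"
    using P.Fubini_integral[of "\<lambda>x y. h (x, y)"] hint by simp
  have "(LINT x|lebesgue. h (x, y)) = (F y - F a) * g' y" for y
  proof (cases "y \<in> {a..b}")
    case True
    have "(LINT x|lebesgue. h (x, y)) = (LINT x|lebesgue. (indicator {a..y} x *\<^sub>R f' x) * g' y)"
      by (rule Bochner_Integration.integral_cong) (auto simp: h_def f'_def split: split_indicator)
    then show ?thesis using fi[of a y] True by (simp del: mult_scaleR_left)
  qed (auto simp: h_def g'_def intro!: integral_eq_zero_AE)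
  moreover have "(LINT y|lebesgue. h (x, y)) = f' x * (G b - G x)" for x
  proof (cases "x \<in> {a..b}")
    case True
    have "(LINT y|lebesgue. h (x, y)) = (LINT y|lebesgue. f' x * (indicator {x..b} y *\<^sub>R g' y))"
      by (rule Bochner_Integration.integral_cong) (auto simp: h_def g'_def split: split_indicator)
    then show ?thesis using gi[of x b] True by (simp del: mult_scaleR_right)
  qed (auto simp: h_def f'_def intro!: integral_eq_zero_AE)
  ultimately have eq2: "(LINT y|lebesgue. (F y - F a) * g' y) = (LINT x|lebesgue. f' x * (G b - G x))"
    using eq by simp
  have IG: "integrable lebesgue (\<lambda>x. f' x * G x)" and IF: "integrable lebesgue (\<lambda>x. F x * g' x)"
    using l1 by (auto simp: locally_integrable_def set_integrable_def f'_def[abs_def] g'_def[abs_def])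
  have "(LINT y|lebesgue. (F y - F a) * g' y) = (LINT y|lebesgue. F y * g' y) - F a * (G b - G a)"
    using IF g' tg by (simp add: left_diff_distrib)
  moreover have "(LINT x|lebesgue. f' x * (G b - G x)) = (F b - F a) * G b - (LINT x|lebesgue. f' x * G x)"
    using IG f' tf by (simp add: right_diff_distrib)
  ultimately have "(LINT y|lebesgue. F y * g' y) - F a * (G b - G a) = (F b - F a) * G b - (LINT x|lebesgue. f' x * G x)"
    using eq2 by metis
  moreover have "X - Fa * (Gb - Ga) = (Fb - Fa) * Gb - Y \<Longrightarrow> Fb * Gb - Fa * Ga = Y + X"
    for X Y Fa Fb Ga Gb :: complex by (simp add: diff_eq_eq) (simp add: algebra_simps)
  ultimately have "F b * G b - F a * G a = (LINT x|lebesgue. f' x * G x) + (LINT y|lebesgue. F y * g' y)"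
    by metis
  also have "(LINT x|lebesgue. f' x * G x) = (LINT x:{a..b}|lebesgue. f x * G x)"
    by (simp add: set_lebesgue_integral_def f'_def)
  also have "\<dots> = integral {a..b} (\<lambda>x. f x * G x)"
    by (rule set_lebesgue_integral_eq_integral) (use l1 in \<open>auto simp: locally_integrable_def\<close>)
  also have "(LINT x|lebesgue. F x * g' x) = (LINT x:{a..b}|lebesgue. F x * g x)"
    by (simp add: set_lebesgue_integral_def g'_def)
  also have "\<dots> = integral {a..b} (\<lambda>x. F x * g x)"
    by (rule set_lebesgue_integral_eq_integral) (use l1 in \<open>auto simp: locally_integrable_def\<close>)
  also have "integral {a..b} (\<lambda>x. f x * G x) + integral {a..b} (\<lambda>x. F x * g x) = integral {a..b} (\<lambda>x. f x * G x + F x * g x)"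
    using l1 by (intro Henstock_Kurzweil_Integration.integral_add[symmetric]) (auto intro: locally_integrable_integrable_on)
  finally show "F b * G b - F a * G a = integral {a..b} (\<lambda>x. f x * G x + F x * g x)" .
qed

section \<open>Test functions and weak derivatives\<close>

text \<open>Recursion through \<open>deriv f\<close> lets closure under sums, products and affine
  substitutions go by induction; \<open>times_differentiable_iff\<close> links it to the iterated
  derivatives in \<open>test_functions\<close>.\<close>

fun times_differentiable :: "nat \<Rightarrow> (real \<Rightarrow> real) \<Rightarrow> bool" where
  "times_differentiable 0 f = True"
| "times_differentiable (Suc k) f =
     ((\<forall>x. f field_differentiable at x) \<and> times_differentiable k (deriv f))"

definition smooth :: "(real \<Rightarrow> real) \<Rightarrow> bool" where
  "smooth f \<longleftrightarrow> (\<forall>k. times_differentiable k f)"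

lemma times_differentiable_SucD: "times_differentiable (Suc k) f \<Longrightarrow> times_differentiable k f"
  by (induction k arbitrary: f) auto

lemma times_differentiable_iff:
  "times_differentiable k f \<longleftrightarrow> (\<forall>j<k. \<forall>x. (deriv ^^ j) f field_differentiable at x)"
proof (induction k arbitrary: f)
  case (Suc k)
  show ?case
    unfolding times_differentiable.simps Suc.IH funpow_simps_right(2)[symmetric, unfolded o_def]
    by (auto simp: less_Suc_eq_0_disj funpow_swap1)
qed simp

lemma smooth_iff: "smooth f \<longleftrightarrow> (\<forall>k x. (deriv ^^ k) f field_differentiable at x)"
  unfolding smooth_def times_differentiable_iff by blast

lemma smooth_deriv: "smooth f \<Longrightarrow> smooth (deriv f)"
  unfolding smooth_def by (metis times_differentiable.simps(2))

lemma smooth_DERIV: "smooth f \<Longrightarrow> (f has_real_derivative deriv f x) (at x)"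
  unfolding smooth_def
  by (metis times_differentiable.simps(2) field_differentiable_derivI)

lemma smooth_funpow_deriv: "smooth f \<Longrightarrow> smooth ((deriv ^^ k) f)"
  by (induction k) (auto intro: smooth_deriv)

lemma smooth_continuous: "smooth f \<Longrightarrow> continuous_on UNIV f"
  by (meson DERIV_continuous_on smooth_DERIV has_field_derivative_at_within)

lemma smooth_if_deriv:
  assumes "\<And>x. (f has_real_derivative g x) (at x)" "smooth g" shows "smooth f"
proof -
  have "deriv f = g" using assms(1) by (intro ext DERIV_imp_deriv)
  then have "times_differentiable (Suc k) f" for k
    using assms by (auto simp: smooth_def field_differentiable_def)
  then show ?thesis unfolding smooth_def using times_differentiable_SucD by blast
qed

lemma times_differentiable_const: "times_differentiable k (\<lambda>x. c)"
proof (induction k arbitrary: c)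
  case (Suc k)
  have "deriv (\<lambda>x::real. c) = (\<lambda>x. 0)" by simp
  then show ?case using Suc by simp
qed simp

lemma times_differentiable_add:
  "times_differentiable k f \<Longrightarrow> times_differentiable k g \<Longrightarrow> times_differentiable k (\<lambda>x. f x + g x)"
proof (induction k arbitrary: f g)
  case (Suc k)
  have "deriv (\<lambda>x. f x + g x) = (\<lambda>x. deriv f x + deriv g x)"
    using Suc.prems by (intro ext deriv_add) auto
  then show ?case using Suc by (auto intro: field_differentiable_add)
qed simp

lemma times_differentiable_mult:
  "times_differentiable k f \<Longrightarrow> times_differentiable k g \<Longrightarrow> times_differentiable k (\<lambda>x. f x * g x)"
proof (induction k arbitrary: f g)
  case (Suc k)
  have "deriv (\<lambda>x. f x * g x) = (\<lambda>x. f x * deriv g x + deriv f x * g x)"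
    using Suc.prems by (intro ext deriv_mult) auto
  then show ?case using Suc.prems Suc.prems[THEN times_differentiable_SucD]
    by (auto intro!: field_differentiable_mult times_differentiable_add Suc.IH)
qed simp

lemma times_differentiable_affine:
  "times_differentiable k f \<Longrightarrow> times_differentiable k (\<lambda>x. f (m * x + c))"
proof (induction k arbitrary: f)
  case (Suc k)
  have D: "((\<lambda>x. f (m * x + c)) has_real_derivative m * deriv f (m * x + c)) (at x)" for x
  proof -
    have "(f has_real_derivative deriv f (m * x + c)) (at (m * x + c))"
      using Suc.prems by (auto intro: field_differentiable_derivI)
    then have "((\<lambda>x. f (m * x + c)) has_real_derivative deriv f (m * x + c) * m) (at x)"
      by (rule DERIV_chain2) (auto intro!: derivative_eq_intros)
    then show ?thesis by (simp add: mult.commute)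
  qed
  then have "deriv (\<lambda>x. f (m * x + c)) = (\<lambda>x. m * deriv f (m * x + c))"
    by (intro ext DERIV_imp_deriv)
  then show ?case using Suc D
    by (auto simp: field_differentiable_def intro!: times_differentiable_mult times_differentiable_const)
qed simp

lemma smooth_const: "smooth (\<lambda>x. c)"
  and smooth_add: "smooth f \<Longrightarrow> smooth g \<Longrightarrow> smooth (\<lambda>x. f x + g x)"
  and smooth_mult: "smooth f \<Longrightarrow> smooth g \<Longrightarrow> smooth (\<lambda>x. f x * g x)"
  and smooth_affine: "smooth f \<Longrightarrow> smooth (\<lambda>x. f (m * x + c))"
  unfolding smooth_def
  by (auto intro: times_differentiable_const times_differentiable_add times_differentiable_mult times_differentiable_affine)

lemma funpow_deriv_add_cmult:
  assumes "smooth f" "smooth g"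
  shows "(deriv ^^ k) (\<lambda>x. f x + c * g x) = (\<lambda>x. (deriv ^^ k) f x + c * (deriv ^^ k) g x)"
proof (induction k)
  case (Suc k)
  have "((\<lambda>x. (deriv ^^ k) f x + c * (deriv ^^ k) g x) has_real_derivative
      (deriv ^^ Suc k) f x + c * (deriv ^^ Suc k) g x) (at x)" for x
    using smooth_DERIV[OF smooth_funpow_deriv[OF assms(1)], of k x]
      smooth_DERIV[OF smooth_funpow_deriv[OF assms(2)], of k x]
    by (auto intro!: derivative_eq_intros)
  then show ?case using Suc by (auto intro!: DERIV_imp_deriv)
qed simp

text \<open>The classical flat function exp(-1/x), with a polynomial in 1/x in front: this family is
  closed under differentiation, so smoothness at the origin needs only one difference
  quotient.\<close>

definition flat_fun :: "real poly \<Rightarrow> real \<Rightarrow> real" where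
  "flat_fun p x = (if x > 0 then poly p (1 / x) * exp (- (1 / x)) else 0)"

lemma poly_mult_exp_minus_tendsto_0: "((\<lambda>x. poly p x * exp (- x)) \<longlongrightarrow> (0::real)) at_top"
proof -
  have "((\<lambda>x. \<Sum>i\<le>degree p. coeff p i * (x ^ i / exp x)) \<longlongrightarrow> (\<Sum>i\<le>degree p. coeff p i * (0::real))) at_top"
    by (intro tendsto_intros tendsto_power_div_exp_0)
  moreover have "(\<lambda>x. \<Sum>i\<le>degree p. coeff p i * (x ^ i / exp x)) = (\<lambda>x. poly p x * exp (- x))"
    by (simp add: poly_altdef sum_distrib_right exp_minus divide_inverse mult.assoc)
  ultimately show ?thesis by simp
qed

lemma flat_fun_DERIV:
  "(flat_fun p has_real_derivative flat_fun ([:0, 0, 1:] * (p - pderiv p)) x) (at x)"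
proof -
  let ?q = "[:0, 0, 1:] * (p - pderiv p)"
  consider "x < 0" | "x = 0" | "x > 0" by linarith
  then show ?thesis
  proof cases
    case 1
    have "((\<lambda>x. 0) has_real_derivative flat_fun ?q x) (at x)" using 1 by (simp add: flat_fun_def)
    then show ?thesis
      by (rule has_field_derivative_transform_within_open[where S = "{..<0}"]) (use 1 in \<open>auto simp: flat_fun_def\<close>)
  next
    case 3
    have "((\<lambda>x. poly p (1 / x) * exp (- (1 / x))) has_real_derivative flat_fun ?q x) (at x)"
      using 3 by (auto intro!: derivative_eq_intros poly_DERIV[THEN DERIV_chain2] simp: flat_fun_def field_simps power2_eq_square)
    then show ?thesis
      by (rule has_field_derivative_transform_within_open[where S = "{0<..}"]) (use 3 in \<open>auto simp: flat_fun_def\<close>)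
  next
    case 2
    \<comment> \<open>With y = 1/h the quotient is y p(y) exp(-y), again a polynomial against a
      decaying exponential.\<close>
    have "((\<lambda>h. (flat_fun p h - flat_fun p 0) / (h - 0)) \<longlongrightarrow> 0) (at_right 0)"
    proof (rule Lim_transform_eventually)
      show "((\<lambda>h. poly (pCons 0 p) (inverse h) * exp (- inverse h)) \<longlongrightarrow> 0) (at_right 0)"
        by (rule filterlim_compose[OF poly_mult_exp_minus_tendsto_0 filterlim_inverse_at_top_right])
      show "\<forall>\<^sub>F h in at_right 0. poly (pCons 0 p) (inverse h) * exp (- inverse h) = (flat_fun p h - flat_fun p 0) / (h - 0)"
        by (rule eventually_at_right_less[THEN eventually_mono]) (auto simp: flat_fun_def field_simps)
    qed
    moreover have "((\<lambda>h. (flat_fun p h - flat_fun p 0) / (h - 0)) \<longlongrightarrow> 0) (at_left 0)"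
      by (rule tendsto_eventually) (auto simp: flat_fun_def eventually_at_left_field intro: exI[of _ "-1"])
    ultimately have "((\<lambda>h. (flat_fun p h - flat_fun p 0) / (h - 0)) \<longlongrightarrow> 0) (at 0)"
      by (simp add: filterlim_split_at)
    then show ?thesis using 2 by (simp add: has_field_derivative_iff flat_fun_def)
  qed
qed

lemma smooth_flat_fun: "smooth (flat_fun p)"
proof -
  have "times_differentiable k (flat_fun p)" for k
  proof (induction k arbitrary: p)
    case (Suc k)
    have "deriv (flat_fun p) = flat_fun ([:0, 0, 1:] * (p - pderiv p))"
      using flat_fun_DERIV by (intro ext DERIV_imp_deriv)
    then show ?case using Suc flat_fun_DERIV by (metis times_differentiable.simps(2) field_differentiable_def)
  qed simp
  then show ?thesis by (simp add: smooth_def)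
qed

section \<open>Test functions and the du Bois-Reymond lemma\<close>

lemma test_functions_iff: "\<phi> \<in> test_functions \<longleftrightarrow> smooth \<phi> \<and> (\<exists>R>0. \<forall>x. \<bar>x\<bar> \<ge> R \<longrightarrow> \<phi> x = 0)"
proof -
  have "compact (closure {x. \<phi> x \<noteq> 0}) \<longleftrightarrow> bounded {x. \<phi> x \<noteq> 0}"
    using bounded_closure_image compact_closure by blast
  also have "\<dots> \<longleftrightarrow> (\<exists>R>0. \<forall>x. \<bar>x\<bar> \<ge> R \<longrightarrow> \<phi> x = 0)"
    unfolding bounded_pos_less by (auto simp: not_le[symmetric])
  finally show ?thesis by (simp add: test_functions_def smooth_iff)
qed

lemma test_functions_deriv:
  assumes "\<phi> \<in> test_functions" shows "deriv \<phi> \<in> test_functions"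
proof -
  obtain R where R: "R > 0" "\<And>x. \<bar>x\<bar> \<ge> R \<Longrightarrow> \<phi> x = 0" and s: "smooth \<phi>"
    using assms by (auto simp: test_functions_iff)
  have "deriv \<phi> x = 0" if "\<bar>x\<bar> \<ge> R + 1" for x
  proof -
    have "(\<phi> has_real_derivative 0) (at x)"
      by (rule has_field_derivative_transform_within_open[where S = "ball x 1" and f = "\<lambda>x. 0"])
        (use that R in \<open>auto simp: dist_real_def\<close>)
    then show ?thesis by (rule DERIV_imp_deriv)
  qed
  then show ?thesis using R(1) smooth_deriv[OF s] by (auto simp: test_functions_iff intro!: exI[of _ "R + 1"])
qed

lemma test_functions_funpow_deriv: "\<phi> \<in> test_functions \<Longrightarrow> (deriv ^^ k) \<phi> \<in> test_functions"
  by (induction k) (auto intro: test_functions_deriv)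

lemma test_functions_add_cmult:
  assumes "\<phi> \<in> test_functions" "\<psi> \<in> test_functions"
  shows "(\<lambda>x. \<phi> x + c * \<psi> x) \<in> test_functions"
proof -
  obtain R where R: "R > 0" "\<And>x. \<bar>x\<bar> \<ge> R \<Longrightarrow> \<phi> x = 0" using assms by (auto simp: test_functions_iff)
  obtain S where S: "S > 0" "\<And>x. \<bar>x\<bar> \<ge> S \<Longrightarrow> \<psi> x = 0" using assms by (auto simp: test_functions_iff)
  show ?thesis using assms R S
    by (auto simp: test_functions_iff intro!: smooth_add smooth_mult smooth_const exI[of _ "max R S"])
qed

lemma integrable_mult_compact_support:
  fixes f :: "real \<Rightarrow> complex" and \<phi> :: "real \<Rightarrow> real"
  assumes \<phi>: "continuous_on UNIV \<phi>" "\<And>x. \<bar>x\<bar> \<ge> R \<Longrightarrow> \<phi> x = 0" and f: "locally_integrable f"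
  shows "integrable lebesgue (\<lambda>x. \<phi> x *\<^sub>R f x)"
    and "(LINT x|lebesgue. \<phi> x *\<^sub>R f x) = integral {-R..R} (\<lambda>x. \<phi> x *\<^sub>R f x)"
proof -
  have "locally_integrable (\<lambda>x. complex_of_real (\<phi> x) * f x)"
    using \<phi>(1) by (intro locally_integrable_mult_continuous[OF f]) (intro continuous_intros)
  then have s: "set_integrable lebesgue {-R..R} (\<lambda>x. \<phi> x *\<^sub>R f x)"
    by (simp add: locally_integrable_def scaleR_conv_of_real)
  have eq: "(\<lambda>x. indicator {-R..R} x *\<^sub>R \<phi> x *\<^sub>R f x) = (\<lambda>x. \<phi> x *\<^sub>R f x)"
    using \<phi>(2) by (auto simp: fun_eq_iff abs_if split: split_indicator)
  show "integrable lebesgue (\<lambda>x. \<phi> x *\<^sub>R f x)" using s eq by (simp add: set_integrable_def)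
  show "(LINT x|lebesgue. \<phi> x *\<^sub>R f x) = integral {-R..R} (\<lambda>x. \<phi> x *\<^sub>R f x)"
    using set_lebesgue_integral_eq_integral(2)[OF s] eq by (simp add: set_lebesgue_integral_def)
qed

lemma test_function_integrable:
  fixes f :: "real \<Rightarrow> complex"
  assumes "\<phi> \<in> test_functions" "locally_integrable f"
  shows "integrable lebesgue (\<lambda>x. \<phi> x *\<^sub>R f x)"
  using assms integrable_mult_compact_support(1)[OF smooth_continuous] by (metis test_functions_iff)

text \<open>With F the flat function, F(m (x - a)) F(m (b - x)) vanishes outside the interval, stays
  below 1 and tends to 1 inside as m = n + 1 grows.\<close>

lemma test_function_bump:
  assumes "a < b"
  obtains B where "\<And>n. B n \<in> test_functions" "\<And>n x. \<bar>B n x\<bar> \<le> indicat_real {a..b} x"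
    "\<And>x. (\<lambda>n. B n x) \<longlonglongrightarrow> indicator {a<..<b} x"
proof
  define F where "F = flat_fun 1"
  have Fs: "smooth F" and F01: "\<And>x. 0 \<le> F x" "\<And>x. F x \<le> 1" and F0: "\<And>x. x \<le> 0 \<Longrightarrow> F x = 0"
    by (auto simp: F_def smooth_flat_fun flat_fun_def)
  define B where "B n x = F ((real n + 1) * x + (- (real n + 1) * a)) * F ((- (real n + 1)) * x + (real n + 1) * b)" for n x
  have Bz: "B n x = 0" if "x \<notin> {a..b}" for n x
  proof -
    have "(real n + 1) * x + (- (real n + 1) * a) = (real n + 1) * (x - a)"
       "(- (real n + 1)) * x + (real n + 1) * b = (real n + 1) * (b - x)" by (simp_all add: algebra_simps)
    then show ?thesis using that by (auto simp: B_def intro!: F0 mult_nonneg_nonpos)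
  qed
  have "smooth (B n)" for n
    unfolding B_def by (intro smooth_mult smooth_affine Fs)
  moreover have "\<exists>R>0. \<forall>x. \<bar>x\<bar> \<ge> R \<longrightarrow> B n x = 0" for n
    by (rule exI[of _ "\<bar>a\<bar> + \<bar>b\<bar> + 1"]) (auto intro!: Bz)
  ultimately show "B n \<in> test_functions" for n by (simp add: test_functions_iff)
  show "\<bar>B n x\<bar> \<le> indicat_real {a..b} x" for n x
  proof (cases "x \<in> {a..b}")
    case True
    have "\<bar>B n x\<bar> \<le> 1 * 1" unfolding B_def abs_mult using F01 by (intro mult_mono) auto
    then show ?thesis using True by simp
  qed (simp add: Bz)
  show "(\<lambda>n. B n x) \<longlonglongrightarrow> indicator {a<..<b} x" for x
  proof (cases "x \<in> {a<..<b}")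
    case True
    have T: "(\<lambda>n. F ((real n + 1) * c)) \<longlonglongrightarrow> 1" if "c > 0" for c
    proof -
      have "(\<lambda>n. exp (- (1 / ((real n + 1) * c)))) \<longlonglongrightarrow> exp (- 0)"
        using that by (intro tendsto_intros) real_asymp
      then show ?thesis using that by (simp add: F_def flat_fun_def)
    qed
    have "(\<lambda>n. F ((real n + 1) * (x - a)) * F ((real n + 1) * (b - x))) \<longlonglongrightarrow> 1 * 1"
      using True by (intro tendsto_mult T) auto
    then show ?thesis using True by (simp add: B_def algebra_simps)
  next
    case False
    have "B n x = 0" for n
    proof (cases "x \<in> {a..b}")
      case True
      then have "x = a \<or> x = b" using False by auto
      then show ?thesis using F0[of 0] by (auto simp: B_def algebra_simps)
    qed (rule Bz)
    then show ?thesis using False by simp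
  qed
qed

text \<open>Dominated convergence along bumps turns vanishing against test functions into vanishing
  over intervals.\<close>

lemma AE_zero_if_test_integrals_zero:
  fixes f :: "real \<Rightarrow> complex"
  assumes f: "locally_integrable f"
    and z: "\<And>\<phi>. \<phi> \<in> test_functions \<Longrightarrow> (LINT x|lebesgue. \<phi> x *\<^sub>R f x) = 0"
  shows "AE x in lebesgue. f x = 0"
proof (rule AE_zero_if_interval_integrals_zero[OF f])
  fix a b :: real assume "a \<le> b"
  show "integral {a..b} f = 0"
  proof (cases "a = b")
    case False
    then obtain B where B: "\<And>n. B n \<in> test_functions" "\<And>n x. \<bar>B n x\<bar> \<le> indicat_real {a..b} x"
      "\<And>x. (\<lambda>n. B n x) \<longlonglongrightarrow> indicator {a<..<b} x"
      using test_function_bump[of a b] \<open>a \<le> b\<close> by (metis order_le_less)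
    have si: "set_integrable lebesgue {a..b} f" using f by (simp add: locally_integrable_def)
    have "(\<lambda>n. LINT x|lebesgue. B n x *\<^sub>R f x) \<longlonglongrightarrow> (LINT x|lebesgue. indicator {a<..<b} x *\<^sub>R f x)"
    proof (rule integral_dominated_convergence[where w = "\<lambda>x. norm (indicator {a..b} x *\<^sub>R f x)"])
      show "(\<lambda>x. indicator {a<..<b} x *\<^sub>R f x) \<in> borel_measurable lebesgue"
        using locally_integrable_borel_measurable[OF f] by (intro borel_measurable_scaleR borel_measurable_indicator) auto
      show "\<And>n. (\<lambda>x. B n x *\<^sub>R f x) \<in> borel_measurable lebesgue"
        using test_function_integrable[OF B(1) f] by (rule borel_measurable_integrable)
      show "integrable lebesgue (\<lambda>x. norm (indicat_real {a..b} x *\<^sub>R f x))"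
        using si by (simp add: set_integrable_def del: norm_scaleR)
      show "AE x in lebesgue. (\<lambda>n. B n x *\<^sub>R f x) \<longlonglongrightarrow> indicat_real {a<..<b} x *\<^sub>R f x"
        using B(3) by (intro AE_I2 tendsto_intros)
      show "\<And>n. AE x in lebesgue. norm (B n x *\<^sub>R f x) \<le> norm (indicat_real {a..b} x *\<^sub>R f x)"
        using B(2) by (intro AE_I2) (auto intro!: mult_right_mono)
    qed
    then have "(LINT x|lebesgue. indicator {a<..<b} x *\<^sub>R f x) = 0"
      unfolding z[OF B(1)] LIMSEQ_const_iff by (rule sym)
    moreover have "(LINT x|lebesgue. indicator {a<..<b} x *\<^sub>R f x) = integral {a<..<b} f"
      using set_lebesgue_integral_eq_integral(2)[OF set_integrable_subset[OF si, of "{a<..<b}"]]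
      by (simp add: subset_eq set_lebesgue_integral_def)
    moreover have "integral {a<..<b} f = integral {a..b} f"
      using integral_open_interval[of a b f] by (simp add: box_real)
    ultimately show ?thesis by simp
  qed simp
qed

section \<open>Weak derivatives as repeated primitives\<close>

lemma has_weak_deriv_unique_AE:
  fixes f :: "real \<Rightarrow> complex"
  assumes "has_weak_deriv k f g" "has_weak_deriv k f h"
  shows "AE x in lebesgue. g x = h x"
proof -
  have l: "locally_integrable g" "locally_integrable h" using assms by (auto simp: has_weak_deriv_def)
  have "AE x in lebesgue. g x - h x = 0"
  proof (rule AE_zero_if_test_integrals_zero)
    show "locally_integrable (\<lambda>x. g x - h x)" using l by (auto simp: locally_integrable_def)
    fix \<phi> assume \<phi>: "\<phi> \<in> test_functions"
    then have "(- 1) ^ k *\<^sub>R (LINT x|lebesgue. \<phi> x *\<^sub>R g x) = ((- 1) ^ k :: real) *\<^sub>R (LINT x|lebesgue. \<phi> x *\<^sub>R h x)"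
      using assms by (auto simp: has_weak_deriv_def)
    then have "(LINT x|lebesgue. \<phi> x *\<^sub>R g x) = (LINT x|lebesgue. \<phi> x *\<^sub>R h x)" by simp
    then show "(LINT x|lebesgue. \<phi> x *\<^sub>R (g x - h x)) = 0"
      using test_function_integrable[OF \<phi> l(1)] test_function_integrable[OF \<phi> l(2)]
      by (simp add: scaleR_diff_right)
  qed
  then show ?thesis by simp
qed

lemma has_weak_deriv_0: "locally_integrable f \<Longrightarrow> has_weak_deriv 0 f f"
  by (simp add: has_weak_deriv_def)

lemma has_weak_deriv_0_AE:
  fixes f :: "real \<Rightarrow> complex"
  assumes "has_weak_deriv 0 f g" shows "AE x in lebesgue. f x = g x"
  using has_weak_deriv_unique_AE[OF has_weak_deriv_0 assms] assms by (simp add: has_weak_deriv_def)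

lemma test_function_integral_by_parts:
  assumes \<phi>: "\<phi> \<in> test_functions" and G: "antideriv G g"
  shows "(LINT x|lebesgue. deriv \<phi> x *\<^sub>R G x) = - (LINT x|lebesgue. \<phi> x *\<^sub>R g x)"
proof -
  obtain R1 where R1: "R1 > 0" "\<And>x. \<bar>x\<bar> \<ge> R1 \<Longrightarrow> \<phi> x = 0" and s: "smooth \<phi>"
    using \<phi> by (auto simp: test_functions_iff)
  obtain R2 where R2: "R2 > 0" "\<And>x. \<bar>x\<bar> \<ge> R2 \<Longrightarrow> deriv \<phi> x = 0"
    using test_functions_deriv[OF \<phi>] by (auto simp: test_functions_iff)
  define R where "R = max R1 R2"
  have R: "R > 0" "\<And>x. \<bar>x\<bar> \<ge> R \<Longrightarrow> \<phi> x = 0" "\<And>x. \<bar>x\<bar> \<ge> R \<Longrightarrow> deriv \<phi> x = 0"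
    using R1 R2 by (auto simp: R_def)
  have Gl: "locally_integrable G" by (rule continuous_locally_integrable[OF antideriv_continuous[OF G]])
  have gl: "locally_integrable g" using G by (rule antideriv_locally_integrable)
  have c: "continuous_on UNIV \<phi>" "continuous_on UNIV (deriv \<phi>)"
    using s smooth_deriv smooth_continuous by blast+
  have "antideriv (\<lambda>x. complex_of_real (\<phi> x)) (\<lambda>x. complex_of_real (deriv \<phi> x))"
  proof (rule antideriv_C1)
    show "((\<lambda>x. complex_of_real (\<phi> x)) has_vector_derivative complex_of_real (deriv \<phi> x)) (at x)" for x
      by (rule has_vector_derivative_of_real[OF smooth_DERIV[OF s]])
  qed (intro continuous_intros c)
  from antideriv_mult[OF this G]
  have "complex_of_real (\<phi> R) * G R - complex_of_real (\<phi> (-R)) * G (-R) =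
     integral {-R..R} (\<lambda>x. complex_of_real (deriv \<phi> x) * G x + complex_of_real (\<phi> x) * g x)"
    by (rule antiderivD) (use R in auto)
  then have "0 = integral {-R..R} (\<lambda>x. complex_of_real (deriv \<phi> x) * G x + complex_of_real (\<phi> x) * g x)"
    using R by simp
  also have "\<dots> = integral {-R..R} (\<lambda>x. complex_of_real (deriv \<phi> x) * G x) + integral {-R..R} (\<lambda>x. complex_of_real (\<phi> x) * g x)"
    by (intro Henstock_Kurzweil_Integration.integral_add locally_integrable_integrable_on locally_integrable_mult_continuous
         continuous_intros c Gl gl)
  also have "integral {-R..R} (\<lambda>x. complex_of_real (deriv \<phi> x) * G x) = (LINT x|lebesgue. deriv \<phi> x *\<^sub>R G x)"
    using integrable_mult_compact_support(2)[OF c(2) R(3) Gl] by (simp add: scaleR_conv_of_real)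
  also have "integral {-R..R} (\<lambda>x. complex_of_real (\<phi> x) * g x) = (LINT x|lebesgue. \<phi> x *\<^sub>R g x)"
    using integrable_mult_compact_support(2)[OF c(1) R(2) gl] by (simp add: scaleR_conv_of_real)
  finally show ?thesis by (simp add: eq_neg_iff_add_eq_0)
qed

lemma has_weak_deriv_Suc:
  assumes f: "has_weak_deriv k f G" and G: "antideriv G g"
  shows "has_weak_deriv (Suc k) f g"
  unfolding has_weak_deriv_def
proof (intro conjI ballI)
  show "locally_integrable f" "locally_integrable g"
    using f G by (auto simp: has_weak_deriv_def antideriv_def)
  fix \<phi> assume \<phi>: "\<phi> \<in> test_functions"
  have "(LINT x|lebesgue. (deriv ^^ Suc k) \<phi> x *\<^sub>R f x) = (-1) ^ k *\<^sub>R (LINT x|lebesgue. deriv \<phi> x *\<^sub>R G x)"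
    using f test_functions_deriv[OF \<phi>] by (simp add: has_weak_deriv_def funpow_Suc_right del: funpow.simps)
  then show "(LINT x|lebesgue. (deriv ^^ Suc k) \<phi> x *\<^sub>R f x) = (-1) ^ Suc k *\<^sub>R (LINT x|lebesgue. \<phi> x *\<^sub>R g x)"
    using test_function_integral_by_parts[OF \<phi> G] by simp
qed

text \<open>The primitive that is 0 to the left of the support returns to 0 on the right exactly
  because the total integral vanishes.\<close>

lemma test_function_antiderivative:
  assumes \<psi>: "\<psi> \<in> test_functions" and z: "(LINT x|lebesgue. \<psi> x *\<^sub>R (1::complex)) = 0"
  obtains \<eta> where "\<eta> \<in> test_functions" "deriv \<eta> = \<psi>"
proof -
  obtain R where R: "R > 0" "\<And>x. \<bar>x\<bar> \<ge> R \<Longrightarrow> \<psi> x = 0" and s: "smooth \<psi>"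
    using \<psi> by (auto simp: test_functions_iff)
  have c: "continuous_on UNIV (\<lambda>x. complex_of_real (\<psi> x))"
    by (intro continuous_intros smooth_continuous s)
  obtain F where F: "antideriv F (\<lambda>x. complex_of_real (\<psi> x))" "F (-R) = 0"
    using antideriv_exists[OF continuous_locally_integrable[OF c]] .
  have D: "((\<lambda>x. Re (F x)) has_real_derivative \<psi> x) (at x)" for x
    using bounded_linear.has_vector_derivative[OF bounded_linear_Re antideriv_derivative[OF F(1) c]]
    by (simp add: has_real_derivative_iff_has_vector_derivative)
  have i: "integral {-R..R} (\<lambda>x. complex_of_real (\<psi> x)) = 0"
    using integrable_mult_compact_support(2)[OF smooth_continuous[OF s] R(2), where f = "\<lambda>x. 1"] z
    by (auto simp: continuous_locally_integrable scaleR_conv_of_real)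
  have l: "F x = 0" if "x \<le> -R" for x
  proof -
    have "F (-R) - F x = integral {x..-R} (\<lambda>x. complex_of_real (\<psi> x))" using F(1) that by (rule antiderivD)
    also have "\<dots> = integral {x..-R} (\<lambda>x. 0)"
      using R that by (intro Henstock_Kurzweil_Integration.integral_cong) auto
    finally show ?thesis using F(2) by simp
  qed
  have FR: "F R = 0" using antiderivD[OF F(1), of "-R" R] R(1) F(2) i by simp
  have r: "F x = 0" if "x \<ge> R" for x
  proof -
    have "F x - F R = integral {R..x} (\<lambda>x. complex_of_real (\<psi> x))" using F(1) that by (rule antiderivD)
    also have "\<dots> = integral {R..x} (\<lambda>x. 0)"
      using R that by (intro Henstock_Kurzweil_Integration.integral_cong) auto
    finally show ?thesis using FR by simp
  qed
  have "(\<lambda>x. Re (F x)) \<in> test_functions"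
    unfolding test_functions_iff
  proof (intro conjI)
    show "smooth (\<lambda>x. Re (F x))" using D s by (rule smooth_if_deriv)
    show "\<exists>R>0. \<forall>x. R \<le> \<bar>x\<bar> \<longrightarrow> Re (F x) = 0"
    proof (intro exI[of _ R] conjI R(1) allI impI)
      fix x assume "R \<le> \<bar>x\<bar>"
      then have "x \<ge> R \<or> x \<le> -R" by linarith
      then show "Re (F x) = 0" using l r by auto
    qed
  qed
  moreover have "deriv (\<lambda>x. Re (F x)) = \<psi>" using D by (intro ext DERIV_imp_deriv)
  ultimately show ?thesis using that by blast
qed

text \<open>A primitive \<open>G0\<close> of \<open>g\<close> satisfies the identity of order k
  against test functions of mean zero, since these are derivatives of test functions. Subtracting a
  multiple of a fixed \<rho> of mean one reduces every test function to this case, at the price of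
  one constant of integration.\<close>

lemma has_weak_deriv_SucE:
  fixes f :: "real \<Rightarrow> complex"
  assumes f: "has_weak_deriv (Suc k) f g"
  obtains G where "antideriv G g" "has_weak_deriv k f G"
proof -
  have lf: "locally_integrable f" and lg: "locally_integrable g" using f by (auto simp: has_weak_deriv_def)
  obtain G0 where G0: "antideriv G0 g" using antideriv_exists[OF lg] .
  have lG0: "locally_integrable G0" by (rule continuous_locally_integrable[OF antideriv_continuous[OF G0]])
  have l1: "locally_integrable (\<lambda>x::real. 1::complex)" by (rule continuous_locally_integrable) simp
  \<comment> \<open>Otherwise the constant function 1 would vanish almost everywhere.\<close>
  have "\<exists>\<rho>0. \<rho>0 \<in> test_functions \<and> (LINT x|lebesgue. \<rho>0 x *\<^sub>R (1::complex)) \<noteq> 0"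
  proof (rule ccontr)
    assume "\<nexists>\<rho>0. \<rho>0 \<in> test_functions \<and> (LINT x|lebesgue. \<rho>0 x *\<^sub>R (1::complex)) \<noteq> 0"
    then have z: "\<And>\<phi>. \<phi> \<in> test_functions \<Longrightarrow> (LINT x|lebesgue. \<phi> x *\<^sub>R (1::complex)) = 0" by blast
    have "AE x::real in lebesgue. (1::complex) = 0"
      by (rule AE_zero_if_test_integrals_zero[OF l1]) (rule z)
    then have "AE x::real in lborel. (1::complex) = 0" by (rule AE_completion_iff[THEN iffD1])
    then have "emeasure lborel {x::real \<in> space lborel. \<not> (1::complex) = 0} = 0"
      by (rule AE_iff_measurable[THEN iffD1, rotated 2]) auto
    then show False by simp
  qed
  then obtain \<rho>0 where \<rho>0: "\<rho>0 \<in> test_functions" "(LINT x|lebesgue. \<rho>0 x *\<^sub>R (1::complex)) \<noteq> 0" by blast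
  define I where "I \<psi> = (LINT x|lebesgue. \<psi> x)" for \<psi> :: "real \<Rightarrow> real"
  have I: "(LINT x|lebesgue. \<psi> x *\<^sub>R (1::complex)) = complex_of_real (I \<psi>)" for \<psi>
    by (simp add: scaleR_conv_of_real I_def)
  \<comment> \<open>The summand \<open>0 * \<rho>0 x\<close> gives the normalised function the shape
    of \<open>test_functions_add_cmult\<close>.\<close>
  define \<rho> where "\<rho> x = 0 * \<rho>0 x + (1 / I \<rho>0) * \<rho>0 x" for x
  have "\<rho> = (\<lambda>x. (\<lambda>x. 0 * \<rho>0 x) x + (1 / I \<rho>0) * \<rho>0 x)" by (simp add: \<rho>_def fun_eq_iff)
  moreover have "(\<lambda>x. 0 * \<rho>0 x) \<in> test_functions"
    by (auto simp: test_functions_iff smooth_const intro: exI[of _ 1])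
  ultimately have \<rho>: "\<rho> \<in> test_functions" using test_functions_add_cmult[OF _ \<rho>0(1)] by metis
  have I\<rho>: "I \<rho> = 1" using \<rho>0(2) I[of \<rho>0] by (simp add: \<rho>_def[abs_def] I_def)
  \<comment> \<open>The value forced by testing the identity of order k with \<rho> itself.\<close>
  define c where "c = (-1) ^ k *\<^sub>R (LINT x|lebesgue. (deriv ^^ k) \<rho> x *\<^sub>R f x) - (LINT x|lebesgue. \<rho> x *\<^sub>R G0 x)"
  have "has_weak_deriv k f (\<lambda>x. G0 x + c)"
    unfolding has_weak_deriv_def
  proof (intro conjI ballI lf)
    show "locally_integrable (\<lambda>x. G0 x + c)"
      by (intro continuous_locally_integrable continuous_intros antideriv_continuous[OF G0])
    fix \<psi> assume \<psi>: "\<psi> \<in> test_functions"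
    define \<xi> where "\<xi> x = \<psi> x + (- I \<psi>) * \<rho> x" for x
    have \<xi>: "\<xi> \<in> test_functions" unfolding \<xi>_def[abs_def] by (rule test_functions_add_cmult[OF \<psi> \<rho>])
    have sm: "smooth \<psi>" "smooth \<rho>" using \<psi> \<rho> by (auto simp: test_functions_iff)
    have ii: "integrable lebesgue \<phi>" if "\<phi> \<in> test_functions" for \<phi> :: "real \<Rightarrow> real"
      using integrable_Re[OF test_function_integrable[OF that l1]] by (simp add: scaleR_conv_of_real)
    have "I \<xi> = 0" using ii[OF \<psi>] ii[OF \<rho>] I\<rho> unfolding I_def \<xi>_def by simp
    then have "(LINT x|lebesgue. \<xi> x *\<^sub>R (1::complex)) = 0" using I by simp
    then obtain \<eta> where \<eta>: "\<eta> \<in> test_functions" "deriv \<eta> = \<xi>"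
      using test_function_antiderivative[OF \<xi>] by blast
    have "(LINT x|lebesgue. (deriv ^^ Suc k) \<eta> x *\<^sub>R f x) = (-1) ^ Suc k *\<^sub>R (LINT x|lebesgue. \<eta> x *\<^sub>R g x)"
      using f \<eta> by (simp only: has_weak_deriv_def)
    then have e1: "(LINT x|lebesgue. (deriv ^^ k) \<xi> x *\<^sub>R f x) = (-1) ^ k *\<^sub>R (LINT x|lebesgue. \<xi> x *\<^sub>R G0 x)"
      using test_function_integral_by_parts[OF \<eta>(1) G0] \<eta>(2) by (simp add: funpow_Suc_right del: funpow.simps)
    have d: "(deriv ^^ k) \<xi> = (\<lambda>x. (deriv ^^ k) \<psi> x + (- I \<psi>) * (deriv ^^ k) \<rho> x)"
      unfolding \<xi>_def[abs_def] by (rule funpow_deriv_add_cmult[OF sm])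
    note int = test_function_integrable[OF test_functions_funpow_deriv[OF \<psi>] lf, of k] 
      test_function_integrable[OF test_functions_funpow_deriv[OF \<rho>] lf, of k]
      test_function_integrable[OF \<psi> lG0] test_function_integrable[OF \<rho> lG0] test_function_integrable[OF \<psi> l1]
    have lin: "(LINT x|lebesgue. (p x + (- I \<psi>) * q x) *\<^sub>R u x) =
        (LINT x|lebesgue. p x *\<^sub>R u x) - I \<psi> *\<^sub>R (LINT x|lebesgue. q x *\<^sub>R u x)"
      if "integrable lebesgue (\<lambda>x. p x *\<^sub>R u x)" "integrable lebesgue (\<lambda>x. q x *\<^sub>R u x)"
      for p q :: "real \<Rightarrow> real" and u :: "real \<Rightarrow> complex"
    proof -
      have "(LINT x|lebesgue. (p x + (- I \<psi>) * q x) *\<^sub>R u x) = (LINT x|lebesgue. p x *\<^sub>R u x - I \<psi> *\<^sub>R (q x *\<^sub>R u x))"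
        by (rule Bochner_Integration.integral_cong) (simp_all add: scaleR_left_diff_distrib)
      then show ?thesis
        using Bochner_Integration.integral_diff[OF that(1) integrable_scaleR_right[OF that(2)]] by (simp only: integral_scaleR_right)
    qed
    have e2: "(LINT x|lebesgue. (deriv ^^ k) \<xi> x *\<^sub>R f x) =
        (LINT x|lebesgue. (deriv ^^ k) \<psi> x *\<^sub>R f x) - I \<psi> *\<^sub>R (LINT x|lebesgue. (deriv ^^ k) \<rho> x *\<^sub>R f x)"
      unfolding d by (rule lin[OF int(1,2)])
    have e3: "(LINT x|lebesgue. \<xi> x *\<^sub>R G0 x) =
        (LINT x|lebesgue. \<psi> x *\<^sub>R G0 x) - I \<psi> *\<^sub>R (LINT x|lebesgue. \<rho> x *\<^sub>R G0 x)"
      unfolding \<xi>_def by (rule lin[OF int(3,4)])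
    have e4: "(LINT x|lebesgue. \<psi> x *\<^sub>R (G0 x + c)) = (LINT x|lebesgue. \<psi> x *\<^sub>R G0 x) + I \<psi> *\<^sub>R c"
    proof -
      have "(LINT x|lebesgue. \<psi> x *\<^sub>R (G0 x + c)) = (LINT x|lebesgue. \<psi> x *\<^sub>R G0 x + (\<psi> x *\<^sub>R 1) * c)"
        by (rule Bochner_Integration.integral_cong) (simp_all add: scaleR_add_right)
      also have "\<dots> = (LINT x|lebesgue. \<psi> x *\<^sub>R G0 x) + (LINT x|lebesgue. (\<psi> x *\<^sub>R 1) * c)"
        by (rule Bochner_Integration.integral_add[OF int(3) integrable_mult_left[OF int(5)]])
      also have "(LINT x|lebesgue. (\<psi> x *\<^sub>R 1) * c) = complex_of_real (I \<psi>) * c"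
        by (simp only: integral_mult_left_zero I)
      finally show ?thesis by (simp add: scaleR_conv_of_real)
    qed
    define X where "X = (LINT x|lebesgue. (deriv ^^ k) \<rho> x *\<^sub>R f x)"
    define Y Z S where "Y = (LINT x|lebesgue. \<psi> x *\<^sub>R G0 x)" and "Z = (LINT x|lebesgue. \<rho> x *\<^sub>R G0 x)"
      and "S = (LINT x|lebesgue. (deriv ^^ k) \<psi> x *\<^sub>R f x)"
    have "S - I \<psi> *\<^sub>R X = (-1) ^ k *\<^sub>R (Y - I \<psi> *\<^sub>R Z)"
      using e1 unfolding e2 e3 X_def Y_def Z_def S_def .
    then have "S = (-1) ^ k *\<^sub>R (Y + I \<psi> *\<^sub>R ((-1) ^ k *\<^sub>R X - Z))"
      by (cases "even k") (simp_all add: scaleR_diff_right diff_eq_eq minus_diff_eq)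
    then show "(LINT x|lebesgue. (deriv ^^ k) \<psi> x *\<^sub>R f x) = (-1) ^ k *\<^sub>R (LINT x|lebesgue. \<psi> x *\<^sub>R (G0 x + c))"
      using e4 by (simp only: c_def X_def[symmetric] Y_def[symmetric] Z_def[symmetric] S_def[symmetric])
  qed
  moreover have "antideriv (\<lambda>x. G0 x + c) g" using antideriv_add[OF G0 antideriv_const] by simp
  ultimately show ?thesis using that by blast
qed

section \<open>The Hilbert space of square integrable functions\<close>

no_notation scalar_prod (infix "\<bullet>" 70)

lemma Lp2_iff: "f \<in> Lp 2 \<longleftrightarrow> f \<in> borel_measurable lebesgue \<and> integrable lebesgue (\<lambda>x. (norm (f x))\<^sup>2)"
  by (simp add: Lp_def)

lemma Lp2_measurable[dest, measurable_dest]: "f \<in> Lp 2 \<Longrightarrow> f \<in> borel_measurable lebesgue"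
  by (simp add: Lp2_iff)

lemma Lp2_integrable_square: "f \<in> Lp 2 \<Longrightarrow> integrable lebesgue (\<lambda>x. (norm (f x))\<^sup>2)"
  by (simp add: Lp2_iff)

lemma Lp2_bound:
  assumes "f \<in> borel_measurable lebesgue" "integrable lebesgue g" "AE x in lebesgue. (norm (f x))\<^sup>2 \<le> g x"
  shows "f \<in> Lp 2"
  unfolding Lp2_iff
proof
  show "integrable lebesgue (\<lambda>x. (norm (f x))\<^sup>2)"
    by (rule Bochner_Integration.integrable_bound[OF assms(2)]) (use assms in \<open>auto intro: order_trans\<close>)
qed (rule assms)

lemma Lp2_bounded_mult:
  fixes f g :: "real \<Rightarrow> complex"
  assumes "f \<in> Lp 2" "g \<in> borel_measurable lebesgue" "AE x in lebesgue. norm (g x) \<le> C"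
  shows "(\<lambda>x. g x * f x) \<in> Lp 2"
proof (rule Lp2_bound)
  show "integrable lebesgue (\<lambda>x. C\<^sup>2 * (norm (f x))\<^sup>2)" using assms(1) by (simp add: Lp2_integrable_square)
  show "AE x in lebesgue. (norm (g x * f x))\<^sup>2 \<le> C\<^sup>2 * (norm (f x))\<^sup>2"
    using assms(3) by eventually_elim (auto simp: norm_mult power_mult_distrib intro!: mult_right_mono power_mono)
qed (use assms in auto)

lemma Lp2_AE_cong:
  fixes f g :: "real \<Rightarrow> complex"
  assumes "f \<in> Lp 2" "AE x in lebesgue. f x = g x" shows "g \<in> Lp 2"
proof -
  have g: "g \<in> borel_measurable lebesgue" using borel_measurable_AE assms by blast
  show ?thesis
    by (rule Lp2_bound[OF g Lp2_integrable_square[OF assms(1)]]) (use assms(2) in auto)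
qed

lemma Lp2_add:
  fixes f g :: "real \<Rightarrow> complex"
  assumes "f \<in> Lp 2" "g \<in> Lp 2" shows "(\<lambda>x. f x + g x) \<in> Lp 2"
proof (rule Lp2_bound)
  show "integrable lebesgue (\<lambda>x. 2 * ((norm (f x))\<^sup>2 + (norm (g x))\<^sup>2))"
    using assms by (simp add: Lp2_integrable_square)
  have "(norm (f x + g x))\<^sup>2 \<le> 2 * ((norm (f x))\<^sup>2 + (norm (g x))\<^sup>2)" for x
  proof -
    have "(norm (f x + g x))\<^sup>2 \<le> (norm (f x) + norm (g x))\<^sup>2"
      by (intro power_mono norm_triangle_ineq) simp
    moreover have "(a + b)\<^sup>2 \<le> 2 * (a\<^sup>2 + b\<^sup>2)" for a b :: real
      using sum_squares_bound[of a b] by (simp add: power2_sum)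
    ultimately show ?thesis using order_trans by blast
  qed
  then show "AE x in lebesgue. (norm (f x + g x))\<^sup>2 \<le> 2 * ((norm (f x))\<^sup>2 + (norm (g x))\<^sup>2)" by simp
qed (use assms in \<open>measurable\<close>)

lemma Lp2_zero[simp]: "(\<lambda>x. 0::complex) \<in> Lp 2"
  by (simp add: Lp2_iff)

lemma Lp2_cmult: "f \<in> Lp 2 \<Longrightarrow> (\<lambda>x. c * f x) \<in> Lp 2" for f :: "real \<Rightarrow> complex"
  by (rule Lp2_bounded_mult[where C = "norm c"]) auto

lemma Lp2_minus: "f \<in> Lp 2 \<Longrightarrow> (\<lambda>x. - f x) \<in> Lp 2" for f :: "real \<Rightarrow> complex"
  using Lp2_cmult[of f "-1"] by simp

lemma Lp2_diff: "f \<in> Lp 2 \<Longrightarrow> g \<in> Lp 2 \<Longrightarrow> (\<lambda>x. f x - g x) \<in> Lp 2" for f g :: "real \<Rightarrow> complex"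
  using Lp2_add[of f "\<lambda>x. - g x"] Lp2_minus[of g] by simp

lemma Lp2_sum:
  fixes f :: "'i \<Rightarrow> real \<Rightarrow> complex"
  shows "(\<And>i. i \<in> I \<Longrightarrow> f i \<in> Lp 2) \<Longrightarrow> (\<lambda>x. \<Sum>i\<in>I. f i x) \<in> Lp 2"
  by (induction I rule: infinite_finite_induct) (auto intro: Lp2_add)

lemma borel_measurable_cnj[measurable]:
  "f \<in> borel_measurable M \<Longrightarrow> (\<lambda>x. cnj (f x)) \<in> borel_measurable M"
  by (rule measurable_compose[OF _ borel_measurable_continuous_onI]) (auto intro: continuous_intros)

lemma Lp2_cnj: "f \<in> Lp 2 \<Longrightarrow> (\<lambda>x. cnj (f x)) \<in> Lp 2"
  by (simp add: Lp2_iff borel_measurable_cnj)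

lemma Lp2_mult_integrable:
  fixes f g :: "real \<Rightarrow> complex"
  assumes "f \<in> Lp 2" "g \<in> Lp 2" shows "integrable lebesgue (\<lambda>x. f x * g x)"
proof (rule Bochner_Integration.integrable_bound)
  show "integrable lebesgue (\<lambda>x. (norm (f x))\<^sup>2 + (norm (g x))\<^sup>2)"
    using assms by (simp add: Lp2_integrable_square)
  have "a * b \<le> a\<^sup>2 + b\<^sup>2" if "0 \<le> a" "0 \<le> b" for a b :: real
    using sum_squares_bound[of a b] mult_nonneg_nonneg[OF that] by linarith
  then show "AE x in lebesgue. norm (f x * g x) \<le> norm ((norm (f x))\<^sup>2 + (norm (g x))\<^sup>2)"
    by (simp add: norm_mult)
qed (use assms in \<open>measurable\<close>)

lemma Lp2_locally_integrable:
  fixes f :: "real \<Rightarrow> complex"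
  assumes "f \<in> Lp 2" shows "locally_integrable f"
  unfolding locally_integrable_def set_integrable_def
proof (intro allI)
  fix a b
  have "(\<lambda>x. complex_of_real (indicat_real {a..b} x)) \<in> Lp 2"
  proof (rule Lp2_bound)
    show "integrable lebesgue (\<lambda>x. indicat_real {a..b} x)"
      by (rule integrable_real_indicator) (auto simp: emeasure_lborel_Icc_eq)
    show "(\<lambda>x. complex_of_real (indicat_real {a..b} x)) \<in> borel_measurable lebesgue"
      by (rule measurable_compose[OF borel_measurable_indicator borel_measurable_of_real]) simp
  qed (auto split: split_indicator)
  from Lp2_mult_integrable[OF this assms]
  show "complex_integrable lebesgue (\<lambda>x. indicat_real {a..b} x *\<^sub>R f x)" by (simp add: scaleR_conv_of_real)
qed

lemma L2_inner_AE_cong: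
  assumes "f \<in> Lp 2" "g \<in> Lp 2" "AE x in lebesgue. f x = f' x" "AE x in lebesgue. g x = g' x"
  shows "L2_inner f g = L2_inner f' g'"
  unfolding L2_inner_def
proof (rule integral_cong_AE)
  have "f' \<in> Lp 2" "g' \<in> Lp 2" using assms Lp2_AE_cong by blast+
  then show "(\<lambda>x. f' x * cnj (g' x)) \<in> borel_measurable lebesgue"
    by (auto intro!: borel_measurable_times borel_measurable_cnj)
  show "AE x in lebesgue. f x * cnj (g x) = f' x * cnj (g' x)" using assms(3,4) by eventually_elim simp
qed (use assms in \<open>auto intro!: borel_measurable_times borel_measurable_cnj\<close>)

lemma L2_inner_integrable: "f \<in> Lp 2 \<Longrightarrow> g \<in> Lp 2 \<Longrightarrow> integrable lebesgue (\<lambda>x. f x * cnj (g x))"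
  by (intro Lp2_mult_integrable Lp2_cnj)

lemma L2_inner_self: "L2_inner f f = complex_of_real (LINT x|lebesgue. (norm (f x))\<^sup>2)"
  by (simp add: L2_inner_def complex_norm_square[symmetric] flip: integral_complex_of_real)

lemma L2_inner_commute: "L2_inner g f = cnj (L2_inner f g)"
  using Bochner_Integration.integral_cnj[of lebesgue "\<lambda>x. f x * cnj (g x)"] by (simp add: L2_inner_def mult.commute)

\<comment> \<open>L^2(R) as a type, so that norm, limits and completeness come from type classes.
  Functions outside \<open>Lp 2\<close> are not even related to themselves, hence the partial
  relation. The class structure is real; complex scalars and the complex inner product are the
  separate operations \<open>cscale\<close> and \<open>cinner\<close>.\<close>
quotient_type l2 = "real \<Rightarrow> complex" / partial: "\<lambda>f g. f \<in> Lp 2 \<and> g \<in> Lp 2 \<and> (AE x in lebesgue. f x = g x)"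
proof (rule part_equivpI)
  show "\<exists>f::real \<Rightarrow> complex. f \<in> Lp 2 \<and> f \<in> Lp 2 \<and> (AE x in lebesgue. f x = f x)"
    by (rule exI[of _ "\<lambda>x. 0"]) simp
  show "symp (\<lambda>f g :: real \<Rightarrow> complex. f \<in> Lp 2 \<and> g \<in> Lp 2 \<and> (AE x in lebesgue. f x = g x))"
    by (rule sympI) auto
  show "transp (\<lambda>f g :: real \<Rightarrow> complex. f \<in> Lp 2 \<and> g \<in> Lp 2 \<and> (AE x in lebesgue. f x = g x))"
    by (rule transpI) (auto elim: eventually_elim2)
qed

lift_definition cinner :: "l2 \<Rightarrow> l2 \<Rightarrow> complex" is L2_inner
  by (auto intro: L2_inner_AE_cong)

lift_definition cscale :: "complex \<Rightarrow> l2 \<Rightarrow> l2" is "\<lambda>c f x. c * f x"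
  by (auto intro: Lp2_cmult)

instantiation l2 :: real_inner
begin

lift_definition zero_l2 :: l2 is "\<lambda>x. 0" by simp
lift_definition plus_l2 :: "l2 \<Rightarrow> l2 \<Rightarrow> l2" is "\<lambda>f g x. f x + g x"
  by (auto intro: Lp2_add elim: eventually_elim2)
lift_definition minus_l2 :: "l2 \<Rightarrow> l2 \<Rightarrow> l2" is "\<lambda>f g x. f x - g x"
  by (auto intro: Lp2_diff elim: eventually_elim2)
lift_definition uminus_l2 :: "l2 \<Rightarrow> l2" is "\<lambda>f x. - f x"
  by (auto intro: Lp2_minus)
definition scaleR_l2 :: "real \<Rightarrow> l2 \<Rightarrow> l2" where "scaleR_l2 r u = cscale (complex_of_real r) u"
definition inner_l2 :: "l2 \<Rightarrow> l2 \<Rightarrow> real" where "inner_l2 u v = Re (cinner u v)"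
definition norm_l2 :: "l2 \<Rightarrow> real" where "norm_l2 u = sqrt (inner u u)"
definition sgn_l2 :: "l2 \<Rightarrow> l2" where "sgn_l2 u = scaleR (inverse (norm u)) u"
definition dist_l2 :: "l2 \<Rightarrow> l2 \<Rightarrow> real" where "dist_l2 u v = norm (u - v)"
definition uniformity_l2 :: "(l2 \<times> l2) filter" where
  "uniformity_l2 = (INF e\<in>{0<..}. principal {(x, y). dist x y < e})"
definition open_l2 :: "l2 set \<Rightarrow> bool" where
  "open_l2 S = (\<forall>x\<in>S. \<forall>\<^sub>F (x', y) in uniformity. x' = x \<longrightarrow> y \<in> S)"

instance
proof
  fix u v w :: l2 and r s :: real
  show "u + v + w = u + (v + w)"
    by transfer (auto simp: add.assoc intro!: Lp2_add)
  show "u + v = v + u" by transfer (auto simp: add.commute intro!: Lp2_add)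
  show "0 + u = u" by transfer auto
  show "- u + u = 0" by transfer auto
  show "u - v = u + - v" by transfer (auto intro!: Lp2_diff)
  show "r *\<^sub>R (u + v) = r *\<^sub>R u + r *\<^sub>R v"
    unfolding scaleR_l2_def by transfer (auto simp: distrib_left intro!: Lp2_add Lp2_cmult)
  show "(r + s) *\<^sub>R u = r *\<^sub>R u + s *\<^sub>R u"
    unfolding scaleR_l2_def by transfer (auto simp: distrib_right intro!: Lp2_add Lp2_cmult)
  show "r *\<^sub>R s *\<^sub>R u = (r * s) *\<^sub>R u"
    unfolding scaleR_l2_def by transfer (auto simp: mult.assoc intro!: Lp2_cmult)
  show "1 *\<^sub>R u = u" unfolding scaleR_l2_def by transfer auto
  show "u \<bullet> v = v \<bullet> u"
    unfolding inner_l2_def by transfer (metis L2_inner_commute cnj.simps(1))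
  show "(u + v) \<bullet> w = u \<bullet> w + v \<bullet> w"
    unfolding inner_l2_def
    by transfer (auto simp: L2_inner_def distrib_right L2_inner_integrable)
  show "r *\<^sub>R u \<bullet> v = r * (u \<bullet> v)"
    unfolding inner_l2_def scaleR_l2_def
    by transfer (auto simp: L2_inner_def mult.assoc)
  show "0 \<le> u \<bullet> u" unfolding inner_l2_def by transfer (auto simp: L2_inner_self)
  show "(u \<bullet> u = 0) = (u = 0)"
    unfolding inner_l2_def
  proof transfer
    fix f :: "real \<Rightarrow> complex" assume "f \<in> Lp 2 \<and> f \<in> Lp 2 \<and> (AE x in lebesgue. f x = f x)"
    then show "(Re (L2_inner f f) = 0) = (f \<in> Lp 2 \<and> (\<lambda>x. 0::complex) \<in> Lp 2 \<and> (AE x in lebesgue. f x = 0))"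
      by (simp add: L2_inner_self integral_nonneg_eq_0_iff_AE Lp2_integrable_square)
  qed
qed (auto simp: norm_l2_def sgn_l2_def dist_l2_def uniformity_l2_def open_l2_def)

end

section \<open>Passage between functions and their classes\<close>

abbreviation cls :: "(real \<Rightarrow> complex) \<Rightarrow> l2" where "cls \<equiv> abs_l2"

lemma cls_add: "f \<in> Lp 2 \<Longrightarrow> g \<in> Lp 2 \<Longrightarrow> cls (\<lambda>x. f x + g x) = cls f + cls g"
  by (simp add: plus_l2.abs_eq)

lemma cls_diff: "f \<in> Lp 2 \<Longrightarrow> g \<in> Lp 2 \<Longrightarrow> cls (\<lambda>x. f x - g x) = cls f - cls g"
  by (simp add: minus_l2.abs_eq)

lemma cls_cmult: "f \<in> Lp 2 \<Longrightarrow> cls (\<lambda>x. c * f x) = cscale c (cls f)"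
  by (simp add: cscale.abs_eq)

lemma cls_zero: "cls (\<lambda>x. 0) = 0"
  by (simp add: zero_l2.abs_eq)

lemma cls_sum:
  fixes f :: "'i \<Rightarrow> real \<Rightarrow> complex"
  shows "(\<And>i. i \<in> I \<Longrightarrow> f i \<in> Lp 2) \<Longrightarrow> cls (\<lambda>x. \<Sum>i\<in>I. f i x) = (\<Sum>i\<in>I. cls (f i))"
  by (induction I rule: infinite_finite_induct) (auto simp: cls_zero cls_add Lp2_sum)

lemma cls_eq_iff:
  "f \<in> Lp 2 \<Longrightarrow> g \<in> Lp 2 \<Longrightarrow> cls f = cls g \<longleftrightarrow> (AE x in lebesgue. f x = g x)"
  using Quotient3_rel[OF Quotient3_l2, of f g] by auto

lemma cls_cong_AE: "f \<in> Lp 2 \<Longrightarrow> AE x in lebesgue. f x = g x \<Longrightarrow> cls f = cls g"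
  using cls_eq_iff Lp2_AE_cong by blast

lemma cinner_cls: "f \<in> Lp 2 \<Longrightarrow> g \<in> Lp 2 \<Longrightarrow> cinner (cls f) (cls g) = L2_inner f g"
  by (simp add: cinner.abs_eq)

lemma cls_cases: obtains f where "f \<in> Lp 2" "u = cls f"
  using Quotient3_abs_rep[OF Quotient3_l2, of u] Quotient3_rep_reflp[OF Quotient3_l2, of u] that by metis

lemma norm_cls_sq: "f \<in> Lp 2 \<Longrightarrow> (norm (cls f))\<^sup>2 = (LINT x|lebesgue. (norm (f x))\<^sup>2)"
  by (simp add: power2_norm_eq_inner inner_l2_def cinner_cls L2_inner_self)

lemma norm_cls: "f \<in> Lp 2 \<Longrightarrow> norm (cls f) = L2_norm f"
  by (simp add: L2_norm_def norm_cls_sq[symmetric])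

lemma Re_cinner: "Re (cinner u v) = u \<bullet> v"
  by (simp add: inner_l2_def)

lemma cinner_add_left: "cinner (u + v) w = cinner u w + cinner v w"
  by transfer (auto simp: L2_inner_def distrib_right L2_inner_integrable)

lemma cinner_cscale_left: "cinner (cscale c u) v = c * cinner u v"
  by transfer (auto simp: L2_inner_def mult.assoc)

lemma cinner_commute: "cinner v u = cnj (cinner u v)"
  by transfer (rule L2_inner_commute)

lemma cinner_add_right: "cinner w (u + v) = cinner w u + cinner w v"
  by (subst (1 2 3) cinner_commute) (simp add: cinner_add_left)

lemma cinner_cscale_right: "cinner u (cscale c v) = cnj c * cinner u v"
  by (subst (1 2) cinner_commute) (simp add: cinner_cscale_left)

lemma cinner_minus_left: "cinner (- u) v = - cinner u v"
  using cinner_add_left[of "-u" u v] cinner_add_left[of 0 0 v] by (simp add: add_eq_0_iff)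

lemma cinner_minus_right: "cinner u (- v) = - cinner u v"
  by (subst (1 2) cinner_commute) (simp add: cinner_minus_left)

lemma cinner_diff_left: "cinner (u - v) w = cinner u w - cinner v w"
  using cinner_add_left[of u "-v" w] by (simp add: cinner_minus_left)

lemma cinner_diff_right: "cinner w (u - v) = cinner w u - cinner w v"
  using cinner_add_right[of w u "-v"] by (simp add: cinner_minus_right)

lemma cinner_zero_left[simp]: "cinner 0 v = 0"
  using cinner_diff_left[of 0 0 v] by simp

lemma cinner_zero_right[simp]: "cinner v 0 = 0"
  using cinner_diff_right[of v 0 0] by simp

lemma cinner_sum_left: "cinner (\<Sum>i\<in>I. u i) v = (\<Sum>i\<in>I. cinner (u i) v)"
  by (induction I rule: infinite_finite_induct) (auto simp: cinner_add_left)

lemma cinner_sum_right: "cinner v (\<Sum>i\<in>I. u i) = (\<Sum>i\<in>I. cinner v (u i))"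
  by (induction I rule: infinite_finite_induct) (auto simp: cinner_add_right)

lemma cinner_self: "cinner u u = complex_of_real ((norm u)\<^sup>2)"
proof -
  have "Im (cinner u u) = 0" using cinner_commute[of u u] by (metis cnj.simps(2) neg_equal_0_iff_equal equal_neg_zero)
  then show ?thesis by (simp add: complex_eq_iff power2_norm_eq_inner Re_cinner)
qed

lemma cscale_of_real: "cscale (complex_of_real r) u = r *\<^sub>R u"
  by (simp add: scaleR_l2_def)

lemma cscale_one[simp]: "cscale 1 u = u"
  using cscale_of_real[of 1] by simp

lemma cscale_zero[simp]: "cscale 0 u = 0"
  using cscale_of_real[of 0] by simp

lemma cscale_cscale[simp]: "cscale a (cscale b u) = cscale (a * b) u"
  by transfer (auto simp: mult.assoc intro!: Lp2_cmult)

lemma cscale_add_right: "cscale a (u + v) = cscale a u + cscale a v"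
  by transfer (auto simp: distrib_left intro!: Lp2_cmult Lp2_add)

lemma cscale_add_left: "cscale (a + b) u = cscale a u + cscale b u"
  by transfer (auto simp: distrib_right intro!: Lp2_cmult Lp2_add)

lemma cscale_minus_left: "cscale (- a) u = - cscale a u"
  by transfer (auto intro!: Lp2_cmult Lp2_minus)

lemma cscale_minus_right: "cscale a (- u) = - cscale a u"
  by transfer (auto intro!: Lp2_minus Lp2_cmult)

lemma cscale_diff_right: "cscale a (u - v) = cscale a u - cscale a v"
  using cscale_add_right[of a u "-v"] by (simp add: cscale_minus_right)

lemma cscale_diff_left: "cscale (a - b) u = cscale a u - cscale b u"
  using cscale_add_left[of a "-b" u] by (simp add: cscale_minus_left)

lemma cscale_0_right[simp]: "cscale a 0 = 0"
  using cscale_diff_right[of a 0 0] by simp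

lemma cscale_sum_right: "cscale a (\<Sum>i\<in>I. u i) = (\<Sum>i\<in>I. cscale a (u i))"
  by (induction I rule: infinite_finite_induct) (auto simp: cscale_add_right)

lemma norm_cscale: "norm (cscale c u) = norm c * norm u"
proof -
  have "complex_of_real ((norm (cscale c u))\<^sup>2) = c * cnj c * complex_of_real ((norm u)\<^sup>2)"
    by (simp only: cinner_self[symmetric]) (simp add: cinner_cscale_left cinner_cscale_right)
  also have "\<dots> = complex_of_real ((norm c * norm u)\<^sup>2)"
    by (simp only: complex_norm_square[symmetric]) (simp add: power_mult_distrib)
  finally have "(norm (cscale c u))\<^sup>2 = (norm c * norm u)\<^sup>2" by (simp only: of_real_eq_iff)
  then show ?thesis by (metis abs_mult abs_norm_cancel power2_eq_iff_nonneg norm_ge_zero mult_nonneg_nonneg)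
qed

lemma cinner_Cauchy_Schwarz: "norm (cinner u v) \<le> norm u * norm v"
proof (cases "cinner u v = 0")
  case False
  \<comment> \<open>The phase that makes the inner product real and nonnegative, so that the real
    Cauchy-Schwarz inequality applies.\<close>
  define c where "c = cnj (cinner u v) / complex_of_real (norm (cinner u v))"
  have c: "norm c = 1" using False by (simp add: c_def norm_divide)
  have "cinner (cscale c u) v = complex_of_real (norm (cinner u v))"
    using False by (simp add: cinner_cscale_left c_def complex_norm_square[symmetric] power2_eq_square mult.commute)
  then have "norm (cinner u v) = cscale c u \<bullet> v" by (metis Re_cinner Re_complex_of_real)
  also have "\<dots> \<le> norm (cscale c u) * norm v" by (rule norm_cauchy_schwarz)
  finally show ?thesis by (simp add: norm_cscale c)
qed simp

text \<open>Riesz-Fischer: a rapidly convergent subsequence converges pointwise almost everywhere,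
  and Fatou's lemma shows that the pointwise limit is the limit in norm.\<close>

instance l2 :: complete_space
proof
  fix X :: "nat \<Rightarrow> l2" assume X: "Cauchy X"
  have "\<exists>r. strict_mono r \<and> (\<forall>k. \<forall>m\<ge>r k. \<forall>n\<ge>r k. dist (X m) (X n) < (1/2) ^ k)"
  proof -
    have "\<exists>M. \<forall>m\<ge>M. \<forall>n\<ge>M. dist (X m) (X n) < (1/2) ^ k" for k :: nat
      using X by (auto simp: Cauchy_def)
    then obtain M where M: "\<And>k m n. m \<ge> M k \<Longrightarrow> n \<ge> M k \<Longrightarrow> dist (X m) (X n) < (1/2) ^ k" by metis
    \<comment> \<open>Partial sums plus k: strictly increasing and still at least
      \<open>M k\<close>.\<close>
    define r where "r k = k + (\<Sum>j\<le>k. M j)" for k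
    have "strict_mono r" by (rule strict_monoI_Suc) (simp add: r_def)
    moreover have "M k \<le> r k" for k using member_le_sum[of k "{..k}" M] by (simp add: r_def)
    ultimately show ?thesis using M by (intro exI[of _ r]) (meson order_trans)
  qed
  then obtain r where r: "strict_mono r" "\<And>k m n. m \<ge> r k \<Longrightarrow> n \<ge> r k \<Longrightarrow> dist (X m) (X n) < (1/2) ^ k" by blast
  have "\<forall>k. \<exists>f. f \<in> Lp 2 \<and> X (r k) = cls f" using cls_cases by metis
  then obtain f where f: "\<And>k. f k \<in> Lp 2" "\<And>k. X (r k) = cls (f k)" by metis
  have fm[measurable]: "f k \<in> borel_measurable lebesgue" for k using f(1) by blast
  have nrm: "(LINT x|lebesgue. (norm (f m x - f n x))\<^sup>2) \<le> ((1/2) ^ k)\<^sup>2" if "m \<ge> k" "n \<ge> k" for m n k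
  proof -
    have "dist (X (r m)) (X (r n)) < (1/2) ^ k"
      using r that strict_mono_less_eq[OF r(1)] by blast
    then have "norm (cls (\<lambda>x. f m x - f n x)) \<le> (1/2) ^ k" using f by (simp add: dist_norm cls_diff)
    then have "(norm (cls (\<lambda>x. f m x - f n x)))\<^sup>2 \<le> ((1/2) ^ k)\<^sup>2" by (intro power_mono) auto
    then show ?thesis using f by (simp add: norm_cls_sq Lp2_diff)
  qed
  have nn: "(\<integral>\<^sup>+x. ennreal ((norm (f m x - f n x))\<^sup>2) \<partial>lebesgue) \<le> ennreal (((1/2) ^ k)\<^sup>2)" if "m \<ge> k" "n \<ge> k" for m n k
    using nrm[OF that] f by (subst nn_integral_eq_integral) (auto simp: Lp2_integrable_square[OF Lp2_diff] intro: ennreal_leI)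
  have "(\<integral>\<^sup>+x. (\<Sum>k. ennreal (2 ^ k * (norm (f (Suc k) x - f k x))\<^sup>2)) \<partial>lebesgue) < \<infinity>"
  proof -
    have "(\<integral>\<^sup>+x. (\<Sum>k. ennreal (2 ^ k * (norm (f (Suc k) x - f k x))\<^sup>2)) \<partial>lebesgue)
      = (\<Sum>k. \<integral>\<^sup>+x. ennreal (2 ^ k * (norm (f (Suc k) x - f k x))\<^sup>2) \<partial>lebesgue)"
      by (rule nn_integral_suminf) simp
    also have "\<dots> \<le> (\<Sum>k. ennreal ((1/2) ^ k))"
    proof (rule suminf_le)
      fix k
      have "(\<integral>\<^sup>+x. ennreal (2 ^ k * (norm (f (Suc k) x - f k x))\<^sup>2) \<partial>lebesgue)
         = ennreal (2 ^ k) * (\<integral>\<^sup>+x. ennreal ((norm (f (Suc k) x - f k x))\<^sup>2) \<partial>lebesgue)"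
        by (subst nn_integral_cmult[symmetric]) (auto simp: ennreal_mult)
      also have "\<dots> \<le> ennreal (2 ^ k) * ennreal (((1/2) ^ k)\<^sup>2)"
        by (intro mult_left_mono nn) auto
      also have "\<dots> = ennreal ((1/2) ^ k)"
        by (subst ennreal_mult[symmetric]) (auto simp: power2_eq_square power_mult_distrib[symmetric] mult.assoc[symmetric])
      finally show "(\<integral>\<^sup>+x. ennreal (2 ^ k * (norm (f (Suc k) x - f k x))\<^sup>2) \<partial>lebesgue) \<le> ennreal ((1/2) ^ k)" .
    qed auto
    also have "(\<Sum>k. ennreal ((1/2) ^ k)) = ennreal (\<Sum>k. (1/2) ^ k)"
      by (rule suminf_ennreal2) (auto intro: summable_geometric)
    also have "\<dots> < \<infinity>" by simp
    finally show ?thesis .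
  qed
  then have "AE x in lebesgue. (\<Sum>k. ennreal (2 ^ k * (norm (f (Suc k) x - f k x))\<^sup>2)) \<noteq> \<infinity>"
    by (intro nn_integral_PInf_AE) (auto simp: less_top)
  \<comment> \<open>The squared distances are at most 4^(-k), which left room for the weight 2^k;
    finiteness of the weighted sum makes the k-th jump eventually at most 2^(-k/2), and these are
    summable.\<close>
  then have conv: "AE x in lebesgue. convergent (\<lambda>k. f k x)"
  proof eventually_elim
    case (elim x)
    have "summable (\<lambda>k. 2 ^ k * (norm (f (Suc k) x - f k x))\<^sup>2)"
      by (rule summable_suminf_not_top) (use elim in auto)
    then have "(\<lambda>k. 2 ^ k * (norm (f (Suc k) x - f k x))\<^sup>2) \<longlonglongrightarrow> 0" by (rule summable_LIMSEQ_zero)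
    then have "eventually (\<lambda>k. 2 ^ k * (norm (f (Suc k) x - f k x))\<^sup>2 < 1) sequentially"
      by (rule order_tendstoD) simp
    then have ev: "eventually (\<lambda>k. norm (f (Suc k) x - f k x) \<le> (sqrt (1/2)) ^ k) sequentially"
    proof eventually_elim
      case (elim k)
      have "(norm (f (Suc k) x - f k x))\<^sup>2 \<le> (1/2) ^ k" using elim by (simp add: field_simps)
      also have "\<dots> = ((sqrt (1/2)) ^ k)\<^sup>2" by (simp add: power_mult_distrib[symmetric] power2_eq_square)
      finally show ?case by (rule power2_le_imp_le) simp
    qed
    have "summable (\<lambda>k. f (Suc k) x - f k x)"
      by (rule summable_comparison_test_ev[OF ev]) (auto intro!: summable_geometric simp: real_sqrt_divide)
    then have "convergent (\<lambda>n. \<Sum>k<n. f (Suc k) x - f k x)" by (simp add: summable_iff_convergent)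
    then have "convergent (\<lambda>n. f n x - f 0 x)" using sum_lessThan_telescope[of "\<lambda>k. f k x"] by simp
    then show ?case by (simp add: convergent_diff_const_right_iff)
  qed
  define g where "g x = lim (\<lambda>k. f k x)" for x
  have gm[measurable]: "g \<in> borel_measurable lebesgue" unfolding g_def by measurable
  have bound: "(\<integral>\<^sup>+x. ennreal ((norm (f k x - g x))\<^sup>2) \<partial>lebesgue) \<le> ennreal (((1/2) ^ k)\<^sup>2)" for k
  proof -
    have "(\<integral>\<^sup>+x. ennreal ((norm (f k x - g x))\<^sup>2) \<partial>lebesgue) = (\<integral>\<^sup>+x. liminf (\<lambda>m. ennreal ((norm (f k x - f m x))\<^sup>2)) \<partial>lebesgue)"
    proof (rule nn_integral_cong_AE)
      show "AE x in lebesgue. ennreal ((norm (f k x - g x))\<^sup>2) = liminf (\<lambda>m. ennreal ((norm (f k x - f m x))\<^sup>2))"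
        using conv
      proof eventually_elim
        case (elim x)
        then have "(\<lambda>m. f m x) \<longlonglongrightarrow> g x" by (simp add: g_def convergent_LIMSEQ_iff)
        then have "(\<lambda>m. ennreal ((norm (f k x - f m x))\<^sup>2)) \<longlonglongrightarrow> ennreal ((norm (f k x - g x))\<^sup>2)"
          by (intro tendsto_ennrealI tendsto_intros)
        then show ?case by (rule lim_imp_Liminf[OF trivial_limit_sequentially, symmetric])
      qed
    qed
    also have "\<dots> \<le> liminf (\<lambda>m. \<integral>\<^sup>+x. ennreal ((norm (f k x - f m x))\<^sup>2) \<partial>lebesgue)"
      by (rule nn_integral_liminf) simp
    also have "\<dots> \<le> limsup (\<lambda>m. \<integral>\<^sup>+x. ennreal ((norm (f k x - f m x))\<^sup>2) \<partial>lebesgue)"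
      by (rule Liminf_le_Limsup) simp
    also have "\<dots> \<le> ennreal (((1/2) ^ k)\<^sup>2)"
      by (rule Limsup_bounded) (rule eventually_sequentiallyI[of k], rule nn, auto)
    finally show ?thesis .
  qed
  have d: "(\<lambda>x. f k x - g x) \<in> Lp 2" for k
    unfolding Lp2_iff
  proof
    show "integrable lebesgue (\<lambda>x. (norm (f k x - g x))\<^sup>2)"
      by (rule integrableI_bounded) (use bound[of k] in \<open>auto simp: top.extremum_strict intro: le_less_trans\<close>)
  qed simp
  have g: "g \<in> Lp 2" using Lp2_diff[OF f(1)[of 0] d[of 0]] by simp
  have nb: "norm (X (r k) - cls g) \<le> (1/2) ^ k" for k
  proof -
    have "(norm (cls (\<lambda>x. f k x - g x)))\<^sup>2 \<le> ((1/2) ^ k)\<^sup>2"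
      using bound[of k] d[of k] nn_integral_eq_integral[OF Lp2_integrable_square[OF d[of k]]]
      by (simp add: norm_cls_sq ennreal_le_iff)
    then have "norm (cls (\<lambda>x. f k x - g x)) \<le> (1/2) ^ k" by (rule power2_le_imp_le) simp
    then show ?thesis using f g by (simp add: cls_diff)
  qed
  have "(\<lambda>k. X (r k)) \<longlonglongrightarrow> cls g"
  proof (rule Lim_null[THEN iffD2], rule Lim_null_comparison)
    show "\<forall>\<^sub>F k in sequentially. norm (X (r k) - cls g) \<le> (1/2) ^ k" using nb by simp
    show "(\<lambda>k. (1/2) ^ k :: real) \<longlonglongrightarrow> 0" by (rule LIMSEQ_realpow_zero) auto
  qed
  then show "convergent X"
    using Cauchy_converges_subseq[OF X r(1), of "cls g"] by (auto simp: convergent_def o_def)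
qed

section \<open>Sobolev functions and antiderivatives\<close>

text \<open>The set where the bound fails is open and null, hence empty.\<close>

lemma continuous_AE_le:
  fixes f :: "real \<Rightarrow> real"
  assumes c: "continuous_on UNIV f" and ae: "AE x in lebesgue. f x \<le> C"
  shows "f x \<le> C"
proof -
  have "open {x. C < f x}" by (intro open_Collect_less continuous_intros c)
  moreover have "negligible {x. C < f x}"
  proof -
    obtain S where "{x \<in> space lebesgue. \<not> f x \<le> C} \<subseteq> S" "emeasure lebesgue S = 0" "S \<in> sets lebesgue"
      using ae by (rule AE_E)
    then have "negligible S" "{x. C < f x} \<subseteq> S"
      by (auto simp: negligible_iff_null_sets null_sets_def)
    then show ?thesis by (rule negligible_subset)
  qed
  ultimately have "{x. C < f x} = {}" using open_not_negligible by blast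
  then show ?thesis by (auto simp: not_less)
qed

lemma continuous_AE_eq:
  fixes f g :: "real \<Rightarrow> complex"
  assumes "continuous_on UNIV f" "continuous_on UNIV g" "AE x in lebesgue. f x = g x"
  shows "f = g"
proof
  fix x
  have "norm (f x - g x) \<le> 0"
    by (rule continuous_AE_le) (use assms in \<open>auto intro!: continuous_intros\<close>)
  then show "f x = g x" by simp
qed

lemma test_function_bounded:
  assumes "\<phi> \<in> test_functions" obtains K where "K \<ge> 0" "\<And>x. \<bar>\<phi> x\<bar> \<le> K"
proof -
  obtain R where R: "R > 0" "\<And>x. \<bar>x\<bar> \<ge> R \<Longrightarrow> \<phi> x = 0" and s: "smooth \<phi>"
    using assms by (auto simp: test_functions_iff)
  have "compact (\<phi> ` {-R..R})"
    by (rule compact_continuous_image) (use smooth_continuous[OF s] continuous_on_subset in blast, simp)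
  then obtain K where K: "\<And>x. x \<in> {-R..R} \<Longrightarrow> \<bar>\<phi> x\<bar> \<le> K"
    using compact_imp_bounded by (fastforce simp: bounded_iff)
  have "\<bar>\<phi> x\<bar> \<le> max K 0" for x
    using K[of x] R(2)[of x] by (cases "x \<in> {-R..R}") auto
  then show ?thesis using that[of "max K 0"] by simp
qed

text \<open>Testing against stretched functions \<phi>(x / (n + 1)) moves the derivative, of size
  O(1/n), onto the integrable \<open>F\<close>. No limits of \<open>F\<close> at infinity are
  discussed; every later integration by parts on the line goes through this lemma.\<close>

lemma integral_antideriv_eq_0:
  assumes F: "antideriv F f" and iF: "integrable lebesgue F" and i: "integrable lebesgue f"
  shows "(LINT x|lebesgue. f x) = 0"
proof -
  have "(-1::real) < 1" by simp
  then obtain B where B: "\<And>n. B n \<in> test_functions" "\<And>n x. \<bar>B n x\<bar> \<le> indicat_real {-1..1} x"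
    "\<And>x. (\<lambda>n. B n x) \<longlonglongrightarrow> indicator {-1<..<1::real} x"
    by (rule test_function_bump) (rule that)
  \<comment> \<open>Some bump is nonzero at 0, because the bumps tend to 1 there; its stretched
    copies tend to this nonzero constant.\<close>
  have "\<not> (\<forall>n::nat. B n 0 = 0)"
  proof
    assume "\<forall>n::nat. B n 0 = 0"
    then show False using B(3)[of 0] by (simp add: LIMSEQ_const_iff)
  qed
  then obtain \<phi> where \<phi>: "\<phi> \<in> test_functions" "\<phi> 0 \<noteq> 0" using B(1) by blast
  have s: "smooth \<phi>" using \<phi> by (simp add: test_functions_iff)
  obtain R where R: "R > 0" "\<And>x. \<bar>x\<bar> \<ge> R \<Longrightarrow> \<phi> x = 0" using \<phi> by (auto simp: test_functions_iff)
  obtain K where K: "K \<ge> 0" "\<And>x. \<bar>\<phi> x\<bar> \<le> K" using test_function_bounded[OF \<phi>(1)] by blast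
  obtain K' where K': "K' \<ge> 0" "\<And>x. \<bar>deriv \<phi> x\<bar> \<le> K'"
    using test_function_bounded[OF test_functions_deriv[OF \<phi>(1)]] by blast
  define m where "m n = 1 / (real n + 1)" for n
  have m: "m n > 0" for n by (simp add: m_def)
  have m0: "m \<longlonglongrightarrow> 0" unfolding m_def[abs_def] by real_asymp
  define \<psi> where "\<psi> n x = \<phi> (m n * x + 0)" for n x
  have \<psi>: "\<psi> n \<in> test_functions" for n
    unfolding test_functions_iff
  proof
    show "smooth (\<psi> n)" unfolding \<psi>_def[abs_def] by (rule smooth_affine[OF s])
    show "\<exists>R>0. \<forall>x. R \<le> \<bar>x\<bar> \<longrightarrow> \<psi> n x = 0"
      using R m[of n] by (intro exI[of _ "R / m n"]) (auto simp: \<psi>_def abs_mult field_simps)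
  qed
  have D: "deriv (\<psi> n) x = m n * deriv \<phi> (m n * x)" for n x
  proof -
    have "(\<psi> n has_real_derivative deriv \<phi> (m n * x + 0) * m n) (at x)"
      unfolding \<psi>_def[abs_def] by (rule DERIV_chain2[OF smooth_DERIV[OF s]]) (auto intro!: derivative_eq_intros)
    then show ?thesis using DERIV_imp_deriv by (simp add: mult.commute) blast
  qed
  have e: "(LINT x|lebesgue. deriv (\<psi> n) x *\<^sub>R F x) = - (LINT x|lebesgue. \<psi> n x *\<^sub>R f x)" for n
    by (rule test_function_integral_by_parts[OF \<psi> F])
  have "(\<lambda>n. LINT x|lebesgue. \<psi> n x *\<^sub>R f x) \<longlonglongrightarrow> (LINT x|lebesgue. \<phi> 0 *\<^sub>R f x)"
  proof (rule integral_dominated_convergence[where w = "\<lambda>x. K * norm (f x)"])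
    show "\<And>n. (\<lambda>x. \<psi> n x *\<^sub>R f x) \<in> borel_measurable lebesgue"
      using test_function_integrable[OF \<psi> antideriv_locally_integrable[OF F]] by (rule borel_measurable_integrable)
    show "AE x in lebesgue. (\<lambda>n. \<psi> n x *\<^sub>R f x) \<longlonglongrightarrow> \<phi> 0 *\<^sub>R f x"
    proof (intro AE_I2 tendsto_scaleR tendsto_const)
      fix x
      have "(\<lambda>n. m n * x + 0) \<longlonglongrightarrow> 0 * x + 0" by (intro tendsto_intros m0)
      moreover have "isCont \<phi> 0" using smooth_DERIV[OF s] DERIV_isCont by blast
      ultimately show "(\<lambda>n. \<psi> n x) \<longlonglongrightarrow> \<phi> 0" unfolding \<psi>_def using isCont_tendsto_compose[of 0 \<phi> "\<lambda>n. m n * x" sequentially] by simp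
    qed
  qed (use i K in \<open>auto simp: \<psi>_def intro!: mult_right_mono\<close>)
  moreover have "(\<lambda>n. LINT x|lebesgue. \<psi> n x *\<^sub>R f x) \<longlonglongrightarrow> 0"
  proof (rule Lim_null_comparison)
    show "(\<lambda>n. m n * (K' * (LINT x|lebesgue. norm (F x)))) \<longlonglongrightarrow> 0"
      by (rule tendsto_mult_left_zero[OF m0])
    show "\<forall>\<^sub>F n in sequentially. norm (LINT x|lebesgue. \<psi> n x *\<^sub>R f x) \<le> m n * (K' * (LINT x|lebesgue. norm (F x)))"
    proof (intro always_eventually allI)
      fix n
      have "norm (LINT x|lebesgue. \<psi> n x *\<^sub>R f x) = norm (LINT x|lebesgue. deriv (\<psi> n) x *\<^sub>R F x)"
        by (simp add: e)
      also have "\<dots> \<le> (LINT x|lebesgue. (m n * K') * norm (F x))"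
      proof (rule Bochner_Integration.integral_norm_bound_integral)
        show "integrable lebesgue (\<lambda>x. deriv (\<psi> n) x *\<^sub>R F x)"
          by (rule test_function_integrable[OF test_functions_deriv[OF \<psi>] continuous_locally_integrable[OF antideriv_continuous[OF F]]])
        show "integrable lebesgue (\<lambda>x. (m n * K') * norm (F x))" using iF by simp
        show "norm (deriv (\<psi> n) x *\<^sub>R F x) \<le> (m n * K') * norm (F x)" for x
          using K' m[of n] by (auto simp: D abs_mult intro!: mult_right_mono mult_left_mono)
      qed
      also have "\<dots> = m n * (K' * (LINT x|lebesgue. norm (F x)))" by simp
      finally show "norm (LINT x|lebesgue. \<psi> n x *\<^sub>R f x) \<le> m n * (K' * (LINT x|lebesgue. norm (F x)))" .
    qed
  qed
  ultimately have "(LINT x|lebesgue. \<phi> 0 *\<^sub>R f x) = 0" by (rule LIMSEQ_unique)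
  then show ?thesis using \<phi>(2) by simp
qed

lemma antideriv_diff_bound:
  assumes F: "antideriv F f" and i: "integrable lebesgue f"
  shows "norm (F b - F a) \<le> (LINT x|lebesgue. norm (f x))"
proof -
  have *: "norm (F b - F a) \<le> (LINT x|lebesgue. norm (f x))" if "a \<le> b" for a b
  proof -
    have si: "set_integrable lebesgue {a..b} f" using F by (simp add: antideriv_def locally_integrable_def)
    have "F b - F a = (LINT x|lebesgue. indicator {a..b} x *\<^sub>R f x)"
      using antiderivD[OF F that] set_lebesgue_integral_eq_integral(2)[OF si] by (simp add: set_lebesgue_integral_def)
    also have "norm \<dots> \<le> (LINT x|lebesgue. norm (f x))"
      by (rule Bochner_Integration.integral_norm_bound_integral)
        (use si i in \<open>auto simp: set_integrable_def split: split_indicator\<close>)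
    finally show ?thesis .
  qed
  show ?thesis using *[of a b] *[of b a] by (cases "a \<le> b") (auto simp: norm_minus_commute)
qed

text \<open>The square of |F| has an integrable derivative and is therefore bounded.\<close>

lemma antideriv_Lp2_bounded:
  assumes F: "antideriv F f" and "F \<in> Lp 2" "f \<in> Lp 2"
  shows "bounded (range F)"
proof -
  have A: "antideriv (\<lambda>x. F x * cnj (F x)) (\<lambda>x. f x * cnj (F x) + F x * cnj (f x))"
    by (rule antideriv_mult[OF F antideriv_cnj[OF F]])
  have I: "integrable lebesgue (\<lambda>x. f x * cnj (F x) + F x * cnj (f x))"
    using assms by (intro Bochner_Integration.integrable_add L2_inner_integrable)
  define C where "C = (LINT x|lebesgue. norm (f x * cnj (F x) + F x * cnj (f x)))"
  have "norm (F x) \<le> 1 + ((norm (F 0))\<^sup>2 + C)" for x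
  proof -
    have "norm (F x * cnj (F x)) - norm (F 0 * cnj (F 0)) \<le> C"
      using antideriv_diff_bound[OF A I, of x 0] norm_triangle_ineq2 order_trans unfolding C_def by blast
    then have "(norm (F x))\<^sup>2 \<le> (norm (F 0))\<^sup>2 + C" by (simp add: norm_mult power2_eq_square)
    moreover have "norm (F x) \<le> 1 + (norm (F x))\<^sup>2"
      using sum_squares_bound[of "norm (F x)" 1] by (simp add: power2_eq_square) (smt (verit) norm_ge_zero zero_le_mult_iff)
    ultimately show ?thesis by linarith
  qed
  then show ?thesis by (auto simp: bounded_iff)
qed

text \<open>An element of W^(2,2) by its C^1 representative: \<open>u\<close> and \<open>u1\<close>
  are continuous, and only \<open>u2\<close> is defined up to a null set. The analysis runs on such
  triples instead of the chosen functions \<open>weak_deriv\<close>.\<close>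

definition sobolev_rep :: "(real \<Rightarrow> complex) \<Rightarrow> (real \<Rightarrow> complex) \<Rightarrow> (real \<Rightarrow> complex) \<Rightarrow> bool" where
  "sobolev_rep u u1 u2 \<longleftrightarrow> antideriv u u1 \<and> antideriv u1 u2 \<and> u \<in> Lp 2 \<and> u1 \<in> Lp 2 \<and> u2 \<in> Lp 2"

lemma sobolev_rep_inner_parts:
  assumes u: "sobolev_rep u u1 u2" and v: "sobolev_rep v v1 v2"
  shows "L2_inner u2 v = - L2_inner u1 v1"
proof -
  have A: "antideriv (\<lambda>x. u1 x * cnj (v x)) (\<lambda>x. u2 x * cnj (v x) + u1 x * cnj (v1 x))"
    using u v by (intro antideriv_mult antideriv_cnj) (auto simp: sobolev_rep_def)
  have i: "integrable lebesgue (\<lambda>x. u2 x * cnj (v x))" "integrable lebesgue (\<lambda>x. u1 x * cnj (v1 x))"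
     "integrable lebesgue (\<lambda>x. u1 x * cnj (v x))"
    using u v by (auto intro!: L2_inner_integrable simp: sobolev_rep_def)
  have "(LINT x|lebesgue. u2 x * cnj (v x) + u1 x * cnj (v1 x)) = 0"
    using i by (intro integral_antideriv_eq_0[OF A]) auto
  then show ?thesis using i by (simp add: L2_inner_def add_eq_0_iff2)
qed

lemma sobolev_rep_symmetric:
  assumes u: "sobolev_rep u u1 u2" and v: "sobolev_rep v v1 v2"
  shows "L2_inner u2 v = L2_inner u v2"
  using sobolev_rep_inner_parts[OF u v] sobolev_rep_inner_parts[OF v u]
  by (metis L2_inner_commute complex_cnj_minus)

lemma sobolev_rep_add:
  "sobolev_rep u u1 u2 \<Longrightarrow> sobolev_rep v v1 v2 \<Longrightarrow> sobolev_rep (\<lambda>x. u x + v x) (\<lambda>x. u1 x + v1 x) (\<lambda>x. u2 x + v2 x)"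
  by (simp add: sobolev_rep_def antideriv_add Lp2_add)

lemma sobolev_rep_cmult:
  "sobolev_rep u u1 u2 \<Longrightarrow> sobolev_rep (\<lambda>x. c * u x) (\<lambda>x. c * u1 x) (\<lambda>x. c * u2 x)"
  by (simp add: sobolev_rep_def antideriv_cmult Lp2_cmult)

lemma sobolev_rep_diff:
  "sobolev_rep u u1 u2 \<Longrightarrow> sobolev_rep v v1 v2 \<Longrightarrow> sobolev_rep (\<lambda>x. u x - v x) (\<lambda>x. u1 x - v1 x) (\<lambda>x. u2 x - v2 x)"
  by (simp add: sobolev_rep_def antideriv_diff Lp2_diff)

lemma sobolev_rep_sum:
  "(\<And>i. i \<in> I \<Longrightarrow> sobolev_rep (u i) (u1 i) (u2 i)) \<Longrightarrow>
    sobolev_rep (\<lambda>x. \<Sum>i\<in>I. u i x) (\<lambda>x. \<Sum>i\<in>I. u1 i x) (\<lambda>x. \<Sum>i\<in>I. u2 i x)"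
  by (simp add: sobolev_rep_def antideriv_sum Lp2_sum)

lemma sobolev_rep_mult:
  assumes u: "sobolev_rep u u1 u2" and w: "antideriv w w1" "antideriv w1 w2"
    and b: "bounded (range w)" "bounded (range w1)" "bounded (range w2)"
  shows "sobolev_rep (\<lambda>x. w x * u x) (\<lambda>x. w1 x * u x + w x * u1 x) (\<lambda>x. w2 x * u x + 2 * (w1 x * u1 x) + w x * u2 x)"
proof -
  have m: "w \<in> borel_measurable lebesgue" "w1 \<in> borel_measurable lebesgue" "w2 \<in> borel_measurable lebesgue"
    using locally_integrable_borel_measurable antideriv_locally_integrable w
      continuous_locally_integrable antideriv_continuous by blast+
  have L: "(\<lambda>x. g x * f x) \<in> Lp 2" if "f \<in> Lp 2" "g \<in> borel_measurable lebesgue" "bounded (range g)" for f g :: "real \<Rightarrow> complex"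
  proof -
    obtain K where "\<And>x. norm (g x) \<le> K" using \<open>bounded (range g)\<close> by (auto simp: bounded_iff)
    then show ?thesis using that by (intro Lp2_bounded_mult[where C = K]) auto
  qed
  have A1: "antideriv (\<lambda>x. w x * u x) (\<lambda>x. w1 x * u x + w x * u1 x)"
    using u w by (intro antideriv_mult) (auto simp: sobolev_rep_def)
  have "antideriv (\<lambda>x. w1 x * u x + w x * u1 x) (\<lambda>x. (w2 x * u x + w1 x * u1 x) + (w1 x * u1 x + w x * u2 x))"
    using u w by (intro antideriv_mult antideriv_add) (auto simp: sobolev_rep_def)
  then have A2: "antideriv (\<lambda>x. w1 x * u x + w x * u1 x) (\<lambda>x. w2 x * u x + 2 * (w1 x * u1 x) + w x * u2 x)"
    by (simp add: algebra_simps)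
  show ?thesis
    using A1 A2 u m b by (auto simp: sobolev_rep_def intro!: Lp2_add Lp2_cmult L)
qed

lemma has_weak_deriv_cong_AE:
  fixes f g :: "real \<Rightarrow> complex"
  assumes h: "has_weak_deriv k f g" and f: "AE x in lebesgue. f x = f' x" and g: "AE x in lebesgue. g x = g' x"
  shows "has_weak_deriv k f' g'"
proof -
  have l: "locally_integrable f" "locally_integrable g" using h by (auto simp: has_weak_deriv_def)
  have l': "locally_integrable f'" "locally_integrable g'"
    using locally_integrable_cong_AE[OF l(1) f] locally_integrable_cong_AE[OF l(2) g] by auto
  have c: "(LINT x|lebesgue. \<phi> x *\<^sub>R a x) = (LINT x|lebesgue. \<phi> x *\<^sub>R b x)"
    if "\<phi> \<in> test_functions" "locally_integrable a" "locally_integrable b" "AE x in lebesgue. a x = b x"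
    for \<phi> and a b :: "real \<Rightarrow> complex"
    using that test_function_integrable[OF that(1)] by (intro integral_cong_AE) auto
  show ?thesis
    using h l l' f g c[OF test_functions_funpow_deriv l(1) l'(1) f] c[OF _ l(2) l'(2) g]
    by (simp add: has_weak_deriv_def)
qed

text \<open>The exponent is left open because the two parts of the potential use 2 and
  \<infinity>.\<close>

lemma sobolev_2_rep:
  fixes f :: "real \<Rightarrow> complex"
  assumes f: "f \<in> sobolev 2 p"
  obtains u u1 u2 g where "antideriv u u1" "antideriv u1 u2" "AE x in lebesgue. f x = u x"
    "AE x in lebesgue. g x = u1 x" "g \<in> Lp p" "u2 \<in> Lp p" "f \<in> Lp p" "has_weak_deriv 2 f u2"
proof -
  have fp: "f \<in> Lp p" and q: "\<And>q. q \<in> {1..2} \<Longrightarrow> \<exists>g\<in>Lp p. has_weak_deriv q f g"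
    using f by (auto simp: sobolev_def)
  obtain g where g: "g \<in> Lp p" "has_weak_deriv 1 f g" using q[of 1] by auto
  obtain u2 where u2: "u2 \<in> Lp p" "has_weak_deriv 2 f u2" using q[of 2] by auto
  obtain u1 where u1: "antideriv u1 u2" "has_weak_deriv 1 f u1"
    using has_weak_deriv_SucE[of 1 f u2] u2(2) by (auto simp: numeral_2_eq_2)
  obtain u where u: "antideriv u u1" "has_weak_deriv 0 f u"
    using has_weak_deriv_SucE[of 0 f u1] u1(2) by auto
  show ?thesis
    using that[OF u(1) u1(1) has_weak_deriv_0_AE[OF u(2)] has_weak_deriv_unique_AE[OF g(2) u1(2)] g(1) u2(1) fp u2(2)] .
qed

lemma Dom_M_E:
  assumes f: "f \<in> Dom_M"
  obtains u u1 u2 where "sobolev_rep u u1 u2" "AE x in lebesgue. f x = u x" "AE x in lebesgue. weak_deriv 2 f x = u2 x"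
proof -
  obtain u u1 u2 g where *: "antideriv u u1" "antideriv u1 u2" "AE x in lebesgue. f x = u x"
    "AE x in lebesgue. g x = u1 x" "g \<in> Lp 2" "u2 \<in> Lp 2" "f \<in> Lp 2" "has_weak_deriv 2 f u2"
    by (rule sobolev_2_rep[OF f[unfolded Dom_M_def]]) (rule that)
  then have "sobolev_rep u u1 u2" using Lp2_AE_cong by (auto simp: sobolev_rep_def)
  moreover have "has_weak_deriv 2 f (weak_deriv 2 f)" unfolding weak_deriv_def by (rule someI[of "has_weak_deriv 2 f", OF *(8)])
  ultimately show ?thesis using that *(3) has_weak_deriv_unique_AE[OF _ *(8)] by blast
qed

lemma Dom_M_I:
  assumes u: "sobolev_rep u u1 u2" and ae: "AE x in lebesgue. f x = u x"
  shows "f \<in> Dom_M" "AE x in lebesgue. weak_deriv 2 f x = u2 x"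
proof -
  have ae': "AE x in lebesgue. u x = f x" using ae by eventually_elim simp
  have A: "antideriv u u1" "antideriv u1 u2" and L: "u \<in> Lp 2" "u1 \<in> Lp 2" "u2 \<in> Lp 2"
    using u by (auto simp: sobolev_rep_def)
  have "has_weak_deriv 0 u u" by (rule has_weak_deriv_0[OF Lp2_locally_integrable[OF L(1)]])
  then have h1: "has_weak_deriv 1 u u1" using has_weak_deriv_Suc A(1) by force
  then have h2: "has_weak_deriv 2 u u2" using has_weak_deriv_Suc[OF h1 A(2)] by (simp add: numeral_2_eq_2)
  have h1': "has_weak_deriv 1 f u1" and h2': "has_weak_deriv 2 f u2"
    using has_weak_deriv_cong_AE[OF h1 ae'] has_weak_deriv_cong_AE[OF h2 ae'] by auto
  have "\<exists>g\<in>Lp 2. has_weak_deriv q f g" if "q \<in> {1..2}" for q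
  proof -
    have "q = 1 \<or> q = 2" using that by auto
    then show ?thesis using L(2,3) h1' h2' by blast
  qed
  then show "f \<in> Dom_M"
    using Lp2_AE_cong[OF L(1) ae'] by (simp add: Dom_M_def sobolev_def)
  have "has_weak_deriv 2 f (weak_deriv 2 f)" unfolding weak_deriv_def by (rule someI[of "has_weak_deriv 2 f", OF h2'])
  then show "AE x in lebesgue. weak_deriv 2 f x = u2 x" using has_weak_deriv_unique_AE[OF _ h2'] by blast
qed

lemma has_weak_deriv_of_real:
  fixes f g :: "real \<Rightarrow> real"
  assumes "has_weak_deriv k f g"
  shows "has_weak_deriv k (\<lambda>x. complex_of_real (f x)) (\<lambda>x. complex_of_real (g x))"
proof -
  have l: "locally_integrable (\<lambda>x. complex_of_real (h x))" if "locally_integrable h" for h :: "real \<Rightarrow> real"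
    unfolding locally_integrable_def set_integrable_def
  proof (intro allI)
    fix a b
    have "integrable lebesgue (\<lambda>x. complex_of_real (indicat_real {a..b} x *\<^sub>R h x))"
      using that by (intro integrable_of_real) (simp add: locally_integrable_def set_integrable_def)
    then show "complex_integrable lebesgue (\<lambda>x. indicat_real {a..b} x *\<^sub>R complex_of_real (h x))"
      by (simp add: scaleR_conv_of_real)
  qed
  have i: "(LINT x|lebesgue. \<phi> x *\<^sub>R complex_of_real (h x)) = complex_of_real (LINT x|lebesgue. \<phi> x *\<^sub>R h x)"
    for h \<phi> :: "real \<Rightarrow> real"
    by (subst integral_complex_of_real[symmetric]) (simp add: scaleR_conv_of_real)
  show ?thesis
    using assms unfolding has_weak_deriv_def i
    by (auto intro: l simp: scaleR_conv_of_real)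
qed

lemma sobolev_of_real:
  fixes f :: "real \<Rightarrow> real"
  assumes "f \<in> sobolev n p" shows "(\<lambda>x. complex_of_real (f x)) \<in> sobolev n p"
proof -
  have L: "(\<lambda>x. complex_of_real (g x)) \<in> Lp p" if "g \<in> Lp p" for g :: "real \<Rightarrow> real"
    using that by (auto simp: Lp_def intro: measurable_compose[OF _ borel_measurable_of_real])
  have "\<exists>g\<in>Lp p. has_weak_deriv q (\<lambda>x. complex_of_real (f x)) g" if "q \<in> {1..n}" for q
  proof -
    have "\<forall>q\<in>{1..n}. \<exists>g\<in>Lp p. has_weak_deriv q f g"
      using assms unfolding sobolev_def mem_Collect_eq by (rule conjunct2)
    from bspec[OF this that] obtain g where g: "g \<in> Lp p" "has_weak_deriv q f g" by (rule bexE)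
    show ?thesis using has_weak_deriv_of_real[OF g(2)] L[OF g(1)] by (rule bexI)
  qed
  then show ?thesis using assms L by (simp add: sobolev_def)
qed

text \<open>A potential \<open>V\<close> in \<open>W\<^sup>2\<^sup>,\<^sup>2 + W\<^sup>2\<^sup>,\<^sup>\<infinity>\<close> enters the proof only through this property: \<open>U\<close> is its continuously
  differentiable representative and \<open>U1\<close>, \<open>U2\<close> are the derivatives of \<open>U\<close>.\<close>

definition potential_rep ::
  "(real \<Rightarrow> real) \<Rightarrow> (real \<Rightarrow> complex) \<Rightarrow> (real \<Rightarrow> complex) \<Rightarrow> (real \<Rightarrow> complex) \<Rightarrow> bool" where
  "potential_rep V U U1 U2 \<longleftrightarrow> (AE x in lebesgue. complex_of_real (V x) = U x) \<and>
     antideriv U U1 \<and> antideriv U1 U2 \<and> bounded (range U) \<and> bounded (range U1) \<and>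
     (\<exists>A\<in>Lp 2. \<exists>B\<in>borel_measurable lebesgue. \<exists>K. (\<forall>x. U2 x = A x + B x) \<and> (AE x in lebesgue. norm (B x) \<le> K))"

lemma potential_rep_exists:
  fixes V1 V2 :: "real \<Rightarrow> real"
  assumes V1: "V1 \<in> sobolev 2 2" and V2: "V2 \<in> sobolev 2 \<infinity>"
  obtains U U1 U2 where "potential_rep (\<lambda>x. V1 x + V2 x) U U1 U2"
proof -
  obtain u u1 u2 g where u: "antideriv u u1" "antideriv u1 u2" "AE x in lebesgue. complex_of_real (V1 x) = u x"
    "AE x in lebesgue. g x = u1 x" "g \<in> Lp 2" "u2 \<in> Lp 2" "(\<lambda>x. complex_of_real (V1 x)) \<in> Lp 2"
    by (rule sobolev_2_rep[OF sobolev_of_real[OF V1]]) (rule that)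
  obtain v v1 v2 h where v: "antideriv v v1" "antideriv v1 v2" "AE x in lebesgue. complex_of_real (V2 x) = v x"
    "AE x in lebesgue. h x = v1 x" "h \<in> Lp \<infinity>" "v2 \<in> Lp \<infinity>" "(\<lambda>x. complex_of_real (V2 x)) \<in> Lp \<infinity>"
    by (rule sobolev_2_rep[OF sobolev_of_real[OF V2]]) (rule that)
  have uL: "u \<in> Lp 2" "u1 \<in> Lp 2" using u Lp2_AE_cong by blast+
  have bu: "bounded (range u)" "bounded (range u1)"
    using antideriv_Lp2_bounded[OF u(1) uL] antideriv_Lp2_bounded[OF u(2) uL(2) u(6)] by auto
  \<comment> \<open>An essential bound becomes a bound at every point once the function is replaced
    by its continuous representative.\<close>
  have bb: "bounded (range a)" if "a' \<in> Lp \<infinity>" "AE x in lebesgue. a' x = a x" "antideriv a b" for a a' b :: "real \<Rightarrow> complex"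
  proof -
    have "\<exists>C. AE x in lebesgue. norm (a' x) \<le> C" using that(1) by (simp add: Lp_def)
    then obtain C where "AE x in lebesgue. norm (a' x) \<le> C" by blast
    then have "AE x in lebesgue. norm (a x) \<le> C" using that(2) by eventually_elim simp
    then have "norm (a x) \<le> C" for x
      by (intro continuous_AE_le continuous_intros antideriv_continuous[OF that(3)])
    then show ?thesis by (auto simp: bounded_iff)
  qed
  have bv: "bounded (range v)" "bounded (range v1)"
    using bb[OF v(7,3,1)] bb[OF v(5,4,2)] by auto
  have badd: "bounded (range (\<lambda>x. a x + b x))" if "bounded (range a)" "bounded (range b)" for a b :: "real \<Rightarrow> complex"
    using bounded_plus_comp[of a UNIV b] that by auto
  have "v2 \<in> borel_measurable lebesgue \<and> (\<exists>K. AE x in lebesgue. norm (v2 x) \<le> K)"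
    using v(6) by (simp add: Lp_def)
  then obtain K where "v2 \<in> borel_measurable lebesgue" "AE x in lebesgue. norm (v2 x) \<le> K" by blast
  moreover have "AE x in lebesgue. complex_of_real (V1 x + V2 x) = u x + v x"
    using u(3) v(3) by eventually_elim simp
  ultimately have "potential_rep (\<lambda>x. V1 x + V2 x) (\<lambda>x. u x + v x) (\<lambda>x. u1 x + v1 x) (\<lambda>x. u2 x + v2 x)"
    unfolding potential_rep_def using u(1,2,6) v(1,2) bu bv
    by (intro conjI antideriv_add badd bexI[of _ u2] bexI[of _ v2]) auto
  then show ?thesis using that by blast
qed

section \<open>The gap around an isolated eigenvalue\<close>

text \<open>A symmetric operator \<open>N\<close> whose real resolvent set contains a punctured neighbourhood of \<open>0\<close>;
  \<open>R h\<close> is the inverse of \<open>N - h\<close> on the closed subspace \<open>W\<close>.\<close>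

locale punctured_resolvent =
  fixes W D :: "'a::{real_inner, complete_space} set" and N :: "'a \<Rightarrow> 'a" and R :: "real \<Rightarrow> 'a \<Rightarrow> 'a" and r :: real
  assumes W: "subspace W" "closed W" and D: "subspace D" "D \<subseteq> W"
    and N_mem: "u \<in> D \<Longrightarrow> N u \<in> W"
    and N_add: "u \<in> D \<Longrightarrow> v \<in> D \<Longrightarrow> N (u + v) = N u + N v"
    and N_scale: "u \<in> D \<Longrightarrow> N (c *\<^sub>R u) = c *\<^sub>R N u"
    and N_sym: "u \<in> D \<Longrightarrow> v \<in> D \<Longrightarrow> N u \<bullet> v = u \<bullet> N v"
    and r: "r > 0"
    and R_mem: "h \<noteq> 0 \<Longrightarrow> \<bar>h\<bar> < r \<Longrightarrow> g \<in> W \<Longrightarrow> R h g \<in> D"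
    and R_right: "h \<noteq> 0 \<Longrightarrow> \<bar>h\<bar> < r \<Longrightarrow> g \<in> W \<Longrightarrow> N (R h g) - h *\<^sub>R R h g = g"
    and R_left: "h \<noteq> 0 \<Longrightarrow> \<bar>h\<bar> < r \<Longrightarrow> u \<in> D \<Longrightarrow> R h (N u - h *\<^sub>R u) = u"
    and R_bounded: "h \<noteq> 0 \<Longrightarrow> \<bar>h\<bar> < r \<Longrightarrow> \<exists>C. \<forall>g\<in>W. norm (R h g) \<le> C * norm g"
    and kernel: "u \<in> D \<Longrightarrow> N u = 0 \<Longrightarrow> u = 0"
begin

lemma D_W: "u \<in> D \<Longrightarrow> u \<in> W" using D by blast

lemma N_diff: "u \<in> D \<Longrightarrow> v \<in> D \<Longrightarrow> N (u - v) = N u - N v"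
  using N_add[of u "(-1) *\<^sub>R v"] N_scale[of v "-1"] subspace_scale[OF D(1), of v "-1"] by simp

lemmas D_add = subspace_add[OF D(1)] and D_scale = subspace_scale[OF D(1)] and D_diff = subspace_diff[OF D(1)]

lemma NR: "h \<noteq> 0 \<Longrightarrow> \<bar>h\<bar> < r \<Longrightarrow> g \<in> W \<Longrightarrow> N (R h g) = g + h *\<^sub>R R h g"
  using R_right[of h g] by (simp add: algebra_simps)

text \<open>If \<open>b\<close> is the infimum of \<open>\<parallel>(N - h) u\<parallel> / \<parallel>u\<parallel>\<close>, the form \<open>\<parallel>(N - h) u\<parallel>\<^sup>2 - b\<^sup>2\<parallel>u\<parallel>\<^sup>2\<close> is nonnegative but not
  coercive, whereas invertibility of \<open>(N - h - b) (N - h + b)\<close> makes it coercive by Cauchy-Schwarz.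
  Hence \<open>h + b\<close> or \<open>h - b\<close> is not in the resolvent set.\<close>

lemma lower_bound_improve:
  assumes b: "0 \<le> b" and h: "h + b \<noteq> 0" "\<bar>h + b\<bar> < r" "h - b \<noteq> 0" "\<bar>h - b\<bar> < r"
    and pos: "\<And>u. u \<in> D \<Longrightarrow> (b * norm u)\<^sup>2 \<le> (norm (N u - h *\<^sub>R u))\<^sup>2"
  shows "\<exists>e>0. \<forall>u\<in>D. (b\<^sup>2 + e) * (norm u)\<^sup>2 \<le> (norm (N u - h *\<^sub>R u))\<^sup>2"
proof -
  define L where "L u = N u - h *\<^sub>R u" for u
  define a where "a u v = L u \<bullet> L v - b\<^sup>2 * (u \<bullet> v)" for u v
  have L_add: "L (u + c *\<^sub>R v) = L u + c *\<^sub>R L v" if "u \<in> D" "v \<in> D" for u v c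
    using that by (simp add: L_def N_add N_scale D_scale algebra_simps)
  have L_sym: "L u \<bullet> v = u \<bullet> L v" if "u \<in> D" "v \<in> D" for u v
    using that by (simp add: L_def inner_diff_left inner_diff_right N_sym)
  have apos: "a u u \<ge> 0" if "u \<in> D" for u
    using pos[OF that] by (simp add: a_def L_def power2_norm_eq_inner[symmetric] power_mult_distrib)
  \<comment> \<open>The form is only semidefinite, so the case of a null vector \<open>v\<close> is
    treated separately.\<close>
  have CS: "(a u v)\<^sup>2 \<le> a u u * a v v" if u: "u \<in> D" and v: "v \<in> D" for u v
  proof -
    have q: "0 \<le> a u u + 2 * t * a u v + t\<^sup>2 * a v v" for t
    proof -
      have "0 \<le> a (u + t *\<^sub>R v) (u + t *\<^sub>R v)" using u v by (intro apos D_add D_scale)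
      also have "\<dots> = a u u + 2 * t * a u v + t\<^sup>2 * a v v"
        using u v by (simp add: a_def L_add inner_add_left inner_add_right inner_commute power2_eq_square algebra_simps)
      finally show ?thesis .
    qed
    show ?thesis
    proof (cases "a v v = 0")
      case True
      have "a u v = 0"
      proof (rule ccontr)
        assume n: "a u v \<noteq> 0"
        \<comment> \<open>At this t the quadratic, which is linear when \<open>a v v = 0\<close>,
          takes the value -1.\<close>
        then show False using q[of "- (a u u + 1) / (2 * a u v)"] True by (simp add: field_simps)
      qed
      then show ?thesis by (simp add: True)
    next
      case False
      then have "a v v > 0" using apos[OF v] by simp
      then show ?thesis using q[of "- a u v / a v v"] by (simp add: field_simps power2_eq_square)
    qed
  qed
  obtain C1 where C1: "\<And>g. g \<in> W \<Longrightarrow> norm (R (h + b) g) \<le> C1 * norm g" using R_bounded[OF h(1,2)] by blast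
  obtain C2 where C2: "\<And>g. g \<in> W \<Longrightarrow> norm (R (h - b) g) \<le> C2 * norm g" using R_bounded[OF h(3,4)] by blast
  define c1 c2 where "c1 = \<bar>C1\<bar>" and "c2 = \<bar>C2\<bar>"
  have c: "0 \<le> c1" "0 \<le> c2" by (auto simp: c1_def c2_def)
  \<comment> \<open>The constant bounding \<open>a v v\<close> by the squared norm of
    \<open>u\<close>; the summand 1 makes it positive.\<close>
  define K where "K = 1 + c2\<^sup>2 + 2 * b * (c2 * (c1 * c2))"
  have K: "K > 0" unfolding K_def using b c by (intro add_pos_nonneg) auto
  have "(b\<^sup>2 + 1 / K) * (norm u)\<^sup>2 \<le> (norm (N u - h *\<^sub>R u))\<^sup>2" if u: "u \<in> D" for u
  proof -
    \<comment> \<open>\<open>y\<close> solves (L + b) y = u and \<open>v\<close> solves (L - b) v =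
      y. Hence (L^2 - b^2) v = u, and \<open>a u v\<close> is the squared norm of
      \<open>u\<close>.\<close>
    define y where "y = R (h - b) u"
    define v where "v = R (h + b) y"
    have y: "y \<in> D" "N y = u + (h - b) *\<^sub>R y" using R_mem NR h u D_W by (auto simp: y_def)
    have v: "v \<in> D" "N v = y + (h + b) *\<^sub>R v" using R_mem NR h y D_W by (auto simp: v_def)
    have Lv: "L v = y + b *\<^sub>R v" using v by (simp add: L_def algebra_simps)
    have Ly: "L y = u - b *\<^sub>R y" using y by (simp add: L_def algebra_simps)
    have "a u v = u \<bullet> L (y + b *\<^sub>R v) - b\<^sup>2 * (u \<bullet> v)"
      unfolding a_def Lv using u y v by (subst L_sym) (auto intro: D_add D_scale)
    also have "L (y + b *\<^sub>R v) = u + (b * b) *\<^sub>R v"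
      using y v by (simp add: L_add Lv Ly algebra_simps)
    finally have auv: "a u v = (norm u)\<^sup>2"
      unfolding power2_norm_eq_inner by (simp add: inner_add_right power2_eq_square)
    have ny: "norm y \<le> c2 * norm u"
      using C2[OF D_W[OF u]] abs_ge_self[of C2] mult_right_mono[of C2 c2 "norm u"] by (simp add: y_def c2_def)
    have "norm v \<le> c1 * norm y"
      using C1[OF D_W[OF y(1)]] abs_ge_self[of C1] mult_right_mono[of C1 c1 "norm y"] by (simp add: v_def c1_def)
    also have "\<dots> \<le> c1 * (c2 * norm u)" by (intro mult_left_mono ny c)
    finally have nv: "norm v \<le> c1 * (c2 * norm u)" .
    have "a v v = (norm y)\<^sup>2 + 2 * b * (y \<bullet> v)"
      unfolding power2_norm_eq_inner by (simp add: a_def Lv inner_add_left inner_add_right inner_commute power2_eq_square algebra_simps)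
    also have "\<dots> \<le> (c2 * norm u)\<^sup>2 + 2 * b * ((c2 * norm u) * (c1 * (c2 * norm u)))"
    proof (intro add_mono power_mono ny mult_left_mono)
      have "y \<bullet> v \<le> norm y * norm v" by (rule norm_cauchy_schwarz)
      also have "\<dots> \<le> (c2 * norm u) * (c1 * (c2 * norm u))" using c by (intro mult_mono ny nv) auto
      finally show "y \<bullet> v \<le> (c2 * norm u) * (c1 * (c2 * norm u))" .
    qed (use b in auto)
    also have "\<dots> \<le> K * (norm u)\<^sup>2" by (simp add: K_def power2_eq_square algebra_simps)
    finally have avv: "a v v \<le> K * (norm u)\<^sup>2" .
    have "(norm u)\<^sup>2 * (norm u)\<^sup>2 \<le> a u u * (K * (norm u)\<^sup>2)"
      using CS[OF u v(1)] mult_left_mono[OF avv apos[OF u]] by (simp add: auv power2_eq_square)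
    then have "(norm u)\<^sup>2 \<le> K * a u u"
    proof (cases "u = 0")
      case True
      then show ?thesis using mult_nonneg_nonneg[OF less_imp_le[OF K] apos[OF u]] by simp
    next
      case False
      then have "(norm u)\<^sup>2 > 0" by simp
      with \<open>(norm u)\<^sup>2 * (norm u)\<^sup>2 \<le> a u u * (K * (norm u)\<^sup>2)\<close> show ?thesis
        by (metis mult.assoc mult.commute mult_le_cancel_right_pos)
    qed
    then have "(norm u)\<^sup>2 / K \<le> a u u" using K by (simp add: field_simps)
    then show ?thesis by (simp add: a_def L_def power2_norm_eq_inner algebra_simps)
  qed
  then show ?thesis using K by (intro exI[of _ "1 / K"]) auto
qed

text \<open>If the infimum b of the quotients were below |h|, then h + b and h - b would be nonzero
  and within r, and \<open>lower_bound_improve\<close> would raise the infimum.\<close>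

lemma lower_bound_punctured:
  assumes h: "h \<noteq> 0" "\<bar>h\<bar> < r / 3" and u: "u \<in> D"
  shows "\<bar>h\<bar> * norm u \<le> norm (N u - h *\<^sub>R u)"
proof (rule ccontr)
  assume n: "\<not> \<bar>h\<bar> * norm u \<le> norm (N u - h *\<^sub>R u)"
  then have u0: "u \<noteq> 0" by auto
  define S where "S = (\<lambda>u. (norm (N u - h *\<^sub>R u))\<^sup>2 / (norm u)\<^sup>2) ` (D - {0})"
  have S: "S \<noteq> {}" "bdd_below S"
    using u u0 by (auto simp: S_def intro!: bdd_belowI[of _ 0])
  have i0: "Inf S \<ge> 0" using S(1) by (intro cInf_greatest) (auto simp: S_def)
  have "Inf S \<le> (norm (N u - h *\<^sub>R u))\<^sup>2 / (norm u)\<^sup>2"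
    using u u0 by (intro cInf_lower S) (auto simp: S_def)
  also have "\<dots> < \<bar>h\<bar>\<^sup>2"
  proof -
    have "(norm (N u - h *\<^sub>R u))\<^sup>2 < (\<bar>h\<bar> * norm u)\<^sup>2" using n by (intro power_strict_mono) auto
    then show ?thesis using u0 by (simp add: field_simps power_mult_distrib)
  qed
  finally have bh: "sqrt (Inf S) < \<bar>h\<bar>" by (simp add: real_less_lsqrt)
  define b where "b = sqrt (Inf S)"
  have b: "0 \<le> b" "b\<^sup>2 = Inf S" using i0 by (auto simp: b_def)
  have "\<exists>e>0. \<forall>u\<in>D. (b\<^sup>2 + e) * (norm u)\<^sup>2 \<le> (norm (N u - h *\<^sub>R u))\<^sup>2"
  proof (rule lower_bound_improve[OF b(1)])
    show "h + b \<noteq> 0" "\<bar>h + b\<bar> < r" "h - b \<noteq> 0" "\<bar>h - b\<bar> < r"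
      using bh b(1) h unfolding b_def[symmetric] by linarith+
    fix v assume v: "v \<in> D"
    show "(b * norm v)\<^sup>2 \<le> (norm (N v - h *\<^sub>R v))\<^sup>2"
    proof (cases "v = 0")
      case False
      have "Inf S \<le> (norm (N v - h *\<^sub>R v))\<^sup>2 / (norm v)\<^sup>2"
        using v False by (intro cInf_lower S) (auto simp: S_def)
      then show ?thesis using False b(2) by (simp add: power_mult_distrib field_simps)
    qed simp
  qed
  then obtain e where e: "e > 0" "\<And>u. u \<in> D \<Longrightarrow> (b\<^sup>2 + e) * (norm u)\<^sup>2 \<le> (norm (N u - h *\<^sub>R u))\<^sup>2" by blast
  have "b\<^sup>2 + e \<le> Inf S"
    using e(2) S(1) by (intro cInf_greatest) (auto simp: S_def field_simps)
  then show False using e(1) b(2) by simp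
qed

text \<open>Squaring \<open>lower_bound_punctured\<close> cancels the terms with the square of h and
  leaves a bound for h times the form; the choices h = r/4 and h = -r/4 give both signs.\<close>

lemma form_bound: "u \<in> D \<Longrightarrow> \<bar>N u \<bullet> u\<bar> \<le> 2 / r * (norm (N u))\<^sup>2"
proof -
  assume u: "u \<in> D"
  have *: "2 * h * (N u \<bullet> u) \<le> (norm (N u))\<^sup>2" if "h \<noteq> 0" "\<bar>h\<bar> < r / 3" for h
  proof -
    have "(\<bar>h\<bar> * norm u)\<^sup>2 \<le> (norm (N u - h *\<^sub>R u))\<^sup>2"
      using lower_bound_punctured[OF that u] by (intro power_mono) auto
    also have "\<dots> = (norm (N u))\<^sup>2 - 2 * h * (N u \<bullet> u) + (\<bar>h\<bar> * norm u)\<^sup>2"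
      unfolding power_mult_distrib power2_norm_eq_inner
      by (simp add: inner_diff_left inner_diff_right inner_commute power2_eq_square)
    finally show ?thesis by simp
  qed
  show ?thesis using *[of "r / 4"] *[of "- r / 4"] r by (simp add: abs_le_iff field_simps)
qed

text \<open>Apply \<open>form_bound\<close> to \<open>C N x + x\<close> and \<open>C N x - x\<close> with \<open>C = 2 / r\<close> and add.\<close>

lemma range_lower_bound:
  assumes x: "x \<in> D" "N x \<in> D"
  shows "norm (N x) \<le> 2 / r * norm (N (N x))"
proof -
  define C where "C = 2 / r"
  have C: "C > 0" using r by (simp add: C_def)
  define p m where "p = C *\<^sub>R N x + x" and "m = C *\<^sub>R N x - x"
  have pm: "p \<in> D" "m \<in> D" using x by (auto simp: p_def m_def intro: D_add D_diff D_scale)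
  have Np: "N p = C *\<^sub>R N (N x) + N x" and Nm: "N m = C *\<^sub>R N (N x) - N x"
    using x by (simp_all add: p_def m_def N_add N_diff N_scale D_scale)
  have 1: "N p \<bullet> p \<le> C * (norm (N p))\<^sup>2" and 2: "- (N m \<bullet> m) \<le> C * (norm (N m))\<^sup>2"
    using form_bound[OF pm(1)] form_bound[OF pm(2)] by (auto simp: C_def abs_le_iff)
  have s: "N (N x) \<bullet> x = (norm (N x))\<^sup>2" using N_sym[OF x(2,1)] by (simp add: power2_norm_eq_inner)
  have "N p \<bullet> p - N m \<bullet> m = 4 * C * (norm (N x))\<^sup>2"
    unfolding Np Nm unfolding p_def m_def using s
    by (simp add: inner_add_left inner_add_right inner_diff_left inner_diff_right power2_norm_eq_inner inner_commute algebra_simps)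
  moreover have "(norm (N p))\<^sup>2 + (norm (N m))\<^sup>2 = 2 * (C\<^sup>2 * (norm (N (N x)))\<^sup>2 + (norm (N x))\<^sup>2)"
    unfolding Np Nm power2_norm_eq_inner
    by (simp add: inner_add_left inner_add_right inner_diff_left inner_diff_right power2_eq_square inner_commute algebra_simps)
  moreover have "N p \<bullet> p - N m \<bullet> m \<le> C * ((norm (N p))\<^sup>2 + (norm (N m))\<^sup>2)"
    using 1 2 by (simp add: distrib_left)
  ultimately have "4 * C * (norm (N x))\<^sup>2 \<le> C * (2 * (C\<^sup>2 * (norm (N (N x)))\<^sup>2 + (norm (N x))\<^sup>2))"
    by metis
  then have "C * (4 * (norm (N x))\<^sup>2) \<le> C * (2 * (C\<^sup>2 * (norm (N (N x)))\<^sup>2 + (norm (N x))\<^sup>2))"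
    by (simp add: mult.assoc mult.left_commute)
  then have "4 * (norm (N x))\<^sup>2 \<le> 2 * (C\<^sup>2 * (norm (N (N x)))\<^sup>2 + (norm (N x))\<^sup>2)"
    using C by (simp only: mult_le_cancel_left_pos)
  then have "(norm (N x))\<^sup>2 \<le> (C * norm (N (N x)))\<^sup>2" by (simp add: power_mult_distrib)
  then show ?thesis unfolding C_def[symmetric] by (rule power2_le_imp_le) (use C in simp)
qed

text \<open>As h tends to 0, - h R h u tends to the component of u in the kernel of N, which is 0
  here. Differences p h - p k lie in the range of N, so \<open>range_lower_bound\<close> gives them
  a rate; letting k tend to 0 bounds |h| times the norm of R h u by a multiple of |h|.\<close>

lemma resolvent_uniform_bound:
  assumes h: "h \<noteq> 0" "\<bar>h\<bar> < r / 3" and u: "u \<in> W"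
  shows "norm (R h u) \<le> 4 / r * norm u"
proof -
  define p where "p h = - (h *\<^sub>R R h u)" for h
  have small: "\<bar>h\<bar> < r" if "\<bar>h\<bar> < r / 3" for h using that r by simp
  have pD: "p h \<in> D" if "h \<noteq> 0" "\<bar>h\<bar> < r / 3" for h
    using D_scale[OF R_mem[OF that(1) small[OF that(2)] u], of "-h"] by (simp add: p_def)
  have nR: "norm (h *\<^sub>R R h u) \<le> norm u" if "h \<noteq> 0" "\<bar>h\<bar> < r / 3" for h
    using lower_bound_punctured[OF that R_mem[OF that(1) small[OF that(2)] u]] R_right[OF that(1) small[OF that(2)] u] by simp
  have Np: "norm (N (p h)) \<le> 2 * \<bar>h\<bar> * norm u" if hh: "h \<noteq> 0" "\<bar>h\<bar> < r / 3" for h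
  proof -
    have "N (p h) = (- h) *\<^sub>R (u + h *\<^sub>R R h u)"
      using N_scale[OF R_mem[OF hh(1) small[OF hh(2)] u], of "-h"] NR[OF hh(1) small[OF hh(2)] u] by (simp add: p_def)
    then have "norm (N (p h)) \<le> \<bar>h\<bar> * (norm u + norm u)"
      using nR[OF hh] norm_triangle_ineq[of u "h *\<^sub>R R h u"] by (simp add: mult_left_mono)
    then show ?thesis by simp
  qed
  have pp: "norm (p h - p k) \<le> 4 / r * (\<bar>h\<bar> + \<bar>k\<bar>) * norm u"
    if hh: "h \<noteq> 0" "\<bar>h\<bar> < r / 3" and kk: "k \<noteq> 0" "\<bar>k\<bar> < r / 3" for h k
  proof -
    define y where "y = R k u"
    define x where "x = R h y"
    have y: "y \<in> D" "N y = u + k *\<^sub>R y" using R_mem NR kk small u by (auto simp: y_def)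
    have x: "x \<in> D" "N x = y + h *\<^sub>R x" using R_mem NR hh small D_W[OF y(1)] by (auto simp: x_def)
    \<comment> \<open>The resolvent identity: R h u = R k u + (h - k) R h (R k u). It exhibits p h -
      p k as the image under N of a multiple of x.\<close>
    define z where "z = y + (h - k) *\<^sub>R x"
    have z: "z \<in> D" using x y by (auto simp: z_def intro: D_add D_scale)
    have "N z = N y + (h - k) *\<^sub>R N x"
      unfolding z_def using x(1) y(1) by (simp only: N_add N_scale D_scale)
    then have "N z - h *\<^sub>R z = u"
      unfolding x(2) y(2) by (simp add: z_def algebra_simps)
    then have Rz: "R h u = z" using R_left[OF hh(1) small[OF hh(2)] z] by simp
    have e: "p h - p k = N ((k - h) *\<^sub>R x)"
      unfolding N_scale[OF x(1)] x(2) by (simp add: p_def Rz z_def y_def[symmetric] algebra_simps)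
    have "norm (p h - p k) \<le> 2 / r * norm (N (p h - p k))"
      unfolding e using x pD[OF hh] pD[OF kk] by (intro range_lower_bound D_scale) (simp_all add: e[symmetric] D_diff)
    also have "\<dots> \<le> 2 / r * (2 * \<bar>h\<bar> * norm u + 2 * \<bar>k\<bar> * norm u)"
      unfolding N_diff[OF pD[OF hh] pD[OF kk]]
      using r norm_triangle_ineq4[of "N (p h)" "N (p k)"] Np[OF hh] Np[OF kk]
      by (intro mult_left_mono) simp_all
    finally show ?thesis by (simp add: algebra_simps add_divide_distrib)
  qed
  define s where "s n = r / (4 * (real n + 1))" for n
  have s: "s n \<noteq> 0" "\<bar>s n\<bar> < r / 3" for n
    using r by (auto simp: s_def field_simps intro!: add_pos_nonneg)
  have s0: "s \<longlonglongrightarrow> 0" unfolding s_def by real_asymp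
  have "Cauchy (\<lambda>n. p (s n))"
  proof (rule metric_CauchyI)
    fix e :: real assume e: "e > 0"
    have "(\<lambda>n. 4 / r * (2 * s n) * norm u) \<longlonglongrightarrow> 4 / r * (2 * 0) * norm u" by (intro tendsto_intros s0)
    then have "\<forall>\<^sub>F n in sequentially. 4 / r * (2 * s n) * norm u < e" using e by (intro order_tendstoD) auto
    then obtain M where M: "4 / r * (2 * s M) * norm u < e" by (auto simp: eventually_sequentially)
    have sM: "\<bar>s n\<bar> \<le> s M" if "n \<ge> M" for n using that r by (auto simp: s_def field_simps)
    have "dist (p (s m)) (p (s n)) < e" if "m \<ge> M" "n \<ge> M" for m n
    proof -
      have "dist (p (s m)) (p (s n)) \<le> 4 / r * (\<bar>s m\<bar> + \<bar>s n\<bar>) * norm u" using pp s by (simp add: dist_norm)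
      also have "\<dots> \<le> 4 / r * (2 * s M) * norm u"
        using sM[OF that(1)] sM[OF that(2)] r by (intro mult_right_mono mult_left_mono) auto
      finally show ?thesis using M by simp
    qed
    then show "\<exists>M. \<forall>m\<ge>M. \<forall>n\<ge>M. dist (p (s m)) (p (s n)) < e" by blast
  qed
  then obtain l where l: "(\<lambda>n. p (s n)) \<longlonglongrightarrow> l" using Cauchy_convergent_iff convergentD by blast
  have lW: "l \<in> W" using closed_sequentially[OF W(2) _ l] pD s D_W by blast
  \<comment> \<open>N is not assumed closed, and the limit l is not known to lie in
    \<open>D\<close>. The bounded inverse at the fixed point k replaces closedness: q solves (N - k)
    q = - k l, the p (s n) converge to it, so q = l and N l = 0.\<close>
  define k where "k = r / 8"
  have k: "k \<noteq> 0" "\<bar>k\<bar> < r / 3" "k > 0" using r by (auto simp: k_def)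
  define q where "q = R k (- (k *\<^sub>R l))"
  have klW: "- (k *\<^sub>R l) \<in> W" using subspace_scale[OF W(1) lW, of "-k"] by simp
  have q: "q \<in> D" "N q - k *\<^sub>R q = - (k *\<^sub>R l)"
    using R_mem[OF k(1) small[OF k(2)] klW] R_right[OF k(1) small[OF k(2)] klW] by (auto simp: q_def)
  have Npl: "(\<lambda>n. N (p (s n))) \<longlonglongrightarrow> 0"
  proof (rule Lim_null_comparison)
    show "\<forall>\<^sub>F n in sequentially. norm (N (p (s n))) \<le> 2 * \<bar>s n\<bar> * norm u" using Np s by simp
    have "(\<lambda>n. 2 * \<bar>s n\<bar> * norm u) \<longlonglongrightarrow> 2 * \<bar>0\<bar> * norm u" by (intro tendsto_intros s0)
    then show "(\<lambda>n. 2 * \<bar>s n\<bar> * norm u) \<longlonglongrightarrow> 0" by simp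
  qed
  have "(\<lambda>n. p (s n) - q) \<longlonglongrightarrow> 0"
  proof (rule Lim_null_comparison)
    show "\<forall>\<^sub>F n in sequentially. norm (p (s n) - q) \<le> norm (N (p (s n)) - k *\<^sub>R p (s n) + k *\<^sub>R l) / k"
    proof (intro always_eventually allI)
      fix n
      have "\<bar>k\<bar> * norm (p (s n) - q) \<le> norm (N (p (s n) - q) - k *\<^sub>R (p (s n) - q))"
        using k(1,2) q pD s by (intro lower_bound_punctured D_diff) auto
      also have "N (p (s n) - q) - k *\<^sub>R (p (s n) - q) = N (p (s n)) - k *\<^sub>R p (s n) - (N q - k *\<^sub>R q)"
        using pD s q by (simp add: N_diff algebra_simps)
      finally show "norm (p (s n) - q) \<le> norm (N (p (s n)) - k *\<^sub>R p (s n) + k *\<^sub>R l) / k"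
        using k(3) q by (simp add: field_simps)
    qed
    have "(\<lambda>n. norm (N (p (s n)) - k *\<^sub>R p (s n) + k *\<^sub>R l) / k) \<longlonglongrightarrow> norm (0 - k *\<^sub>R l + k *\<^sub>R l) / k"
      using k(1) by (intro tendsto_intros Npl l)
    then show "(\<lambda>n. norm (N (p (s n)) - k *\<^sub>R p (s n) + k *\<^sub>R l) / k) \<longlonglongrightarrow> 0" by simp
  qed
  then have "(\<lambda>n. p (s n)) \<longlonglongrightarrow> q" by (simp add: LIM_zero_iff)
  then have "q = l" using l LIMSEQ_unique by blast
  then have "q = 0" using q kernel by simp
  then have p0: "(\<lambda>n. p (s n)) \<longlonglongrightarrow> 0" using l \<open>q = l\<close> by simp
  have "norm (p h - 0) \<le> 4 / r * (\<bar>h\<bar> + \<bar>0\<bar>) * norm u"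
  proof (rule LIMSEQ_le)
    show "(\<lambda>n. norm (p h - p (s n))) \<longlonglongrightarrow> norm (p h - 0)" by (intro tendsto_intros p0)
    show "(\<lambda>n. 4 / r * (\<bar>h\<bar> + \<bar>s n\<bar>) * norm u) \<longlonglongrightarrow> 4 / r * (\<bar>h\<bar> + \<bar>0\<bar>) * norm u"
      by (intro tendsto_intros s0)
  qed (use pp[OF h s] in blast)
  then have "\<bar>h\<bar> * norm (R h u) \<le> \<bar>h\<bar> * (4 / r * norm u)" by (simp add: p_def mult_ac)
  then show ?thesis by (rule mult_left_le_imp_le) (use h(1) in simp)
qed

text \<open>At h = r/8 the resolvent bound 4/r turns the term |h| times the norm of w into half of
  that norm, which is absorbed.\<close>

lemma gap:
  assumes w: "w \<in> D" shows "r / 8 * norm w \<le> norm (N w)"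
proof -
  define h where "h = r / 8"
  have h: "h \<noteq> 0" "\<bar>h\<bar> < r / 3" "\<bar>h\<bar> < r" "h > 0" using r by (auto simp: h_def)
  have g: "N w - h *\<^sub>R w \<in> W"
    using subspace_diff[OF W(1)] subspace_scale[OF W(1)] N_mem[OF w] D_W[OF w] by blast
  have "norm w \<le> 4 / r * norm (N w - h *\<^sub>R w)"
    using resolvent_uniform_bound[OF h(1,2) g] R_left[OF h(1,3) w] by simp
  also have "\<dots> \<le> 4 / r * (norm (N w) + h * norm w)"
    using norm_triangle_ineq4[of "N w" "h *\<^sub>R w"] r h(4) by (intro mult_left_mono) auto
  finally show ?thesis using r by (simp add: h_def field_simps)
qed

end

section \<open>Hermite functions\<close>

lemma integrable_poly_gauss:
  fixes p :: "real poly"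
  shows "integrable lebesgue (\<lambda>x. poly p x * exp (- x\<^sup>2 / 2))"
proof -
  have "integrable lborel (\<lambda>x. \<Sum>k\<le>degree p. (coeff p k * sqrt (2 * pi)) * (std_normal_density x * x ^ k))"
    by (intro Bochner_Integration.integrable_sum integrable_mult_right integrable_std_normal_moment)
  moreover have "(\<lambda>x. \<Sum>k\<le>degree p. (coeff p k * sqrt (2 * pi)) * (std_normal_density x * x ^ k))
     = (\<lambda>x. poly p x * exp (- x\<^sup>2 / 2))"
  proof
    fix x
    have "(coeff p k * sqrt (2 * pi)) * (std_normal_density x * x ^ k) = coeff p k * x ^ k * exp (- x\<^sup>2 / 2)" for k
      by (simp add: std_normal_density_def)
    then show "(\<Sum>k\<le>degree p. (coeff p k * sqrt (2 * pi)) * (std_normal_density x * x ^ k)) = poly p x * exp (- x\<^sup>2 / 2)"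
      by (simp only: poly_altdef sum_distrib_right)
  qed
  ultimately have "integrable lborel (\<lambda>x. poly p x * exp (- x\<^sup>2 / 2))" by simp
  then show ?thesis by (subst integrable_completion) auto
qed

text \<open>Polynomials times exp(-x^2/2) are closed under differentiation, so the calculus of
  Hermite functions reduces to identities between polynomials; \<open>gauss_deriv\<close> is the
  derivative read off on the polynomial.\<close>

definition gauss_poly :: "real poly \<Rightarrow> real \<Rightarrow> complex" where
  "gauss_poly p x = complex_of_real (poly p x * exp (- x\<^sup>2 / 2))"

definition gauss_deriv :: "real poly \<Rightarrow> real poly" where
  "gauss_deriv p = pderiv p - [:0, 1:] * p"

lemma gauss_poly_mult: "gauss_poly p x * gauss_poly q x = complex_of_real (poly (p * q) x * exp (- x\<^sup>2))"
  by (simp add: gauss_poly_def flip: exp_add of_real_mult)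

lemma gauss_poly_continuous: "continuous_on UNIV (gauss_poly p)"
  unfolding gauss_poly_def by (intro continuous_intros) auto

lemma gauss_poly_cnj[simp]: "cnj (gauss_poly p x) = gauss_poly p x"
  by (simp add: gauss_poly_def)

lemma gauss_poly_Lp2: "gauss_poly p \<in> Lp 2"
proof (rule Lp2_bound)
  show "gauss_poly p \<in> borel_measurable lebesgue"
    by (rule locally_integrable_borel_measurable[OF continuous_locally_integrable[OF gauss_poly_continuous]])
  show "integrable lebesgue (\<lambda>x. poly (p * p) x * exp (- x\<^sup>2 / 2))" by (rule integrable_poly_gauss)
  show "AE x in lebesgue. (norm (gauss_poly p x))\<^sup>2 \<le> poly (p * p) x * exp (- x\<^sup>2 / 2)"
  proof (intro AE_I2)
    fix x :: real
    have "exp (- x\<^sup>2 / 2) * exp (- x\<^sup>2 / 2) \<le> 1 * exp (- x\<^sup>2 / 2)" by (intro mult_right_mono) auto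
    then have "(poly p x * poly p x) * (exp (- x\<^sup>2 / 2) * exp (- x\<^sup>2 / 2)) \<le> (poly p x * poly p x) * exp (- x\<^sup>2 / 2)"
      by (intro mult_left_mono) auto
    then show "(norm (gauss_poly p x))\<^sup>2 \<le> poly (p * p) x * exp (- x\<^sup>2 / 2)"
      by (simp only: gauss_poly_def norm_of_real power2_abs) (simp add: power2_eq_square mult_ac)
  qed
qed

lemma gauss_poly_DERIV: "((\<lambda>x. poly p x * exp (- x\<^sup>2 / 2)) has_real_derivative poly (gauss_deriv p) x * exp (- x\<^sup>2 / 2)) (at x)"
  by (auto intro!: derivative_eq_intros poly_DERIV simp: gauss_deriv_def algebra_simps)

lemma gauss_poly_antideriv: "antideriv (gauss_poly p) (gauss_poly (gauss_deriv p))"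
  unfolding gauss_poly_def[abs_def]
  by (rule antideriv_C1[OF has_vector_derivative_of_real[OF gauss_poly_DERIV]])
    (use gauss_poly_continuous in \<open>simp add: gauss_poly_def[abs_def]\<close>)

lemma gauss_poly_sobolev_rep:
  "sobolev_rep (gauss_poly p) (gauss_poly (gauss_deriv p)) (gauss_poly (gauss_deriv (gauss_deriv p)))"
  by (simp add: sobolev_rep_def gauss_poly_antideriv gauss_poly_Lp2)

lemma gauss_poly_bounded: "bounded (range (gauss_poly p))"
  by (rule antideriv_Lp2_bounded[OF gauss_poly_antideriv gauss_poly_Lp2 gauss_poly_Lp2])

definition gauss_integral :: "real poly \<Rightarrow> real" where
  "gauss_integral p = (LINT x|lebesgue. poly p x * exp (- x\<^sup>2))"

lemma L2_inner_gauss_poly: "L2_inner (gauss_poly p) (gauss_poly q) = complex_of_real (gauss_integral (p * q))"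
  by (simp add: L2_inner_def gauss_integral_def gauss_poly_mult del: of_real_mult)

lemma integrable_gauss:
  fixes p :: "real poly"
  shows "integrable lebesgue (\<lambda>x. poly p x * exp (- x\<^sup>2))"
  using integrable_Re[OF Lp2_mult_integrable[OF gauss_poly_Lp2[of p] gauss_poly_Lp2[of 1]]]
  by (simp add: gauss_poly_mult del: of_real_mult)

lemma gauss_integral_diff: "gauss_integral (p - q) = gauss_integral p - gauss_integral q"
  by (simp add: gauss_integral_def left_diff_distrib integrable_gauss)

lemma gauss_integral_smult: "gauss_integral (Polynomial.smult c p) = c * gauss_integral p"
  by (simp add: gauss_integral_def mult.assoc)

text \<open>The integrand is the derivative of p(x) exp(-x^2), written as a product of two
  \<open>gauss_poly\<close> so that \<open>integral_antideriv_eq_0\<close> applies.\<close>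

lemma gauss_integral_deriv: "gauss_integral (pderiv p - [:0, 2:] * p) = 0"
proof -
  have "L2_inner (gauss_poly (gauss_deriv (gauss_deriv p))) (gauss_poly 1) = - L2_inner (gauss_poly (gauss_deriv p)) (gauss_poly (gauss_deriv 1))" for p
    by (rule sobolev_rep_inner_parts[OF gauss_poly_sobolev_rep gauss_poly_sobolev_rep])
  have A: "antideriv (\<lambda>x. gauss_poly p x * gauss_poly 1 x)
      (\<lambda>x. gauss_poly (gauss_deriv p) x * gauss_poly 1 x + gauss_poly p x * gauss_poly (gauss_deriv 1) x)"
    by (intro antideriv_mult gauss_poly_antideriv)
  have "(LINT x|lebesgue. gauss_poly (gauss_deriv p) x * gauss_poly 1 x + gauss_poly p x * gauss_poly (gauss_deriv 1) x) = 0"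
    by (rule integral_antideriv_eq_0[OF A]) (intro Bochner_Integration.integrable_add Lp2_mult_integrable gauss_poly_Lp2)+
  moreover have "gauss_poly (gauss_deriv p) x * gauss_poly 1 x + gauss_poly p x * gauss_poly (gauss_deriv 1) x =
     complex_of_real (poly (pderiv p - [:0, 2:] * p) x * exp (- x\<^sup>2))" for x
    unfolding gauss_poly_mult of_real_add[symmetric] by (simp add: gauss_deriv_def algebra_simps)
  ultimately show ?thesis by (simp add: gauss_integral_def del: of_real_mult)
qed

lemma gauss_integral_1: "gauss_integral 1 = sqrt pi"
proof -
  have "(LINT x|lborel. normal_density 0 (1 / sqrt 2) x) = 1" by simp
  moreover have "normal_density 0 (1 / sqrt 2) x = exp (- x\<^sup>2) / sqrt pi" for x
    by (simp add: normal_density_def power_divide)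
  ultimately have "(LINT x|lborel. exp (- x\<^sup>2)) = sqrt pi" by (simp add: field_simps)
  then show ?thesis by (simp add: gauss_integral_def integral_completion)
qed

text \<open>(-1)^j times the usual Hermite polynomial: without the sign the recursion is
  differentiation of exp(-x^2). The sign returns in \<open>hermite_scale\<close>.\<close>

primrec hermite_q :: "nat \<Rightarrow> real poly" where
  "hermite_q 0 = 1"
| "hermite_q (Suc j) = pderiv (hermite_q j) - [:0, 2:] * hermite_q j"

lemma pderiv_hermite_q: "pderiv (hermite_q (Suc j)) = Polynomial.smult (- 2 * (real j + 1)) (hermite_q j)"
proof (induction j)
  case 0 show ?case by (simp add: pderiv_pCons one_pCons)
next
  case (Suc j)
  have *: "pderiv (pderiv a - [:0, 2:] * a) = Polynomial.smult (c - 2) a"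
    if "pderiv a = Polynomial.smult c b" "a = pderiv b - [:0, 2:] * b" for a b :: "real poly" and c
  proof (rule poly_ext)
    fix x
    have "poly (pderiv b) x = poly a x + 2 * x * poly b x" by (subst that(2)) simp
    then show "poly (pderiv (pderiv a - [:0, 2:] * a)) x = poly (Polynomial.smult (c - 2) a) x"
      unfolding pderiv_diff pderiv_mult that(1) pderiv_smult by (simp add: pderiv_pCons algebra_simps)
  qed
  have "- 2 * (real j + 1) - 2 = - 2 * (real (Suc j) + 1)" by simp
  then show ?case
    unfolding hermite_q.simps(2)[of "Suc j"] using *[OF Suc hermite_q.simps(2)] by metis
qed

lemma hermite_q_three_term:
  "[:0, 1:] * hermite_q (Suc j) = Polynomial.smult (- 1 / 2) (hermite_q (Suc (Suc j))) - Polynomial.smult (real j + 1) (hermite_q j)"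
proof (rule poly_ext)
  fix x
  have "hermite_q (Suc (Suc j)) = Polynomial.smult (- 2 * (real j + 1)) (hermite_q j) - [:0, 2:] * hermite_q (Suc j)"
    unfolding hermite_q.simps(2)[of "Suc j"] pderiv_hermite_q ..
  from arg_cong[OF this, of "\<lambda>p. poly p x"]
  show "poly ([:0, 1:] * hermite_q (Suc j)) x =
      poly (Polynomial.smult (- 1 / 2) (hermite_q (Suc (Suc j))) - Polynomial.smult (real j + 1) (hermite_q j)) x"
    by (simp add: field_simps del: hermite_q.simps)
qed

text \<open>The eigenvalue equation of the harmonic oscillator: the j-th Hermite function satisfies
  h'' = (x^2 - (2 j + 1)) h.\<close>

lemma hermite_q_ode: "gauss_deriv (gauss_deriv (hermite_q j)) = ([:0, 0, 1:] - [:2 * real j + 1:]) * hermite_q j"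
proof (rule poly_ext)
  fix x
  have 1: "gauss_deriv (hermite_q j) = hermite_q (Suc j) + [:0, 1:] * hermite_q j"
    by (rule poly_ext) (simp add: gauss_deriv_def algebra_simps)
  have 2: "poly (pderiv (hermite_q j)) x = poly (hermite_q (Suc j)) x + 2 * x * poly (hermite_q j) x" by simp
  show "poly (gauss_deriv (gauss_deriv (hermite_q j))) x = poly (([:0, 0, 1:] - [:2 * real j + 1:]) * hermite_q j) x"
    unfolding 1 unfolding gauss_deriv_def pderiv_add pderiv_mult pderiv_hermite_q
    by (simp add: 2 pderiv_pCons algebra_simps del: hermite_q.simps)
qed

lemma gauss_integral_hermite_q_Suc:
  "gauss_integral (hermite_q (Suc j) * r) = - gauss_integral (hermite_q j * pderiv r)"
proof -
  have "hermite_q (Suc j) * r = (pderiv (hermite_q j * r) - [:0, 2:] * (hermite_q j * r)) - hermite_q j * pderiv r"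
    by (simp add: pderiv_mult algebra_simps)
  then show ?thesis using gauss_integral_deriv[of "hermite_q j * r"] by (simp add: gauss_integral_diff del: hermite_q.simps)
qed

text \<open>One integration by parts lowers both indices by one, since differentiating a Hermite
  polynomial gives a multiple of the previous one.\<close>

lemma gauss_integral_hermite_q:
  "gauss_integral (hermite_q j * hermite_q k) = (if j = k then 2 ^ j * fact j * sqrt pi else 0)"
proof (induction j arbitrary: k)
  case 0
  show ?case
  proof (cases k)
    case (Suc i)
    have "gauss_integral (hermite_q (Suc i) * 1) = - gauss_integral (hermite_q i * pderiv 1)"
      by (rule gauss_integral_hermite_q_Suc)
    then show ?thesis using Suc by (simp add: gauss_integral_def del: hermite_q.simps(2))
  qed (simp add: gauss_integral_1)
next
  case (Suc j)
  show ?case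
  proof (cases k)
    case 0
    have "gauss_integral (hermite_q (Suc j) * 1) = - gauss_integral (hermite_q j * pderiv 1)"
      by (rule gauss_integral_hermite_q_Suc)
    then show ?thesis using 0 by (simp add: gauss_integral_def del: hermite_q.simps(2))
  next
    case k: (Suc i)
    have "gauss_integral (hermite_q (Suc j) * hermite_q (Suc i)) = - gauss_integral (Polynomial.smult (- 2 * (real i + 1)) (hermite_q j * hermite_q i))"
      unfolding gauss_integral_hermite_q_Suc pderiv_hermite_q by (simp del: hermite_q.simps)
    then show ?thesis unfolding k gauss_integral_smult Suc.IH by (auto simp del: hermite_q.simps simp: algebra_simps)
  qed
qed

lemma deriv_pow_gauss: "(deriv ^^ j) (\<lambda>t. exp (- t\<^sup>2)) = (\<lambda>x. poly (hermite_q j) x * exp (- x\<^sup>2))"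
proof (induction j)
  case (Suc j)
  have "((\<lambda>x. poly (hermite_q j) x * exp (- x\<^sup>2)) has_real_derivative poly (hermite_q (Suc j)) x * exp (- x\<^sup>2)) (at x)" for x
    by (auto intro!: derivative_eq_intros poly_DERIV simp: algebra_simps)
  then show ?case unfolding funpow.simps o_def Suc by (intro ext DERIV_imp_deriv)
qed simp

definition hermite_scale :: "nat \<Rightarrow> real" where
  "hermite_scale j = (-1) ^ j / sqrt (2 ^ j * fact j * sqrt pi)"

lemma hermite_scale_neq_0: "hermite_scale j \<noteq> 0"
  by (simp add: hermite_scale_def)

lemma hermite_fun_eq: "hermite_fun j = gauss_poly (Polynomial.smult (hermite_scale j) (hermite_q j))"
proof
  fix x
  have "exp (x\<^sup>2) * (poly (hermite_q j) x * exp (- x\<^sup>2)) = poly (hermite_q j) x"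
    by (simp add: mult.left_commute[of "exp (x\<^sup>2)"] flip: exp_add)
  then have "hermite_poly j x = (-1) ^ j * poly (hermite_q j) x"
    unfolding hermite_poly_def deriv_pow_gauss by (simp add: mult.assoc)
  then show "hermite_fun j x = gauss_poly (Polynomial.smult (hermite_scale j) (hermite_q j)) x"
    by (simp add: hermite_fun_def gauss_poly_def hermite_scale_def)
qed

lemma hermite_fun_Lp2: "hermite_fun j \<in> Lp 2"
  unfolding hermite_fun_eq by (rule gauss_poly_Lp2)

lemma hermite_fun_continuous: "continuous_on UNIV (hermite_fun j)"
  unfolding hermite_fun_eq by (rule gauss_poly_continuous)

lemma hermite_fun_orthonormal: "L2_inner (hermite_fun j) (hermite_fun k) = (if j = k then 1 else 0)"
proof -
  have "hermite_scale j * hermite_scale j * (2 ^ j * fact j * sqrt pi) = 1"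
  proof -
    have "hermite_scale j * hermite_scale j = ((-1) ^ j * (-1) ^ j) / (2 ^ j * fact j * sqrt pi)"
      by (simp add: hermite_scale_def)
    then show ?thesis by (simp flip: power_mult_distrib)
  qed
  then show ?thesis
    by (auto simp: hermite_fun_eq L2_inner_gauss_poly gauss_integral_smult gauss_integral_hermite_q mult.assoc
       simp flip: of_real_mult)
qed

lemma gauss_deriv_smult: "gauss_deriv (Polynomial.smult c p) = Polynomial.smult c (gauss_deriv p)"
  by (simp add: gauss_deriv_def pderiv_smult smult_diff_right)

section \<open>Completeness of the Hermite functions\<close>

lemma moments_zero:
  assumes f: "f \<in> Lp 2" and orth: "\<And>j. L2_inner f (hermite_fun j) = 0"
  shows "(LINT x|lebesgue. f x * gauss_poly (monom 1 k) x) = 0"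
proof -
  define S where "S p = (LINT x|lebesgue. f x * gauss_poly p x)" for p
  have i: "integrable lebesgue (\<lambda>x. f x * gauss_poly p x)" for p
    by (rule Lp2_mult_integrable[OF f gauss_poly_Lp2])
  have Sd: "S (p - q) = S p - S q" for p q
  proof -
    have "f x * gauss_poly (p - q) x = f x * gauss_poly p x - f x * gauss_poly q x" for x
      by (simp add: gauss_poly_def algebra_simps)
    then show ?thesis unfolding S_def by (simp add: i)
  qed
  have Ss: "S (Polynomial.smult c p) = complex_of_real c * S p" for c p
  proof -
    have "(\<lambda>x. f x * gauss_poly (Polynomial.smult c p) x) = (\<lambda>x. complex_of_real c * (f x * gauss_poly p x))"
      by (simp add: gauss_poly_def fun_eq_iff)
    then show ?thesis unfolding S_def by simp
  qed
  have S0: "S (hermite_q j) = 0" for j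
  proof -
    have "complex_of_real (hermite_scale j) * S (hermite_q j) = L2_inner f (hermite_fun j)"
      unfolding Ss[symmetric] by (simp add: S_def L2_inner_def hermite_fun_eq)
    then show ?thesis using orth hermite_scale_neq_0[of j] by simp
  qed
  \<comment> \<open>Stated for all j at once: multiplication by x shifts the index in both
    directions by the three-term relation.\<close>
  have "\<forall>j. S (monom 1 k * hermite_q j) = 0"
  proof (induction k)
    case 0 then show ?case using S0 by (simp add: monom_0 one_pCons[symmetric])
  next
    case (Suc k)
    have m: "monom 1 (Suc k) * p = monom 1 k * ([:0, 1:] * p)" for p :: "real poly"
      by (simp add: monom_Suc)
    show ?case
    proof
      fix j
      show "S (monom 1 (Suc k) * hermite_q j) = 0"
      proof (cases j)
        case 0
        have "[:0, 1:] * hermite_q 0 = Polynomial.smult (- 1 / 2) (hermite_q 1)" by (simp add: one_pCons)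
        then show ?thesis unfolding m 0 by (simp only: mult_smult_right Ss Suc[rule_format]) simp
      next
        case (Suc i)
        show ?thesis unfolding m Suc hermite_q_three_term
          using \<open>\<forall>j. S (monom 1 k * hermite_q j) = 0\<close>
          by (simp only: right_diff_distrib mult_smult_right Sd Ss) simp
      qed
    qed
  qed
  from spec[OF this, of 0] show ?thesis by (simp add: S_def)
qed

text \<open>Positive and negative part, divided by their common mass, are probability densities with
  equal characteristic functions, hence equal by Levy's uniqueness theorem.\<close>

lemma real_AE_zero_if_fourier_zero:
  fixes g :: "real \<Rightarrow> real"
  assumes g: "integrable lborel g" and F: "\<And>t. (LINT x|lborel. complex_of_real (g x) * iexp (t * x)) = 0"
  shows "AE x in lborel. g x = 0"
proof -
  have [measurable]: "g \<in> borel_measurable lborel" using g by simp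
  define p m where "p x = max 0 (g x)" and "m x = max 0 (- g x)" for x
  have pm[measurable]: "p \<in> borel_measurable borel" "m \<in> borel_measurable borel"
    using g by (auto simp: p_def[abs_def] m_def[abs_def])
  have ipm: "integrable lborel p" "integrable lborel m"
    using g by (auto simp: p_def[abs_def] m_def[abs_def])
  have gpm: "g x = p x - m x" and pm0: "p x \<ge> 0" "m x \<ge> 0" for x by (auto simp: p_def m_def)
  have Feq: "(LINT x|lborel. complex_of_real (p x) * iexp (t * x)) = (LINT x|lborel. complex_of_real (m x) * iexp (t * x))" for t
  proof -
    have i: "integrable lborel (\<lambda>x. complex_of_real (a x) * iexp (t * x))" if "integrable lborel a" for a
    proof (rule Bochner_Integration.integrable_bound)
      show "integrable lborel (\<lambda>x. complex_of_real (a x))" using that by simp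
      have [measurable]: "a \<in> borel_measurable borel" using that by simp
      show "(\<lambda>x. complex_of_real (a x) * iexp (t * x)) \<in> borel_measurable lborel" by measurable
    qed (simp add: norm_mult)
    have "(LINT x|lborel. complex_of_real (p x) * iexp (t * x) - complex_of_real (m x) * iexp (t * x)) = 0"
      using F[of t] by (simp add: gpm left_diff_distrib)
    then show ?thesis using i[OF ipm(1)] i[OF ipm(2)] by simp
  qed
  \<comment> \<open>The common mass of both parts, by the case t = 0 of \<open>Feq\<close>. If it is
    0, both parts vanish and there is nothing to normalise.\<close>
  define c where "c = (LINT x|lborel. p x)"
  have cm: "c = (LINT x|lborel. m x)"
    using Feq[of 0] unfolding c_def by (simp add: integral_complex_of_real)
  show ?thesis
  proof (cases "c = 0")
    case True
    then have "AE x in lborel. p x = 0" "AE x in lborel. m x = 0"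
      using cm c_def integral_nonneg_eq_0_iff_AE[OF ipm(1)] integral_nonneg_eq_0_iff_AE[OF ipm(2)] pm0 by auto
    then show ?thesis by eventually_elim (simp add: gpm)
  next
    case False
    moreover have "c \<ge> 0" unfolding c_def by (intro integral_nonneg_AE) (simp add: pm0)
    ultimately have c: "c > 0" by simp
    have rd: "real_distribution (density lborel (\<lambda>x. ennreal (a x / c)))"
      if "integrable lborel a" "\<And>x. a x \<ge> 0" "(LINT x|lborel. a x) = c" for a
    proof -
      have [measurable]: "a \<in> borel_measurable borel" using that(1) by simp
      have "(\<integral>\<^sup>+x. ennreal (a x / c) \<partial>lborel) = ennreal (LINT x|lborel. a x / c)"
        using that c by (intro nn_integral_eq_integral) auto
      also have "\<dots> = 1" using that c by simp
      finally have "prob_space (density lborel (\<lambda>x. ennreal (a x / c)))"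
        by (intro prob_spaceI) (simp add: emeasure_density)
      then show ?thesis by (simp add: real_distribution_def real_distribution_axioms_def)
    qed
    have ch: "char (density lborel (\<lambda>x. ennreal (a x / c))) t = (LINT x|lborel. complex_of_real (a x) * iexp (t * x)) / c"
      if "integrable lborel a" "\<And>x. a x \<ge> 0" for a t
    proof -
      have [measurable]: "a \<in> borel_measurable borel" using that(1) by simp
      have "char (density lborel (\<lambda>x. ennreal (a x / c))) t = (LINT x|lborel. (a x / c) *\<^sub>R iexp (t * x))"
        unfolding char_def using that c by (subst integral_density) auto
      also have "\<dots> = (LINT x|lborel. (complex_of_real (a x) * iexp (t * x)) / c)"
        by (simp add: scaleR_conv_of_real)
      finally show ?thesis by simp
    qed
    have "density lborel (\<lambda>x. ennreal (p x / c)) = density lborel (\<lambda>x. ennreal (m x / c))"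
      using rd ch ipm pm0 c_def cm Feq by (intro Levy_uniqueness) (auto simp: fun_eq_iff)
    then have "AE x in lborel. ennreal (p x / c) = ennreal (m x / c)"
      by (subst (asm) sigma_finite_measure.density_unique_iff[OF sigma_finite_lborel]) auto
    then show ?thesis
    proof eventually_elim
      case (elim x)
      then show ?case using pm0[of x] c by (simp add: gpm ennreal_inj)
    qed
  qed
qed

text \<open>Exponential moments dominate the partial sums of the exponential series, so the Fourier
  transform is a limit of combinations of moments. Without them a function need not be determined by
  its moments.\<close>

lemma real_AE_zero_if_moments_zero:
  fixes g :: "real \<Rightarrow> real"
  assumes g: "\<And>t. integrable lborel (\<lambda>x. \<bar>g x\<bar> * exp \<bar>t * x\<bar>)" and gm: "g \<in> borel_measurable lborel"
    and m: "\<And>k. (LINT x|lborel. g x * x ^ k) = 0"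
  shows "AE x in lborel. g x = 0"
proof (rule real_AE_zero_if_fourier_zero)
  have [measurable]: "g \<in> borel_measurable borel" using gm by simp
  show "integrable lborel g"
    by (rule Bochner_Integration.integrable_bound[OF g[of 0]]) auto
  have im: "integrable lborel (\<lambda>x. g x * x ^ k)" for k
  proof (rule Bochner_Integration.integrable_bound[OF integrable_mult_right[OF g[of 1], of "fact k"]])
    have "\<bar>x\<bar> ^ k \<le> fact k * exp \<bar>x\<bar>" for x :: real
    proof -
      have "(\<Sum>n\<in>{k}. \<bar>x\<bar> ^ n /\<^sub>R fact n) \<le> exp \<bar>x\<bar>"
        unfolding exp_def by (rule sum_le_suminf[OF summable_exp_generic]) auto
      then show ?thesis by (simp add: field_simps)
    qed
    then have "\<bar>g x\<bar> * \<bar>x\<bar> ^ k \<le> \<bar>g x\<bar> * (fact k * exp \<bar>x\<bar>)" for x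
      by (intro mult_left_mono) auto
    then show "AE x in lborel. norm (g x * x ^ k) \<le> norm (fact k * (\<bar>g x\<bar> * exp \<bar>1 * x\<bar>))"
      by (intro AE_I2) (simp add: abs_mult power_abs mult.left_commute)
  qed auto
  fix t
  define s where "s n x = complex_of_real (g x) * (\<Sum>k<n. (\<i> * complex_of_real (t * x)) ^ k /\<^sub>R fact k)" for n x
  have s0: "(LINT x|lborel. s n x) = 0" for n
  proof -
    have "complex_of_real (g x) * ((\<i> * complex_of_real (t * x)) ^ k /\<^sub>R fact k) =
        ((\<i> * complex_of_real t) ^ k / fact k) * complex_of_real (g x * x ^ k)" for x k
    proof -
      have "(\<i> * complex_of_real (t * x)) ^ k = (\<i> * complex_of_real t) ^ k * complex_of_real (x ^ k)"
        unfolding of_real_power power_mult_distrib[symmetric] by (simp add: mult.assoc)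
      then show ?thesis by (simp add: scaleR_conv_of_real divide_inverse del: of_real_power)
    qed
    then have "s n x = (\<Sum>k<n. ((\<i> * complex_of_real t) ^ k / fact k) * complex_of_real (g x * x ^ k))" for x
      unfolding s_def sum_distrib_left by (intro sum.cong) auto
    then have "(LINT x|lborel. s n x) = (\<Sum>k<n. ((\<i> * complex_of_real t) ^ k / fact k) * (LINT x|lborel. complex_of_real (g x * x ^ k)))"
      using im by (simp add: Bochner_Integration.integral_sum del: of_real_mult)
    then show ?thesis by (simp only: integral_complex_of_real m) simp
  qed
  have "(\<lambda>n. LINT x|lborel. s n x) \<longlonglongrightarrow> (LINT x|lborel. complex_of_real (g x) * iexp (t * x))"
  proof (rule integral_dominated_convergence[where w = "\<lambda>x. \<bar>g x\<bar> * exp \<bar>t * x\<bar>"])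
    show "AE x in lborel. (\<lambda>n. s n x) \<longlonglongrightarrow> complex_of_real (g x) * iexp (t * x)"
    proof (intro AE_I2)
      fix x
      have "(\<lambda>n. \<Sum>k<n. (\<i> * complex_of_real (t * x)) ^ k /\<^sub>R fact k) \<longlonglongrightarrow> exp (\<i> * complex_of_real (t * x))"
        using exp_converges[of "\<i> * complex_of_real (t * x)"] by (simp add: sums_def)
      then show "(\<lambda>n. s n x) \<longlonglongrightarrow> complex_of_real (g x) * iexp (t * x)"
        unfolding s_def by (intro tendsto_mult tendsto_const) simp
    qed
    show "AE x in lborel. norm (s n x) \<le> \<bar>g x\<bar> * exp \<bar>t * x\<bar>" for n
    proof (intro AE_I2)
      fix x
      have "norm (\<Sum>k<n. (\<i> * complex_of_real (t * x)) ^ k /\<^sub>R fact k) \<le> (\<Sum>k<n. \<bar>t * x\<bar> ^ k /\<^sub>R fact k)"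
        by (rule order_trans[OF norm_sum]) (simp add: norm_power norm_mult abs_mult)
      also have "\<dots> \<le> exp \<bar>t * x\<bar>"
        unfolding exp_def by (rule sum_le_suminf[OF summable_exp_generic]) auto
      finally show "norm (s n x) \<le> \<bar>g x\<bar> * exp \<bar>t * x\<bar>" by (simp add: s_def norm_mult mult_left_mono)
    qed
    show "(\<lambda>x. complex_of_real (g x) * iexp (t * x)) \<in> borel_measurable lborel" by measurable
    show "\<And>n. s n \<in> borel_measurable lborel" unfolding s_def by measurable
  qed (use g in auto)
  then show "(LINT x|lborel. complex_of_real (g x) * iexp (t * x)) = 0"
    unfolding s0 LIMSEQ_const_iff by simp
qed

text \<open>f(x) exp(-x^2/2) has all exponential moments by Cauchy-Schwarz, and orthogonality to the
  Hermite functions makes its moments vanish. Real and imaginary part are treated separately because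
  the moment lemma is real.\<close>

lemma hermite_complete:
  assumes f: "f \<in> Lp 2" and orth: "\<And>j. L2_inner f (hermite_fun j) = 0"
  shows "AE x in lebesgue. f x = 0"
proof -
  have key: "AE x in lebesgue. h x = 0"
    if h: "h \<in> borel_measurable lebesgue" and le: "\<And>x. \<bar>h x\<bar> \<le> norm (f x)"
      and mom: "\<And>k. (LINT x|lebesgue. h x * (x ^ k * exp (- x\<^sup>2 / 2))) = 0" for h :: "real \<Rightarrow> real"
  proof -
    \<comment> \<open>The probability measures behind the moment lemma live on Borel sets, so
      \<open>h\<close> is replaced by a Borel function.\<close>
    obtain h' where h': "h' \<in> borel_measurable lborel" "AE x in lborel. h x = h' x"
      using completion_ex_borel_measurable_real[OF h] by blast
    have [measurable]: "h' \<in> borel_measurable borel" using h' by simp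
    have ae: "AE x in lebesgue. h x = h' x" using h'(2) by (rule AE_completion)
    have "AE x in lborel. h' x * exp (- x\<^sup>2 / 2) = 0"
    proof (rule real_AE_zero_if_moments_zero)
      fix t
      have e: "(\<lambda>x. complex_of_real (exp (\<bar>t * x\<bar> - x\<^sup>2 / 2))) \<in> Lp 2"
      proof (rule Lp2_bound)
        have "integrable lebesgue (\<lambda>x. exp (2 * t\<^sup>2) * (poly 1 x * exp (- x\<^sup>2 / 2)))"
          by (intro integrable_mult_right integrable_poly_gauss)
        then show "integrable lebesgue (\<lambda>x. exp (2 * t\<^sup>2) * exp (- x\<^sup>2 / 2))" by simp
        show "(\<lambda>x. complex_of_real (exp (\<bar>t * x\<bar> - x\<^sup>2 / 2))) \<in> borel_measurable lebesgue"
          by (intro measurable_completion) measurable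
        show "AE x in lebesgue. (norm (complex_of_real (exp (\<bar>t * x\<bar> - x\<^sup>2 / 2))))\<^sup>2 \<le> exp (2 * t\<^sup>2) * exp (- x\<^sup>2 / 2)"
        proof (intro AE_I2)
          fix x :: real
          \<comment> \<open>Half of the Gaussian exponent absorbs |t x|; the other half keeps the
            square integrable.\<close>
          have "2 * (2 * \<bar>t\<bar>) * \<bar>x\<bar> \<le> (2 * \<bar>t\<bar>)\<^sup>2 + \<bar>x\<bar>\<^sup>2" by (rule sum_squares_bound)
          then have "2 * (\<bar>t * x\<bar> - x\<^sup>2 / 2) \<le> 2 * t\<^sup>2 + - x\<^sup>2 / 2"
            by (simp add: abs_mult power_mult_distrib)
          then have "exp (2 * (\<bar>t * x\<bar> - x\<^sup>2 / 2)) \<le> exp (2 * t\<^sup>2 + - x\<^sup>2 / 2)" by simp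
          then show "(norm (complex_of_real (exp (\<bar>t * x\<bar> - x\<^sup>2 / 2))))\<^sup>2 \<le> exp (2 * t\<^sup>2) * exp (- x\<^sup>2 / 2)"
            by (simp add: exp_add[symmetric] exp_double[symmetric] del: of_real_exp)
        qed
      qed
      have "integrable lebesgue (\<lambda>x. norm (f x * complex_of_real (exp (\<bar>t * x\<bar> - x\<^sup>2 / 2))))"
        by (intro integrable_norm Lp2_mult_integrable f e)
      then have "integrable lebesgue (\<lambda>x. \<bar>h' x * exp (- x\<^sup>2 / 2)\<bar> * exp \<bar>t * x\<bar>)"
      proof (rule Bochner_Integration.integrable_bound)
        show "(\<lambda>x. \<bar>h' x * exp (- x\<^sup>2 / 2)\<bar> * exp \<bar>t * x\<bar>) \<in> borel_measurable lebesgue"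
          by (intro measurable_completion) measurable
        show "AE x in lebesgue. norm (\<bar>h' x * exp (- x\<^sup>2 / 2)\<bar> * exp \<bar>t * x\<bar>)
            \<le> norm (norm (f x * complex_of_real (exp (\<bar>t * x\<bar> - x\<^sup>2 / 2))))"
          using ae
        proof eventually_elim
          case (elim x)
          have "\<bar>h' x * exp (- x\<^sup>2 / 2)\<bar> * exp \<bar>t * x\<bar> = \<bar>h' x\<bar> * exp (\<bar>t * x\<bar> - x\<^sup>2 / 2)"
            by (simp add: abs_mult mult.assoc flip: exp_add)
          also have "\<dots> \<le> norm (f x) * exp (\<bar>t * x\<bar> - x\<^sup>2 / 2)"
            using le[of x] elim by (intro mult_right_mono) auto
          finally show ?case by (simp add: norm_mult del: of_real_exp)
        qed
      qed
      then show "integrable lborel (\<lambda>x. \<bar>h' x * exp (- x\<^sup>2 / 2)\<bar> * exp \<bar>t * x\<bar>)"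
        by (subst (asm) integrable_completion) measurable
    next
      fix k
      have hm: "(\<lambda>x. h' x * (x ^ k * exp (- x\<^sup>2 / 2))) \<in> borel_measurable lborel" by measurable
      have "(LINT x|lborel. h' x * exp (- x\<^sup>2 / 2) * x ^ k) = (LINT x|lborel. h' x * (x ^ k * exp (- x\<^sup>2 / 2)))"
        by (simp add: mult_ac)
      also have "\<dots> = (LINT x|lebesgue. h' x * (x ^ k * exp (- x\<^sup>2 / 2)))"
        by (rule integral_completion[OF hm, symmetric])
      also have "\<dots> = (LINT x|lebesgue. h x * (x ^ k * exp (- x\<^sup>2 / 2)))"
      proof (rule integral_cong_AE)
        show "(\<lambda>x. h' x * (x ^ k * exp (- x\<^sup>2 / 2))) \<in> borel_measurable lebesgue"
          by (rule measurable_completion[OF hm])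
        have "(\<lambda>x::real. x ^ k * exp (- x\<^sup>2 / 2)) \<in> borel_measurable lebesgue"
          by (intro measurable_completion) measurable
        then show "(\<lambda>x. h x * (x ^ k * exp (- x\<^sup>2 / 2))) \<in> borel_measurable lebesgue" by (rule borel_measurable_times[OF h])
        show "AE x in lebesgue. h' x * (x ^ k * exp (- x\<^sup>2 / 2)) = h x * (x ^ k * exp (- x\<^sup>2 / 2))"
          using ae by eventually_elim simp
      qed
      finally show "(LINT x|lborel. h' x * exp (- x\<^sup>2 / 2) * x ^ k) = 0" using mom by simp
    qed measurable
    then have "AE x in lebesgue. h' x * exp (- x\<^sup>2 / 2) = 0" by (rule AE_completion)
    then show ?thesis using ae by eventually_elim simp
  qed
  have M: "(LINT x|lebesgue. f x * complex_of_real (x ^ k * exp (- x\<^sup>2 / 2))) = 0" for k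
    using moments_zero[OF f orth, of k] by (simp add: gauss_poly_def poly_monom)
  have Mi: "integrable lebesgue (\<lambda>x. f x * complex_of_real (x ^ k * exp (- x\<^sup>2 / 2)))" for k
    using Lp2_mult_integrable[OF f gauss_poly_Lp2[of "monom 1 k"]] by (simp add: gauss_poly_def poly_monom)
  have fm: "f \<in> borel_measurable lebesgue" using f by blast
  have "AE x in lebesgue. Re (f x) = 0"
  proof (rule key)
    show "(LINT x|lebesgue. Re (f x) * (x ^ k * exp (- x\<^sup>2 / 2))) = 0" for k
      using integral_Re[OF Mi[of k]] M[of k] by (simp del: of_real_mult of_real_power of_real_exp)
  qed (use fm in \<open>auto simp: abs_Re_le_cmod\<close>)
  moreover have "AE x in lebesgue. Im (f x) = 0"
  proof (rule key)
    show "(LINT x|lebesgue. Im (f x) * (x ^ k * exp (- x\<^sup>2 / 2))) = 0" for k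
      using integral_Im[OF Mi[of k]] M[of k] by (simp del: of_real_mult of_real_power of_real_exp)
  qed (use fm in \<open>auto simp: abs_Im_le_cmod\<close>)
  ultimately show ?thesis by eventually_elim (simp add: complex_eq_iff)
qed

section \<open>The Schroedinger operator\<close>

text \<open>Gronwall's argument: E satisfies |E'| \<le> L E with L = 1 + K, so E exp(-L x) decreases
  and E exp(L x) increases. One is used on each side of \<open>x0\<close>.\<close>

lemma ode_unique:
  assumes u: "antideriv u u1" "antideriv u1 (\<lambda>x. q x * u x)" and q: "continuous_on UNIV q" "bounded (range q)"
    and z: "u x0 = 0" "u1 x0 = 0"
  shows "u x = 0"
proof -
  have uc: "continuous_on UNIV u" "continuous_on UNIV u1" using u by (auto intro: antideriv_continuous)
  have Du: "(u has_vector_derivative u1 x) (at x)" for x by (rule antideriv_derivative[OF u(1) uc(2)])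
  have Du1: "(u1 has_vector_derivative q x * u x) (at x)" for x
    by (rule antideriv_derivative[OF u(2)]) (intro continuous_intros q uc)
  obtain K where K: "\<And>x. norm (q x) \<le> K" "K \<ge> 0"
    using q(2) by (metis bounded_iff norm_ge_zero order_trans rangeI)
  define E where "E x = (norm (u x))\<^sup>2 + (norm (u1 x))\<^sup>2" for x
  define E' where "E' x = 2 * (u x \<bullet> u1 x) + 2 * (u1 x \<bullet> (q x * u x))" for x
  have DE: "(E has_real_derivative E' x) (at x)" for x
    using Du[of x] Du1[of x] unfolding E_def[abs_def] E'_def power2_norm_eq_inner has_real_derivative_iff_has_vector_derivative has_vector_derivative_def
    by (auto intro!: derivative_eq_intros simp: inner_commute algebra_simps)
  define L where "L = 1 + K"
  have b: "\<bar>E' x\<bar> \<le> L * E x" for x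
  proof -
    have 1: "\<bar>u x \<bullet> u1 x\<bar> \<le> norm (u x) * norm (u1 x)" by (rule Cauchy_Schwarz_ineq2)
    have "\<bar>u1 x \<bullet> (q x * u x)\<bar> \<le> norm (u1 x) * norm (q x * u x)" by (rule Cauchy_Schwarz_ineq2)
    also have "\<dots> \<le> norm (u1 x) * (K * norm (u x))"
      unfolding norm_mult by (intro mult_left_mono mult_right_mono K) auto
    finally have 2: "\<bar>u1 x \<bullet> (q x * u x)\<bar> \<le> K * (norm (u x) * norm (u1 x))" by (simp add: mult_ac)
    have "\<bar>E' x\<bar> \<le> 2 * \<bar>u x \<bullet> u1 x\<bar> + 2 * \<bar>u1 x \<bullet> (q x * u x)\<bar>" unfolding E'_def by linarith
    also have "\<dots> \<le> 2 * (norm (u x) * norm (u1 x)) + 2 * (K * (norm (u x) * norm (u1 x)))" using 1 2 by linarith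
    also have "\<dots> = L * (2 * norm (u x) * norm (u1 x))" by (simp add: L_def algebra_simps)
    also have "\<dots> \<le> L * E x" unfolding E_def using K(2) by (intro mult_left_mono sum_squares_bound) (simp add: L_def)
    finally show ?thesis .
  qed
  have E0: "E x0 = 0" using z by (simp add: E_def)
  have "E x \<le> 0"
  proof (cases "x0 \<le> x")
    case True
    have "E x * exp (- L * x) \<le> E x0 * exp (- L * x0)"
    proof (rule DERIV_nonpos_imp_nonincreasing[OF True, where f = "\<lambda>x. E x * exp (- L * x)"])
      fix t assume "x0 \<le> t" "t \<le> x"
      have "((\<lambda>x. E x * exp (- L * x)) has_real_derivative (E' t - L * E t) * exp (- L * t)) (at t)"
        by (auto intro!: derivative_eq_intros DE simp: algebra_simps)
      moreover have "(E' t - L * E t) * exp (- L * t) \<le> 0" using b[of t] by (intro mult_nonpos_nonneg) auto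
      ultimately show "\<exists>y. ((\<lambda>x. E x * exp (- L * x)) has_real_derivative y) (at t) \<and> y \<le> 0" by blast
    qed
    then show ?thesis using E0 by (simp add: mult_le_0_iff not_le[symmetric])
  next
    case False
    have "E x * exp (L * x) \<le> E x0 * exp (L * x0)"
    proof (rule DERIV_nonneg_imp_nondecreasing[where f = "\<lambda>x. E x * exp (L * x)"])
      show "x \<le> x0" using False by simp
      fix t assume "x \<le> t" "t \<le> x0"
      have "((\<lambda>x. E x * exp (L * x)) has_real_derivative (E' t + L * E t) * exp (L * t)) (at t)"
        by (auto intro!: derivative_eq_intros DE simp: algebra_simps)
      moreover have "(E' t + L * E t) * exp (L * t) \<ge> 0" using b[of t] by (intro mult_nonneg_nonneg) auto
      ultimately show "\<exists>y. ((\<lambda>x. E x * exp (L * x)) has_real_derivative y) (at t) \<and> 0 \<le> y" by blast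
    qed
    then show ?thesis using E0 by (simp add: mult_le_0_iff not_le[symmetric])
  qed
  moreover have "E x \<ge> (norm (u x))\<^sup>2" by (simp add: E_def)
  ultimately have "(norm (u x))\<^sup>2 \<le> 0" by linarith
  then show ?thesis by simp
qed

lemma integrable_const_lebesgue: "integrable (lebesgue :: real measure) (\<lambda>x. c :: complex) \<Longrightarrow> c = 0"
proof (rule ccontr)
  assume "integrable (lebesgue :: real measure) (\<lambda>x. c)" "c \<noteq> 0"
  then have "ennreal (norm c) * emeasure (lebesgue :: real measure) UNIV < \<infinity>"
    by (simp add: integrable_iff_bounded)
  then show False using \<open>c \<noteq> 0\<close> by (simp add: ennreal_mult_eq_top_iff less_top)
qed

text \<open>The Wronskian is constant, and as a combination of products of square integrable
  functions it is integrable on the line, hence 0. Then \<open>v\<close> and a multiple of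
  \<open>u\<close> have the same initial data at \<open>x0\<close>.\<close>

lemma ode_L2_solutions_proportional:
  assumes u: "antideriv u u1" "antideriv u1 (\<lambda>x. q x * u x)" "u \<in> Lp 2" "u1 \<in> Lp 2"
    and v: "antideriv v v1" "antideriv v1 (\<lambda>x. q x * v x)" "v \<in> Lp 2" "v1 \<in> Lp 2"
    and q: "continuous_on UNIV q" "bounded (range q)" and nz: "u x0 \<noteq> 0"
  shows "v = (\<lambda>x. v x0 / u x0 * u x)"
proof -
  have A: "antideriv (\<lambda>x. u x * v1 x - u1 x * v x) (\<lambda>x. 0)"
    using antideriv_diff[OF antideriv_mult[OF u(1) v(2)] antideriv_mult[OF u(2) v(1)]] by (simp add: algebra_simps)
  define c where "c = u x0 * v1 x0 - u1 x0 * v x0"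
  have "(\<lambda>x. u x * v1 x - u1 x * v x) = (\<lambda>x. c)"
    by (rule antideriv_eqI[OF A antideriv_const, of x0]) (simp add: c_def)
  moreover have "integrable lebesgue (\<lambda>x. u x * v1 x - u1 x * v x)"
    using u v by (intro Bochner_Integration.integrable_diff Lp2_mult_integrable)
  ultimately have "c = 0" using integrable_const_lebesgue by simp
  then have c: "u x0 * v1 x0 = u1 x0 * v x0" by (simp add: c_def)
  define k where "k = v x0 / u x0"
  have A1: "antideriv (\<lambda>x. v x - k * u x) (\<lambda>x. v1 x - k * u1 x)"
    by (intro antideriv_diff antideriv_cmult u v)
  have "antideriv (\<lambda>x. v1 x - k * u1 x) (\<lambda>x. q x * v x - k * (q x * u x))"
    by (intro antideriv_diff antideriv_cmult u v)
  then have A2: "antideriv (\<lambda>x. v1 x - k * u1 x) (\<lambda>x. q x * (v x - k * u x))" by (simp add: algebra_simps)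
  have *: "v x - k * u x = 0" for x
    by (rule ode_unique[OF A1 A2 q, of x0]) (use nz c in \<open>auto simp: k_def field_simps\<close>)
  show ?thesis
  proof
    fix x show "v x = v x0 / u x0 * u x" using *[of x] unfolding k_def right_minus_eq .
  qed
qed

lemma sobolev_rep_unique:
  assumes u: "sobolev_rep u u1 u2" and v: "sobolev_rep v v1 v2" and e: "cls u = cls v"
  shows "u = v" "u1 = v1" "AE x in lebesgue. u2 x = v2 x"
proof -
  have a: "antideriv u u1" "antideriv u1 u2" "antideriv v v1" "antideriv v1 v2" "u \<in> Lp 2" "v \<in> Lp 2"
    using u v by (auto simp: sobolev_rep_def)
  have c: "continuous_on UNIV u" "continuous_on UNIV v" "continuous_on UNIV u1" "continuous_on UNIV v1"
    using a antideriv_continuous by blast+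
  show uv: "u = v" using e a c by (intro continuous_AE_eq) (auto simp: cls_eq_iff)
  show uv1: "u1 = v1" using antideriv_unique_AE[OF a(1) a(3)[folded uv]] c by (intro continuous_AE_eq)
  show "AE x in lebesgue. u2 x = v2 x" by (rule antideriv_unique_AE[OF a(2) a(4)[folded uv1]])
qed

lemma sobolev_rep_norm_deriv:
  assumes "sobolev_rep u u1 u2" shows "(norm (cls u1))\<^sup>2 \<le> norm (cls u) * norm (cls u2)"
proof -
  have L: "u \<in> Lp 2" "u1 \<in> Lp 2" "u2 \<in> Lp 2" using assms by (auto simp: sobolev_rep_def)
  have "cinner (cls u2) (cls u) = - cinner (cls u1) (cls u1)"
    using sobolev_rep_inner_parts[OF assms assms] L by (simp add: cinner_cls)
  then have "norm (cinner (cls u2) (cls u)) = (norm (cls u1))\<^sup>2" by (simp add: cinner_self norm_power)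
  then show ?thesis using cinner_Cauchy_Schwarz[of "cls u2" "cls u"] by (simp add: mult.commute)
qed

locale schroedinger_op =
  fixes V :: "real \<Rightarrow> real" and U U1 U2 :: "real \<Rightarrow> complex"
  assumes potential: "potential_rep V U U1 U2"
begin

lemma U_AE: "AE x in lebesgue. complex_of_real (V x) = U x"
  and U_antideriv: "antideriv U U1" "antideriv U1 U2"
  and U_bounded: "bounded (range U)" "bounded (range U1)"
  using potential by (auto simp: potential_rep_def)

lemma U_continuous: "continuous_on UNIV U" "continuous_on UNIV U1"
  using U_antideriv antideriv_continuous by auto

lemma U_measurable: "U \<in> borel_measurable lebesgue" "U1 \<in> borel_measurable lebesgue"
  using U_continuous continuous_locally_integrable locally_integrable_borel_measurable by auto

lemma U_cnj: "cnj (U x) = U x"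
proof -
  have "(\<lambda>x. cnj (U x)) = U"
  proof (rule continuous_AE_eq)
    show "AE x in lebesgue. cnj (U x) = U x" using U_AE by eventually_elim (metis complex_cnj_complex_of_real)
  qed (intro continuous_intros U_continuous)+
  then show ?thesis by (rule fun_cong)
qed

lemma U_mult_Lp2: "f \<in> Lp 2 \<Longrightarrow> (\<lambda>x. U x * f x) \<in> Lp 2"
proof -
  assume "f \<in> Lp 2"
  moreover obtain K where "\<And>x. norm (U x) \<le> K" using U_bounded(1) by (auto simp: bounded_iff)
  ultimately show ?thesis using U_measurable by (intro Lp2_bounded_mult[where C = K]) auto
qed

definition U_bound :: real where "U_bound = (SUP x. norm (U x))"

lemma U_bound: "norm (U x) \<le> U_bound" "0 \<le> U_bound"
proof -
  have "bdd_above (range (\<lambda>x. norm (U x)))" using U_bounded(1) by (auto simp: bounded_iff bdd_above_def)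
  then show *: "norm (U x) \<le> U_bound" for x unfolding U_bound_def by (rule cSUP_upper[OF UNIV_I])
  show "0 \<le> U_bound" using norm_ge_zero *[of 0] by (rule order_trans)
qed

lemma norm_U_mult: "f \<in> Lp 2 \<Longrightarrow> norm (cls (\<lambda>x. U x * f x)) \<le> U_bound * norm (cls f)"
proof -
  assume f: "f \<in> Lp 2"
  have "(norm (cls (\<lambda>x. U x * f x)))\<^sup>2 \<le> (LINT x|lebesgue. U_bound\<^sup>2 * (norm (f x))\<^sup>2)"
    unfolding norm_cls_sq[OF U_mult_Lp2[OF f]]
    by (rule integral_mono[OF Lp2_integrable_square[OF U_mult_Lp2[OF f]]])
      (use f U_bound in \<open>auto simp: Lp2_integrable_square norm_mult power_mult_distrib intro!: mult_right_mono power_mono\<close>)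
  also have "\<dots> = (U_bound * norm (cls f))\<^sup>2" by (simp add: norm_cls_sq[OF f] power_mult_distrib)
  finally show ?thesis by (rule power2_le_imp_le) (simp add: U_bound)
qed

definition D :: "l2 set" where "D = {cls u | u u1 u2. sobolev_rep u u1 u2}"

text \<open>A choice over representatives; by \<open>sobolev_rep_unique\<close> the result does not
  depend on the one chosen, which is \<open>M_cls\<close>.\<close>

definition M :: "l2 \<Rightarrow> l2" where
  "M w = (SOME v. \<exists>u u1 u2. sobolev_rep u u1 u2 \<and> w = cls u \<and> v = cls (\<lambda>x. - u2 x + U x * u x))"

lemma M_Lp2: "sobolev_rep u u1 u2 \<Longrightarrow> (\<lambda>x. - u2 x + U x * u x) \<in> Lp 2"
  by (intro Lp2_add Lp2_minus U_mult_Lp2) (auto simp: sobolev_rep_def)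

lemma M_cls:
  assumes u: "sobolev_rep u u1 u2" shows "M (cls u) = cls (\<lambda>x. - u2 x + U x * u x)"
proof -
  have "\<exists>v. \<exists>u' u1 u2. sobolev_rep u' u1 u2 \<and> cls u = cls u' \<and> v = cls (\<lambda>x. - u2 x + U x * u' x)"
    using u by blast
  from someI_ex[OF this]
  obtain v v1 v2 where v: "sobolev_rep v v1 v2" "cls u = cls v" "M (cls u) = cls (\<lambda>x. - v2 x + U x * v x)"
    unfolding M_def by blast
  have "u = v" "AE x in lebesgue. u2 x = v2 x" using sobolev_rep_unique[OF u v(1,2)] by auto
  then have "AE x in lebesgue. - v2 x + U x * v x = - u2 x + U x * u x" by auto
  then show ?thesis unfolding v(3) by (rule cls_cong_AE[OF M_Lp2[OF v(1)]])
qed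

lemma D_I: "sobolev_rep u u1 u2 \<Longrightarrow> cls u \<in> D"
  by (auto simp: D_def)

lemma D_E:
  assumes "w \<in> D" obtains u u1 u2 where "sobolev_rep u u1 u2" "w = cls u" "M w = cls (\<lambda>x. - u2 x + U x * u x)"
  using assms M_cls by (auto simp: D_def)

lemma D_M_add:
  assumes "v \<in> D" "w \<in> D" shows "v + w \<in> D" "M (v + w) = M v + M w"
proof -
  obtain u u1 u2 where u: "sobolev_rep u u1 u2" "v = cls u" "M v = cls (\<lambda>x. - u2 x + U x * u x)" using assms(1) by (rule D_E)
  obtain t t1 t2 where t: "sobolev_rep t t1 t2" "w = cls t" "M w = cls (\<lambda>x. - t2 x + U x * t x)" using assms(2) by (rule D_E)
  note s = sobolev_rep_add[OF u(1) t(1)]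
  have e: "v + w = cls (\<lambda>x. u x + t x)" using u t by (simp add: cls_add sobolev_rep_def)
  show "v + w \<in> D" unfolding e by (rule D_I[OF s])
  have "M (v + w) = cls (\<lambda>x. (- u2 x + U x * u x) + (- t2 x + U x * t x))"
    unfolding e M_cls[OF s] by (simp add: algebra_simps)
  then show "M (v + w) = M v + M w" unfolding u(3) t(3) by (simp only: cls_add M_Lp2[OF u(1)] M_Lp2[OF t(1)])
qed

lemma D_M_cscale:
  assumes "v \<in> D" shows "cscale c v \<in> D" "M (cscale c v) = cscale c (M v)"
proof -
  obtain u u1 u2 where u: "sobolev_rep u u1 u2" "v = cls u" "M v = cls (\<lambda>x. - u2 x + U x * u x)" using assms(1) by (rule D_E)
  note s = sobolev_rep_cmult[OF u(1), of c]
  have e: "cscale c v = cls (\<lambda>x. c * u x)" using u by (simp add: cls_cmult sobolev_rep_def)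
  show "cscale c v \<in> D" unfolding e by (rule D_I[OF s])
  have "M (cscale c v) = cls (\<lambda>x. c * (- u2 x + U x * u x))"
    unfolding e M_cls[OF s] by (simp add: algebra_simps)
  then show "M (cscale c v) = cscale c (M v)" unfolding u(3) by (simp only: cls_cmult M_Lp2[OF u(1)])
qed

lemma D_M_minus: "v \<in> D \<Longrightarrow> - v \<in> D" "v \<in> D \<Longrightarrow> M (- v) = - M v"
  using D_M_cscale[of v "-1"] by (simp_all add: cscale_minus_left)

lemma D_M_diff: "v \<in> D \<Longrightarrow> w \<in> D \<Longrightarrow> v - w \<in> D" "v \<in> D \<Longrightarrow> w \<in> D \<Longrightarrow> M (v - w) = M v - M w"
  using D_M_add[of v "-w"] D_M_minus[of w] by simp_all

lemma D_M_zero: "0 \<in> D" "M 0 = 0"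
proof -
  have s: "sobolev_rep (\<lambda>x. 0) (\<lambda>x. 0) (\<lambda>x. 0)" by (simp add: sobolev_rep_def antideriv_const)
  show "0 \<in> D" "M 0 = 0" using D_I[OF s] M_cls[OF s] by (simp_all add: cls_zero)
qed

lemma D_M_sum:
  "(\<And>i. i \<in> I \<Longrightarrow> v i \<in> D) \<Longrightarrow> (\<Sum>i\<in>I. v i) \<in> D \<and> M (\<Sum>i\<in>I. v i) = (\<Sum>i\<in>I. M (v i))"
  by (induction I rule: infinite_finite_induct) (auto simp: D_M_zero D_M_add)

lemma M_symmetric:
  assumes "v \<in> D" "w \<in> D" shows "cinner (M v) w = cinner v (M w)"
proof -
  obtain u u1 u2 where u: "sobolev_rep u u1 u2" "v = cls u" "M v = cls (\<lambda>x. - u2 x + U x * u x)" using assms(1) by (rule D_E)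
  obtain t t1 t2 where t: "sobolev_rep t t1 t2" "w = cls t" "M w = cls (\<lambda>x. - t2 x + U x * t x)" using assms(2) by (rule D_E)
  have L: "u \<in> Lp 2" "t \<in> Lp 2" "u2 \<in> Lp 2" "t2 \<in> Lp 2" using u t by (auto simp: sobolev_rep_def)
  have "L2_inner (\<lambda>x. - u2 x + U x * u x) t = - L2_inner u2 t + L2_inner (\<lambda>x. U x * u x) t"
    using L2_inner_integrable[OF L(3,2)] L2_inner_integrable[OF U_mult_Lp2[OF L(1)] L(2)]
    by (simp add: L2_inner_def distrib_right left_diff_distrib)
  moreover have "L2_inner u (\<lambda>x. - t2 x + U x * t x) = - L2_inner u t2 + L2_inner u (\<lambda>x. U x * t x)"
    using L2_inner_integrable[OF L(1,4)] L2_inner_integrable[OF L(1) U_mult_Lp2[OF L(2)]]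
    by (simp add: L2_inner_def distrib_left right_diff_distrib del: complex_cnj_mult)
  moreover have "L2_inner (\<lambda>x. U x * u x) t = L2_inner u (\<lambda>x. U x * t x)"
    by (simp add: L2_inner_def U_cnj mult_ac)
  ultimately show ?thesis
    unfolding u(2) t(2) M_cls[OF u(1)] M_cls[OF t(1)] cinner_cls[OF M_Lp2[OF u(1)] L(2)] cinner_cls[OF L(1) M_Lp2[OF t(1)]]
    using sobolev_rep_symmetric[OF u(1) t(1)] by simp
qed

lemma Dom_M_l2:
  assumes f: "f \<in> Dom_M"
  shows "f \<in> Lp 2" "schroedinger V f \<in> Lp 2" "cls f \<in> D" "M (cls f) = cls (schroedinger V f)"
proof -
  obtain u u1 u2 where u: "sobolev_rep u u1 u2" "AE x in lebesgue. f x = u x" "AE x in lebesgue. weak_deriv 2 f x = u2 x"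
    using f by (rule Dom_M_E)
  have ae: "AE x in lebesgue. u x = f x" using u(2) by eventually_elim simp
  have uL: "u \<in> Lp 2" using u(1) by (simp add: sobolev_rep_def)
  have ae2: "AE x in lebesgue. - u2 x + U x * u x = schroedinger V f x"
    using u(2,3) U_AE by eventually_elim (simp add: schroedinger_def)
  show "f \<in> Lp 2" by (rule Lp2_AE_cong[OF uL ae])
  show "schroedinger V f \<in> Lp 2" by (rule Lp2_AE_cong[OF M_Lp2[OF u(1)] ae2])
  have c: "cls f = cls u" using cls_cong_AE[OF uL ae] by simp
  show "cls f \<in> D" unfolding c by (rule D_I[OF u(1)])
  show "M (cls f) = cls (schroedinger V f)" unfolding c M_cls[OF u(1)] by (rule cls_cong_AE[OF M_Lp2[OF u(1)] ae2])
qed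

lemma D_Dom_M: assumes "w \<in> D" obtains f where "f \<in> Dom_M" "w = cls f"
proof -
  obtain u u1 u2 where u: "sobolev_rep u u1 u2" "w = cls u" using assms by (rule D_E)
  have "u \<in> Dom_M" by (rule Dom_M_I(1)[OF u(1)]) simp
  then show ?thesis using that u(2) by blast
qed

lemma resolvent_l2:
  assumes z: "z \<in> resolvent_set Dom_M (schroedinger V)"
  shows "\<exists>C. \<forall>g. \<exists>w\<in>D. M w - cscale z w = g \<and> norm w \<le> C * norm g"
    and "w \<in> D \<Longrightarrow> M w - cscale z w = 0 \<Longrightarrow> w = 0"
proof -
  have eq: "M (cls f) - cscale z (cls f) = cls g \<longleftrightarrow> (AE x in lebesgue. schroedinger V f x - z * f x = g x)"
    if "f \<in> Dom_M" "g \<in> Lp 2" for f g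
    using Dom_M_l2[OF that(1)] that(2) by (simp add: cls_cmult[symmetric] cls_diff[symmetric] Lp2_cmult Lp2_diff cls_eq_iff)
  obtain C where C: "\<And>g. g \<in> Lp 2 \<Longrightarrow> \<exists>f\<in>Dom_M.
     (AE x in lebesgue. schroedinger V f x - z * f x = g x) \<and>
     (\<forall>f'\<in>Dom_M. (AE x in lebesgue. schroedinger V f' x - z * f' x = g x) \<longrightarrow> (AE x in lebesgue. f' x = f x)) \<and>
     L2_norm f \<le> C * L2_norm g"
    using z by (auto simp: resolvent_set_def)
  have "\<exists>w\<in>D. M w - cscale z w = g \<and> norm w \<le> C * norm g" for g
  proof -
    obtain g' where g': "g' \<in> Lp 2" "g = cls g'" by (rule cls_cases)
    obtain f where f: "f \<in> Dom_M" "AE x in lebesgue. schroedinger V f x - z * f x = g' x" "L2_norm f \<le> C * L2_norm g'"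
      using C[OF g'(1)] by blast
    show ?thesis
      using f Dom_M_l2[OF f(1)] eq[OF f(1) g'(1)] g' by (intro bexI[of _ "cls f"]) (auto simp: norm_cls)
  qed
  then show "\<exists>C. \<forall>g. \<exists>w\<in>D. M w - cscale z w = g \<and> norm w \<le> C * norm g" by blast
  assume w: "w \<in> D" "M w - cscale z w = 0"
  obtain f' where f': "f' \<in> Dom_M" "w = cls f'" using w(1) by (rule D_Dom_M)
  \<comment> \<open>For g = 0 the distinguished solution has norm at most C * 0, and uniqueness
    makes every other solution equal to it.\<close>
  have z0: "(\<lambda>x. 0::complex) \<in> Lp 2" by simp
  obtain f where f: "f \<in> Dom_M" "\<And>f'. f' \<in> Dom_M \<Longrightarrow> AE x in lebesgue. schroedinger V f' x - z * f' x = 0 \<Longrightarrow> AE x in lebesgue. f' x = f x"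
    "L2_norm f \<le> C * L2_norm (\<lambda>x. 0)"
    using C[OF z0] by blast
  have "norm (cls f) \<le> 0" using f(3) Dom_M_l2[OF f(1)] norm_cls[OF z0] by (simp add: norm_cls[symmetric] cls_zero)
  moreover have "AE x in lebesgue. f' x = f x"
    using f(2)[OF f'(1)] eq[OF f'(1) z0] w(2) f'(2) by (simp add: cls_zero)
  then have "cls f' = cls f" by (rule cls_cong_AE[OF Dom_M_l2(1)[OF f'(1)]])
  ultimately show "w = 0" using f'(2) by simp
qed

end

section \<open>Discrete eigenvalues\<close>

text \<open>Used to remove the damping of the weights: uniform norm bounds survive a pointwise limit
  by Fatou's lemma.\<close>

lemma Lp2_Fatou:
  fixes f :: "nat \<Rightarrow> real \<Rightarrow> complex"
  assumes f: "\<And>n. f n \<in> Lp 2" and b: "\<And>n. norm (cls (f n)) \<le> K" and l: "\<And>x. (\<lambda>n. f n x) \<longlonglongrightarrow> g x"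
  shows "g \<in> Lp 2"
proof -
  have fm[measurable]: "f n \<in> borel_measurable lebesgue" for n using f by blast
  have gm[measurable]: "g \<in> borel_measurable lebesgue"
    by (rule borel_measurable_LIMSEQ_metric[OF fm]) (rule l)
  have "(\<integral>\<^sup>+x. ennreal ((norm (g x))\<^sup>2) \<partial>lebesgue) = (\<integral>\<^sup>+x. liminf (\<lambda>n. ennreal ((norm (f n x))\<^sup>2)) \<partial>lebesgue)"
  proof (rule nn_integral_cong)
    fix x
    have "(\<lambda>n. ennreal ((norm (f n x))\<^sup>2)) \<longlonglongrightarrow> ennreal ((norm (g x))\<^sup>2)"
      by (intro tendsto_ennrealI tendsto_intros l)
    then show "ennreal ((norm (g x))\<^sup>2) = liminf (\<lambda>n. ennreal ((norm (f n x))\<^sup>2))"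
      by (rule lim_imp_Liminf[OF trivial_limit_sequentially, symmetric])
  qed
  also have "\<dots> \<le> liminf (\<lambda>n. \<integral>\<^sup>+x. ennreal ((norm (f n x))\<^sup>2) \<partial>lebesgue)"
    by (rule nn_integral_liminf) simp
  also have "\<dots> \<le> limsup (\<lambda>n. \<integral>\<^sup>+x. ennreal ((norm (f n x))\<^sup>2) \<partial>lebesgue)"
    by (rule Liminf_le_Limsup) simp
  also have "\<dots> \<le> ennreal (K\<^sup>2)"
  proof (rule Limsup_bounded, rule always_eventually, rule allI)
    fix n
    have "(\<integral>\<^sup>+x. ennreal ((norm (f n x))\<^sup>2) \<partial>lebesgue) = ennreal ((norm (cls (f n)))\<^sup>2)"
      using nn_integral_eq_integral[OF Lp2_integrable_square[OF f]] by (simp add: norm_cls_sq[OF f])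
    also have "\<dots> \<le> ennreal (K\<^sup>2)" by (intro ennreal_leI power_mono b) simp
    finally show "(\<integral>\<^sup>+x. ennreal ((norm (f n x))\<^sup>2) \<partial>lebesgue) \<le> ennreal (K\<^sup>2)" .
  qed
  finally have "(\<integral>\<^sup>+x. ennreal ((norm (g x))\<^sup>2) \<partial>lebesgue) < \<infinity>"
    by (simp add: le_less_trans[OF _ ennreal_less_top])
  then show ?thesis unfolding Lp2_iff by (intro conjI gm integrableI_bounded) simp_all
qed

lemma norm_cls_mono:
  assumes "f \<in> Lp 2" "g \<in> Lp 2" "\<And>x. norm (f x) \<le> norm (g x)"
  shows "norm (cls f) \<le> norm (cls g)"
proof -
  have "(norm (cls f))\<^sup>2 \<le> (norm (cls g))\<^sup>2"
    unfolding norm_cls_sq[OF assms(1)] norm_cls_sq[OF assms(2)]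
    by (rule integral_mono[OF Lp2_integrable_square[OF assms(1)] Lp2_integrable_square[OF assms(2)]])
      (intro power_mono assms(3) norm_ge_zero)
  then show ?thesis by (rule power2_le_imp_le) simp
qed

lemma L2_tail_small:
  assumes f: "f \<in> Lp 2" and e: "e > 0"
  obtains R where "R > 0" "norm (cls (\<lambda>x. indicator {x. \<bar>x\<bar> > R} x * f x)) \<le> e" "(\<lambda>x. indicator {x. \<bar>x\<bar> > R} x * f x) \<in> Lp 2"
proof -
  define h where "h n x = complex_of_real (indicat_real {x. \<bar>x\<bar> > real n} x) * f x" for n x
  have m: "(\<lambda>x. complex_of_real (indicat_real {x. \<bar>x\<bar> > real n} x)) \<in> borel_measurable lebesgue" for n
  proof (rule measurable_completion)
    have "{x::real. \<bar>x\<bar> > real n} \<in> sets borel" by measurable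
    then show "(\<lambda>x. complex_of_real (indicat_real {x. \<bar>x\<bar> > real n} x)) \<in> borel_measurable lborel" by simp
  qed
  have h: "h n \<in> Lp 2" for n
    unfolding h_def[abs_def] by (rule Lp2_bounded_mult[OF f m, of _ 1]) (auto split: split_indicator)
  have "(\<lambda>n. LINT x|lebesgue. (norm (h n x))\<^sup>2) \<longlonglongrightarrow> integral\<^sup>L lebesgue (\<lambda>x::real. 0 :: real)"
  proof (rule integral_dominated_convergence[where f = "\<lambda>x. 0" and s = "\<lambda>n x. (norm (h n x))\<^sup>2" and w = "\<lambda>x. (norm (f x))\<^sup>2"])
    show "AE x in lebesgue. (\<lambda>n. (norm (h n x))\<^sup>2) \<longlonglongrightarrow> 0"
    proof (intro AE_I2)
      fix x :: real
      obtain n0 where "\<bar>x\<bar> \<le> real n0" using real_arch_simple by blast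
      then show "(\<lambda>n. (norm (h n x))\<^sup>2) \<longlonglongrightarrow> 0"
        by (intro tendsto_eventually eventually_sequentiallyI[of n0]) (auto simp: h_def)
    qed
    show "\<And>n. AE x in lebesgue. norm ((norm (h n x))\<^sup>2) \<le> (norm (f x))\<^sup>2"
      by (intro AE_I2) (auto simp: h_def split: split_indicator)
    show "(\<lambda>x. (norm (h n x))\<^sup>2) \<in> borel_measurable lebesgue" for n
      using Lp2_integrable_square[OF h] by blast
  qed (use f in \<open>auto simp: Lp2_integrable_square\<close>)
  then have "\<forall>\<^sub>F n in sequentially. (LINT x|lebesgue. (norm (h n x))\<^sup>2) < e\<^sup>2"
    using e by (intro order_tendstoD(2)[where y = 0]) auto
  then have "\<forall>\<^sub>F n in sequentially. 0 < n \<and> (LINT x|lebesgue. (norm (h n x))\<^sup>2) < e\<^sup>2"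
    using eventually_gt_at_top[of 0] by eventually_elim simp
  from eventually_happens'[OF sequentially_bot this]
  obtain n where n: "n > 0" "(LINT x|lebesgue. (norm (h n x))\<^sup>2) < e\<^sup>2" by blast
  then have "(norm (cls (h n)))\<^sup>2 \<le> e\<^sup>2" by (simp add: norm_cls_sq[OF h])
  then have "norm (cls (h n)) \<le> e" by (rule power2_le_imp_le) (use e in simp)
  moreover have "(\<lambda>x. indicator {x. \<bar>x\<bar> > real n} x * f x) = h n" by (auto simp: h_def fun_eq_iff split: split_indicator)
  ultimately show ?thesis using that[of "real n"] n(1) h[of n] by simp
qed

text \<open>All that is used of a discrete eigenvalue from here on: a normalised eigenfunction,
  given with its derivative and its differential equation, and the gap on its orthogonal
  complement.\<close>

locale eigen_op = schroedinger_op +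
  fixes \<phi> \<phi>1 :: "real \<Rightarrow> complex" and lam \<delta> :: real
  assumes rep: "sobolev_rep \<phi> \<phi>1 (\<lambda>x. (U x - of_real lam) * \<phi> x)"
    and norm_1: "norm (cls \<phi>) = 1" and gap_pos: "\<delta> > 0"
    and spectral_gap: "w \<in> D \<Longrightarrow> cinner w (cls \<phi>) = 0 \<Longrightarrow> \<delta> * norm w \<le> norm (M w - cscale (of_real lam) w)"

context schroedinger_op begin

lemma eigenvector_rep:
  assumes w: "w \<in> D" "M w = cscale z w"
  obtains u u1 where "w = cls u" "sobolev_rep u u1 (\<lambda>x. (U x - z) * u x)"
proof -
  obtain u u1 u2 where u: "sobolev_rep u u1 u2" "w = cls u" using w(1) by (rule D_E)
  have uL: "u \<in> Lp 2" using u(1) by (simp add: sobolev_rep_def)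
  have "cls (\<lambda>x. - u2 x + U x * u x) = cls (\<lambda>x. z * u x)"
    using w(2) unfolding u(2) M_cls[OF u(1)] cls_cmult[OF uL] .
  then have "AE x in lebesgue. - u2 x + U x * u x = z * u x"
    by (subst (asm) cls_eq_iff[OF M_Lp2[OF u(1)] Lp2_cmult[OF uL]])
  then have ae: "AE x in lebesgue. u2 x = (U x - z) * u x"
    by eventually_elim (auto simp: algebra_simps)
  then have "sobolev_rep u u1 (\<lambda>x. (U x - z) * u x)"
    using u(1) antideriv_cong_AE[OF _ ae] Lp2_AE_cong[OF _ ae] by (auto simp: sobolev_rep_def)
  then show ?thesis using that u(2) by blast
qed

text \<open>Symmetry makes the eigenvalue real. The complement of the eigenvector is invariant under
  N and its resolvents, and N is injective on it because the eigenvalue is simple; so the abstract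
  gap applies there.\<close>

lemma disc_spectrum_eigen_op:
  assumes mu: "\<mu> \<in> disc_spectrum Dom_M (schroedinger V)"
  obtains \<phi> \<phi>1 lam \<delta> where "\<mu> = complex_of_real lam" "eigen_op V U U1 U2 \<phi> \<phi>1 lam \<delta>"
proof -
  obtain f where f: "f \<in> Dom_M" "AE x in lebesgue. schroedinger V f x = \<mu> * f x" "\<not> (AE x in lebesgue. f x = 0)"
    using mu by (auto simp: disc_spectrum_def is_eigenvalue_def eigenspace_def)
  note fl = Dom_M_l2[OF f(1)]
  have "M (cls f) = cls (\<lambda>x. \<mu> * f x)" unfolding fl(4) by (rule cls_cong_AE[OF fl(2) f(2)])
  then have Mf: "M (cls f) = cscale \<mu> (cls f)" by (simp add: cls_cmult[OF fl(1)])
  have f0: "cls f \<noteq> 0" using f(3) cls_eq_iff[OF fl(1), of "\<lambda>x. 0"] by (simp add: cls_zero)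
  define e where "e = cscale (of_real (1 / norm (cls f))) (cls f)"
  have e: "e \<in> D" "M e = cscale \<mu> e" "norm e = 1"
    using f0 D_M_cscale[OF fl(3)] Mf by (auto simp: e_def norm_cscale norm_divide mult.commute)
  obtain \<phi> \<phi>1 where \<phi>: "e = cls \<phi>" "sobolev_rep \<phi> \<phi>1 (\<lambda>x. (U x - \<mu>) * \<phi> x)"
    using eigenvector_rep[OF e(1,2)] .
  have "cinner (M e) e = cinner e (M e)" by (rule M_symmetric[OF e(1,1)])
  then have "\<mu> = cnj \<mu>" using e by (simp add: cinner_cscale_left cinner_cscale_right cinner_self)
  then obtain lam where lam: "\<mu> = complex_of_real lam" by (metis Reals_cnj_iff Reals_cases)
  have one_dim: "\<exists>c. w = cscale c e" if w: "w \<in> D" "M w = cscale \<mu> w" for w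
  proof -
    obtain v v1 where v: "w = cls v" "sobolev_rep v v1 (\<lambda>x. (U x - \<mu>) * v x)" using eigenvector_rep[OF w] .
    have "\<exists>x0. \<phi> x0 \<noteq> 0"
    proof (rule ccontr)
      assume "\<nexists>x0. \<phi> x0 \<noteq> 0"
      then have "\<phi> = (\<lambda>x. 0)" by auto
      then show False using e(3) \<phi>(1) by (simp add: cls_zero)
    qed
    then obtain x0 where x0: "\<phi> x0 \<noteq> 0" by blast
    have qc: "continuous_on UNIV (\<lambda>x. U x - \<mu>)" by (intro continuous_intros U_continuous)
    have qb: "bounded (range (\<lambda>x. U x - \<mu>))"
      using bounded_plus_comp[OF U_bounded(1), of "\<lambda>x. - \<mu>"] by simp
    have "v = (\<lambda>x. v x0 / \<phi> x0 * \<phi> x)"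
      by (rule ode_L2_solutions_proportional[where q = "\<lambda>x. U x - \<mu>" and u = \<phi> and v = v])
        (use \<phi>(2) v(2) qc qb x0 in \<open>auto simp: sobolev_rep_def\<close>)
    moreover have "\<phi> \<in> Lp 2" using \<phi>(2) by (simp add: sobolev_rep_def)
    ultimately have "cls v = cscale (v x0 / \<phi> x0) e" unfolding \<phi>(1) by (metis cls_cmult)
    then show ?thesis using v(1) by blast
  qed
  have "\<mu> isolated_in spectrum Dom_M (schroedinger V)" using mu by (simp add: disc_spectrum_def)
  then obtain T where T: "open T" "T \<inter> spectrum Dom_M (schroedinger V) = {\<mu>}" by (auto simp: isolated_in_def)
  then obtain r where r: "r > 0" "ball \<mu> r \<subseteq> T" using open_contains_ball by blast
  have res: "\<mu> + of_real h \<in> resolvent_set Dom_M (schroedinger V)" if "h \<noteq> 0" "\<bar>h\<bar> < r" for h :: real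
  proof -
    have "\<mu> + of_real h \<in> T" using r(2) that by (auto simp: dist_norm)
    show ?thesis
    proof (rule ccontr)
      assume "\<mu> + of_real h \<notin> resolvent_set Dom_M (schroedinger V)"
      then have "\<mu> + of_real h \<in> T \<inter> spectrum Dom_M (schroedinger V)"
        using \<open>\<mu> + of_real h \<in> T\<close> by (simp add: spectrum_def)
      then show False using T(2) that(1) by simp
    qed
  qed
  \<comment> \<open>Orthogonality is complex although the abstract setting is real: this removes all
    complex multiples of e, hence the whole kernel of N.\<close>
  define W where "W = {w. cinner w e = 0}"
  define N where "N w = M w - cscale \<mu> w" for w
  define R where "R h g = (SOME w. w \<in> D \<and> M w - cscale (\<mu> + of_real h) w = g)" for h :: real and g
  have NS: "N w - h *\<^sub>R w = M w - cscale (\<mu> + of_real h) w" for w h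
    by (simp add: N_def cscale_add_left cscale_of_real)
  have Rs: "R h g \<in> D" "N (R h g) - h *\<^sub>R R h g = g" if "h \<noteq> 0" "\<bar>h\<bar> < r" for h g
  proof -
    have "\<exists>w. w \<in> D \<and> M w - cscale (\<mu> + of_real h) w = g"
      using resolvent_l2(1)[OF res[OF that]] by blast
    from someI_ex[OF this] show "R h g \<in> D" "N (R h g) - h *\<^sub>R R h g = g" unfolding NS R_def by auto
  qed
  have inj: "v = w" if "h \<noteq> 0" "\<bar>h\<bar> < r" "v \<in> D" "w \<in> D" "N v - h *\<^sub>R v = N w - h *\<^sub>R w" for h v w
  proof -
    have "M (v - w) - cscale (\<mu> + of_real h) (v - w) = 0"
      using that(3-5) unfolding NS by (simp add: D_M_diff cscale_diff_right algebra_simps)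
    then have "v - w = 0" using resolvent_l2(2)[OF res[OF that(1,2)]] D_M_diff(1) that(3,4) by blast
    then show ?thesis by simp
  qed
  have NW: "cinner (N w) e = 0" if "w \<in> D" for w
    using M_symmetric[OF that e(1)] \<open>\<mu> = cnj \<mu>\<close>
    by (simp add: N_def cinner_diff_left e(2) cinner_cscale_left cinner_cscale_right)
  interpret G: punctured_resolvent W "D \<inter> W" N R r
  proof
    show "subspace W"
      unfolding subspace_def W_def scaleR_l2_def by (auto simp: cinner_add_left cinner_cscale_left)
    have "continuous_on UNIV (\<lambda>w. cinner w e)"
    proof (rule lipschitz_on_continuous_on[OF lipschitz_onI[where L = 1]])
      show "dist (cinner v e) (cinner w e) \<le> 1 * dist v w" for v w
        using cinner_Cauchy_Schwarz[of "v - w" e] e(3) by (simp add: cinner_diff_left dist_norm)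
    qed simp
    then show "closed W" unfolding W_def by (intro closed_Collect_eq continuous_intros)
    show "subspace (D \<inter> W)"
      using \<open>subspace W\<close> D_M_zero D_M_add D_M_cscale unfolding subspace_def scaleR_l2_def by auto
    show "D \<inter> W \<subseteq> W" by simp
    show "r > 0" by (rule r)
    show "N u \<in> W" if "u \<in> D \<inter> W" for u using NW that by (simp add: W_def)
    show "N (u + v) = N u + N v" if "u \<in> D \<inter> W" "v \<in> D \<inter> W" for u v
      using that by (simp add: N_def D_M_add cscale_add_right)
    show "N (c *\<^sub>R u) = c *\<^sub>R N u" if "u \<in> D \<inter> W" for u c
      using that unfolding scaleR_l2_def by (simp add: N_def D_M_cscale cscale_diff_right mult.commute)
    show "N u \<bullet> v = u \<bullet> N v" if "u \<in> D \<inter> W" "v \<in> D \<inter> W" for u v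
      using that M_symmetric[of u v] lam
      by (simp add: N_def Re_cinner[symmetric] cinner_diff_left cinner_diff_right cinner_cscale_left cinner_cscale_right)
    fix h :: real assume h: "h \<noteq> 0" "\<bar>h\<bar> < r"
    \<comment> \<open>Pairing (N - h) R h g = g with e: the term with N vanishes, since the range of
      N is orthogonal to e, and h is nonzero.\<close>
    show "R h g \<in> D \<inter> W" if g: "g \<in> W" for g
    proof -
      have "cinner (N (R h g) - h *\<^sub>R R h g) e = 0" using Rs[OF h] g by (simp add: W_def)
      then have "complex_of_real h * cinner (R h g) e = 0"
        using NW[OF Rs(1)[OF h]] by (simp add: cinner_diff_left scaleR_l2_def cinner_cscale_left)
      then show ?thesis using h Rs(1)[OF h] by (simp add: W_def)
    qed
    show "N (R h g) - h *\<^sub>R R h g = g" if "g \<in> W" for g using Rs[OF h] by simp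
    show "R h (N u - h *\<^sub>R u) = u" if "u \<in> D \<inter> W" for u
      using inj[OF h Rs(1)[OF h]] Rs(2)[OF h] that by blast
    show "\<exists>C. \<forall>g\<in>W. norm (R h g) \<le> C * norm g"
    proof -
      obtain C where C: "\<And>g. \<exists>w\<in>D. M w - cscale (\<mu> + of_real h) w = g \<and> norm w \<le> C * norm g"
        using resolvent_l2(1)[OF res[OF h]] by blast
      have "norm (R h g) \<le> C * norm g" for g
      proof -
        obtain w where w: "w \<in> D" "M w - cscale (\<mu> + of_real h) w = g" "norm w \<le> C * norm g" using C by blast
        have "R h g = w" using inj[OF h Rs(1)[OF h] w(1)] Rs(2)[OF h] w(2) NS by simp
        then show ?thesis using w(3) by simp
      qed
      then show ?thesis by blast
    qed
  next
    \<comment> \<open>A kernel element is a multiple of e by simplicity, and orthogonality to e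
      makes the factor 0.\<close>
    fix u assume u: "u \<in> D \<inter> W" "N u = 0"
    then obtain c where c: "u = cscale c e" using one_dim[of u] by (auto simp: N_def)
    then have "c = 0" using u(1) e(3) by (simp add: W_def cinner_cscale_left cinner_self)
    then show "u = 0" using c by simp
  qed
  have "eigen_op V U U1 U2 \<phi> \<phi>1 lam (r / 8)"
  proof
    show "sobolev_rep \<phi> \<phi>1 (\<lambda>x. (U x - of_real lam) * \<phi> x)" using \<phi>(2) lam by simp
    show "norm (cls \<phi>) = 1" using e(3) \<phi>(1) by simp
    show "r / 8 > 0" using r by simp
    show "r / 8 * norm w \<le> norm (M w - cscale (of_real lam) w)" if "w \<in> D" "cinner w (cls \<phi>) = 0" for w
      using G.gap[of w] that by (simp add: W_def \<phi>(1) N_def lam)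
  qed
  then show ?thesis using that lam by blast
qed

end

section \<open>Decay of eigenfunctions\<close>

lemma antideriv_of_real:
  assumes "\<And>x. (f has_real_derivative g x) (at x)" "continuous_on UNIV g"
  shows "antideriv (\<lambda>x. complex_of_real (f x)) (\<lambda>x. complex_of_real (g x))"
  by (rule antideriv_C1[OF has_vector_derivative_of_real[OF assms(1)]]) (intro continuous_intros assms(2))

text \<open>A bounded substitute for x that tends to x as s tends to 0, with its first two
  derivatives bounded independently of s.\<close>

definition damp :: "real \<Rightarrow> real \<Rightarrow> real" where "damp s x = x / (1 + s * x\<^sup>2)"
definition damp1 :: "real \<Rightarrow> real \<Rightarrow> real" where "damp1 s x = (1 - s * x\<^sup>2) / (1 + s * x\<^sup>2)\<^sup>2"
definition damp2 :: "real \<Rightarrow> real \<Rightarrow> real" where "damp2 s x = (2 * s\<^sup>2 * x ^ 3 - 6 * s * x) / (1 + s * x\<^sup>2) ^ 3"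

lemma damp_denominator: "s > 0 \<Longrightarrow> 1 + s * x\<^sup>2 \<ge> (1::real)"
  by simp

lemma damp_DERIV:
  assumes s: "s > 0"
  shows "(damp s has_real_derivative damp1 s x) (at x)" "(damp1 s has_real_derivative damp2 s x) (at x)"
proof -
  have n: "1 + s * x\<^sup>2 \<noteq> 0" using damp_denominator[OF s, of x] by linarith
  show "(damp s has_real_derivative damp1 s x) (at x)"
    unfolding damp_def[abs_def] damp1_def using n
    by (auto intro!: derivative_eq_intros simp: field_simps power2_eq_square)
  \<comment> \<open>In terms of q the square of x occurs only through s x^2 = q - 1, which leaves a
    rational identity in q.\<close>
  define q where "q = 1 + s * x\<^sup>2"
  have q: "q \<noteq> 0" "s * x\<^sup>2 = q - 1" using n by (auto simp: q_def)
  have "((\<lambda>x. (1 - s * x\<^sup>2) / (1 + s * x\<^sup>2)\<^sup>2) has_real_derivative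
      ((- (s * (2 * x))) * (1 + s * x\<^sup>2)\<^sup>2 - (1 - s * x\<^sup>2) * (2 * (1 + s * x\<^sup>2) * (s * (2 * x)))) / ((1 + s * x\<^sup>2)\<^sup>2 * (1 + s * x\<^sup>2)\<^sup>2)) (at x)"
    using n by (auto intro!: derivative_eq_intros)
  moreover have "((- (s * (2 * x))) * q\<^sup>2 - (1 - s * x\<^sup>2) * (2 * q * (s * (2 * x)))) / (q\<^sup>2 * q\<^sup>2)
     = (2 * s * x * (s * x\<^sup>2) - 6 * s * x) / q ^ 3"
    unfolding q(2) using q(1) by (simp add: divide_simps power2_eq_square power3_eq_cube power4_eq_xxxx) (simp add: algebra_simps)
  ultimately show "(damp1 s has_real_derivative damp2 s x) (at x)"
    unfolding damp1_def[abs_def] damp2_def q_def by (simp add: power2_eq_square power3_eq_cube mult_ac)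
qed

lemma damp_bounds:
  assumes s: "0 < s" "s \<le> 1"
  shows "\<bar>damp s x\<bar> \<le> \<bar>x\<bar>" "\<bar>damp s x\<bar> \<le> 1 / s" "\<bar>damp1 s x\<bar> \<le> 1" "\<bar>damp2 s x\<bar> \<le> 6"
proof -
  define q where "q = 1 + s * x\<^sup>2"
  have q: "q \<ge> 1" "s * x\<^sup>2 = q - 1" using damp_denominator[OF s(1), of x] by (auto simp: q_def)
  have sx: "s * \<bar>x\<bar> \<le> q"
  proof -
    have "2 * \<bar>x\<bar> \<le> 1 + x\<^sup>2" using sum_squares_bound[of "\<bar>x\<bar>" 1] by simp
    then have "\<bar>x\<bar> \<le> 1 + x\<^sup>2" using abs_ge_zero[of x] by linarith
    then have "s * \<bar>x\<bar> \<le> s * (1 + x\<^sup>2)" using s by (intro mult_left_mono) auto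
    also have "\<dots> \<le> q" using s by (simp add: q_def distrib_left)
    finally show ?thesis .
  qed
  have "\<bar>x\<bar> * 1 \<le> \<bar>x\<bar> * q" using q by (intro mult_left_mono) auto
  then show "\<bar>damp s x\<bar> \<le> \<bar>x\<bar>" using q by (simp add: damp_def q_def[symmetric] abs_divide divide_le_eq)
  show "\<bar>damp s x\<bar> \<le> 1 / s" using q sx s by (simp add: damp_def q_def[symmetric] abs_divide field_simps)
  have q2: "q \<le> q\<^sup>2" "q\<^sup>2 \<le> q ^ 3" "0 < q\<^sup>2" "0 < q ^ 3"
    using q power_increasing[of 1 2 q] power_increasing[of 2 3 q] by auto
  have "\<bar>1 - s * x\<^sup>2\<bar> \<le> q" unfolding q(2) using q(1) by (simp add: abs_le_iff)
  then show "\<bar>damp1 s x\<bar> \<le> 1" using q2 by (simp add: damp1_def q_def[symmetric] abs_divide divide_le_eq)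
  \<comment> \<open>The numerator factors as 2 s x (q - 4); s |x| \<le> q and |q - 4| \<le> 3 q then
    give the constant 6.\<close>
  have "2 * s\<^sup>2 * x ^ 3 - 6 * s * x = 2 * (s * x) * (q - 4)"
    unfolding q_def by (simp add: power2_eq_square power3_eq_cube algebra_simps)
  then have "\<bar>2 * s\<^sup>2 * x ^ 3 - 6 * s * x\<bar> = 2 * (s * \<bar>x\<bar>) * \<bar>q - 4\<bar>" using s by (simp add: abs_mult)
  also have "\<dots> \<le> 2 * q * (3 * q)" using sx q(1) s by (intro mult_mono) (auto simp: abs_le_iff)
  also have "\<dots> = 6 * q\<^sup>2" by (simp add: power2_eq_square)
  also have "\<dots> \<le> 6 * q ^ 3" using q2 by simp
  finally show "\<bar>damp2 s x\<bar> \<le> 6" using q2 by (simp add: damp2_def q_def[symmetric] abs_divide divide_le_eq)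
qed

definition wt :: "nat \<Rightarrow> real \<Rightarrow> real \<Rightarrow> real" where "wt k s x = damp s x ^ Suc k"
definition wt1 :: "nat \<Rightarrow> real \<Rightarrow> real \<Rightarrow> real" where "wt1 k s x = (real k + 1) * (damp s x ^ k * damp1 s x)"
text \<open>The second derivative of \<open>wt k s\<close> is split into \<open>wt2a\<close> and
  \<open>wt2b\<close>, which compare with the different powers k - 1 and k of x. For k = 0 the
  truncated exponent is harmless, as the factor \<open>real k\<close> vanishes.\<close>

definition wt2a :: "nat \<Rightarrow> real \<Rightarrow> real \<Rightarrow> real" where
  "wt2a k s x = (real k + 1) * real k * (damp s x ^ (k - 1) * (damp1 s x)\<^sup>2)"
definition wt2b :: "nat \<Rightarrow> real \<Rightarrow> real \<Rightarrow> real" where "wt2b k s x = (real k + 1) * (damp s x ^ k * damp2 s x)"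

lemma wt_DERIV:
  assumes s: "s > 0"
  shows "(wt k s has_real_derivative wt1 k s x) (at x)" "(wt1 k s has_real_derivative wt2a k s x + wt2b k s x) (at x)"
proof -
  show "(wt k s has_real_derivative wt1 k s x) (at x)"
    unfolding wt_def[abs_def] wt1_def
    by (auto intro!: derivative_eq_intros damp_DERIV[OF s] simp: algebra_simps simp del: power_Suc)
  show "(wt1 k s has_real_derivative wt2a k s x + wt2b k s x) (at x)"
  proof -
    have P: "((\<lambda>x. damp s x ^ k) has_real_derivative real k * (damp1 s x * damp s x ^ (k - Suc 0))) (at x)"
      by (rule DERIV_power[OF damp_DERIV(1)[OF s]])
    show ?thesis
      using DERIV_cmult[OF DERIV_mult[OF P damp_DERIV(2)[OF s]], of "real k + 1"]
      unfolding wt1_def[abs_def] wt2a_def wt2b_def by (simp add: algebra_simps power2_eq_square)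
  qed
qed

text \<open>Two families: bounds by powers of x, uniform in s, carry the estimates; bounds by
  constants depending on s only put the weighted functions in L^2.\<close>

lemma wt_bounds:
  assumes s: "0 < s" "s \<le> 1"
  shows "\<bar>wt k s x\<bar> \<le> \<bar>x ^ Suc k\<bar>" "\<bar>wt1 k s x\<bar> \<le> \<bar>(real k + 1) * x ^ k\<bar>"
    "\<bar>wt2a k s x\<bar> \<le> \<bar>(real k + 1) * real k * x ^ (k - 1)\<bar>" "\<bar>wt2b k s x\<bar> \<le> \<bar>6 * (real k + 1) * x ^ k\<bar>"
    "\<bar>wt k s x\<bar> \<le> (1 / s) ^ Suc k" "\<bar>wt1 k s x\<bar> \<le> (real k + 1) * (1 / s) ^ k"
    "\<bar>wt2a k s x + wt2b k s x\<bar> \<le> (real k + 1) * real k * (1 / s) ^ (k - 1) + 6 * (real k + 1) * (1 / s) ^ k"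
    "\<bar>wt2a k s x\<bar> \<le> (real k + 1) * real k * (1 / s) ^ (k - 1)" "\<bar>wt2b k s x\<bar> \<le> 6 * (real k + 1) * (1 / s) ^ k"
proof -
  note d = damp_bounds[OF s, of x]
  have p: "\<bar>damp s x\<bar> ^ j \<le> \<bar>x\<bar> ^ j" "\<bar>damp s x\<bar> ^ j \<le> (1 / s) ^ j" for j
    using d by (auto intro!: power_mono)
  have d1: "(damp1 s x)\<^sup>2 \<le> 1" using d(3) by (simp add: abs_square_le_1)
  have m: "\<bar>damp s x\<bar> ^ j * c \<le> \<bar>x\<bar> ^ j * K" "\<bar>damp s x\<bar> ^ j * c \<le> (1 / s) ^ j * K" if "0 \<le> c" "c \<le> K" for j c K
    using p[of j] that s by (auto intro!: mult_mono)
  show "\<bar>wt k s x\<bar> \<le> \<bar>x ^ Suc k\<bar>" "\<bar>wt k s x\<bar> \<le> (1 / s) ^ Suc k"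
    unfolding wt_def power_abs by (rule p)+
  show "\<bar>wt1 k s x\<bar> \<le> \<bar>(real k + 1) * x ^ k\<bar>" "\<bar>wt1 k s x\<bar> \<le> (real k + 1) * (1 / s) ^ k"
    using m[of "\<bar>damp1 s x\<bar>" 1 k] d(3) by (auto simp: wt1_def abs_mult power_abs intro!: mult_left_mono)
  show "\<bar>wt2a k s x\<bar> \<le> \<bar>(real k + 1) * real k * x ^ (k - 1)\<bar>"
    using m[of "(damp1 s x)\<^sup>2" 1 "k - 1"] d1 by (auto simp: wt2a_def abs_mult power_abs intro!: mult_left_mono)
  have e: "\<bar>wt2b k s x\<bar> = (real k + 1) * (\<bar>damp s x\<bar> ^ k * \<bar>damp2 s x\<bar>)"
    by (simp add: wt2b_def abs_mult power_abs)
  have "(real k + 1) * (\<bar>damp s x\<bar> ^ k * \<bar>damp2 s x\<bar>) \<le> (real k + 1) * (\<bar>x\<bar> ^ k * 6)"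
    using m(1)[of "\<bar>damp2 s x\<bar>" 6 k] d(4) by (intro mult_left_mono) auto
  moreover have "\<bar>6 * (real k + 1) * x ^ k\<bar> = (real k + 1) * (\<bar>x\<bar> ^ k * 6)"
    by (simp add: abs_mult power_abs)
  ultimately show "\<bar>wt2b k s x\<bar> \<le> \<bar>6 * (real k + 1) * x ^ k\<bar>" unfolding e by simp
  show A': "\<bar>wt2a k s x\<bar> \<le> (real k + 1) * real k * (1 / s) ^ (k - 1)"
    using m[of "(damp1 s x)\<^sup>2" 1 "k - 1"] d1 by (auto simp: wt2a_def abs_mult power_abs intro!: mult_left_mono)
  have "(real k + 1) * (\<bar>damp s x\<bar> ^ k * \<bar>damp2 s x\<bar>) \<le> (real k + 1) * ((1 / s) ^ k * 6)"
    using m(2)[of "\<bar>damp2 s x\<bar>" 6 k] d(4) by (intro mult_left_mono) auto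
  then show B': "\<bar>wt2b k s x\<bar> \<le> 6 * (real k + 1) * (1 / s) ^ k"
    unfolding e by (simp only: mult_ac)
  show "\<bar>wt2a k s x + wt2b k s x\<bar> \<le> (real k + 1) * real k * (1 / s) ^ (k - 1) + 6 * (real k + 1) * (1 / s) ^ k"
    using A' B' by linarith
qed

lemma wt_continuous:
  assumes s: "s > 0"
  shows "continuous_on UNIV (wt k s)" "continuous_on UNIV (wt1 k s)" "continuous_on UNIV (wt2a k s)" "continuous_on UNIV (wt2b k s)"
proof -
  have d: "continuous_on UNIV (damp s)" "continuous_on UNIV (damp1 s)"
    by (rule DERIV_continuous_on[OF has_field_derivative_at_within[OF damp_DERIV(1)[OF s]]],
        rule DERIV_continuous_on[OF has_field_derivative_at_within[OF damp_DERIV(2)[OF s]]])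
  have n: "1 + s * x\<^sup>2 \<noteq> 0" for x using damp_denominator[OF s, of x] by linarith
  have d2: "continuous_on UNIV (damp2 s)"
    unfolding damp2_def[abs_def] using n by (intro continuous_intros) auto
  show "continuous_on UNIV (wt k s)" "continuous_on UNIV (wt1 k s)" "continuous_on UNIV (wt2a k s)" "continuous_on UNIV (wt2b k s)"
    unfolding wt_def[abs_def] wt1_def[abs_def] wt2a_def[abs_def] wt2b_def[abs_def]
    by (intro continuous_intros d d2)+
qed

lemma norm_real_weight_mono:
  fixes z :: complex
  assumes "\<bar>a\<bar> \<le> \<bar>b * p\<bar>"
  shows "norm (complex_of_real a * z) \<le> norm (complex_of_real b * (complex_of_real p * z))"
  using mult_right_mono[OF assms norm_ge_zero[of z]] by (simp only: norm_mult norm_of_real abs_mult mult.assoc)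

lemma Lp2_real_weight:
  fixes f :: "real \<Rightarrow> complex" and w :: "real \<Rightarrow> real"
  assumes "f \<in> Lp 2" "continuous_on UNIV w" "\<And>x. \<bar>w x\<bar> \<le> K"
  shows "(\<lambda>x. complex_of_real (w x) * f x) \<in> Lp 2"
  by (rule Lp2_bounded_mult[OF assms(1), where C = K])
    (use assms in \<open>auto intro!: locally_integrable_borel_measurable continuous_locally_integrable continuous_intros\<close>)

section \<open>Power weights on the eigenfunction\<close>

context eigen_op begin

lemma rep_parts:
  "antideriv \<phi> \<phi>1" "antideriv \<phi>1 (\<lambda>x. (U x - of_real lam) * \<phi> x)" "\<phi> \<in> Lp 2" "\<phi>1 \<in> Lp 2"
  "(\<lambda>x. (U x - of_real lam) * \<phi> x) \<in> Lp 2"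
  using rep by (auto simp: sobolev_rep_def)

lemma eigenvector: "cls \<phi> \<in> D" "M (cls \<phi>) = cscale (of_real lam) (cls \<phi>)"
proof -
  show "cls \<phi> \<in> D" by (rule D_I[OF rep])
  have "M (cls \<phi>) = cls (\<lambda>x. of_real lam * \<phi> x)"
    unfolding M_cls[OF rep] by (simp add: algebra_simps)
  then show "M (cls \<phi>) = cscale (of_real lam) (cls \<phi>)" by (simp add: cls_cmult rep_parts)
qed

text \<open>M - lam annihilates the component of g along the eigenfunction, so the gap applied to
  the rest controls g up to that component.\<close>

lemma norm_orthogonal_bound:
  assumes g: "g \<in> D"
  shows "norm g \<le> norm (M g - cscale (of_real lam) g) / \<delta> + norm (cinner g (cls \<phi>))"
proof -
  define a where "a = cinner g (cls \<phi>)"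
  define w where "w = g - cscale a (cls \<phi>)"
  have w: "w \<in> D" "M w - cscale (of_real lam) w = M g - cscale (of_real lam) g"
    using g eigenvector by (simp_all add: w_def D_M_diff D_M_cscale cscale_diff_right mult.commute)
  have "cinner w (cls \<phi>) = 0" by (simp add: w_def cinner_diff_left cinner_cscale_left cinner_self norm_1 a_def)
  then have "\<delta> * norm w \<le> norm (M g - cscale (of_real lam) g)" using spectral_gap[OF w(1)] w(2) by simp
  then have "norm w \<le> norm (M g - cscale (of_real lam) g) / \<delta>" using gap_pos by (simp add: field_simps)
  moreover have "norm g \<le> norm w + norm a"
    using norm_triangle_ineq[of w "cscale a (cls \<phi>)"] by (simp add: w_def norm_cscale norm_1)
  ultimately show ?thesis by (simp add: a_def)
qed

text \<open>With \<open>w = (x / (1 + s x\<^sup>2))\<^sup>k\<^sup>+\<^sup>1\<close>, \<open>(M - \<lambda>)(w \<phi>) = - 2 w' \<phi>' - w'' \<phi>\<close> is bounded uniformly in \<open>s\<close> by the previous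
  step of the induction, so the spectral gap bounds \<open>w \<phi>\<close> up to its component along \<open>\<phi>\<close>, and that
  component is absorbed because \<open>\<phi>\<close> is small in norm outside a large interval.\<close>

lemma decay_step:
  assumes k: "(\<lambda>x. complex_of_real (x ^ k) * \<phi> x) \<in> Lp 2" "(\<lambda>x. complex_of_real (x ^ k) * \<phi>1 x) \<in> Lp 2"
    and k1: "(\<lambda>x. complex_of_real (x ^ (k - 1)) * \<phi> x) \<in> Lp 2"
  shows "(\<lambda>x. complex_of_real (x ^ Suc k) * \<phi> x) \<in> Lp 2" "(\<lambda>x. complex_of_real (x ^ Suc k) * \<phi>1 x) \<in> Lp 2"
proof -
  define c where "c = real k + 1"
  have LA: "(\<lambda>x. complex_of_real (c * real k) * (complex_of_real (x ^ (k - 1)) * \<phi> x)) \<in> Lp 2" by (rule Lp2_cmult[OF k1])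
  have LB: "(\<lambda>x. complex_of_real (6 * c) * (complex_of_real (x ^ k) * \<phi> x)) \<in> Lp 2" by (rule Lp2_cmult[OF k(1)])
  have LC: "(\<lambda>x. complex_of_real c * (complex_of_real (x ^ k) * \<phi>1 x)) \<in> Lp 2" by (rule Lp2_cmult[OF k(2)])
  have LD: "(\<lambda>x. complex_of_real c * (complex_of_real (x ^ k) * \<phi> x)) \<in> Lp 2" by (rule Lp2_cmult[OF k(1)])
  define A B C0 D0 where "A = norm (cls (\<lambda>x. complex_of_real (c * real k) * (complex_of_real (x ^ (k - 1)) * \<phi> x)))"
    and "B = norm (cls (\<lambda>x. complex_of_real (6 * c) * (complex_of_real (x ^ k) * \<phi> x)))"
    and "C0 = norm (cls (\<lambda>x. complex_of_real c * (complex_of_real (x ^ k) * \<phi>1 x)))"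
    and "D0 = norm (cls (\<lambda>x. complex_of_real c * (complex_of_real (x ^ k) * \<phi> x)))"
  define C where "C = (A + B) + 2 * C0"
  obtain R where R: "R > 0" "norm (cls (\<lambda>x. indicator {x. \<bar>x\<bar> > R} x * \<phi> x)) \<le> 1 / 2" "(\<lambda>x. indicator {x. \<bar>x\<bar> > R} x * \<phi> x) \<in> Lp 2"
    using L2_tail_small[OF rep_parts(3), of "1/2"] by auto
  \<comment> \<open>The solution of K = C / \<delta> + K / 2 + R^(k + 1), the inequality to be
    obtained for the norm of the weighted eigenfunction.\<close>
  define K where "K = 2 * (C / \<delta> + R ^ Suc k)"
  have main: "norm (cls (\<lambda>x. complex_of_real (wt k s x) * \<phi> x)) \<le> K \<and>
      norm (cls (\<lambda>x. complex_of_real (wt k s x) * \<phi>1 x)) \<le> sqrt (K * (C + (U_bound + \<bar>lam\<bar>) * K)) + D0 \<and>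
      (\<lambda>x. complex_of_real (wt k s x) * \<phi> x) \<in> Lp 2 \<and> (\<lambda>x. complex_of_real (wt k s x) * \<phi>1 x) \<in> Lp 2"
    if s: "0 < s" "s \<le> 1" for s
  proof -
    note b = wt_bounds[OF s, of k] and wc = wt_continuous[OF s(1), of k]
    define w w1 w2 where "w x = complex_of_real (wt k s x)" and "w1 x = complex_of_real (wt1 k s x)"
      and "w2 x = complex_of_real (wt2a k s x + wt2b k s x)" for x
    have ad: "antideriv w w1" "antideriv w1 w2"
      unfolding w_def[abs_def] w1_def[abs_def] w2_def[abs_def]
      by (rule antideriv_of_real[OF wt_DERIV(1)[OF s(1)] wc(2)])
        (rule antideriv_of_real[OF wt_DERIV(2)[OF s(1)]], intro continuous_intros wc)
    have bd: "bounded (range w)" "bounded (range w1)" "bounded (range w2)"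
      using b(5) b(6) b(7) unfolding bounded_iff w_def w1_def w2_def
      by (auto simp del: of_real_add power_Suc)
    have Lw: "(\<lambda>x. w x * f x) \<in> Lp 2" "(\<lambda>x. w1 x * f x) \<in> Lp 2" "(\<lambda>x. w2 x * f x) \<in> Lp 2" if f: "f \<in> Lp 2" for f
      unfolding w_def w1_def w2_def
      by (rule Lp2_real_weight[OF f wc(1) b(5)], rule Lp2_real_weight[OF f wc(2) b(6)],
          rule Lp2_real_weight[OF f _ b(7)], intro continuous_intros wc)
    define q where "q x = (U x - of_real lam) * \<phi> x" for x
    have q: "q \<in> Lp 2" using rep_parts(5) by (simp add: q_def[abs_def])
    note rw = sobolev_rep_mult[OF rep[folded q_def] ad bd]
    have L2a: "(\<lambda>x. complex_of_real (wt2a k s x) * \<phi> x) \<in> Lp 2" "(\<lambda>x. complex_of_real (wt2b k s x) * \<phi> x) \<in> Lp 2"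
      by (rule Lp2_real_weight[OF rep_parts(3) wc(3) b(8)], rule Lp2_real_weight[OF rep_parts(3) wc(4) b(9)])
    have n2a: "norm (cls (\<lambda>x. complex_of_real (wt2a k s x) * \<phi> x)) \<le> A"
      unfolding A_def c_def by (rule norm_cls_mono[OF L2a(1) LA[unfolded c_def] norm_real_weight_mono[OF b(3)]])
    have n2b: "norm (cls (\<lambda>x. complex_of_real (wt2b k s x) * \<phi> x)) \<le> B"
      unfolding B_def c_def by (rule norm_cls_mono[OF L2a(2) LB[unfolded c_def] norm_real_weight_mono[OF b(4)]])
    have n1: "norm (cls (\<lambda>x. w1 x * \<phi>1 x)) \<le> C0"
      unfolding C0_def c_def w1_def by (rule norm_cls_mono[OF Lw(2)[OF rep_parts(4), unfolded w1_def] LC[unfolded c_def] norm_real_weight_mono[OF b(2)]])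
    have n1': "norm (cls (\<lambda>x. w1 x * \<phi> x)) \<le> D0"
      unfolding D0_def c_def w1_def by (rule norm_cls_mono[OF Lw(2)[OF rep_parts(3), unfolded w1_def] LD[unfolded c_def] norm_real_weight_mono[OF b(2)]])
    define z where "z x = w2 x * \<phi> x + 2 * (w1 x * \<phi>1 x)" for x
    have z: "z \<in> Lp 2" unfolding z_def[abs_def] by (intro Lp2_add Lp2_cmult Lw rep_parts)
    have nz: "norm (cls z) \<le> C"
    proof -
      have "cls z = cls (\<lambda>x. (complex_of_real (wt2a k s x) * \<phi> x + complex_of_real (wt2b k s x) * \<phi> x) + 2 * (w1 x * \<phi>1 x))"
        by (simp add: z_def[abs_def] w2_def distrib_right)
      also have "\<dots> = (cls (\<lambda>x. complex_of_real (wt2a k s x) * \<phi> x) + cls (\<lambda>x. complex_of_real (wt2b k s x) * \<phi> x))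
          + cscale 2 (cls (\<lambda>x. w1 x * \<phi>1 x))"
        using L2a Lw(2)[OF rep_parts(4)] by (simp add: cls_add cls_cmult Lp2_add Lp2_cmult)
      also have "norm \<dots> \<le> (A + B) + 2 * C0"
        using n2a n2b n1 by (intro norm_triangle_mono) (simp_all add: norm_cscale)
      finally show ?thesis by (simp add: C_def)
    qed
    define g where "g = cls (\<lambda>x. w x * \<phi> x)"
    have gD: "g \<in> D" unfolding g_def by (rule D_I[OF rw])
    have "M g - cscale (of_real lam) g = cls (\<lambda>x. (- (w2 x * \<phi> x + 2 * (w1 x * \<phi>1 x) + w x * q x) + U x * (w x * \<phi> x)) - of_real lam * (w x * \<phi> x))"
      unfolding g_def M_cls[OF rw] using cls_diff[OF M_Lp2[OF rw] Lp2_cmult[OF Lw(1)[OF rep_parts(3)]], of "of_real lam"]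
        cls_cmult[OF Lw(1)[OF rep_parts(3)], of "of_real lam"] by simp
    also have "\<dots> = cls (\<lambda>x. - z x)" by (simp add: z_def q_def algebra_simps)
    also have "\<dots> = - cls z" using cls_cmult[OF z, of "-1"] by (simp add: cscale_minus_left)
    finally have nM: "norm (M g - cscale (of_real lam) g) \<le> C" using nz by simp
    have gb: "norm g \<le> C / \<delta> + norm (cinner g (cls \<phi>))"
      using norm_orthogonal_bound[OF gD] divide_right_mono[OF nM, of \<delta>] gap_pos by linarith
    \<comment> \<open>The part of \<phi> inside the interval, where the weight is at most R^(k + 1).
      On the part outside, of norm at most 1/2, Cauchy-Schwarz gives half the norm of g.\<close>
    define t where "t x = \<phi> x - indicator {x. \<bar>x\<bar> > R} x * \<phi> x" for x
    have t: "t \<in> Lp 2" unfolding t_def[abs_def] by (rule Lp2_diff[OF rep_parts(3) R(3)])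
    have "cls \<phi> = cls (\<lambda>x. indicator {x. \<bar>x\<bar> > R} x * \<phi> x) + cls t"
      using cls_add[OF R(3) t] by (simp add: t_def)
    then have "cinner g (cls \<phi>) = cinner g (cls (\<lambda>x. indicator {x. \<bar>x\<bar> > R} x * \<phi> x)) + cinner g (cls t)"
      by (simp add: cinner_add_right)
    moreover have "norm (cinner g (cls (\<lambda>x. indicator {x. \<bar>x\<bar> > R} x * \<phi> x))) \<le> norm g * (1 / 2)"
      using cinner_Cauchy_Schwarz R(2) by (meson mult_left_mono norm_ge_zero order_trans)
    moreover have "norm (cinner g (cls t)) \<le> R ^ Suc k"
    proof -
      have "cinner g (cls t) = cinner (cls (\<lambda>x. w x * t x)) (cls \<phi>)"
        unfolding g_def cinner_cls[OF Lw(1)[OF rep_parts(3)] t] cinner_cls[OF Lw(1)[OF t] rep_parts(3)] L2_inner_def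
        by (rule Bochner_Integration.integral_cong) (auto simp: t_def split: split_indicator)
      then have "norm (cinner g (cls t)) \<le> norm (cls (\<lambda>x. w x * t x))"
        using cinner_Cauchy_Schwarz[of "cls (\<lambda>x. w x * t x)" "cls \<phi>"] norm_1 by simp
      also have "\<dots> \<le> norm (cls (\<lambda>x. complex_of_real (R ^ Suc k) * \<phi> x))"
      proof (rule norm_cls_mono[OF Lw(1)[OF t] Lp2_cmult[OF rep_parts(3)]])
        fix x
        show "norm (w x * t x) \<le> norm (complex_of_real (R ^ Suc k) * \<phi> x)"
        proof (cases "\<bar>x\<bar> > R")
          case False
          have "\<bar>wt k s x\<bar> \<le> \<bar>x\<bar> ^ Suc k" using b(1)[of x] by (simp only: power_abs)
          also have "\<dots> \<le> R ^ Suc k" using False by (intro power_mono) auto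
          finally have "\<bar>wt k s x\<bar> \<le> \<bar>R ^ Suc k\<bar>" by simp
          moreover have "t x = \<phi> x" using False by (simp add: t_def)
          ultimately show ?thesis unfolding w_def norm_mult norm_of_real by (simp only: mult_right_mono[OF _ norm_ge_zero])
        qed (simp add: t_def)
      qed
      also have "\<dots> = R ^ Suc k" using R(1) by (simp add: cls_cmult rep_parts norm_cscale norm_1 norm_power norm_mult)
      finally show ?thesis .
    qed
    ultimately have "norm (cinner g (cls \<phi>)) \<le> norm g / 2 + R ^ Suc k"
      using norm_triangle_ineq[of "cinner g (cls (\<lambda>x. indicator {x. \<bar>x\<bar> > R} x * \<phi> x))" "cinner g (cls t)"] by simp
    \<comment> \<open>Absorbing half of the norm of g is legitimate because that norm is finite: for
      each s > 0 the weight is bounded.\<close>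
    then have gK: "norm g \<le> K" using gb unfolding K_def by simp
    then have K0: "K \<ge> 0" using norm_ge_zero order_trans by blast
    have C0: "C \<ge> 0" using nz norm_ge_zero order_trans by blast
    have nq: "norm (cls (\<lambda>x. w x * q x)) \<le> (U_bound + \<bar>lam\<bar>) * K"
    proof -
      have "norm (cls (\<lambda>x. w x * q x)) \<le> norm (cls (\<lambda>x. complex_of_real (U_bound + \<bar>lam\<bar>) * (w x * \<phi> x)))"
      proof (rule norm_cls_mono[OF Lw(1)[OF q] Lp2_cmult[OF Lw(1)[OF rep_parts(3)]]])
        fix x
        have "norm (U x - of_real lam) \<le> U_bound + \<bar>lam\<bar>"
          using norm_triangle_ineq4[of "U x" "of_real lam"] U_bound(1)[of x] by simp
        also have "\<dots> = norm (complex_of_real (U_bound + \<bar>lam\<bar>))" using U_bound(2) by (simp del: of_real_add)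
        finally have "norm (w x * \<phi> x) * norm (U x - of_real lam) \<le> norm (w x * \<phi> x) * norm (complex_of_real (U_bound + \<bar>lam\<bar>))"
          by (rule mult_left_mono) simp
        then show "norm (w x * q x) \<le> norm (complex_of_real (U_bound + \<bar>lam\<bar>) * (w x * \<phi> x))"
          by (simp only: q_def norm_mult mult_ac)
      qed
      also have "\<dots> = (U_bound + \<bar>lam\<bar>) * norm g"
        unfolding cls_cmult[OF Lw(1)[OF rep_parts(3)]] g_def[symmetric] norm_cscale using U_bound(2) by (simp del: of_real_add)
      also have "\<dots> \<le> (U_bound + \<bar>lam\<bar>) * K" using gK U_bound(2) by (intro mult_left_mono) auto
      finally show ?thesis .
    qed
    have "norm (cls (\<lambda>x. w2 x * \<phi> x + 2 * (w1 x * \<phi>1 x) + w x * q x)) \<le> C + (U_bound + \<bar>lam\<bar>) * K"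
      using cls_add[OF z Lw(1)[OF q]] nz nq norm_triangle_mono by (fastforce simp: z_def)
    \<comment> \<open>The norm of the derivative is interpolated between function and second
      derivative; subtracting w1 \<phi> afterwards isolates the weighted \<phi>1.\<close>
    then have "norm g * norm (cls (\<lambda>x. w2 x * \<phi> x + 2 * (w1 x * \<phi>1 x) + w x * q x)) \<le> K * (C + (U_bound + \<bar>lam\<bar>) * K)"
      using gK K0 by (intro mult_mono) auto
    then have "(norm (cls (\<lambda>x. w1 x * \<phi> x + w x * \<phi>1 x)))\<^sup>2 \<le> K * (C + (U_bound + \<bar>lam\<bar>) * K)"
      using sobolev_rep_norm_deriv[OF rw] by (simp add: g_def)
    then have d: "norm (cls (\<lambda>x. w1 x * \<phi> x + w x * \<phi>1 x)) \<le> sqrt (K * (C + (U_bound + \<bar>lam\<bar>) * K))"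
      by (rule real_le_rsqrt)
    have ce: "cls (\<lambda>x. w x * \<phi>1 x) = cls (\<lambda>x. w1 x * \<phi> x + w x * \<phi>1 x) - cls (\<lambda>x. w1 x * \<phi> x)"
      using Lw(1)[OF rep_parts(4)] Lw(2)[OF rep_parts(3)] by (simp add: cls_add)
    have "norm (cls (\<lambda>x. w x * \<phi>1 x)) \<le> sqrt (K * (C + (U_bound + \<bar>lam\<bar>) * K)) + D0"
      unfolding ce using norm_triangle_ineq4[of "cls (\<lambda>x. w1 x * \<phi> x + w x * \<phi>1 x)" "cls (\<lambda>x. w1 x * \<phi> x)"] d n1' by linarith
    then show ?thesis using gK Lw(1)[OF rep_parts(3)] Lw(1)[OF rep_parts(4)] by (simp add: g_def w_def)
  qed
  define s where "s n = 1 / (real n + 1)" for n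
  have s: "0 < s n" "s n \<le> 1" for n by (auto simp: s_def)
  have s0: "s \<longlonglongrightarrow> 0" unfolding s_def[abs_def] by real_asymp
  have wl: "(\<lambda>n. complex_of_real (wt k (s n) x)) \<longlonglongrightarrow> complex_of_real (x ^ Suc k)" for x
  proof -
    have "(\<lambda>n. damp (s n) x) \<longlonglongrightarrow> x / (1 + 0 * x\<^sup>2)" unfolding damp_def by (intro tendsto_intros s0) simp
    then have "(\<lambda>n. damp (s n) x) \<longlonglongrightarrow> x" by simp
    then show ?thesis unfolding wt_def by (intro tendsto_intros)
  qed
  show "(\<lambda>x. complex_of_real (x ^ Suc k) * \<phi> x) \<in> Lp 2"
    by (rule Lp2_Fatou[where f = "\<lambda>n x. complex_of_real (wt k (s n) x) * \<phi> x"])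
      (use main[OF s] in \<open>auto intro!: tendsto_mult wl simp del: power_Suc of_real_power\<close>)
  show "(\<lambda>x. complex_of_real (x ^ Suc k) * \<phi>1 x) \<in> Lp 2"
    by (rule Lp2_Fatou[where f = "\<lambda>n x. complex_of_real (wt k (s n) x) * \<phi>1 x"])
      (use main[OF s] in \<open>auto intro!: tendsto_mult wl simp del: power_Suc of_real_power\<close>)
qed

lemma decay: "(\<lambda>x. complex_of_real (x ^ k) * \<phi> x) \<in> Lp 2" "(\<lambda>x. complex_of_real (x ^ k) * \<phi>1 x) \<in> Lp 2"
proof -
  \<comment> \<open>All lower powers together, because \<open>decay_step\<close> also asks for the
    power k - 1, which is 0 for k = 0.\<close>
  have "\<forall>j\<le>k. (\<lambda>x. complex_of_real (x ^ j) * \<phi> x) \<in> Lp 2 \<and> (\<lambda>x. complex_of_real (x ^ j) * \<phi>1 x) \<in> Lp 2"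
  proof (induction k)
    case 0 show ?case by (simp add: rep_parts)
  next
    case (Suc k)
    have "(\<lambda>x. complex_of_real (x ^ Suc k) * \<phi> x) \<in> Lp 2 \<and> (\<lambda>x. complex_of_real (x ^ Suc k) * \<phi>1 x) \<in> Lp 2"
      using Suc[rule_format, OF order_refl] Suc[rule_format, OF diff_le_self[of k 1]]
      by (intro conjI decay_step) (elim conjE, assumption)+
    then show ?case using Suc by (auto simp: le_Suc_eq simp del: power_Suc)
  qed
  then show "(\<lambda>x. complex_of_real (x ^ k) * \<phi> x) \<in> Lp 2" "(\<lambda>x. complex_of_real (x ^ k) * \<phi>1 x) \<in> Lp 2" by auto
qed

end

section \<open>Hermite expansions\<close>

definition hb :: "nat \<Rightarrow> l2" where "hb j = cls (hermite_fun j)"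

definition proj :: "nat \<Rightarrow> l2 \<Rightarrow> l2" where "proj n u = (\<Sum>j\<le>n. cscale (cinner u (hb j)) (hb j))"

lemma hb_orthonormal: "cinner (hb j) (hb k) = (if j = k then 1 else 0)"
  by (simp add: hb_def cinner_cls hermite_fun_Lp2 hermite_fun_orthonormal)

lemma cinner_hb_sum: "finite J \<Longrightarrow> cinner (\<Sum>j\<in>J. cscale (c j) (hb j)) (hb k) = (if k \<in> J then c k else 0)"
  by (simp add: cinner_sum_left cinner_cscale_left hb_orthonormal if_distrib[of "\<lambda>x. _ * x"] sum.delta cong: if_cong)

lemma norm_sq_hb_sum:
  assumes "finite J"
  shows "(norm (\<Sum>j\<in>J. cscale (c j) (hb j)))\<^sup>2 = (\<Sum>j\<in>J. (norm (c j))\<^sup>2)"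
proof -
  define S where "S = (\<Sum>j\<in>J. cscale (c j) (hb j))"
  have "cinner S S = (\<Sum>j\<in>J. c j * cinner (hb j) S)"
    by (subst (1) S_def) (simp add: cinner_sum_left cinner_cscale_left)
  also have "\<dots> = (\<Sum>j\<in>J. complex_of_real ((norm (c j))\<^sup>2))"
  proof (rule sum.cong[OF refl])
    fix j assume "j \<in> J"
    then have "cinner (hb j) S = cnj (c j)"
      using cinner_commute[of "hb j" S] cinner_hb_sum[OF assms, of c j] by (simp add: S_def)
    then show "c j * cinner (hb j) S = complex_of_real ((norm (c j))\<^sup>2)" by (simp only: complex_norm_square)
  qed
  finally have "complex_of_real ((norm S)\<^sup>2) = complex_of_real (\<Sum>j\<in>J. (norm (c j))\<^sup>2)"
    unfolding cinner_self of_real_sum .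
  then show ?thesis unfolding S_def by (simp only: of_real_eq_iff)
qed

lemma cinner_proj: "cinner (proj n u) (hb k) = (if k \<le> n then cinner u (hb k) else 0)"
  by (simp add: proj_def cinner_hb_sum)

lemma norm_sq_proj: "(norm (proj n u))\<^sup>2 = (\<Sum>j\<le>n. (norm (cinner u (hb j)))\<^sup>2)"
  unfolding proj_def by (rule norm_sq_hb_sum) simp

lemma norm_sq_proj_diff:
  assumes "n \<le> N"
  shows "(norm (proj N u - proj n u))\<^sup>2 = (\<Sum>j\<in>{n<..N}. (norm (cinner u (hb j)))\<^sup>2)"
proof -
  have "{..N} = {..n} \<union> {n<..N}" using assms by auto
  then have "proj N u = proj n u + (\<Sum>j\<in>{n<..N}. cscale (cinner u (hb j)) (hb j))"
    unfolding proj_def by (simp add: sum.union_disjoint ivl_disj_int)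
  then show ?thesis by (simp add: norm_sq_hb_sum)
qed

lemma norm_proj_le: "norm (proj n u) \<le> norm u"
proof -
  have *: "cinner v (proj n u) = 0" if "\<And>j. j \<le> n \<Longrightarrow> cinner v (hb j) = 0" for v
    unfolding proj_def cinner_sum_right cinner_cscale_right using that by (intro sum.neutral) auto
  have "cinner (u - proj n u) (proj n u) = 0" by (rule *) (simp add: cinner_diff_left cinner_proj)
  then have "cinner u (proj n u) = cinner (proj n u) (proj n u)" unfolding cinner_diff_left by simp
  then have "(norm (proj n u))\<^sup>2 = norm (cinner u (proj n u))" by (simp add: cinner_self norm_power)
  also have "\<dots> \<le> norm u * norm (proj n u)" by (rule cinner_Cauchy_Schwarz)
  finally show ?thesis by (cases "norm (proj n u) = 0") (simp_all add: power2_eq_square)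
qed

lemma hb_complete: assumes "\<And>j. cinner u (hb j) = 0" shows "u = 0"
proof -
  obtain f where f: "f \<in> Lp 2" "u = cls f" by (rule cls_cases)
  have "AE x in lebesgue. f x = 0"
    by (rule hermite_complete[OF f(1)]) (use assms f in \<open>simp add: hb_def cinner_cls hermite_fun_Lp2\<close>)
  then have "cls f = cls (\<lambda>x. 0)" by (rule cls_cong_AE[OF f(1)])
  then show ?thesis using f(2) cls_zero by simp
qed

lemma cinner_continuous: "continuous_on UNIV (\<lambda>u. cinner u v)"
proof (rule lipschitz_on_continuous_on[OF lipschitz_onI[where L = "norm v"]])
  show "dist (cinner u v) (cinner w v) \<le> norm v * dist u w" for u w
    using cinner_Cauchy_Schwarz[of "u - w" v] by (simp add: cinner_diff_left dist_norm mult.commute)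
qed simp

text \<open>Bessel's inequality makes the projections a Cauchy sequence; the limit has the same
  coefficients as u, and completeness of the Hermite functions identifies the two.\<close>

lemma proj_tendsto: "(\<lambda>n. proj n u) \<longlonglongrightarrow> u"
proof -
  define a where "a n = (\<Sum>j\<le>n. (norm (cinner u (hb j)))\<^sup>2)" for n
  have "convergent a"
  proof (rule Bseq_mono_convergent)
    have "a n \<le> (norm u)\<^sup>2" "0 \<le> a n" for n
      unfolding a_def norm_sq_proj[symmetric] by (intro power_mono norm_proj_le) auto
    then show "Bseq a" by (intro BseqI'[where K = "(norm u)\<^sup>2"]) simp
    show "\<forall>m n. m \<le> n \<longrightarrow> a m \<le> a n" unfolding a_def by (intro allI impI sum_mono2) auto
  qed
  then have Ca: "Cauchy a" by (rule convergent_Cauchy)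
  have d: "(norm (proj m u - proj n u))\<^sup>2 = \<bar>a m - a n\<bar>" for m n
  proof -
    have *: "(norm (proj m u - proj n u))\<^sup>2 = \<bar>a m - a n\<bar>" if "n \<le> m" for m n
    proof -
      have "{..m} = {..n} \<union> {n<..m}" using that by auto
      then have "a m - a n = (\<Sum>j\<in>{n<..m}. (norm (cinner u (hb j)))\<^sup>2)"
        unfolding a_def by (simp add: sum.union_disjoint ivl_disj_int)
      then show ?thesis unfolding norm_sq_proj_diff[OF that] by (simp add: sum_nonneg)
    qed
    show ?thesis using *[of n m] *[of m n] by (cases "n \<le> m") (auto simp: norm_minus_commute abs_minus_commute)
  qed
  have "Cauchy (\<lambda>n. proj n u)"
  proof (rule metric_CauchyI)
    fix e :: real assume e: "e > 0"
    then obtain k where k: "\<And>m n. m \<ge> k \<Longrightarrow> n \<ge> k \<Longrightarrow> dist (a m) (a n) < e\<^sup>2"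
      using metric_CauchyD[OF Ca, of "e\<^sup>2"] by auto
    have "dist (proj m u) (proj n u) < e" if "m \<ge> k" "n \<ge> k" for m n
    proof -
      have "(dist (proj m u) (proj n u))\<^sup>2 < e\<^sup>2" using k[OF that] d[of m n] by (simp add: dist_norm)
      then show ?thesis by (rule power2_less_imp_less) (use e in simp)
    qed
    then show "\<exists>M. \<forall>m\<ge>M. \<forall>n\<ge>M. dist (proj m u) (proj n u) < e" by blast
  qed
  then obtain l where l: "(\<lambda>n. proj n u) \<longlonglongrightarrow> l" using Cauchy_convergent_iff[THEN iffD1] convergentD by blast
  have "cinner (u - l) (hb k) = 0" for k
  proof -
    have "(\<lambda>n. cinner (proj n u) (hb k)) \<longlonglongrightarrow> cinner l (hb k)"
      by (rule continuous_on_tendsto_compose[OF cinner_continuous l]) auto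
    moreover have "(\<lambda>n. cinner (proj n u) (hb k)) \<longlonglongrightarrow> cinner u (hb k)"
      by (rule tendsto_eventually) (auto simp: cinner_proj eventually_sequentially intro!: exI[of _ k])
    ultimately have "cinner l (hb k) = cinner u (hb k)" by (rule LIMSEQ_unique)
    then show ?thesis by (simp add: cinner_diff_left)
  qed
  then have "u - l = 0" by (rule hb_complete)
  then show ?thesis using l by simp
qed

text \<open>Beyond index n the factor 2 j + 1 is at least 2 n + 3, so the tail of u is smaller than
  that of v by this factor. Finite blocks are compared first, then the upper end tends to
  infinity.\<close>

lemma proj_tail_le:
  assumes c: "\<And>j. cinner v (hb j) = of_nat (2 * j + 1) * cinner u (hb j)"
  shows "real (2 * n + 3) * norm (u - proj n u) \<le> norm (v - proj n v)"
proof (rule LIMSEQ_le)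
  show "(\<lambda>N. real (2 * n + 3) * norm (proj N u - proj n u)) \<longlonglongrightarrow> real (2 * n + 3) * norm (u - proj n u)"
    by (intro tendsto_intros proj_tendsto)
  show "(\<lambda>N. norm (proj N v - proj n v)) \<longlonglongrightarrow> norm (v - proj n v)" by (intro tendsto_intros proj_tendsto)
  have "real (2 * n + 3) * norm (proj N u - proj n u) \<le> norm (proj N v - proj n v)" if N: "n \<le> N" for N
  proof -
    have "(real (2 * n + 3) * norm (proj N u - proj n u))\<^sup>2 = (\<Sum>j\<in>{n<..N}. (real (2 * n + 3))\<^sup>2 * (norm (cinner u (hb j)))\<^sup>2)"
      by (simp add: power_mult_distrib norm_sq_proj_diff[OF N] sum_distrib_left)
    also have "\<dots> \<le> (\<Sum>j\<in>{n<..N}. (norm (cinner v (hb j)))\<^sup>2)"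
    proof (rule sum_mono)
      fix j assume "j \<in> {n<..N}"
      then have "real (2 * n + 3) \<le> real (2 * j + 1)" by simp
      then have "(real (2 * n + 3))\<^sup>2 \<le> (real (2 * j + 1))\<^sup>2" by (intro power_mono) auto
      then have "(real (2 * n + 3))\<^sup>2 * (norm (cinner u (hb j)))\<^sup>2 \<le> (real (2 * j + 1))\<^sup>2 * (norm (cinner u (hb j)))\<^sup>2"
        by (rule mult_right_mono) simp
      also have "\<dots> = (norm (cinner v (hb j)))\<^sup>2" unfolding c norm_mult norm_of_nat by (simp only: power_mult_distrib)
      finally show "(real (2 * n + 3))\<^sup>2 * (norm (cinner u (hb j)))\<^sup>2 \<le> (norm (cinner v (hb j)))\<^sup>2" .
    qed
    also have "\<dots> = (norm (proj N v - proj n v))\<^sup>2" by (rule norm_sq_proj_diff[OF N, symmetric])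
    finally show ?thesis by (rule power2_le_imp_le) simp
  qed
  then show "\<exists>N0. \<forall>N\<ge>N0. real (2 * n + 3) * norm (proj N u - proj n u) \<le> norm (proj N v - proj n v)" by blast
qed

text \<open>The harmonic oscillator - u'' + x^2 u; the second derivative is an argument because it
  is known only as part of a representing triple.\<close>

definition osc :: "(real \<Rightarrow> complex) \<Rightarrow> (real \<Rightarrow> complex) \<Rightarrow> l2" where
  "osc u u2 = cls (\<lambda>x. - u2 x + complex_of_real (x\<^sup>2) * u x)"

lemma hermite_fun_weight: "(\<lambda>x. complex_of_real (x ^ k) * gauss_poly p x) \<in> Lp 2"
proof -
  have "(\<lambda>x. complex_of_real (x ^ k) * gauss_poly p x) = gauss_poly (monom 1 k * p)"
    by (simp add: fun_eq_iff gauss_poly_def poly_monom)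
  then show ?thesis using gauss_poly_Lp2 by simp
qed

lemma hermite_fun_sobolev_rep:
  "sobolev_rep (hermite_fun j) (gauss_poly (gauss_deriv (Polynomial.smult (hermite_scale j) (hermite_q j))))
     (\<lambda>x. (complex_of_real (x\<^sup>2) - of_nat (2 * j + 1)) * hermite_fun j x)"
proof -
  let ?p = "Polynomial.smult (hermite_scale j) (hermite_q j)"
  have "gauss_poly (gauss_deriv (gauss_deriv ?p)) = (\<lambda>x. (complex_of_real (x\<^sup>2) - of_nat (2 * j + 1)) * hermite_fun j x)"
    unfolding gauss_deriv_smult hermite_q_ode hermite_fun_eq gauss_poly_def
    by (rule ext) (simp add: power2_eq_square algebra_simps)
  then show ?thesis using gauss_poly_sobolev_rep[of ?p] by (simp add: hermite_fun_eq)
qed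

text \<open>The second derivative is moved onto the Hermite function, whose own equation brings x^2
  - (2 j + 1); the terms with x^2 cancel.\<close>

lemma osc_coefficient:
  assumes u: "sobolev_rep u u1 u2" and x2: "(\<lambda>x. complex_of_real (x\<^sup>2) * u x) \<in> Lp 2"
  shows "cinner (osc u u2) (hb j) = of_nat (2 * j + 1) * cinner (cls u) (hb j)"
proof -
  note h = hermite_fun_sobolev_rep[of j]
  have L: "u \<in> Lp 2" "u2 \<in> Lp 2" using u by (auto simp: sobolev_rep_def)
  note hL = hermite_fun_Lp2[of j]
  have i: "integrable lebesgue (\<lambda>x. u2 x * cnj (hermite_fun j x))" "integrable lebesgue (\<lambda>x. complex_of_real (x\<^sup>2) * u x * cnj (hermite_fun j x))"
    "integrable lebesgue (\<lambda>x. u x * cnj (hermite_fun j x))"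
    using L2_inner_integrable[OF L(2) hL] L2_inner_integrable[OF x2 hL] L2_inner_integrable[OF L(1) hL] by auto
  have "L2_inner u2 (hermite_fun j) = L2_inner u (\<lambda>x. (complex_of_real (x\<^sup>2) - of_nat (2 * j + 1)) * hermite_fun j x)"
    by (rule sobolev_rep_symmetric[OF u h])
  also have "\<dots> = (LINT x|lebesgue. complex_of_real (x\<^sup>2) * u x * cnj (hermite_fun j x) - of_nat (2 * j + 1) * (u x * cnj (hermite_fun j x)))"
    unfolding L2_inner_def by (rule Bochner_Integration.integral_cong) (simp_all add: algebra_simps)
  also have "\<dots> = L2_inner (\<lambda>x. complex_of_real (x\<^sup>2) * u x) (hermite_fun j) - of_nat (2 * j + 1) * L2_inner u (hermite_fun j)"
    unfolding L2_inner_def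
    by (subst Bochner_Integration.integral_diff[OF i(2) integrable_mult_right[OF i(3)]]) simp
  finally have e: "L2_inner u2 (hermite_fun j) = L2_inner (\<lambda>x. complex_of_real (x\<^sup>2) * u x) (hermite_fun j) - of_nat (2 * j + 1) * L2_inner u (hermite_fun j)" .
  have "cinner (osc u u2) (hb j) = cinner (- cls u2 + cls (\<lambda>x. complex_of_real (x\<^sup>2) * u x)) (hb j)"
    unfolding osc_def using cls_add[OF Lp2_minus[OF L(2)] x2] cls_cmult[OF L(2), of "-1"] by (simp add: cscale_minus_left)
  also have "\<dots> = of_nat (2 * j + 1) * cinner (cls u) (hb j)"
    unfolding hb_def cinner_add_left cinner_minus_left cinner_cls[OF L(2) hL] cinner_cls[OF x2 hL] cinner_cls[OF L(1) hL] e
    by simp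
  finally show ?thesis .
qed

text \<open>Expanding the square, only the real part of the inner product of u'' with x^2 u can
  spoil the bound. By parts it equals the squared norm of u minus that of x u'.\<close>

lemma osc_bound:
  assumes u: "sobolev_rep u u1 u2" and x2: "(\<lambda>x. complex_of_real (x\<^sup>2) * u x) \<in> Lp 2"
    and x1: "(\<lambda>x. complex_of_real x * u x) \<in> Lp 2" "(\<lambda>x. complex_of_real x * u1 x) \<in> Lp 2"
  shows "(norm (cls u2))\<^sup>2 \<le> (norm (osc u u2))\<^sup>2 + 2 * (norm (cls u))\<^sup>2"
proof -
  have A: "antideriv u u1" "antideriv u1 u2" and L: "u \<in> Lp 2" "u1 \<in> Lp 2" "u2 \<in> Lp 2"
    using u by (auto simp: sobolev_rep_def)
  define X Y where "X x = complex_of_real x" and "Y x = complex_of_real (x\<^sup>2)" for x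
  have aX: "antideriv X (\<lambda>x. complex_of_real 1)"
    unfolding X_def[abs_def] by (rule antideriv_of_real) (auto intro!: derivative_eq_intros)
  have aY: "antideriv Y (\<lambda>x. complex_of_real (2 * x))"
    unfolding Y_def[abs_def] by (rule antideriv_of_real) (auto intro!: derivative_eq_intros continuous_intros)
  define a where "a = L2_inner u2 (\<lambda>x. Y x * u x)"
  define b where "b = L2_inner u1 (\<lambda>x. X x * u x)"
  define c where "c = L2_inner (\<lambda>x. X x * u1 x) (\<lambda>x. X x * u1 x)"
  have y2: "(\<lambda>x. Y x * u x) \<in> Lp 2" and y1: "(\<lambda>x. X x * u x) \<in> Lp 2" "(\<lambda>x. X x * u1 x) \<in> Lp 2"
    using x2 x1 by (simp_all add: X_def Y_def)
  note i1 = L2_inner_integrable[OF L(3) y2] and i2 = L2_inner_integrable[OF L(2) y1(1)] and i3 = L2_inner_integrable[OF y1(2) y1(2)]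
    and i4 = L2_inner_integrable[OF y1(1) L(2)] and i5 = L2_inner_integrable[OF L(1) L(1)]
  \<comment> \<open>Integrating the derivative of u' x^2 cnj(u) gives a + 2 b + c = 0.\<close>
  have B1: "antideriv (\<lambda>x. u1 x * (Y x * cnj (u x)))
      (\<lambda>x. u2 x * (Y x * cnj (u x)) + u1 x * (complex_of_real (2 * x) * cnj (u x) + Y x * cnj (u1 x)))"
    by (intro antideriv_mult A aY antideriv_cnj)
  have cY: "cnj (Y x) = Y x" "cnj (X x) = X x" "Y x = X x * X x" "complex_of_real (2 * x) = 2 * X x" for x
    by (simp_all add: X_def Y_def power2_eq_square)
  have e1: "u2 x * (Y x * cnj (u x)) + u1 x * (complex_of_real (2 * x) * cnj (u x) + Y x * cnj (u1 x)) =
     (u2 x * cnj (Y x * u x) + 2 * (u1 x * cnj (X x * u x))) + (X x * u1 x) * cnj (X x * u1 x)" for x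
    unfolding complex_cnj_mult cY(1,2,4) by (simp add: cY(3) algebra_simps)
  have "(LINT x|lebesgue. (u2 x * cnj (Y x * u x) + 2 * (u1 x * cnj (X x * u x))) + (X x * u1 x) * cnj (X x * u1 x)) = 0"
  proof (rule integral_antideriv_eq_0[OF B1[unfolded e1]])
    show "integrable lebesgue (\<lambda>x. u1 x * (Y x * cnj (u x)))"
      using L2_inner_integrable[OF L(2) y2] by (simp add: cY(1))
    show "integrable lebesgue (\<lambda>x. (u2 x * cnj (Y x * u x) + 2 * (u1 x * cnj (X x * u x))) + (X x * u1 x) * cnj (X x * u1 x))"
      by (intro Bochner_Integration.integrable_add integrable_mult_right i1 i2 i3)
  qed
  then have E1: "(a + 2 * b) + c = 0"
    unfolding a_def b_def c_def L2_inner_def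
    by (subst (asm) Bochner_Integration.integral_add[OF Bochner_Integration.integrable_add[OF i1 integrable_mult_right[OF i2]] i3],
        subst (asm) Bochner_Integration.integral_add[OF i1 integrable_mult_right[OF i2]]) simp
  \<comment> \<open>Integrating the derivative of x |u|^2 determines the real part of b.\<close>
  have B2: "antideriv (\<lambda>x. u x * (X x * cnj (u x))) (\<lambda>x. u1 x * (X x * cnj (u x)) + u x * (complex_of_real 1 * cnj (u x) + X x * cnj (u1 x)))"
    by (intro antideriv_mult A aX antideriv_cnj)
  have e2: "u1 x * (X x * cnj (u x)) + u x * (complex_of_real 1 * cnj (u x) + X x * cnj (u1 x)) =
     (u1 x * cnj (X x * u x) + (X x * u x) * cnj (u1 x)) + u x * cnj (u x)" for x
    unfolding complex_cnj_mult cY(2) by (simp add: algebra_simps)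
  have "(LINT x|lebesgue. (u1 x * cnj (X x * u x) + (X x * u x) * cnj (u1 x)) + u x * cnj (u x)) = 0"
  proof (rule integral_antideriv_eq_0[OF B2[unfolded e2]])
    show "integrable lebesgue (\<lambda>x. u x * (X x * cnj (u x)))"
      using L2_inner_integrable[OF L(1) y1(1)] by (simp add: cY(2))
    show "integrable lebesgue (\<lambda>x. (u1 x * cnj (X x * u x) + (X x * u x) * cnj (u1 x)) + u x * cnj (u x))"
      by (intro Bochner_Integration.integrable_add i2 i4 i5)
  qed
  then have "(b + L2_inner (\<lambda>x. X x * u x) u1) + L2_inner u u = 0"
    unfolding b_def L2_inner_def
    by (subst (asm) Bochner_Integration.integral_add[OF Bochner_Integration.integrable_add[OF i2 i4] i5],
        subst (asm) Bochner_Integration.integral_add[OF i2 i4])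
  then have E2: "2 * Re b = - (norm (cls u))\<^sup>2"
    unfolding L2_inner_commute[of "\<lambda>x. X x * u x" u1] b_def[symmetric] L2_inner_self norm_cls_sq[OF L(1)]
    by (simp add: complex_eq_iff)
  have "Re c \<ge> 0" unfolding c_def L2_inner_self by simp
  moreover have "Re a + 2 * Re b + Re c = 0" using arg_cong[OF E1, of Re] by simp
  ultimately have ra: "Re a \<le> (norm (cls u))\<^sup>2" using E2 by linarith
  define p q where "p = cls u2" and "q = cls (\<lambda>x. Y x * u x)"
  have "osc u u2 = q - p"
    unfolding osc_def p_def q_def using cls_diff[OF y2 L(3)] by (simp add: Y_def)
  moreover have "p \<bullet> q = Re a" unfolding p_def q_def a_def Re_cinner[symmetric] cinner_cls[OF L(3) y2] ..
  ultimately have "(norm (osc u u2))\<^sup>2 = (norm q)\<^sup>2 + (norm p)\<^sup>2 - 2 * Re a"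
    by (simp add: power2_norm_eq_inner inner_diff_left inner_diff_right inner_commute)
  then show ?thesis using ra unfolding p_def[symmetric] using zero_le_power2[of "norm q"] by linarith
qed

context schroedinger_op begin

lemma hb_D: "hb j \<in> D"
  unfolding hb_def by (rule D_I[OF hermite_fun_sobolev_rep])

lemma proj_D: "proj n u \<in> D"
  unfolding proj_def using D_M_sum[of "{..n}" "\<lambda>j. cscale (cinner u (hb j)) (hb j)"] hb_D D_M_cscale(1) by blast

end

context eigen_op begin

abbreviation e :: l2 where "e \<equiv> cls \<phi>"

definition osc_e :: l2 where "osc_e = osc \<phi> (\<lambda>x. (U x - of_real lam) * \<phi> x)"

lemma osc_e_coefficient: "cinner osc_e (hb j) = of_nat (2 * j + 1) * cinner e (hb j)"
  unfolding osc_e_def by (rule osc_coefficient[OF rep]) (use decay(1)[of 2] in simp)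

text \<open>Truncation commutes with the oscillator, so the oscillator maps the residual to the tail
  of \<open>osc_e\<close>, of norm T. By \<open>osc_bound\<close> its second derivative is at most 2
  T in norm; the potential and the shift contribute the rest of the constant.\<close>

lemma residual_bounds:
  "norm (e - proj n e) \<le> norm (osc_e - proj n osc_e)"
  "norm (M (e - proj n e) - cscale (of_real lam) (e - proj n e)) \<le> (2 + U_bound + \<bar>lam\<bar>) * norm (osc_e - proj n osc_e)"
proof -
  define T where "T = norm (osc_e - proj n osc_e)"
  have "real (2 * n + 3) * norm (e - proj n e) \<le> T"
    unfolding T_def by (rule proj_tail_le[OF osc_e_coefficient])
  moreover have "1 * norm (e - proj n e) \<le> real (2 * n + 3) * norm (e - proj n e)" by (intro mult_right_mono) auto
  ultimately have n0: "norm (e - proj n e) \<le> T" by simp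
  then show "norm (e - proj n e) \<le> norm (osc_e - proj n osc_e)" by (simp add: T_def)
  define c where "c j = cinner e (hb j)" for j
  define h1 where "h1 j = gauss_poly (gauss_deriv (Polynomial.smult (hermite_scale j) (hermite_q j)))" for j
  have hrep: "sobolev_rep (hermite_fun j) (h1 j) (\<lambda>x. (complex_of_real (x\<^sup>2) - of_nat (2 * j + 1)) * hermite_fun j x)" for j
    unfolding h1_def by (rule hermite_fun_sobolev_rep)
  \<comment> \<open>A concrete representative of the residual with both derivatives: decay of \<phi>
    and of the Hermite functions supplies the weighted integrability that \<open>osc_bound\<close>
    asks for.\<close>
  define r r1 r2 where "r x = \<phi> x - (\<Sum>j\<le>n. c j * hermite_fun j x)"
    and "r1 x = \<phi>1 x - (\<Sum>j\<le>n. c j * h1 j x)"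
    and "r2 x = (U x - of_real lam) * \<phi> x - (\<Sum>j\<le>n. c j * ((complex_of_real (x\<^sup>2) - of_nat (2 * j + 1)) * hermite_fun j x))" for x
  have rr: "sobolev_rep r r1 r2"
    unfolding r_def[abs_def] r1_def[abs_def] r2_def[abs_def]
    by (intro sobolev_rep_diff rep sobolev_rep_sum sobolev_rep_cmult hrep)
  have rL: "r \<in> Lp 2" "r2 \<in> Lp 2" using rr by (auto simp: sobolev_rep_def)
  have wh: "(\<lambda>x. complex_of_real (x ^ k) * hermite_fun j x) \<in> Lp 2" "(\<lambda>x. complex_of_real (x ^ k) * h1 j x) \<in> Lp 2" for k j
    unfolding hermite_fun_eq h1_def by (rule hermite_fun_weight)+
  have wr: "(\<lambda>x. complex_of_real (x ^ k) * r x) \<in> Lp 2" "(\<lambda>x. complex_of_real (x ^ k) * r1 x) \<in> Lp 2" for k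
  proof -
    have "(\<lambda>x. complex_of_real (x ^ k) * \<phi> x - (\<Sum>j\<le>n. c j * (complex_of_real (x ^ k) * hermite_fun j x))) \<in> Lp 2"
      by (intro Lp2_diff Lp2_sum Lp2_cmult wh decay)
    then show "(\<lambda>x. complex_of_real (x ^ k) * r x) \<in> Lp 2"
      by (simp add: r_def right_diff_distrib sum_distrib_left mult.left_commute del: of_real_power)
    have "(\<lambda>x. complex_of_real (x ^ k) * \<phi>1 x - (\<Sum>j\<le>n. c j * (complex_of_real (x ^ k) * h1 j x))) \<in> Lp 2"
      by (intro Lp2_diff Lp2_sum Lp2_cmult wh decay)
    then show "(\<lambda>x. complex_of_real (x ^ k) * r1 x) \<in> Lp 2"
      by (simp add: r1_def right_diff_distrib sum_distrib_left mult.left_commute del: of_real_power)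
  qed
  have ob: "(norm (cls r2))\<^sup>2 \<le> (norm (osc r r2))\<^sup>2 + 2 * (norm (cls r))\<^sup>2"
    by (rule osc_bound[OF rr]) (use wr[of 2] wr[of 1] in simp_all)
  have cr: "cls r = e - proj n e"
    unfolding r_def[abs_def] proj_def hb_def c_def
    by (simp add: cls_diff cls_sum cls_cmult rep_parts Lp2_sum Lp2_cmult hermite_fun_Lp2)
  have "osc r r2 = cls (\<lambda>x. (- ((U x - of_real lam) * \<phi> x) + complex_of_real (x\<^sup>2) * \<phi> x) - (\<Sum>j\<le>n. (c j * of_nat (2 * j + 1)) * hermite_fun j x))"
    unfolding osc_def
  proof (rule arg_cong[where f = cls], rule ext)
    fix x
    have "(\<Sum>j\<le>n. c j * ((complex_of_real (x\<^sup>2) - of_nat (2 * j + 1)) * hermite_fun j x)) =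
      (\<Sum>j\<le>n. complex_of_real (x\<^sup>2) * (c j * hermite_fun j x) - (c j * of_nat (2 * j + 1)) * hermite_fun j x)"
      by (rule sum.cong) (simp_all add: algebra_simps)
    also have "\<dots> = complex_of_real (x\<^sup>2) * (\<Sum>j\<le>n. c j * hermite_fun j x) - (\<Sum>j\<le>n. (c j * of_nat (2 * j + 1)) * hermite_fun j x)"
      by (simp only: sum_subtractf sum_distrib_left)
    finally show "- r2 x + complex_of_real (x\<^sup>2) * r x =
        (- ((U x - of_real lam) * \<phi> x) + complex_of_real (x\<^sup>2) * \<phi> x) - (\<Sum>j\<le>n. (c j * of_nat (2 * j + 1)) * hermite_fun j x)"
      unfolding r_def r2_def by (simp only: right_diff_distrib) (simp add: algebra_simps)
  qed
  also have "\<dots> = osc_e - proj n osc_e"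
  proof -
    have L1: "(\<lambda>x. - ((U x - of_real lam) * \<phi> x) + complex_of_real (x\<^sup>2) * \<phi> x) \<in> Lp 2"
      by (intro Lp2_add Lp2_minus rep_parts) (use decay(1)[of 2] in simp)
    have L2: "(\<lambda>x. \<Sum>j\<le>n. (c j * of_nat (2 * j + 1)) * hermite_fun j x) \<in> Lp 2"
      by (intro Lp2_sum Lp2_cmult hermite_fun_Lp2)
    have "cls (\<lambda>x. \<Sum>j\<le>n. (c j * of_nat (2 * j + 1)) * hermite_fun j x) = (\<Sum>j\<le>n. cscale (c j * of_nat (2 * j + 1)) (hb j))"
      unfolding hb_def using cls_sum[of "{..n}" "\<lambda>j x. (c j * of_nat (2 * j + 1)) * hermite_fun j x"]
      by (simp only: Lp2_cmult[OF hermite_fun_Lp2] cls_cmult[OF hermite_fun_Lp2])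
    also have "\<dots> = proj n osc_e"
      unfolding proj_def osc_e_coefficient c_def by (simp add: mult.commute)
    finally show ?thesis unfolding cls_diff[OF L1 L2] by (simp only: osc_e_def osc_def)
  qed
  finally have oT: "norm (osc r r2) = T" by (simp add: T_def)
  have T0: "T \<ge> 0" by (simp add: T_def)
  have "(norm (cls r2))\<^sup>2 \<le> T\<^sup>2 + 2 * T\<^sup>2"
    using ob power_mono[OF n0, of 2] unfolding oT cr by simp
  also have "\<dots> \<le> (2 * T)\<^sup>2" by (simp add: power_mult_distrib)
  finally have nr2: "norm (cls r2) \<le> 2 * T" by (rule power2_le_imp_le) (use T0 in simp)
  have "M (cls r) - cscale (of_real lam) (cls r) = (- cls r2 + cls (\<lambda>x. U x * r x)) - cscale (of_real lam) (cls r)"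
    unfolding M_cls[OF rr] using cls_add[OF Lp2_minus[OF rL(2)] U_mult_Lp2[OF rL(1)]] cls_cmult[OF rL(2), of "-1"]
    by (simp add: cscale_minus_left)
  also have "norm \<dots> \<le> (norm (cls r2) + norm (cls (\<lambda>x. U x * r x))) + norm (cscale (of_real lam) (cls r))"
    using norm_triangle_ineq4[of "- cls r2 + cls (\<lambda>x. U x * r x)" "cscale (of_real lam) (cls r)"]
      norm_triangle_ineq[of "- cls r2" "cls (\<lambda>x. U x * r x)"] unfolding norm_minus_cancel by linarith
  also have "\<dots> \<le> (2 * T + U_bound * T) + \<bar>lam\<bar> * T"
  proof (intro add_mono nr2)
    show "norm (cls (\<lambda>x. U x * r x)) \<le> U_bound * T"
      using norm_U_mult[OF rL(1)] mult_left_mono[OF n0 U_bound(2)] unfolding cr by linarith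
    show "norm (cscale (of_real lam) (cls r)) \<le> \<bar>lam\<bar> * T"
      using n0 unfolding norm_cscale cr by (simp add: mult_left_mono)
  qed
  also have "\<dots> = (2 + U_bound + \<bar>lam\<bar>) * T" by (simp add: algebra_simps)
  finally show "norm (M (e - proj n e) - cscale (of_real lam) (e - proj n e)) \<le> (2 + U_bound + \<bar>lam\<bar>) * norm (osc_e - proj n osc_e)"
    unfolding cr T_def .
qed

end

section \<open>The quadratic matrix polynomial\<close>

text \<open>By Leibniz' formula the determinant is a polynomial in the entries.\<close>

lemma det_mat_holomorphic:
  assumes K: "\<And>i j. i < N \<Longrightarrow> j < N \<Longrightarrow> K i j holomorphic_on S"
  shows "(\<lambda>z. Determinant.det (mat N N (\<lambda>(i, j). K i j z))) holomorphic_on S"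
proof -
  have "Determinant.det (mat N N (\<lambda>(i, j). K i j z)) =
      (\<Sum>p | p permutes {0..<N}. signof p * (\<Prod>i = 0..<N. K i (p i) z))" for z
  proof -
    have "(\<Prod>i = 0..<N. mat N N (\<lambda>(i, j). K i j z) $$ (i, p i)) = (\<Prod>i = 0..<N. K i (p i) z)"
      if "p permutes {0..<N}" for p
    proof (rule prod.cong[OF refl])
      fix i assume "i \<in> {0..<N}"
      moreover have "p i \<in> {0..<N}" using permutes_in_image[OF that] calculation by blast
      ultimately show "mat N N (\<lambda>(i, j). K i j z) $$ (i, p i) = K i (p i) z" by simp
    qed
    then show ?thesis by (subst det_def'[OF mat_carrier]) (auto intro!: sum.cong)
  qed
  moreover have "(\<lambda>z. \<Sum>p | p permutes {0..<N}. signof p * (\<Prod>i = 0..<N. K i (p i) z)) holomorphic_on S"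
  proof (intro holomorphic_intros)
    fix p i assume p: "p \<in> {p. p permutes {0..<N}}" and i: "i \<in> {0..<N}"
    have "p i \<in> {0..<N}" using permutes_in_image[of p "{0..<N}" i] p i by blast
    then show "(\<lambda>z. K i (p i) z) holomorphic_on S" using K i by simp
  qed
  ultimately show ?thesis by simp
qed

text \<open>By Cramer's rule the solution of a linear system depends holomorphically on the parameter, so any linear
  functional of it obeys the maximum principle as long as the determinant has no zero.\<close>

lemma linear_system_maximum_principle:
  fixes K :: "nat \<Rightarrow> nat \<Rightarrow> complex \<Rightarrow> complex"
  assumes K: "\<And>i j. i < N \<Longrightarrow> j < N \<Longrightarrow> K i j holomorphic_on UNIV" and R: "R > 0"
    and nz: "\<And>z. dist c z \<le> R \<Longrightarrow> Determinant.det (mat N N (\<lambda>(i, j). K i j z)) \<noteq> 0"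
    and u0: "\<And>i. i < N \<Longrightarrow> (\<Sum>j<N. K i j c * u0 j) = b i"
    and bd: "\<And>z u. dist c z = R \<Longrightarrow> (\<And>i. i < N \<Longrightarrow> (\<Sum>j<N. K i j z * u j) = b i) \<Longrightarrow> norm (\<Sum>i<N. y i * u i) \<le> B"
  shows "norm (\<Sum>i<N. y i * u0 i) \<le> B"
proof -
  define A where "A z = mat N N (\<lambda>(i, j). K i j z)" for z
  define d where "d z = Determinant.det (A z)" for z
  define G where "G i j z = adj_mat (A z) $$ (i, j)" for i j z
  have A: "A z \<in> carrier_mat N N" for z by (simp add: A_def)
  have Ai: "A z $$ (i, j) = K i j z" if "i < N" "j < N" for i j z using that by (simp add: A_def)
  note adj = adj_mat[OF A]
  have AG: "(\<Sum>l<N. K i l z * G l j z) = (if i = j then d z else 0)" if "i < N" "j < N" for i j z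
  proof -
    have "(A z * adj_mat (A z)) $$ (i, j) = (\<Sum>l<N. K i l z * G l j z)"
      using that A[of z] adj(1)[of z] by (auto simp: scalar_prod_def G_def Ai atLeast0LessThan intro!: sum.cong)
    then show ?thesis using that unfolding adj(2) by (cases "i = j") (simp_all add: d_def)
  qed
  have GA: "(\<Sum>l<N. G i l z * K l j z) = (if i = j then d z else 0)" if "i < N" "j < N" for i j z
  proof -
    have "(adj_mat (A z) * A z) $$ (i, j) = (\<Sum>l<N. G i l z * K l j z)"
      using that A[of z] adj(1)[of z] by (auto simp: scalar_prod_def G_def Ai atLeast0LessThan intro!: sum.cong)
    then show ?thesis using that unfolding adj(3) by (cases "i = j") (simp_all add: d_def)
  qed
  have dh: "d holomorphic_on UNIV" unfolding d_def[abs_def] A_def by (rule det_mat_holomorphic[OF K])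
  \<comment> \<open>An entry of the adjugate is a signed minor, hence again a determinant with
    holomorphic entries.\<close>
  have Gh: "G i j holomorphic_on UNIV" if ij: "i < N" "j < N" for i j
  proof -
    have "G i j z = (-1) ^ (j + i) * Determinant.det (mat (N - 1) (N - 1)
        (\<lambda>(a, b). K (if a < j then a else Suc a) (if b < i then b else Suc b) z))" for z
    proof -
      have "mat_delete (A z) j i = mat (N - 1) (N - 1) (\<lambda>(a, b). K (if a < j then a else Suc a) (if b < i then b else Suc b) z)"
        unfolding mat_delete_def using ij A[of z] by (auto intro!: cong_mat simp: Ai)
      then show ?thesis using ij A[of z] by (simp add: G_def adj_mat_def cofactor_def)
    qed
    moreover have "(\<lambda>z. (-1) ^ (j + i) * Determinant.det (mat (N - 1) (N - 1)
        (\<lambda>(a, b). K (if a < j then a else Suc a) (if b < i then b else Suc b) z))) holomorphic_on UNIV"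
      by (intro holomorphic_intros det_mat_holomorphic K) auto
    ultimately show ?thesis by (simp add: fun_eq_iff[symmetric] holomorphic_transform)
  qed
  define u where "u z i = (\<Sum>j<N. G i j z * b j) / d z" for z i
  have usol: "(\<Sum>j<N. K i j z * u z j) = b i" if "d z \<noteq> 0" "i < N" for z i
  proof -
    have "(\<Sum>j<N. K i j z * u z j) = (\<Sum>j<N. \<Sum>l<N. K i j z * G j l z * b l) / d z"
      by (simp add: u_def sum_divide_distrib sum_distrib_left mult.assoc)
    also have "(\<Sum>j<N. \<Sum>l<N. K i j z * G j l z * b l) = (\<Sum>l<N. (\<Sum>j<N. K i j z * G j l z) * b l)"
      by (subst sum.swap) (simp add: sum_distrib_right)
    also have "\<dots> = (\<Sum>l<N. (if i = l then d z * b l else 0))"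
      using that by (intro sum.cong) (auto simp: AG)
    also have "\<dots> = d z * b i" using that by (simp add: sum.delta)
    finally show ?thesis using that by simp
  qed
  have dn: "d z \<noteq> 0" if "dist c z \<le> R" for z using nz[OF that] by (simp add: d_def A_def)
  \<comment> \<open>At the centre the matrix is invertible, so the given solution is the one
    produced by the formula.\<close>
  have uc: "u c i = u0 i" if "i < N" for i
  proof -
    have "(\<Sum>j<N. G i j c * b j) = (\<Sum>j<N. \<Sum>l<N. G i j c * K j l c * u0 l)"
      by (intro sum.cong refl) (simp add: u0[symmetric] sum_distrib_left mult.assoc)
    also have "\<dots> = (\<Sum>l<N. (\<Sum>j<N. G i j c * K j l c) * u0 l)"
      by (subst sum.swap) (simp add: sum_distrib_right)
    also have "\<dots> = (\<Sum>l<N. (if i = l then d c * u0 l else 0))"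
      using that by (intro sum.cong) (auto simp: GA)
    also have "\<dots> = d c * u0 i" using that by (simp add: sum.delta)
    finally show ?thesis using dn[of c] R by (simp add: u_def)
  qed
  define g where "g z = (\<Sum>i<N. y i * u z i)" for z
  have gh: "g holomorphic_on cball c R"
    unfolding g_def[abs_def] u_def using dn
    by (intro holomorphic_intros) (auto intro: holomorphic_on_subset[OF Gh] holomorphic_on_subset[OF dh])
  have "norm (g c) \<le> B"
  proof (rule maximum_modulus_frontier[where S = "cball c R" and f = g and \<xi> = c])
    show "g holomorphic_on interior (cball c R)" using gh holomorphic_on_subset interior_subset by blast
    show "continuous_on (closure (cball c R)) g" using holomorphic_on_imp_continuous_on[OF gh] by simp
    show "norm (g z) \<le> B" if "z \<in> frontier (cball c R)" for z
    proof -
      have z: "dist c z = R" using that R by (simp add: frontier_cball sphere_def)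
      show ?thesis unfolding g_def by (rule bd[OF z]) (use usol dn z in auto)
    qed
  qed (use R in auto)
  then show ?thesis by (simp add: g_def uc)
qed

lemma norm_hb: "norm (hb k) = 1"
proof -
  have "complex_of_real ((norm (hb k))\<^sup>2) = complex_of_real 1" using hb_orthonormal[of k k] unfolding cinner_self by simp
  then show ?thesis unfolding of_real_eq_iff using norm_ge_zero[of "hb k"] by (simp add: power2_eq_1_iff)
qed

lemma hermite_space_E:
  assumes "g \<in> hermite_space n"
  obtains c where "g = (\<lambda>x. \<Sum>j\<le>n. c j * hermite_fun j x)" "g \<in> Lp 2" "continuous_on UNIV g"
    "cls g = (\<Sum>j\<le>n. cscale (c j) (hb j))"
proof -
  obtain c where c: "g = (\<lambda>x. \<Sum>j\<le>n. c j * hermite_fun j x)" using assms by (auto simp: hermite_space_def)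
  have "g \<in> Lp 2" unfolding c by (intro Lp2_sum Lp2_cmult hermite_fun_Lp2)
  moreover have "continuous_on UNIV g" unfolding c by (intro continuous_intros hermite_fun_continuous)
  moreover have "cls g = (\<Sum>j\<le>n. cscale (c j) (hb j))"
    unfolding c hb_def using cls_sum[of "{..n}" "\<lambda>j x. c j * hermite_fun j x"]
    by (simp only: Lp2_cmult[OF hermite_fun_Lp2] cls_cmult[OF hermite_fun_Lp2])
  ultimately show ?thesis using that c by blast
qed

text \<open>Resolves the definite description in \<open>hermite_proj\<close>: the Fourier sum has
  the defining property, and another candidate has the same class and is continuous, hence the same
  function.\<close>

lemma L2_inner_hermite_proj:
  assumes G: "G \<in> Lp 2" and j: "j \<le> n"
  shows "L2_inner (hermite_proj n G) (hermite_fun j) = cinner (cls G) (hb j)"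
proof -
  define P where "P g \<longleftrightarrow> g \<in> hermite_space n \<and> (\<forall>h\<in>hermite_space n. L2_inner (\<lambda>x. G x - g x) h = 0)" for g
  define g0 where "g0 x = (\<Sum>k\<le>n. cinner (cls G) (hb k) * hermite_fun k x)" for x
  have g0: "g0 \<in> hermite_space n" by (auto simp: hermite_space_def g0_def[abs_def])
  have in_eq: "L2_inner (\<lambda>x. G x - g x) h = cinner (cls G - cls g) (cls h)"
    if "g \<in> Lp 2" "h \<in> Lp 2" for g h
    using that G by (simp add: cls_diff[symmetric] cinner_cls Lp2_diff)
  have cg0: "cls g0 = proj n (cls G)" and g0L: "g0 \<in> Lp 2"
  proof -
    show "g0 \<in> Lp 2" unfolding g0_def[abs_def] by (intro Lp2_sum Lp2_cmult hermite_fun_Lp2)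
    show "cls g0 = proj n (cls G)"
      unfolding g0_def[abs_def] proj_def hb_def using cls_sum[of "{..n}" "\<lambda>k x. cinner (cls G) (hb k) * hermite_fun k x"]
      by (simp only: Lp2_cmult[OF hermite_fun_Lp2] cls_cmult[OF hermite_fun_Lp2] hb_def)
  qed
  have P0: "P g0"
    unfolding P_def
  proof (intro conjI ballI g0)
    fix h assume "h \<in> hermite_space n"
    then obtain c where h: "h \<in> Lp 2" "cls h = (\<Sum>j\<le>n. cscale (c j) (hb j))" by (rule hermite_space_E)
    show "L2_inner (\<lambda>x. G x - g0 x) h = 0"
      unfolding in_eq[OF g0L h(1)] cg0 h(2) cinner_sum_right cinner_cscale_right
      by (intro sum.neutral) (simp add: cinner_diff_left cinner_proj)
  qed
  have uniq: "g = g0" if "P g" for g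
  proof -
    obtain c where g: "g \<in> Lp 2" "continuous_on UNIV g" "g = (\<lambda>x. \<Sum>j\<le>n. c j * hermite_fun j x)"
      using \<open>P g\<close> hermite_space_E unfolding P_def by metis
    have g0c: "continuous_on UNIV g0" unfolding g0_def[abs_def] by (intro continuous_intros hermite_fun_continuous)
    define d where "d x = g x - g0 x" for x
    have dL: "d \<in> Lp 2" unfolding d_def[abs_def] by (rule Lp2_diff[OF g(1) g0L])
    have "d = (\<lambda>x. \<Sum>j\<le>n. (c j - cinner (cls G) (hb j)) * hermite_fun j x)"
      by (simp add: d_def[abs_def] g(3) g0_def left_diff_distrib sum_subtractf)
    then have "d \<in> hermite_space n" by (auto simp: hermite_space_def)
    then have "cinner (cls G - cls g) (cls d) = 0" "cinner (cls G - cls g0) (cls d) = 0"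
      using \<open>P g\<close> P0 in_eq[OF g(1) dL] in_eq[OF g0L dL] unfolding P_def by metis+
    then have "cinner (cls g - cls g0) (cls d) = 0" unfolding cinner_diff_left by simp
    moreover have "cls d = cls g - cls g0" unfolding d_def[abs_def] by (rule cls_diff[OF g(1) g0L])
    ultimately have "cls g = cls g0" by (simp add: cinner_self)
    then have "AE x in lebesgue. g x = g0 x" by (simp add: cls_eq_iff[OF g(1) g0L])
    then show ?thesis by (rule continuous_AE_eq[OF g(2) g0c])
  qed
  have "hermite_proj n G = g0"
    unfolding hermite_proj_def P_def[symmetric] by (rule the_equality) (rule P0, rule uniq)
  then show ?thesis using j
    by (simp add: hb_def[symmetric] cinner_cls[OF g0L hermite_fun_Lp2, symmetric] cg0 cinner_proj)
qed

section \<open>The matrix polynomial as a sesquilinear form\<close>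

context schroedinger_op begin

text \<open>The matrix polynomial applies M twice, so M must map Hermite functions back into the
  domain. The critical term is U2 h: the square integrable part of U2 meets a bounded h, the bounded
  part a square integrable h.\<close>

lemma M_hb_D: "M (hb k) \<in> D" and hermite_fun_Dom_M: "hermite_fun k \<in> Dom_M"
proof -
  let ?p = "Polynomial.smult (hermite_scale k) (hermite_q k)"
  define h h1 h2 where "h = gauss_poly ?p" and "h1 = gauss_poly (gauss_deriv ?p)" and "h2 = gauss_poly (gauss_deriv (gauss_deriv ?p))"
  have hh: "hermite_fun k = h" by (simp add: hermite_fun_eq h_def)
  have r0: "sobolev_rep h h1 h2" unfolding h_def h1_def h2_def by (rule gauss_poly_sobolev_rep)
  show "hermite_fun k \<in> Dom_M" unfolding hh by (rule Dom_M_I(1)[OF r0]) simp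
  have r2: "sobolev_rep h2 (gauss_poly (gauss_deriv (gauss_deriv (gauss_deriv ?p))))
      (gauss_poly (gauss_deriv (gauss_deriv (gauss_deriv (gauss_deriv ?p)))))"
    unfolding h2_def by (rule gauss_poly_sobolev_rep)
  have A: "antideriv h h1" "antideriv h1 h2" and L: "h \<in> Lp 2" "h1 \<in> Lp 2" "h2 \<in> Lp 2" using r0 by (auto simp: sobolev_rep_def)
  have U1L: "(\<lambda>x. U1 x * f x) \<in> Lp 2" if "f \<in> Lp 2" for f
  proof -
    obtain K where "\<And>x. norm (U1 x) \<le> K" using U_bounded(2) by (auto simp: bounded_iff)
    then show ?thesis using that U_measurable by (intro Lp2_bounded_mult[where C = K]) auto
  qed
  have U2L: "(\<lambda>x. U2 x * h x) \<in> Lp 2"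
  proof -
    obtain A B K where AB: "A \<in> Lp 2" "B \<in> borel_measurable lebesgue" "\<And>x. U2 x = A x + B x" "AE x in lebesgue. norm (B x) \<le> K"
      using potential by (auto simp: potential_rep_def)
    obtain K' where K': "\<And>x. norm (h x) \<le> K'" using gauss_poly_bounded[of ?p] by (auto simp: bounded_iff h_def)
    have "(\<lambda>x. h x * A x) \<in> Lp 2" using K' L by (intro Lp2_bounded_mult[OF AB(1), where C = K']) auto
    moreover have "(\<lambda>x. B x * h x) \<in> Lp 2" by (rule Lp2_bounded_mult[OF L(1) AB(2,4)])
    ultimately have "(\<lambda>x. h x * A x + B x * h x) \<in> Lp 2" by (rule Lp2_add)
    then show ?thesis by (simp add: AB(3) algebra_simps)
  qed
  have "antideriv (\<lambda>x. U x * h x) (\<lambda>x. U1 x * h x + U x * h1 x)"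
    by (rule antideriv_mult[OF U_antideriv(1) A(1)])
  moreover have "antideriv (\<lambda>x. U1 x * h x + U x * h1 x) (\<lambda>x. (U2 x * h x + U1 x * h1 x) + (U1 x * h1 x + U x * h2 x))"
    by (intro antideriv_add antideriv_mult U_antideriv A)
  ultimately have "sobolev_rep (\<lambda>x. U x * h x) (\<lambda>x. U1 x * h x + U x * h1 x) (\<lambda>x. (U2 x * h x + U1 x * h1 x) + (U1 x * h1 x + U x * h2 x))"
    unfolding sobolev_rep_def by (intro conjI Lp2_add U_mult_Lp2 U1L U2L L)
  from sobolev_rep_add[OF sobolev_rep_cmult[OF r2, of "-1"] this]
  have "cls (\<lambda>x. - 1 * h2 x + U x * h x) \<in> D" by (rule D_I)
  then show "M (hb k) \<in> D" unfolding hb_def hh M_cls[OF r0] by simp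
qed

text \<open>Symmetry moves one factor z - M to the other argument, which is legitimate since
  \<open>M_hb_D\<close> keeps the image of the first factor in the domain.\<close>

lemma P_mat_entry:
  assumes "j \<le> n"
  shows "L2_inner (P_op V n z (hermite_fun k)) (hermite_fun j) =
    cinner (cscale z (hb k) - M (hb k)) (cscale (cnj z) (hb j) - M (hb j))"
proof -
  have sh: "shifted_op (schroedinger V) z f \<in> Lp 2 \<and> cls (shifted_op (schroedinger V) z f) = cscale z (cls f) - M (cls f)"
    if "f \<in> Dom_M" for f
    using Dom_M_l2[OF that] by (simp add: shifted_op_def Lp2_diff Lp2_cmult cls_diff cls_cmult)
  define f1 where "f1 = shifted_op (schroedinger V) z (hermite_fun k)"
  have f1: "f1 \<in> Lp 2" "cls f1 = cscale z (hb k) - M (hb k)"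
    using sh[OF hermite_fun_Dom_M[of k]] by (auto simp: f1_def hb_def)
  have f1D: "cls f1 \<in> D" unfolding f1(2) by (intro D_M_diff D_M_cscale hb_D M_hb_D)
  then obtain u u1 u2 where u: "sobolev_rep u u1 u2" "cls f1 = cls u" by (rule D_E)
  have "AE x in lebesgue. f1 x = u x" using u f1(1) by (simp add: cls_eq_iff sobolev_rep_def)
  then have "f1 \<in> Dom_M" by (rule Dom_M_I(1)[OF u(1)])
  note G = sh[OF this]
  have "L2_inner (P_op V n z (hermite_fun k)) (hermite_fun j) = cinner (cscale z (cls f1) - M (cls f1)) (hb j)"
    unfolding P_op_def f1_def[symmetric] using L2_inner_hermite_proj[OF conjunct1[OF G] assms] conjunct2[OF G] by simp
  also have "\<dots> = cinner (cls f1) (cscale (cnj z) (hb j) - M (hb j))"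
    by (simp add: cinner_diff_left cinner_diff_right cinner_cscale_left cinner_cscale_right M_symmetric[OF f1D hb_D])
  finally show ?thesis unfolding f1(2) .
qed

definition K :: "nat \<Rightarrow> nat \<Rightarrow> complex \<Rightarrow> complex" where
  "K j k z = cinner (cscale z (hb k) - M (hb k)) (cscale (cnj z) (hb j) - M (hb j))"

lemma P_mat_eq: "P_mat V n z = mat (Suc n) (Suc n) (\<lambda>(j, k). K j k z)"
  unfolding P_mat_def K_def by (rule cong_mat) (auto simp: P_mat_entry)

text \<open>\<open>cinner\<close> is conjugate linear in its second argument, where z enters
  conjugated; the entry is thus a polynomial in z.\<close>

lemma K_holomorphic: "K j k holomorphic_on S"
proof -
  have "K j k = (\<lambda>z. z * (z * cinner (hb k) (hb j)) - z * cinner (hb k) (M (hb j)) - (z * cinner (M (hb k)) (hb j) - cinner (M (hb k)) (M (hb j))))"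
    by (rule ext) (simp add: K_def cinner_diff_left cinner_diff_right cinner_cscale_left cinner_cscale_right algebra_simps)
  then show ?thesis by (simp only:) (intro holomorphic_intros)
qed

lemma K_form:
  assumes "U' = (\<Sum>k<Suc n. cscale (u k) (hb k))" "v = (\<Sum>j<Suc n. cscale (c j) (hb j))"
  shows "cinner (cscale z U' - M U') (cscale (cnj z) v - M v) = (\<Sum>j<Suc n. cnj (c j) * (\<Sum>k<Suc n. K j k z * u k))"
proof -
  have d: "cscale z (\<Sum>k<Suc n. cscale (u k) (hb k)) - M (\<Sum>k<Suc n. cscale (u k) (hb k)) =
      (\<Sum>k<Suc n. cscale (u k) (cscale z (hb k) - M (hb k)))" for u :: "nat \<Rightarrow> complex" and z
  proof -
    have "M (\<Sum>k<Suc n. cscale (u k) (hb k)) = (\<Sum>k<Suc n. cscale (u k) (M (hb k)))"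
      using D_M_sum[of "{..<Suc n}" "\<lambda>k. cscale (u k) (hb k)"] by (simp only: D_M_cscale[OF hb_D])
    then show ?thesis
      by (simp only: cscale_sum_right sum_subtractf[symmetric] cscale_diff_right cscale_cscale mult.commute[of z])
  qed
  show ?thesis
    unfolding assms d cinner_sum_left cinner_sum_right cinner_cscale_left cinner_cscale_right K_def sum_distrib_left
    by (simp only: mult_ac)
qed

text \<open>Without a zero of the determinant, the maximum principle would bound the solution at z =
  0, the first unit vector, by solutions of the same system on a large circle, where the quadratic
  term in z makes them small.\<close>

lemma Spec_P_nonempty: "\<exists>z. z \<in> Spec_P V n"
proof (rule ccontr)
  assume "\<nexists>z. z \<in> Spec_P V n"
  then have nz: "Determinant.det (mat (Suc n) (Suc n) (\<lambda>(j, k). K j k z)) \<noteq> 0" for z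
    by (simp add: Spec_P_def P_mat_eq)
  define m where "m = (\<Sum>k<Suc n. norm (M (hb k)))"
  define B where "B = (\<Sum>j<Suc n. norm (K j 0 0))"
  have m: "m \<ge> 0" "B \<ge> 0" by (simp_all add: m_def B_def sum_nonneg)
  \<comment> \<open>\<open>m\<close> bounds M on the span and \<open>B\<close> the right-hand side.
    This radius makes R^2 - 2 R m - m^2 at least 2 B + 1, so a solution on the circle has norm at
    most B / (2 B + 1).\<close>
  define R where "R = 4 * m + 2 * B + 2"
  have R: "R > 0" using m by (simp add: R_def)
  have "norm (\<Sum>i<Suc n. (if i = 0 then 1 else 0) * (if i = 0 then 1 else 0 :: complex)) \<le> 1 / 2"
  proof (rule linear_system_maximum_principle[where K = K and c = 0 and R = R and b = "\<lambda>j. K j 0 0"])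
    show "(\<Sum>k<Suc n. K j k 0 * (if k = 0 then 1 else 0)) = K j 0 0" for j
      by (simp add: if_distrib[of "\<lambda>x. _ * x"] sum.delta cong: if_cong del: sum.lessThan_Suc)
    fix z and u :: "nat \<Rightarrow> complex"
    assume z: "dist 0 z = R" and s: "\<And>j. j < Suc n \<Longrightarrow> (\<Sum>k<Suc n. K j k z * u k) = K j 0 0"
    define U' where "U' = (\<Sum>k<Suc n. cscale (u k) (hb k))"
    have uk: "norm (u k) \<le> norm U'" if "k < Suc n" for k
    proof -
      have "u k = cinner U' (hb k)" using cinner_hb_sum[of "{..<Suc n}" u k] that by (simp only: U'_def finite_lessThan lessThan_iff if_True)
      then show ?thesis using cinner_Cauchy_Schwarz[of U' "hb k"] by (simp add: norm_hb)
    qed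
    have MU: "M U' = (\<Sum>k<Suc n. cscale (u k) (M (hb k)))"
      using D_M_sum[of "{..<Suc n}" "\<lambda>k. cscale (u k) (hb k)"] by (simp only: U'_def D_M_cscale[OF hb_D])
    have mU: "norm (M U') \<le> m * norm U'"
    proof -
      have "norm (M U') \<le> (\<Sum>k<Suc n. norm (cscale (u k) (M (hb k))))" unfolding MU by (rule norm_sum)
      also have "\<dots> \<le> (\<Sum>k<Suc n. norm U' * norm (M (hb k)))"
        unfolding norm_cscale by (intro sum_mono mult_right_mono uk) auto
      finally show ?thesis by (simp only: m_def sum_distrib_left[symmetric] mult.commute)
    qed
    have e: "cinner (cscale z U' - M U') (cscale (cnj z) U' - M U') = (\<Sum>j<Suc n. cnj (u j) * K j 0 0)"
      unfolding K_form[OF U'_def U'_def] by (intro sum.cong refl) (simp only: s lessThan_iff)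
    have "norm (\<Sum>j<Suc n. cnj (u j) * K j 0 0) \<le> (\<Sum>j<Suc n. norm U' * norm (K j 0 0))"
      by (rule order_trans[OF norm_sum]) (auto simp: norm_mult simp del: sum.lessThan_Suc intro!: sum_mono mult_right_mono uk)
    then have r: "norm (\<Sum>j<Suc n. cnj (u j) * K j 0 0) \<le> B * norm U'" by (simp only: B_def sum_distrib_left[symmetric] mult.commute)
    define x where "x = norm U'"
    have x: "x \<ge> 0" by (simp add: x_def)
    have nz: "norm z = R" using z by (simp add: dist_norm)
    define t1 t2 where "t1 = cscale z U'" and "t2 = cscale (cnj z) U'"
    have n12: "norm t1 = R * x" "norm t2 = R * x" by (simp_all add: t1_def t2_def norm_cscale nz x_def)
    have "cinner t1 t2 = (z * z) * complex_of_real (x\<^sup>2)"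
      by (simp add: t1_def t2_def cinner_cscale_left cinner_cscale_right cinner_self x_def)
    then have c12: "norm (cinner t1 t2) = R * R * (x * x)" by (simp add: norm_mult nz power2_eq_square x)
    have ct: "cinner t1 t2 = cinner (t1 - M U') (t2 - M U') + cinner t1 (M U') + cinner (M U') t2 - cinner (M U') (M U')"
      by (simp add: cinner_diff_left cinner_diff_right)
    have "R * R * (x * x) \<le> norm (cinner (t1 - M U') (t2 - M U')) + norm (cinner t1 (M U')) + norm (cinner (M U') t2) + norm (cinner (M U') (M U'))"
      unfolding c12[symmetric] ct
      using norm_triangle_ineq4[of "cinner (t1 - M U') (t2 - M U') + cinner t1 (M U') + cinner (M U') t2" "cinner (M U') (M U')"]
        norm_triangle_ineq[of "cinner (t1 - M U') (t2 - M U') + cinner t1 (M U')" "cinner (M U') t2"]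
        norm_triangle_ineq[of "cinner (t1 - M U') (t2 - M U')" "cinner t1 (M U')"] by linarith
    also have "\<dots> \<le> B * x + (R * x) * (m * x) + (m * x) * (R * x) + (m * x) * (m * x)"
    proof (intro add_mono)
      show "norm (cinner (t1 - M U') (t2 - M U')) \<le> B * x" using r unfolding t1_def t2_def e x_def .
      have "m * x \<ge> 0" using m x by simp
      note mx = this and mU' = mU[folded x_def]
      show "norm (cinner t1 (M U')) \<le> (R * x) * (m * x)"
        by (rule order_trans[OF cinner_Cauchy_Schwarz]) (unfold n12, rule mult_left_mono[OF mU'], use R x in simp)
      show "norm (cinner (M U') t2) \<le> (m * x) * (R * x)"
        by (rule order_trans[OF cinner_Cauchy_Schwarz]) (unfold n12, rule mult_right_mono[OF mU'], use R x in simp)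
      show "norm (cinner (M U') (M U')) \<le> (m * x) * (m * x)"
        by (rule order_trans[OF cinner_Cauchy_Schwarz]) (rule mult_mono[OF mU' mU' mx norm_ge_zero])
    qed
    finally have "x * (R * R * x) \<le> x * (B + 2 * R * m * x + m * m * x)" by (simp add: algebra_simps)
    then have "x = 0 \<or> R * R * x \<le> B + 2 * R * m * x + m * m * x" using x by (simp add: mult_le_cancel_left) linarith
    then have "x * (R * R - 2 * R * m - m * m) \<le> B" using m by (auto simp: algebra_simps)
    moreover have "R * R - 2 * R * m - m * m \<ge> 2 * B + 1"
    proof -
      have "R * R - 2 * R * m - m * m = 7 * m * m + 12 * (m * B) + 12 * m + 4 * (B * B) + 8 * B + 4"
        by (simp add: R_def algebra_simps)
      then show ?thesis using m mult_nonneg_nonneg[OF m] mult_nonneg_nonneg[OF m(1) m(1)] mult_nonneg_nonneg[OF m(2) m(2)] by linarith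
    qed
    ultimately have "x * (2 * B + 1) \<le> B" using x by (meson mult_left_mono order_trans)
    then have "x * (2 * B + 1) \<le> 1 / 2 * (2 * B + 1)" by simp
    then have "x \<le> 1 / 2" by (rule mult_right_le_imp_le) (use m(2) in simp)
    then show "norm (\<Sum>i<Suc n. (if i = 0 then 1 else 0) * u i) \<le> 1 / 2"
      using uk[of 0] unfolding x_def[symmetric]
      by (simp add: if_distrib[of "\<lambda>y. y * _"] sum.delta cong: if_cong del: sum.lessThan_Suc)
  qed (use K_holomorphic R nz in auto)
  then show False by (simp add: sum.delta if_distrib[of "\<lambda>y. y * _"] cong: if_cong del: sum.lessThan_Suc)
qed

end

section \<open>Zeros near an eigenvalue\<close>

context eigen_op begin

definition N :: "l2 \<Rightarrow> l2" where "N w = M w - cscale (of_real lam) w"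

lemma N_add: "v \<in> D \<Longrightarrow> w \<in> D \<Longrightarrow> N (v + w) = N v + N w"
  by (simp add: N_def D_M_add cscale_add_right)

lemma N_diff: "v \<in> D \<Longrightarrow> w \<in> D \<Longrightarrow> N (v - w) = N v - N w"
  by (simp add: N_def D_M_diff cscale_diff_right)

lemma N_cscale: "v \<in> D \<Longrightarrow> N (cscale c v) = cscale c (N v)"
  by (simp add: N_def D_M_cscale cscale_diff_right mult.commute)

lemma N_symmetric: "v \<in> D \<Longrightarrow> w \<in> D \<Longrightarrow> cinner (N v) w = cinner v (N w)"
  by (simp add: N_def M_symmetric cinner_diff_left cinner_diff_right cinner_cscale_left cinner_cscale_right)

lemma N_e: "N e = 0"
  by (simp add: N_def eigenvector)

lemma shift_N: "cscale z w - M w = cscale (z - of_real lam) w - N w"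
  by (simp add: N_def cscale_diff_left)

lemma cinner_e_self: "cinner e e = 1"
  by (simp add: cinner_self norm_1)

text \<open>For \<open>\<alpha> = \<langle>U', e\<rangle>\<close> and \<open>c = \<zeta>\<^sup>2 / |\<zeta>|\<^sup>2\<close>, the test vector \<open>U' + (c - 1) \<alpha> p\<close> turns the form \<open>\<zeta>\<^sup>2 |\<alpha>|\<^sup>2\<close> of the component along
  \<open>e\<close> into \<open>|\<zeta>|\<^sup>2 |\<alpha>|\<^sup>2\<close> while the component orthogonal to \<open>e\<close> is kept; both parts are then
  coercive.\<close>

lemma form_estimate:
  assumes UD: "U' \<in> D" and pD: "p \<in> D" and \<zeta>: "norm \<zeta> = 20 * \<epsilon>" and \<epsilon>: "\<epsilon> > 0" "20 * \<epsilon> \<le> \<delta> / 4" "20 * \<epsilon> \<le> 1"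
    and r: "norm (e - p) \<le> \<epsilon>" "norm (N (e - p)) \<le> \<epsilon>"
    and eq: "\<And>c. cinner (cscale \<zeta> U' - N U') (cscale (cnj \<zeta>) (U' + cscale c p) - N (U' + cscale c p)) = cinner (N p) (N (U' + cscale c p))"
  shows "norm (cinner U' e) \<le> 1 / 2"
proof (rule ccontr)
  define \<alpha> where "\<alpha> = cinner U' e"
  define A where "A = norm \<alpha>"
  assume "\<not> norm (cinner U' e) \<le> 1 / 2"
  then have A: "A > 1 / 2" by (simp add: A_def \<alpha>_def)
  define w where "w = U' - cscale \<alpha> e"
  define r where "r = e - p"
  define X where "X = norm (N w)"
  define \<tau> where "\<tau> = 20 * \<epsilon>"
  have \<tau>: "norm \<zeta> = \<tau>" "\<tau> > 0" "\<tau> \<le> 1" "\<tau> \<le> \<delta> / 4" using \<zeta> \<epsilon> by (auto simp: \<tau>_def)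
  have eD: "e \<in> D" by (rule eigenvector)
  have wD: "w \<in> D" unfolding w_def by (intro D_M_diff UD D_M_cscale eD)
  have rD: "r \<in> D" unfolding r_def by (intro D_M_diff pD eD)
  have we: "cinner w e = 0" by (simp add: w_def cinner_diff_left cinner_cscale_left cinner_e_self \<alpha>_def)
  have NU: "N U' = N w" unfolding w_def by (simp add: N_diff UD D_M_cscale eD N_cscale N_e)
  have Np: "N p = - N r" unfolding r_def by (simp add: N_diff eD pD N_e)
  have X0: "X \<ge> 0" by (simp add: X_def)
  \<comment> \<open>\<tau> is at most a quarter of the gap, so on the complement the shift by
    \<zeta> is a small perturbation of N.\<close>
  have tw: "\<tau> * norm w \<le> X / 4"
  proof -
    have "\<tau> * norm w \<le> \<delta> / 4 * norm w" using \<tau> by (intro mult_right_mono) auto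
    also have "\<dots> \<le> X / 4" using spectral_gap[OF wD we] by (simp add: X_def N_def)
    finally show ?thesis .
  qed
  define c where "c = \<zeta>\<^sup>2 / complex_of_real (\<tau>\<^sup>2)"
  have cn: "norm c = 1" using \<tau> by (simp add: c_def norm_divide norm_power)
  have cz: "\<zeta>\<^sup>2 * cnj c = complex_of_real (\<tau>\<^sup>2)"
  proof -
    have "\<zeta>\<^sup>2 * cnj (\<zeta>\<^sup>2) = complex_of_real (\<tau>\<^sup>2) * complex_of_real (\<tau>\<^sup>2)"
      unfolding complex_norm_square[symmetric] norm_power \<tau> by (simp add: power2_eq_square)
    moreover have "complex_of_real (\<tau>\<^sup>2) \<noteq> 0" using \<tau> by simp
    ultimately show ?thesis unfolding c_def complex_cnj_divide complex_cnj_complex_of_real times_divide_eq_right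
      by (simp only: nonzero_mult_div_cancel_left not_False_eq_True)
  qed
  define \<beta> where "\<beta> = (c - 1) * \<alpha>"
  have \<beta>: "norm \<beta> \<le> 2 * A"
    unfolding \<beta>_def norm_mult A_def using norm_triangle_ineq4[of c 1] cn by (intro mult_right_mono) auto
  \<comment> \<open>Only multiples of p = e - r may be added to U'. The component along e becomes c
    \<alpha> as wanted, and the price is the error term with r.\<close>
  define v where "v = U' + cscale \<beta> p"
  have v: "v = cscale (c * \<alpha>) e + w - cscale \<beta> r"
    by (simp add: v_def w_def r_def \<beta>_def cscale_diff_right left_diff_distrib cscale_diff_left)
  have Nv: "N v = N w - cscale \<beta> (N r)"
    unfolding v by (simp add: N_diff N_add N_cscale wD rD eD D_M_cscale D_M_add N_e)
  define s s' q where "s = cscale \<zeta> w - N w" and "s' = cscale (cnj \<zeta>) w - N w" and "q = cscale (cnj \<zeta>) r - N r"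
  have L: "cscale \<zeta> U' - N U' = cscale (\<zeta> * \<alpha>) e + s"
    unfolding NU s_def by (simp add: w_def cscale_diff_right)
  have R: "cscale (cnj \<zeta>) v - N v = cscale (cnj \<zeta> * (c * \<alpha>)) e + s' - cscale \<beta> q"
    unfolding Nv unfolding v s'_def q_def by (simp add: cscale_diff_right cscale_add_right mult.commute)
  have Nwe: "cinner (N w) e = 0" by (simp add: N_symmetric[OF wD eD] N_e)
  \<comment> \<open>w and the range of N are orthogonal to e, so the form splits into its part along
    e and its part on the complement.\<close>
  have se: "cinner s e = 0" "cinner e s' = 0"
  proof -
    show "cinner s e = 0" by (simp add: s_def cinner_diff_left cinner_cscale_left we Nwe)
    have "cinner s' e = 0" by (simp add: s'_def cinner_diff_left cinner_cscale_left we Nwe)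
    then show "cinner e s' = 0" using cinner_commute[of s' e] by simp
  qed
  have form: "cinner (cscale (\<zeta> * \<alpha>) e + s) (cscale (cnj \<zeta> * (c * \<alpha>)) e + s' - cscale \<beta> q) = cinner (N p) (N v)"
    unfolding L[symmetric] R[symmetric] v_def by (rule eq)
  have "cinner (cscale (\<zeta> * \<alpha>) e + s) (cscale (cnj \<zeta> * (c * \<alpha>)) e + s' - cscale \<beta> q) =
      (\<zeta>\<^sup>2 * cnj c) * (\<alpha> * cnj \<alpha>) + cinner s s' - cnj \<beta> * cinner (cscale (\<zeta> * \<alpha>) e + s) q"
    unfolding cinner_diff_right cinner_cscale_right
    by (simp add: cinner_add_left cinner_add_right cinner_cscale_left cinner_cscale_right se cinner_e_self power2_eq_square algebra_simps)
  then have "complex_of_real (\<tau>\<^sup>2) * complex_of_real (A\<^sup>2) + cinner s s' = cnj \<beta> * cinner (cscale (\<zeta> * \<alpha>) e + s) q + cinner (N p) (N v)"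
    unfolding form cz complex_norm_square[symmetric] A_def by (simp add: algebra_simps)
  then have "Re (complex_of_real (\<tau>\<^sup>2) * complex_of_real (A\<^sup>2) + cinner s s') = Re (cnj \<beta> * cinner (cscale (\<zeta> * \<alpha>) e + s) q + cinner (N p) (N v))"
    by (rule arg_cong)
  then have "\<tau>\<^sup>2 * A\<^sup>2 + Re (cinner s s') = Re (cnj \<beta> * cinner (cscale (\<zeta> * \<alpha>) e + s) q + cinner (N p) (N v))"
    unfolding of_real_mult[symmetric] plus_complex.sel(1) Re_complex_of_real .
  also have "\<dots> \<le> norm (cnj \<beta> * cinner (cscale (\<zeta> * \<alpha>) e + s) q + cinner (N p) (N v))"
    by (rule complex_Re_le_cmod)
  also have "\<dots> \<le> norm \<beta> * norm (cinner (cscale (\<zeta> * \<alpha>) e + s) q) + norm (cinner (N p) (N v))"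
    using norm_triangle_ineq[of "cnj \<beta> * cinner (cscale (\<zeta> * \<alpha>) e + s) q" "cinner (N p) (N v)"] by (simp add: norm_mult)
  also have "\<dots> \<le> 2 * A * ((\<tau> * A + 2 * X) * (2 * \<epsilon>)) + \<epsilon> * (X + 2 * A * \<epsilon>)"
  proof (rule add_mono)
    have "norm s \<le> norm (cscale \<zeta> w) + norm (N w)" unfolding s_def by (rule norm_triangle_ineq4)
    also have "\<dots> \<le> 2 * X" using tw X0 unfolding norm_cscale \<tau>(1) X_def[symmetric] by linarith
    finally have sX: "norm s \<le> 2 * X" .
    have "norm (cscale (\<zeta> * \<alpha>) e + s) \<le> norm (cscale (\<zeta> * \<alpha>) e) + norm s" by (rule norm_triangle_ineq)
    also have "\<dots> \<le> \<tau> * A + 2 * X" using sX unfolding norm_cscale norm_mult \<tau>(1) A_def[symmetric] norm_1 by simp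
    finally have l: "norm (cscale (\<zeta> * \<alpha>) e + s) \<le> \<tau> * A + 2 * X" .
    have "norm q \<le> norm (cscale (cnj \<zeta>) r) + norm (N r)" unfolding q_def by (rule norm_triangle_ineq4)
    also have "\<dots> \<le> 1 * \<epsilon> + \<epsilon>"
      unfolding norm_cscale complex_mod_cnj \<tau>(1) r_def using assms(7,8) \<tau> by (intro add_mono mult_mono) auto
    finally have nq: "norm q \<le> 2 * \<epsilon>" by simp
    have nn: "0 \<le> \<tau> * A + 2 * X" using \<tau> A X0 by simp
    have "norm (cinner (cscale (\<zeta> * \<alpha>) e + s) q) \<le> (\<tau> * A + 2 * X) * (2 * \<epsilon>)"
      by (rule order_trans[OF cinner_Cauchy_Schwarz mult_mono[OF l nq nn norm_ge_zero]])
    then show "norm \<beta> * norm (cinner (cscale (\<zeta> * \<alpha>) e + s) q) \<le> 2 * A * ((\<tau> * A + 2 * X) * (2 * \<epsilon>))"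
      by (rule mult_mono[OF \<beta>]) (use A in auto)
    have nr: "norm (N r) \<le> \<epsilon>" using assms(8) by (simp add: r_def)
    have "norm (N v) \<le> norm (N w) + norm (cscale \<beta> (N r))" unfolding Nv by (rule norm_triangle_ineq4)
    also have "\<dots> \<le> X + 2 * A * \<epsilon>"
      unfolding norm_cscale X_def[symmetric] by (intro add_left_mono mult_mono \<beta> nr) (use A in auto)
    finally have nv: "norm (N v) \<le> X + 2 * A * \<epsilon>" .
    have np: "norm (N p) \<le> \<epsilon>" unfolding Np norm_minus_cancel by (rule nr)
    show "norm (cinner (N p) (N v)) \<le> \<epsilon> * (X + 2 * A * \<epsilon>)"
      by (rule order_trans[OF cinner_Cauchy_Schwarz mult_mono[OF np nv _ norm_ge_zero]]) (use \<epsilon> in simp)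
  qed
  finally have main: "\<tau>\<^sup>2 * A\<^sup>2 + Re (cinner s s') \<le> 2 * A * ((\<tau> * A + 2 * X) * (2 * \<epsilon>)) + \<epsilon> * (X + 2 * A * \<epsilon>)" .
  \<comment> \<open>7/16 = 1 - 1/16 - 1/4 - 1/4: the square of N w minus the terms that contain the
    shift once or twice.\<close>
  have "7 / 16 * X\<^sup>2 \<le> Re (cinner s s')"
  proof -
    define a1 a2 a3 where "a1 = cinner (cscale \<zeta> w) (cscale (cnj \<zeta>) w)" and "a2 = cinner (cscale \<zeta> w) (N w)" and "a3 = cinner (N w) (cscale (cnj \<zeta>) w)"
    have "cinner s s' = a1 - a2 - a3 + cinner (N w) (N w)"
      by (simp add: s_def s'_def a1_def a2_def a3_def cinner_diff_left cinner_diff_right)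
    then have ee: "Re (cinner s s') = Re a1 - Re a2 - Re a3 + X\<^sup>2" by (simp add: cinner_self X_def)
    have nz: "norm (cscale \<zeta> w) \<le> X / 4" "norm (cscale (cnj \<zeta>) w) \<le> X / 4"
      using tw by (simp_all add: norm_cscale \<tau>)
    have X4: "0 \<le> X / 4" using X0 by simp
    have b1: "norm a1 \<le> X / 4 * (X / 4)" unfolding a1_def
      by (rule order_trans[OF cinner_Cauchy_Schwarz mult_mono[OF nz X4 norm_ge_zero]])
    have b2: "norm a2 \<le> X / 4 * X" unfolding a2_def X_def
      by (rule order_trans[OF cinner_Cauchy_Schwarz mult_right_mono[OF nz(1)[unfolded X_def] norm_ge_zero]])
    have b3: "norm a3 \<le> X * (X / 4)" unfolding a3_def X_def
      by (rule order_trans[OF cinner_Cauchy_Schwarz mult_left_mono[OF nz(2)[unfolded X_def] norm_ge_zero]])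
    have "Re a1 \<ge> - (X / 4 * (X / 4))" "Re a2 \<le> X / 4 * X" "Re a3 \<le> X * (X / 4)"
      using b1 b2 b3 abs_Re_le_cmod[of a1] complex_Re_le_cmod[of a2] complex_Re_le_cmod[of a3] by linarith+
    then show ?thesis unfolding ee by (simp add: power2_eq_square)
  qed
  then have "400 * \<epsilon>\<^sup>2 * A\<^sup>2 + 7 / 16 * X\<^sup>2 \<le> 80 * \<epsilon>\<^sup>2 * A\<^sup>2 + 8 * \<epsilon> * A * X + \<epsilon> * X + 2 * A * \<epsilon>\<^sup>2"
    using main unfolding \<tau>_def by (simp add: power2_eq_square algebra_simps)
  \<comment> \<open>By A > 1/2 the terms of lower degree in A are raised, so that everything becomes
    quadratic in \<epsilon> A and X.\<close>
  moreover have "\<epsilon> * X \<le> 2 * A * (\<epsilon> * X)"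
    using mult_right_mono[of 1 "2 * A" "\<epsilon> * X"] A \<epsilon> X0 by simp
  moreover have "2 * A * \<epsilon>\<^sup>2 \<le> 2 * A * (2 * A * \<epsilon>\<^sup>2)"
    using mult_right_mono[of 1 "2 * A" "2 * A * \<epsilon>\<^sup>2"] A \<epsilon> by simp
  ultimately have "316 * (\<epsilon> * A)\<^sup>2 + 7 / 16 * X\<^sup>2 \<le> 10 * (\<epsilon> * A) * X"
    by (simp add: power2_eq_square algebra_simps)
  \<comment> \<open>This is where the factor 20 is decided: of its square 400 there remains 316
    against the 100 from completing the square, while 7/16 exceeds 1/4.\<close>
  moreover have "0 \<le> (X / 2 - 10 * (\<epsilon> * A))\<^sup>2" by simp
  then have "10 * (\<epsilon> * A) * X \<le> X\<^sup>2 / 4 + 100 * (\<epsilon> * A)\<^sup>2" by (simp add: power2_eq_square algebra_simps)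
  moreover have "0 < (\<epsilon> * A)\<^sup>2" using A \<epsilon> by simp
  moreover have "0 \<le> X\<^sup>2" by simp
  ultimately show False by linarith
qed

text \<open>The functional of pairing with e is at most 1/2 for solutions on the circle by
  \<open>form_estimate\<close>, yet close to 1 for the solution p at the centre, so the determinant
  must vanish inside.\<close>

lemma zero_near:
  assumes r: "norm (e - proj n e) \<le> \<epsilon>" "norm (N (e - proj n e)) \<le> \<epsilon>"
    and \<epsilon>: "\<epsilon> > 0" "20 * \<epsilon> \<le> \<delta> / 4" "20 * \<epsilon> \<le> 1"
  shows "\<exists>z\<in>Spec_P V n. norm (z - of_real lam) \<le> 20 * \<epsilon>"
proof (rule ccontr)
  assume "\<not> (\<exists>z\<in>Spec_P V n. norm (z - of_real lam) \<le> 20 * \<epsilon>)"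
  then have nz: "Determinant.det (mat (Suc n) (Suc n) (\<lambda>(j, k). K j k z)) \<noteq> 0" if "dist (complex_of_real lam) z \<le> 20 * \<epsilon>" for z
    using that by (auto simp: Spec_P_def P_mat_eq dist_norm norm_minus_commute)
  define u0 where "u0 k = cinner e (hb k)" for k
  define y where "y k = cinner (hb k) e" for k
  \<comment> \<open>The coordinates of P_n(lam) applied to the projection; at the centre the system
    is solved by the coefficients \<open>u0\<close>.\<close>
  define b where "b j = (\<Sum>k<Suc n. K j k (of_real lam) * u0 k)" for j
  have p: "proj n e = (\<Sum>k<Suc n. cscale (u0 k) (hb k))" by (simp only: proj_def u0_def lessThan_Suc_atMost)
  have y: "(\<Sum>k<Suc n. y k * u k) = cinner (\<Sum>k<Suc n. cscale (u k) (hb k)) e" for u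
    unfolding y_def cinner_sum_left cinner_cscale_left by (simp only: mult.commute)
  have "norm (\<Sum>k<Suc n. y k * u0 k) \<le> 1 / 2"
  proof (rule linear_system_maximum_principle[where K = K and c = "of_real lam" and R = "20 * \<epsilon>" and b = b])
    show "K j k holomorphic_on UNIV" for j k by (rule K_holomorphic)
    show "20 * \<epsilon> > 0" using \<epsilon> by simp
    show "Determinant.det (mat (Suc n) (Suc n) (\<lambda>(j, k). K j k z)) \<noteq> 0" if "dist (complex_of_real lam) z \<le> 20 * \<epsilon>" for z
      by (rule nz[OF that])
    show "(\<Sum>k<Suc n. K j k (of_real lam) * u0 k) = b j" for j by (simp only: b_def)
    fix z and u :: "nat \<Rightarrow> complex"
    assume z: "dist (complex_of_real lam) z = 20 * \<epsilon>" and s: "\<And>j. j < Suc n \<Longrightarrow> (\<Sum>k<Suc n. K j k z * u k) = b j"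
    define U' where "U' = (\<Sum>k<Suc n. cscale (u k) (hb k))"
    have UD: "U' \<in> D" unfolding U'_def by (rule conjunct1[OF D_M_sum]) (rule D_M_cscale(1)[OF hb_D])
    show "norm (\<Sum>k<Suc n. y k * u k) \<le> 1 / 2"
      unfolding y U'_def[symmetric]
    proof (rule form_estimate[OF UD proj_D _ \<epsilon> r])
      show "norm (z - of_real lam) = 20 * \<epsilon>" using z by (simp add: dist_norm norm_minus_commute)
      fix c
      \<comment> \<open>v lies in the Hermite span, so pairing the system with it gives the same
        value as the form at lam, where the shift has disappeared.\<close>
      define v where "v = U' + cscale c (proj n e)"
      have v: "v = (\<Sum>k<Suc n. cscale (u k + c * u0 k) (hb k))"
        unfolding v_def p U'_def cscale_sum_right cscale_add_left cscale_cscale sum.distrib ..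
      have "cinner (cscale z U' - M U') (cscale (cnj z) v - M v) = (\<Sum>j<Suc n. cnj (u j + c * u0 j) * b j)"
        unfolding K_form[OF U'_def v] by (intro sum.cong refl) (simp only: s lessThan_iff)
      also have "\<dots> = cinner (cscale (of_real lam) (proj n e) - M (proj n e)) (cscale (cnj (of_real lam)) v - M v)"
        unfolding K_form[OF p v] b_def ..
      also have "\<dots> = cinner (N (proj n e)) (N v)"
        unfolding complex_cnj_complex_of_real shift_N by (simp add: cinner_minus_left cinner_minus_right)
      finally show "cinner (cscale (z - of_real lam) U' - N U') (cscale (cnj (z - of_real lam)) (U' + cscale c (proj n e)) - N (U' + cscale c (proj n e)))
          = cinner (N (proj n e)) (N (U' + cscale c (proj n e)))"
        unfolding v_def[symmetric] shift_N complex_cnj_diff complex_cnj_complex_of_real .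
    qed
  qed
  then have h: "norm (cinner (proj n e) e) \<le> 1 / 2" unfolding y p[symmetric] .
  \<comment> \<open>As \<epsilon> is at most 1/20, the projection has a component along e larger
    than 1/2.\<close>
  have "1 = norm (cinner (proj n e) e + cinner (e - proj n e) e)" by (simp add: cinner_diff_left cinner_e_self)
  also have "\<dots> \<le> norm (cinner (proj n e) e) + norm (cinner (e - proj n e) e)" by (rule norm_triangle_ineq)
  also have "\<dots> \<le> 1 / 2 + \<epsilon>"
    using h r(1) cinner_Cauchy_Schwarz[of "e - proj n e" e] unfolding norm_1 by linarith
  finally show False using \<epsilon> by simp
qed

end

section \<open>Rate of convergence\<close>

definition poly_growth :: "(real \<Rightarrow> complex) \<Rightarrow> bool" where
  "poly_growth f \<longleftrightarrow> (\<exists>C k. \<forall>x. norm (f x) \<le> C * (1 + x\<^sup>2) ^ k)"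

lemma one_le_weight: "1 \<le> (1 + x\<^sup>2 :: real) ^ k"
  by (rule one_le_power) simp

lemma poly_growth_E:
  assumes "poly_growth f" obtains C k where "C \<ge> 0" "\<And>x. norm (f x) \<le> C * (1 + x\<^sup>2) ^ k"
proof -
  obtain C k where C: "\<And>x. norm (f x) \<le> C * (1 + x\<^sup>2) ^ k" using assms by (auto simp: poly_growth_def)
  have "C \<ge> 0" using order_trans[OF norm_ge_zero C[of 0]] by simp
  then show ?thesis using C that by blast
qed

lemma poly_growth_add:
  assumes "poly_growth f" "poly_growth g" shows "poly_growth (\<lambda>x. f x + g x)"
proof -
  obtain C k where C: "C \<ge> 0" "\<And>x. norm (f x) \<le> C * (1 + x\<^sup>2) ^ k" by (rule poly_growth_E[OF assms(1)]) (rule that)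
  obtain B l where B: "B \<ge> 0" "\<And>x. norm (g x) \<le> B * (1 + x\<^sup>2) ^ l" by (rule poly_growth_E[OF assms(2)]) (rule that)
  have "norm (f x + g x) \<le> (C + B) * (1 + x\<^sup>2) ^ (k + l)" for x
  proof -
    have "(1 + x\<^sup>2) ^ k \<le> (1 + x\<^sup>2) ^ (k + l)" "(1 + x\<^sup>2) ^ l \<le> (1 + x\<^sup>2) ^ (k + l)" by (rule power_increasing; simp)+
    then have "C * (1 + x\<^sup>2) ^ k + B * (1 + x\<^sup>2) ^ l \<le> C * (1 + x\<^sup>2) ^ (k + l) + B * (1 + x\<^sup>2) ^ (k + l)"
      using C(1) B(1) by (intro add_mono mult_left_mono)
    then show ?thesis using norm_triangle_ineq[of "f x" "g x"] C(2)[of x] B(2)[of x] unfolding distrib_right by linarith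
  qed
  then show ?thesis unfolding poly_growth_def by blast
qed

lemma poly_growth_mult:
  assumes "poly_growth f" "poly_growth g" shows "poly_growth (\<lambda>x. f x * g x)"
proof -
  obtain C k where C: "C \<ge> 0" "\<And>x. norm (f x) \<le> C * (1 + x\<^sup>2) ^ k" by (rule poly_growth_E[OF assms(1)]) (rule that)
  obtain B l where B: "B \<ge> 0" "\<And>x. norm (g x) \<le> B * (1 + x\<^sup>2) ^ l" by (rule poly_growth_E[OF assms(2)]) (rule that)
  have "norm (f x * g x) \<le> (C * B) * (1 + x\<^sup>2) ^ (k + l)" for x
  proof -
    have "norm (f x) * norm (g x) \<le> (C * (1 + x\<^sup>2) ^ k) * (B * (1 + x\<^sup>2) ^ l)"
      using C(1) by (intro mult_mono C(2) B(2)) auto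
    then show ?thesis by (simp add: norm_mult power_add mult_ac)
  qed
  then show ?thesis unfolding poly_growth_def by blast
qed

text \<open>Integration from 0 to x costs a factor |x|, which is at most 1 + x^2.\<close>

lemma poly_growth_antideriv:
  assumes F: "antideriv F f" and c: "continuous_on UNIV f" and f: "poly_growth f"
  shows "poly_growth F"
proof -
  obtain C k where C: "C \<ge> 0" "\<And>x. norm (f x) \<le> C * (1 + x\<^sup>2) ^ k" by (rule poly_growth_E[OF f]) (rule that)
  have "norm (F x) \<le> (norm (F 0) + C) * (1 + x\<^sup>2) ^ Suc k" for x
  proof -
    have b: "norm (F b - F a) \<le> C * (1 + x\<^sup>2) ^ k * (b - a)" if "a \<le> b" "\<And>t. t \<in> {a..b} \<Longrightarrow> \<bar>t\<bar> \<le> \<bar>x\<bar>" for a b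
      unfolding antiderivD[OF F that(1)]
    proof (rule integral_bound[OF that(1)])
      show "continuous_on {a..b} f" using c continuous_on_subset by blast
      fix t assume "t \<in> {a..b}"
      then have "t\<^sup>2 \<le> x\<^sup>2" using that(2) by (simp only: abs_le_square_iff)
      then have "C * (1 + t\<^sup>2) ^ k \<le> C * (1 + x\<^sup>2) ^ k" using C(1) by (intro mult_left_mono power_mono) auto
      then show "norm (f t) \<le> C * (1 + x\<^sup>2) ^ k" using C(2)[of t] by linarith
    qed
    have "norm (F x - F 0) \<le> C * (1 + x\<^sup>2) ^ k * \<bar>x\<bar>"
      using b[of 0 x] b[of x 0] by (cases "0 \<le> x") (auto simp: norm_minus_commute)
    also have "\<dots> \<le> C * (1 + x\<^sup>2) ^ k * (1 + x\<^sup>2)"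
    proof (rule mult_left_mono)
      have "0 \<le> (\<bar>x\<bar> - 1)\<^sup>2 + x\<^sup>2" by simp
      then show "\<bar>x\<bar> \<le> 1 + x\<^sup>2" by (simp add: power2_eq_square algebra_simps)
      show "0 \<le> C * (1 + x\<^sup>2) ^ k" using C(1) by simp
    qed
    finally have "norm (F x - F 0) \<le> C * (1 + x\<^sup>2) ^ Suc k" by (simp add: mult_ac)
    moreover have "norm (F 0) * 1 \<le> norm (F 0) * (1 + x\<^sup>2) ^ Suc k"
      by (rule mult_left_mono[OF one_le_weight norm_ge_zero])
    ultimately show ?thesis using norm_triangle_ineq[of "F x - F 0" "F 0"] unfolding distrib_right by simp
  qed
  then show ?thesis unfolding poly_growth_def by blast
qed

text \<open>Functions of class C^k whose k-th derivative has polynomial growth. Boundedness is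
  assumed for the derivative of order q of \<open>V\<close>; integration then controls the lower
  derivatives up to powers of x, and the decay of the eigenfunction tolerates such growth.\<close>

fun tempered :: "nat \<Rightarrow> (real \<Rightarrow> complex) \<Rightarrow> bool" where
  "tempered 0 f \<longleftrightarrow> continuous_on UNIV f \<and> poly_growth f"
| "tempered (Suc k) f \<longleftrightarrow> (\<exists>f'. antideriv f f' \<and> tempered k f')"

lemma tempered_growth: "tempered k f \<Longrightarrow> continuous_on UNIV f \<and> poly_growth f"
proof (induction k arbitrary: f)
  case (Suc k)
  then obtain f' where f': "antideriv f f'" "tempered k f'" by auto
  have "continuous_on UNIV f'" "poly_growth f'" using Suc.IH[OF f'(2)] by auto
  then show ?case using antideriv_continuous[OF f'(1)] poly_growth_antideriv[OF f'(1)] by simp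
qed simp

lemma tempered_SucD: "tempered (Suc k) f \<Longrightarrow> tempered k f"
proof (induction k arbitrary: f)
  case 0 then show ?case using tempered_growth[of "Suc 0" f] by simp
next
  case (Suc k)
  obtain f' where f': "antideriv f f'" "tempered (Suc k) f'" using Suc.prems by auto
  then have "tempered k f'" using Suc.IH by simp
  then show ?case using f' by auto
qed

lemma tempered_mono: "tempered k f \<Longrightarrow> j \<le> k \<Longrightarrow> tempered j f"
proof (induction k)
  case (Suc k) then show ?case using tempered_SucD[of k f] by (cases "j = Suc k") (simp_all del: tempered.simps)
qed simp

lemma tempered_add: "tempered k f \<Longrightarrow> tempered k g \<Longrightarrow> tempered k (\<lambda>x. f x + g x)"
proof (induction k arbitrary: f g)
  case 0 then show ?case by (auto intro: continuous_on_add poly_growth_add)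
next
  case (Suc k)
  then obtain f' g' where "antideriv f f'" "tempered k f'" "antideriv g g'" "tempered k g'" by auto
  then show ?case using antideriv_add Suc.IH by fastforce
qed

lemma tempered_mult: "tempered k f \<Longrightarrow> tempered k g \<Longrightarrow> tempered k (\<lambda>x. f x * g x)"
proof (induction k arbitrary: f g)
  case 0 then show ?case by (auto intro: continuous_on_mult poly_growth_mult)
next
  case (Suc k)
  then obtain f' g' where d: "antideriv f f'" "tempered k f'" "antideriv g g'" "tempered k g'" by auto
  have "tempered k (\<lambda>x. f' x * g x + f x * g' x)"
    by (intro tempered_add Suc.IH d tempered_SucD[OF Suc.prems(1)] tempered_SucD[OF Suc.prems(2)])
  then show ?case using antideriv_mult[OF d(1,3)] by auto
qed

lemma tempered_const: "tempered k (\<lambda>x. c)"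
proof (induction k arbitrary: c)
  case 0
  have "\<forall>x::real. norm c \<le> norm c * (1 + x\<^sup>2) ^ 0" by simp
  then show ?case unfolding tempered.simps poly_growth_def using continuous_on_const by blast
next
  case (Suc k) then show ?case using antideriv_const[of c] by (auto intro!: exI[of _ "\<lambda>x. 0"])
qed

lemma tempered_minus: "tempered k f \<Longrightarrow> tempered k (\<lambda>x. - f x)"
  using tempered_mult[OF tempered_const[of k "-1"]] by simp

lemma tempered_square: "tempered k (\<lambda>x. complex_of_real (x\<^sup>2))"
proof -
  have "antideriv (\<lambda>x. complex_of_real x) (\<lambda>x. complex_of_real 1)"
    by (rule antideriv_of_real) (auto intro!: derivative_eq_intros)
  then have "tempered (Suc k) (\<lambda>x. complex_of_real x)" using tempered_const by auto
  then have "tempered k (\<lambda>x. complex_of_real x)" by (rule tempered_SucD)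
  from tempered_mult[OF this this] show ?thesis by (simp add: power2_eq_square)
qed

text \<open>Weak derivatives are peeled off one at a time; each passage to a primitive raises the
  order by one.\<close>

lemma weak_deriv_tempered:
  fixes f :: "real \<Rightarrow> complex"
  assumes "has_weak_deriv k f g" "tempered j g"
  shows "\<exists>f0. (AE x in lebesgue. f x = f0 x) \<and> tempered (k + j) f0"
  using assms
proof (induction k arbitrary: g j)
  case 0 then show ?case using has_weak_deriv_0_AE[OF 0(1)] by auto
next
  case (Suc k)
  obtain G where G: "antideriv G g" "has_weak_deriv k f G" by (rule has_weak_deriv_SucE[OF Suc.prems(1)]) (rule that)
  have "tempered (Suc j) G" using G(1) Suc.prems(2) by auto
  from Suc.IH[OF G(2) this] show ?case by simp
qed

lemma (in schroedinger_op) U_tempered: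
  assumes g: "has_weak_deriv q V g" "continuous_on UNIV g" "bounded (range g)"
  shows "tempered q U"
proof -
  obtain C where C: "\<And>x. norm (g x) \<le> C" using g(3) by (auto simp: bounded_iff)
  have "\<forall>x. norm (complex_of_real (g x)) \<le> C * (1 + x\<^sup>2) ^ 0" using C by simp
  then have "tempered 0 (\<lambda>x. complex_of_real (g x))"
    unfolding tempered.simps poly_growth_def using continuous_on_of_real[OF g(2)] by blast
  from weak_deriv_tempered[OF has_weak_deriv_of_real[OF g(1)] this]
  obtain f0 where f0: "AE x in lebesgue. complex_of_real (V x) = f0 x" "tempered q f0" by auto
  have "AE x in lebesgue. U x = f0 x" using f0(1) U_AE by eventually_elim simp
  then have "U = f0" by (rule continuous_AE_eq[OF U_continuous(1) conjunct1[OF tempered_growth[OF f0(2)]]])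
  then show ?thesis using f0(2) by simp
qed

section \<open>Functions generated by the eigenfunction and its derivative\<close>

context eigen_op begin

text \<open>Since \<phi>1' = (U - lam) \<phi>, combinations of \<phi> and \<phi>1 stay of this form
  under differentiation, with one order of smoothness of the coefficients lost each time.
  Multiplication by x^2 loses none.\<close>

definition span_class :: "nat \<Rightarrow> (real \<Rightarrow> complex) \<Rightarrow> bool" where
  "span_class k f \<longleftrightarrow> (\<exists>a b. tempered k a \<and> tempered k b \<and> f = (\<lambda>x. a x * \<phi> x + b x * \<phi>1 x))"

text \<open>a f = (a / h) (h f) with h = (1 + x^2)^l: the quotient is bounded, and h f is a
  combination of even powers of x times f.\<close>

lemma tempered_mult_Lp2:
  assumes a: "tempered k a" and d: "\<And>k. (\<lambda>x. complex_of_real (x ^ k) * f x) \<in> Lp 2"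
  shows "(\<lambda>x. a x * f x) \<in> Lp 2"
proof -
  have ac: "continuous_on UNIV a" "poly_growth a" using tempered_growth[OF a] by auto
  obtain C l where C: "\<And>x. norm (a x) \<le> C * (1 + x\<^sup>2) ^ l" by (rule poly_growth_E[OF ac(2)]) (rule that)
  have w: "(\<lambda>x. complex_of_real (x ^ m * (1 + x\<^sup>2) ^ l) * f x) \<in> Lp 2" for m
  proof (induction l arbitrary: m)
    case 0 then show ?case using d by simp
  next
    case (Suc l)
    have "complex_of_real (x ^ m * (1 + x\<^sup>2) ^ Suc l) * f x =
      complex_of_real (x ^ m * (1 + x\<^sup>2) ^ l) * f x + complex_of_real (x ^ (m + 2) * (1 + x\<^sup>2) ^ l) * f x" for x
      unfolding distrib_right[symmetric] of_real_add[symmetric] by (simp add: power_add power2_eq_square algebra_simps)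
    then show ?case using Lp2_add[OF Suc.IH[of m] Suc.IH[of "m + 2"]] by simp
  qed
  define h where "h x = complex_of_real ((1 + x\<^sup>2) ^ l)" for x :: real
  have hc: "continuous_on UNIV h" unfolding h_def[abs_def] by (intro continuous_intros)
  have h0: "h x \<noteq> 0" for x using one_le_weight[of x l] unfolding h_def of_real_eq_0_iff by linarith
  have "(\<lambda>x. a x / h x * (h x * f x)) \<in> Lp 2"
  proof (rule Lp2_bounded_mult)
    show "(\<lambda>x. h x * f x) \<in> Lp 2" using w[of 0] by (simp add: h_def)
    have "continuous_on UNIV (\<lambda>x. a x / h x)" by (intro continuous_on_divide ac hc ballI h0)
    then show "(\<lambda>x. a x / h x) \<in> borel_measurable lebesgue"
      by (intro locally_integrable_borel_measurable continuous_locally_integrable)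
    have "norm (a x / h x) \<le> C" for x
    proof -
      have p: "(1 + x\<^sup>2) ^ l > 0" using one_le_weight[of x l] by linarith
      then have "norm (h x) = (1 + x\<^sup>2) ^ l" unfolding h_def norm_of_real by simp
      then show ?thesis using C[of x] p by (simp add: norm_divide divide_le_eq)
    qed
    then show "AE x in lebesgue. norm (a x / h x) \<le> C" by simp
  qed
  then show ?thesis using h0 by simp
qed

lemma span_class_Lp2: "span_class k f \<Longrightarrow> f \<in> Lp 2"
  unfolding span_class_def using tempered_mult_Lp2 decay by (auto intro!: Lp2_add)

lemma span_class_mono: "span_class k f \<Longrightarrow> j \<le> k \<Longrightarrow> span_class j f"
  unfolding span_class_def using tempered_mono by blast

lemma span_class_add:
  assumes "span_class k f" "span_class k g" shows "span_class k (\<lambda>x. f x + g x)"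
proof -
  obtain a b c d where h: "tempered k a" "tempered k b" "f = (\<lambda>x. a x * \<phi> x + b x * \<phi>1 x)"
    "tempered k c" "tempered k d" "g = (\<lambda>x. c x * \<phi> x + d x * \<phi>1 x)"
    using assms unfolding span_class_def by auto
  have "tempered k (\<lambda>x. a x + c x)" "tempered k (\<lambda>x. b x + d x)" by (intro tempered_add h)+
  moreover have "(\<lambda>x. f x + g x) = (\<lambda>x. (a x + c x) * \<phi> x + (b x + d x) * \<phi>1 x)" by (simp add: h(3,6) algebra_simps)
  ultimately show ?thesis unfolding span_class_def by (intro exI conjI)
qed

lemma span_class_mult:
  assumes "span_class k f" "tempered k m" shows "span_class k (\<lambda>x. m x * f x)"
proof -
  obtain a b where h: "tempered k a" "tempered k b" "f = (\<lambda>x. a x * \<phi> x + b x * \<phi>1 x)"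
    using assms unfolding span_class_def by auto
  have "tempered k (\<lambda>x. m x * a x)" "tempered k (\<lambda>x. m x * b x)" by (intro tempered_mult h assms)+
  moreover have "(\<lambda>x. m x * f x) = (\<lambda>x. (m x * a x) * \<phi> x + (m x * b x) * \<phi>1 x)" by (simp add: h(3) algebra_simps)
  ultimately show ?thesis unfolding span_class_def by (intro exI conjI)
qed

lemma span_class_antideriv:
  assumes f: "span_class (Suc k) f" and U: "tempered k U"
  obtains f' where "antideriv f f'" "span_class k f'"
proof -
  obtain a b where h: "tempered (Suc k) a" "tempered (Suc k) b" "f = (\<lambda>x. a x * \<phi> x + b x * \<phi>1 x)"
    using f unfolding span_class_def by auto
  obtain a' b' where d: "antideriv a a'" "tempered k a'" "antideriv b b'" "tempered k b'" using h(1,2) by auto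
  have "antideriv f (\<lambda>x. (a' x * \<phi> x + a x * \<phi>1 x) + (b' x * \<phi>1 x + b x * ((U x - of_real lam) * \<phi> x)))"
    unfolding h(3) by (intro antideriv_add antideriv_mult d rep_parts)
  moreover have "(\<lambda>x. (a' x * \<phi> x + a x * \<phi>1 x) + (b' x * \<phi>1 x + b x * ((U x - of_real lam) * \<phi> x))) =
     (\<lambda>x. (a' x + b x * (U x + - of_real lam)) * \<phi> x + (a x + b' x) * \<phi>1 x)"
    by (simp add: algebra_simps)
  moreover have "tempered k (\<lambda>x. a' x + b x * (U x + - of_real lam))"
    by (intro tempered_add tempered_mult d U tempered_const tempered_SucD[OF h(2)])
  moreover have "tempered k (\<lambda>x. a x + b' x)"
    by (intro tempered_add d tempered_SucD[OF h(1)])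
  ultimately show ?thesis using that unfolding span_class_def by simp blast
qed

text \<open>Each application of the oscillator costs two orders of smoothness and gains a factor 2 n
  + 3 in the tail.\<close>

lemma osc_iterate:
  assumes U: "tempered q U" and u: "span_class (2 * t + k) u" and q: "2 * t + k \<le> q"
  shows "\<exists>v. span_class k v \<and> (\<forall>n. real (2 * n + 3) ^ t * norm (cls u - proj n (cls u)) \<le> norm (cls v - proj n (cls v)))"
  using u q
proof (induction t arbitrary: u)
  case 0 then show ?case by auto
next
  case (Suc t)
  define m where "m = 2 * t + k"
  have m: "span_class (Suc (Suc m)) u" "Suc (Suc m) \<le> q" using Suc.prems by (simp_all add: m_def)
  have tU: "tempered (Suc m) U" "tempered m U" by (rule tempered_mono[OF U]; use m in simp)+
  obtain u1 where u1: "antideriv u u1" "span_class (Suc m) u1" by (rule span_class_antideriv[OF m(1) tU(1)]) (rule that)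
  obtain u2 where u2: "antideriv u1 u2" "span_class m u2" by (rule span_class_antideriv[OF u1(2) tU(2)]) (rule that)
  have um: "span_class m u" using span_class_mono[OF m(1)] by simp
  have rep: "sobolev_rep u u1 u2"
    unfolding sobolev_rep_def using u1 u2 um span_class_Lp2 by auto
  have xu: "span_class m (\<lambda>x. complex_of_real (x\<^sup>2) * u x)" by (rule span_class_mult[OF um tempered_square])
  define w where "w = (\<lambda>x. - u2 x + complex_of_real (x\<^sup>2) * u x)"
  have w: "span_class (2 * t + k) w"
    using span_class_add[OF span_class_mult[OF u2(2) tempered_const[of m "-1"]] xu] by (simp add: w_def m_def)
  have "cinner (cls w) (hb j) = of_nat (2 * j + 1) * cinner (cls u) (hb j)" for j
    using osc_coefficient[OF rep span_class_Lp2[OF xu]] unfolding osc_def w_def .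
  note tail = proj_tail_le[OF this]
  obtain v where v: "span_class k v" "\<And>n. real (2 * n + 3) ^ t * norm (cls w - proj n (cls w)) \<le> norm (cls v - proj n (cls v))"
    using Suc.IH[OF w] Suc.prems(2) by auto
  have "real (2 * n + 3) ^ Suc t * norm (cls u - proj n (cls u)) \<le> norm (cls v - proj n (cls v))" for n
  proof -
    have "real (2 * n + 3) ^ Suc t * norm (cls u - proj n (cls u)) = real (2 * n + 3) ^ t * (real (2 * n + 3) * norm (cls u - proj n (cls u)))"
      by (simp only: power_Suc mult_ac)
    also have "\<dots> \<le> real (2 * n + 3) ^ t * norm (cls w - proj n (cls w))" by (intro mult_left_mono tail) simp
    finally show ?thesis using v(2)[of n] by linarith
  qed
  then show ?case using v(1) by blast
qed

lemma osc_e_rate: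
  assumes U: "tempered q U" and t: "2 * t \<le> q"
  shows "\<exists>v. \<forall>n. real (2 * n + 3) ^ t * norm (osc_e - proj n osc_e) \<le> norm (v - proj n v)"
proof -
  define u where "u = (\<lambda>x. - ((U x - of_real lam) * \<phi> x) + complex_of_real (x\<^sup>2) * \<phi> x)"
  have "tempered q (\<lambda>x. - (U x + - of_real lam) + complex_of_real (x\<^sup>2))"
    by (intro tempered_add tempered_minus U tempered_const tempered_square)
  moreover have "u = (\<lambda>x. (- (U x + - of_real lam) + complex_of_real (x\<^sup>2)) * \<phi> x + 0 * \<phi>1 x)"
    by (simp add: u_def algebra_simps)
  ultimately have "span_class q u" unfolding span_class_def using tempered_const[of q 0] by (intro exI conjI)
  then have "span_class (2 * t + 0) u" by (rule span_class_mono) (use t in simp)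
  from osc_iterate[OF U this] t show ?thesis
    unfolding osc_e_def osc_def u_def[symmetric] by auto
qed

text \<open>The distance of the zero is linear in \<epsilon>, and \<epsilon> is (2 n + 3)^(-t) times
  a null sequence, the tail of the fixed vector v; this null sequence yields the little o.\<close>

lemma eigenvalue_approximation:
  assumes v: "\<And>n. real (2 * n + 3) ^ t * norm (osc_e - proj n osc_e) \<le> norm (v - proj n v)"
  shows "\<exists>z. (\<forall>n. z n \<in> Spec_P V n) \<and> z \<longlonglongrightarrow> of_real lam \<and> (\<lambda>n. norm (z n - of_real lam)) \<in> o(\<lambda>n. 1 / real (2 * n + 3) ^ t)"
proof -
  define C where "C = 2 + U_bound + \<bar>lam\<bar>"
  have C: "C \<ge> 1" using U_bound(2) by (simp add: C_def)
  \<comment> \<open>The tail of v may vanish, but \<open>zero_near\<close> asks for a positive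
    \<epsilon>; the summand 1 / (n + 1) ensures this and still tends to 0.\<close>
  define S where "S n = C * (norm (v - proj n v) + 1 / real (Suc n))" for n
  define \<epsilon> where "\<epsilon> n = S n / real (2 * n + 3) ^ t" for n
  have w1: "real (2 * n + 3) ^ t \<ge> 1" for n by (rule one_le_power) simp
  have S0: "S n > 0" for n using C by (simp add: S_def add_nonneg_pos)
  have \<epsilon>0: "\<epsilon> n > 0" and \<epsilon>S: "\<epsilon> n \<le> S n" for n
  proof -
    show "\<epsilon> n > 0" unfolding \<epsilon>_def using S0[of n] w1[of n] by simp
    have "S n * 1 \<le> S n * real (2 * n + 3) ^ t" by (rule mult_left_mono[OF w1]) (use S0[of n] in simp)
    then show "\<epsilon> n \<le> S n" unfolding \<epsilon>_def using w1[of n] by (simp add: divide_le_eq)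
  qed
  have "(\<lambda>n. C * (norm (v - proj n v) + 1 / real (Suc n))) \<longlonglongrightarrow> C * (norm (v - v) + 0)"
    by (intro tendsto_intros proj_tendsto LIMSEQ_inverse_real_of_nat[unfolded inverse_eq_divide])
  then have S_lim: "S \<longlonglongrightarrow> 0" by (simp add: S_def[abs_def])
  have CT: "C * norm (osc_e - proj n osc_e) \<le> \<epsilon> n" for n
  proof -
    have "norm (osc_e - proj n osc_e) \<le> norm (v - proj n v) / real (2 * n + 3) ^ t"
      using v[of n] w1[of n] by (simp add: le_divide_eq mult.commute)
    also have "\<dots> \<le> (norm (v - proj n v) + 1 / real (Suc n)) / real (2 * n + 3) ^ t"
      by (intro divide_right_mono) auto
    finally have "C * norm (osc_e - proj n osc_e) \<le> C * ((norm (v - proj n v) + 1 / real (Suc n)) / real (2 * n + 3) ^ t)"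
      by (rule mult_left_mono) (use C in simp)
    then show ?thesis by (simp only: \<epsilon>_def S_def times_divide_eq_right)
  qed
  have r: "norm (e - proj n e) \<le> \<epsilon> n" "norm (N (e - proj n e)) \<le> \<epsilon> n" for n
  proof -
    have "1 * norm (osc_e - proj n osc_e) \<le> C * norm (osc_e - proj n osc_e)" by (rule mult_right_mono[OF C norm_ge_zero])
    then show "norm (e - proj n e) \<le> \<epsilon> n" using residual_bounds(1)[of n] CT[of n] by linarith
    show "norm (N (e - proj n e)) \<le> \<epsilon> n" using residual_bounds(2)[of n] CT[of n] unfolding N_def C_def by linarith
  qed
  \<comment> \<open>For the finitely many n with \<epsilon> too large any element of the spectrum
    serves.\<close>
  have "\<exists>z. z \<in> Spec_P V n \<and> (20 * \<epsilon> n \<le> \<delta> / 4 \<longrightarrow> 20 * \<epsilon> n \<le> 1 \<longrightarrow> norm (z - of_real lam) \<le> 20 * \<epsilon> n)" for n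
    using zero_near[OF r[of n] \<epsilon>0[of n]] Spec_P_nonempty[of n] by blast
  then obtain z where z: "\<And>n. z n \<in> Spec_P V n"
    "\<And>n. 20 * \<epsilon> n \<le> \<delta> / 4 \<Longrightarrow> 20 * \<epsilon> n \<le> 1 \<Longrightarrow> norm (z n - of_real lam) \<le> 20 * \<epsilon> n"
    by metis
  have ev: "eventually (\<lambda>n. S n < c) sequentially" if "c > 0" for c
    by (rule order_tendstoD(2)[OF S_lim that])
  have zb: "eventually (\<lambda>n. norm (z n - of_real lam) \<le> 20 * \<epsilon> n) sequentially"
  proof -
    have "eventually (\<lambda>n. S n < \<delta> / 80) sequentially" "eventually (\<lambda>n. S n < 1 / 20) sequentially"
      by (rule ev; use gap_pos in simp)+
    then show ?thesis
    proof eventually_elim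
      fix n assume "S n < \<delta> / 80" "S n < 1 / 20"
      then have "20 * \<epsilon> n \<le> \<delta> / 4" "20 * \<epsilon> n \<le> 1" using \<epsilon>S[of n] by linarith+
      then show "norm (z n - of_real lam) \<le> 20 * \<epsilon> n" by (rule z(2))
    qed
  qed
  have "(\<lambda>n. norm (z n - of_real lam)) \<in> o(\<lambda>n. 1 / real (2 * n + 3) ^ t)"
  proof (rule landau_o.smallI)
    fix c :: real assume c: "c > 0"
    have "eventually (\<lambda>n. S n < c / 20) sequentially" by (rule ev) (use c in simp)
    then show "eventually (\<lambda>n. norm (norm (z n - of_real lam)) \<le> c * norm (1 / real (2 * n + 3) ^ t)) sequentially"
      using zb
    proof eventually_elim
      fix n assume n: "S n < c / 20" "norm (z n - of_real lam) \<le> 20 * \<epsilon> n"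
      have w: "real (2 * n + 3) ^ t > 0" using w1[of n] by linarith
      have "20 * \<epsilon> n = (20 * S n) / real (2 * n + 3) ^ t" by (simp add: \<epsilon>_def)
      also have "\<dots> \<le> c / real (2 * n + 3) ^ t" by (rule divide_right_mono) (use n w in auto)
      finally have "norm (z n - of_real lam) \<le> c / real (2 * n + 3) ^ t" using n(2) by linarith
      moreover have "norm (1 / real (2 * n + 3) ^ t) = 1 / real (2 * n + 3) ^ t" using w by simp
      ultimately show "norm (norm (z n - of_real lam)) \<le> c * norm (1 / real (2 * n + 3) ^ t)"
        by simp
    qed
  qed
  moreover have "z \<longlonglongrightarrow> of_real lam"
  proof (rule LIM_zero_cancel, rule Lim_null_comparison)
    show "eventually (\<lambda>n. norm (z n - of_real lam) \<le> 20 * S n) sequentially"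
      using zb by eventually_elim (use \<epsilon>S in \<open>meson mult_left_mono order_trans zero_le_numeral\<close>)
    show "(\<lambda>n. 20 * S n) \<longlonglongrightarrow> 0" using tendsto_mult_left[OF S_lim, of 20] by simp
  qed
  ultimately show ?thesis using z(1) by blast
qed

end

lemma rate_bigo:
  assumes "real q - 2 \<le> 4 * real t"
  shows "(\<lambda>n. 1 / real (2 * n + 3) ^ t) \<in> O(\<lambda>n. real n powr ((2 - real q) / 4))"
proof (rule landau_o.bigI[where c = 1])
  show "eventually (\<lambda>n. norm (1 / real (2 * n + 3) ^ t) \<le> 1 * norm (real n powr ((2 - real q) / 4))) sequentially"
    using eventually_ge_at_top[of 1]
  proof eventually_elim
    fix n :: nat assume n: "1 \<le> n"
    have "1 / real (2 * n + 3) ^ t \<le> 1 / real n ^ t"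
      using n by (intro divide_left_mono power_mono mult_pos_pos zero_less_power) auto
    also have "\<dots> = real n powr (- real t)" using n by (simp add: powr_minus powr_realpow inverse_eq_divide)
    also have "\<dots> \<le> real n powr ((2 - real q) / 4)" using n assms by (intro powr_mono) auto
    finally show "norm (1 / real (2 * n + 3) ^ t) \<le> 1 * norm (real n powr ((2 - real q) / 4))" by simp
  qed
qed simp

theorem theorem5:
  fixes V V1 V2 :: "real \<Rightarrow> real"
  assumes V: "V = (\<lambda>x. V1 x + V2 x)"
    and V1: "V1 \<in> sobolev 2 2"
    and V2: "V2 \<in> sobolev 2 \<infinity>"
  shows "(\<forall>\<mu>\<in>disc_spectrum Dom_M (schroedinger V).
            \<exists>z. (\<forall>n. z n \<in> Spec_P V n) \<and> z \<longlonglongrightarrow> \<mu>) \<and>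
         (\<forall>q::nat. q \<ge> 3 \<and>
              (\<exists>g. has_weak_deriv q V g \<and> continuous_on UNIV g \<and> bounded (range g)) \<longrightarrow>
            (\<forall>\<mu>\<in>disc_spectrum Dom_M (schroedinger V).
              \<exists>z. (\<forall>n. z n \<in> Spec_P V n) \<and> z \<longlonglongrightarrow> \<mu> \<and>
                (\<lambda>n. norm (z n - \<mu>)) \<in> o(\<lambda>n. real n powr ((2 - real q) / 4))))"
proof -
  obtain U U1 U2 where "potential_rep (\<lambda>x. V1 x + V2 x) U U1 U2"
    by (rule potential_rep_exists[OF V1 V2]) (rule that)
  then interpret schroedinger_op V U U1 U2 unfolding V by unfold_locales
  show ?thesis
  proof (intro conjI ballI allI impI)
    fix \<mu> assume "\<mu> \<in> disc_spectrum Dom_M (schroedinger V)"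
    then obtain \<phi> \<phi>1 lam \<delta> where \<mu>: "\<mu> = complex_of_real lam" and "eigen_op V U U1 U2 \<phi> \<phi>1 lam \<delta>"
      by (rule disc_spectrum_eigen_op)
    then interpret eigen_op V U U1 U2 \<phi> \<phi>1 lam \<delta> by simp
    show "\<exists>z. (\<forall>n. z n \<in> Spec_P V n) \<and> z \<longlonglongrightarrow> \<mu>"
      using eigenvalue_approximation[of 0 osc_e] unfolding \<mu> by auto
  next
    fix q :: nat and \<mu>
    assume q: "3 \<le> q \<and> (\<exists>g. has_weak_deriv q V g \<and> continuous_on UNIV g \<and> bounded (range g))"
      and "\<mu> \<in> disc_spectrum Dom_M (schroedinger V)"
    then obtain \<phi> \<phi>1 lam \<delta> where \<mu>: "\<mu> = complex_of_real lam" and "eigen_op V U U1 U2 \<phi> \<phi>1 lam \<delta>"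
      by (elim disc_spectrum_eigen_op)
    then interpret eigen_op V U U1 U2 \<phi> \<phi>1 lam \<delta> by simp
    have "tempered q U" using q U_tempered by auto
    \<comment> \<open>The least t with 4 t \<ge> q - 2, which is what the exponent demands; for q
      \<ge> 3 it also satisfies 2 t \<le> q, so \<open>V\<close> has enough derivatives.\<close>
    define t where "t = (q + 1) div 4"
    have t: "2 * t \<le> q" "q \<le> 4 * t + 2" using q unfolding t_def by presburger+
    obtain v where v: "\<And>n. real (2 * n + 3) ^ t * norm (osc_e - proj n osc_e) \<le> norm (v - proj n v)"
      using osc_e_rate[OF \<open>tempered q U\<close> t(1)] by auto
    obtain z where z: "\<And>n. z n \<in> Spec_P V n" "z \<longlonglongrightarrow> \<mu>"
      "(\<lambda>n. norm (z n - \<mu>)) \<in> o(\<lambda>n. 1 / real (2 * n + 3) ^ t)"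
      using eigenvalue_approximation[OF v] unfolding \<mu> by auto
    have "real q - 2 \<le> 4 * real t" using t(2) by linarith
    from landau_o.small_big_trans[OF z(3) rate_bigo[OF this]]
    show "\<exists>z. (\<forall>n. z n \<in> Spec_P V n) \<and> z \<longlonglongrightarrow> \<mu> \<and>
        (\<lambda>n. norm (z n - \<mu>)) \<in> o(\<lambda>n. real n powr ((2 - real q) / 4))"
      using z(1,2) by blast
  qed
qed

end
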